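(* Let $\mathscr G$ be an ample groupoid and $\mathcal O$ a $\mathscr G$-sheaf of rings. If $I$ is a (left) primitive ideal of $\Gamma_c(\mathscr G,\mathcal O)$, then there exist $x\in\mathscr G^{(0)}$ and a left $B_x$-module $M$ such that $I=\mathrm{Ann}(\mathrm{Ind}_x(M))$.
   Context: "Compact" includes Hausdorff. A groupoid $\mathscr G$ (identified with its set of arrows) has unit space $\mathscr G^{(0)}$, $\boldsymbol d(\gamma)=\gamma^{-1}\gamma$, $\boldsymbol r(\gamma)=\gamma\gamma^{-1}$. It is ample if it is a topological groupoid such that $\mathscr G^{(0)}$ is locally compact Hausdorff with a basis of compact open sets and $\boldsymbol r$ is a local homeomorphism. A bisection is a subset on which $\boldsymbol d$ and $\boldsymbol r$ are injective. $\mathscr G_x^x=\{g:\boldsymbol d(g)=\boldsymbol r(g)=x\}$. A $\mathscr G$-sheaf $(E,p,\alpha)$ is a space $E$, a local homeomorphism $p:E\to\mathscr G^{(0)}$ and a continuous map $\alpha:\mathscr G\times_{\boldsymbol d,p}E\to E$, $(\gamma,e)\mapsto\alpha_\gamma(e)$, with $\alpha_{p(e)}(e)=e$, $p(\alpha_\gamma(e))=\boldsymbol r(\gamma)$, and $\alpha_\beta(\alpha_\gamma(e))=\alpha_{\beta\gamma}(e)$ whenever defined. The stalk at $x$ is $p^{-1}(x)$. A $\mathscr G$-sheaf of rings $\mathcal O=(E,p,\alpha)$ is a $\mathscr G$-sheaf with a unital ring structure on each stalk $\mathcal O_x$ such that fiberwise addition and multiplication $E\times_{p,p}E\to E$ and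 the unit section $x\mapsto 1_x$ are continuous, and each $\alpha_\gamma:\mathcal O_{\boldsymbol d(\gamma)}\to\mathcal O_{\boldsymbol r(\gamma)}$ is a (unital) ring homomorphism. $\Gamma_c(\mathscr G,\mathcal O)$ is the additive group generated by all maps $f:\mathscr G\to E$ with $p\circ f=\boldsymbol r$ for which there is a compact open bisection $U$ with $f|_U$ continuous and $f=0$ off $U$. It is a ring (with local units, not necessarily unital) under pointwise addition and convolution $(f*g)(\gamma)=\sum_{\beta\rho=\gamma}f(\beta)\alpha_\beta(g(\rho))$. $B_x=\mathcal O_x\rtimes\mathscr G_x^x$ is the skew group ring, with product $(b\delta)(c\eta)=b\alpha_\delta(c)\,\delta\eta$ for $b,c\in\mathcal O_x$, $\delta,\eta\in\mathscr G_x^x$. Let $\mathcal L_x=\bigoplus_{\boldsymbol d(\gamma)=x}\mathcal O_{\boldsymbol r(\gamma)}$, writing $a1_\gamma$ for the element with entry $a$ at coordinate $\gamma$ and $0$ elsewhere. It is a $\Gamma_c(\mathscr G,\mathcal O)$-$B_x$-bimodule via $a1_\gamma\cdot b\delta=a\alpha_\gamma(b)1_{\gamma\delta}$ and $f\cdot a1_\gamma=\sum_{\boldsymbol d(\beta)=\boldsymbol r(\gamma)}f(\beta)\alpha_\beta(a)1_{\beta\gamma}$. For a left $B_x$-module $M$, $\mathrm{Ind}_x(M)=\mathcal L_x\otimes_{B_x}M$, a left $\Gamma_c(\mathscr G,\mathcal O)$-module. An ideal of a ring $R$ is (left) primitive if it is the annihilator of a simple left $R$-module; a simple left $R$-module is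 a module $N$ with $RN\neq 0$ whose only submodules are $0$ and $N$. *)

theory Defs
  imports "HOL-Analysis.Abstract_Topological_Spaces" "HOL-Algebra.Module" "HOL-Algebra.Free_Abelian_Groups"
begin

section \<open>Ample groupoids\<close>

definition local_homeomorphism :: "'a topology \<Rightarrow> 'b topology \<Rightarrow> ('a \<Rightarrow> 'b) \<Rightarrow> bool" where
  "local_homeomorphism X Y f \<longleftrightarrow>
     (\<forall>x \<in> topspace X. \<exists>U. openin X U \<and> x \<in> U \<and> openin Y (f ` U) \<and>
        homeomorphic_map (subtopology X U) (subtopology Y (f ` U)) f)"

text \<open>Compactness includes the Hausdorff property. An ample groupoid need not be Hausdorff, so for
  sets of arrows this is not automatic.\<close>

definition compact_Hausdorff_in :: "'a topology \<Rightarrow> 'a set \<Rightarrow> bool" where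
  "compact_Hausdorff_in X K \<longleftrightarrow> compactin X K \<and> Hausdorff_space (subtopology X K)"

text \<open>A groupoid is its set of arrows, the units being arrows themselves. The product
  \<open>\<beta> \<cdot> \<gamma>\<close> is meaningful only when \<open>gdom \<beta> = gran \<gamma>\<close>.\<close>

record 'g top_groupoid =
  arrow_space :: "'g topology"
  gmult :: "'g \<Rightarrow> 'g \<Rightarrow> 'g" (infixl \<open>\<cdot>\<index>\<close> 70)
  ginv :: "'g \<Rightarrow> 'g"

definition arrows :: "'g top_groupoid \<Rightarrow> 'g set" where
  "arrows \<G> = topspace (arrow_space \<G>)"

definition gdom :: "'g top_groupoid \<Rightarrow> 'g \<Rightarrow> 'g" where
  "gdom \<G> \<gamma> = ginv \<G> \<gamma> \<cdot>\<^bsub>\<G>\<^esub> \<gamma>"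

definition gran :: "'g top_groupoid \<Rightarrow> 'g \<Rightarrow> 'g" where
  "gran \<G> \<gamma> = \<gamma> \<cdot>\<^bsub>\<G>\<^esub> ginv \<G> \<gamma>"

definition units :: "'g top_groupoid \<Rightarrow> 'g set" where
  "units \<G> = gdom \<G> ` arrows \<G>"

definition unit_space :: "'g top_groupoid \<Rightarrow> 'g topology" where
  "unit_space \<G> = subtopology (arrow_space \<G>) (units \<G>)"

definition composable :: "'g top_groupoid \<Rightarrow> ('g \<times> 'g) set" where
  "composable \<G> = {(\<beta>, \<gamma>). \<beta> \<in> arrows \<G> \<and> \<gamma> \<in> arrows \<G> \<and> gdom \<G> \<beta> = gran \<G> \<gamma>}"

locale groupoid =
  fixes \<G> :: "'g top_groupoid" (structure)
  assumes inv_closed: "\<gamma> \<in> arrows \<G> \<Longrightarrow> ginv \<G> \<gamma> \<in> arrows \<G>"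
    and gdom_inv: "\<gamma> \<in> arrows \<G> \<Longrightarrow> gdom \<G> (ginv \<G> \<gamma>) = gran \<G> \<gamma>"
    and gran_inv: "\<gamma> \<in> arrows \<G> \<Longrightarrow> gran \<G> (ginv \<G> \<gamma>) = gdom \<G> \<gamma>"
    and mult_closed: "(\<beta>, \<gamma>) \<in> composable \<G> \<Longrightarrow> \<beta> \<cdot> \<gamma> \<in> arrows \<G>"
    and gdom_mult: "(\<beta>, \<gamma>) \<in> composable \<G> \<Longrightarrow> gdom \<G> (\<beta> \<cdot> \<gamma>) = gdom \<G> \<gamma>"
    and gran_mult: "(\<beta>, \<gamma>) \<in> composable \<G> \<Longrightarrow> gran \<G> (\<beta> \<cdot> \<gamma>) = gran \<G> \<beta>"
    and mult_assoc: "\<lbrakk>(\<beta>, \<gamma>) \<in> composable \<G>; (\<gamma>, \<rho>) \<in> composable \<G>\<rbrakk>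
          \<Longrightarrow> (\<beta> \<cdot> \<gamma>) \<cdot> \<rho> = \<beta> \<cdot> (\<gamma> \<cdot> \<rho>)"
    and mult_gdom: "\<gamma> \<in> arrows \<G> \<Longrightarrow> \<gamma> \<cdot> gdom \<G> \<gamma> = \<gamma>"
    and gran_mult_self: "\<gamma> \<in> arrows \<G> \<Longrightarrow> gran \<G> \<gamma> \<cdot> \<gamma> = \<gamma>"

locale topological_groupoid = groupoid +
  assumes continuous_mult:
      "continuous_map
         (subtopology (prod_topology (arrow_space \<G>) (arrow_space \<G>)) (composable \<G>))
         (arrow_space \<G>) (\<lambda>(\<beta>, \<gamma>). \<beta> \<cdot> \<gamma>)"
    and continuous_inv: "continuous_map (arrow_space \<G>) (arrow_space \<G>) (ginv \<G>)"

locale ample_groupoid = topological_groupoid +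
  assumes locally_compact_units: "locally_compact_space (unit_space \<G>)"
    and Hausdorff_units: "Hausdorff_space (unit_space \<G>)"
    and compact_open_basis:
      "\<lbrakk>openin (unit_space \<G>) U; x \<in> U\<rbrakk>
         \<Longrightarrow> \<exists>K. openin (unit_space \<G>) K \<and> compact_Hausdorff_in (unit_space \<G>) K \<and> x \<in> K \<and> K \<subseteq> U"
    and local_homeomorphism_gran:
      "local_homeomorphism (arrow_space \<G>) (unit_space \<G>) (gran \<G>)"

definition bisection :: "'g top_groupoid \<Rightarrow> 'g set \<Rightarrow> bool" where
  "bisection \<G> U \<longleftrightarrow> U \<subseteq> arrows \<G> \<and> inj_on (gdom \<G>) U \<and> inj_on (gran \<G>) U"

definition compact_open_bisection :: "'g top_groupoid \<Rightarrow> 'g set \<Rightarrow> bool" where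
  "compact_open_bisection \<G> U \<longleftrightarrow>
     bisection \<G> U \<and> openin (arrow_space \<G>) U \<and> compact_Hausdorff_in (arrow_space \<G>) U"

definition isotropy :: "'g top_groupoid \<Rightarrow> 'g \<Rightarrow> 'g set" where
  "isotropy \<G> x = {\<gamma> \<in> arrows \<G>. gdom \<G> \<gamma> = x \<and> gran \<G> \<gamma> = x}"

definition gdom_fiber :: "'g top_groupoid \<Rightarrow> 'g \<Rightarrow> 'g set" where
  "gdom_fiber \<G> x = {\<gamma> \<in> arrows \<G>. gdom \<G> \<gamma> = x}"


section \<open>Sheaves of rings\<close>

record ('g, 'e) gsheaf =
  sheaf_space :: "'e topology"
  sheaf_proj :: "'e \<Rightarrow> 'g"
  sheaf_act :: "'g \<Rightarrow> 'e \<Rightarrow> 'e"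

locale groupoid_sheaf =
  fixes \<G> :: "'g top_groupoid" (structure) and \<O> :: "('g, 'e, 'more) gsheaf_scheme"
  assumes local_homeomorphism_proj:
      "local_homeomorphism (sheaf_space \<O>) (unit_space \<G>) (sheaf_proj \<O>)"
    and continuous_act:
      "continuous_map
         (subtopology (prod_topology (arrow_space \<G>) (sheaf_space \<O>))
            {(\<gamma>, e). gdom \<G> \<gamma> = sheaf_proj \<O> e})
         (sheaf_space \<O>) (\<lambda>(\<gamma>, e). sheaf_act \<O> \<gamma> e)"
    and act_unit: "e \<in> topspace (sheaf_space \<O>) \<Longrightarrow> sheaf_act \<O> (sheaf_proj \<O> e) e = e"
    and proj_act:
      "\<lbrakk>\<gamma> \<in> arrows \<G>; e \<in> topspace (sheaf_space \<O>); gdom \<G> \<gamma> = sheaf_proj \<O> e\<rbrakk>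
         \<Longrightarrow> sheaf_proj \<O> (sheaf_act \<O> \<gamma> e) = gran \<G> \<gamma>"
    and act_act:
      "\<lbrakk>(\<beta>, \<gamma>) \<in> composable \<G>; e \<in> topspace (sheaf_space \<O>); gdom \<G> \<gamma> = sheaf_proj \<O> e\<rbrakk>
         \<Longrightarrow> sheaf_act \<O> \<beta> (sheaf_act \<O> \<gamma> e) = sheaf_act \<O> (\<beta> \<cdot> \<gamma>) e"

text \<open>\<open>fiber_add\<close> and \<open>fiber_mult\<close> are meaningful only for two points of the same stalk.\<close>

record ('g, 'e) ring_gsheaf = "('g, 'e) gsheaf" +
  fiber_add :: "'e \<Rightarrow> 'e \<Rightarrow> 'e"
  fiber_mult :: "'e \<Rightarrow> 'e \<Rightarrow> 'e"
  fiber_zero :: "'g \<Rightarrow> 'e"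
  fiber_one :: "'g \<Rightarrow> 'e"

definition stalk :: "('g, 'e) ring_gsheaf \<Rightarrow> 'g \<Rightarrow> 'e ring" where
  "stalk \<O> x =
     \<lparr>carrier = {e \<in> topspace (sheaf_space \<O>). sheaf_proj \<O> e = x},
      monoid.mult = fiber_mult \<O>, one = fiber_one \<O> x, ring.zero = fiber_zero \<O> x, ring.add = fiber_add \<O>\<rparr>"

locale groupoid_ring_sheaf =
  groupoid_sheaf \<G> \<O> for \<G> :: "'g top_groupoid" (structure) and \<O> :: "('g, 'e) ring_gsheaf" +
  assumes ring_stalk: "x \<in> units \<G> \<Longrightarrow> ring (stalk \<O> x)"
    and continuous_fiber_add:
      "continuous_map
         (subtopology (prod_topology (sheaf_space \<O>) (sheaf_space \<O>))
            {(e, e'). sheaf_proj \<O> e = sheaf_proj \<O> e'})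
         (sheaf_space \<O>) (\<lambda>(e, e'). fiber_add \<O> e e')"
    and continuous_fiber_mult:
      "continuous_map
         (subtopology (prod_topology (sheaf_space \<O>) (sheaf_space \<O>))
            {(e, e'). sheaf_proj \<O> e = sheaf_proj \<O> e'})
         (sheaf_space \<O>) (\<lambda>(e, e'). fiber_mult \<O> e e')"
    and continuous_fiber_one:
      "continuous_map (unit_space \<G>) (sheaf_space \<O>) (fiber_one \<O>)"
    and act_ring_hom:
      "\<gamma> \<in> arrows \<G> \<Longrightarrow>
         sheaf_act \<O> \<gamma> \<in> ring_hom (stalk \<O> (gdom \<G> \<gamma>)) (stalk \<O> (gran \<G> \<gamma>))"


section \<open>Modules over rings that need not be unital\<close>

text \<open>The field \<open>one\<close> of \<open>R\<close> is used only for unital modules; as in \<^locale>\<open>module\<close>, the fields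
  \<open>mult\<close> and \<open>one\<close> of \<open>M\<close> play no role.\<close>

locale left_module = M?: abelian_group M
  for R :: "('r, 'x) ring_scheme" and M :: "('r, 'm, 'y) module_scheme" +
  assumes smult_closed: "\<lbrakk>a \<in> carrier R; m \<in> carrier M\<rbrakk> \<Longrightarrow> a \<odot>\<^bsub>M\<^esub> m \<in> carrier M"
    and smult_l_distr:
      "\<lbrakk>a \<in> carrier R; b \<in> carrier R; m \<in> carrier M\<rbrakk>
         \<Longrightarrow> (a \<oplus>\<^bsub>R\<^esub> b) \<odot>\<^bsub>M\<^esub> m = a \<odot>\<^bsub>M\<^esub> m \<oplus>\<^bsub>M\<^esub> b \<odot>\<^bsub>M\<^esub> m"
    and smult_r_distr:
      "\<lbrakk>a \<in> carrier R; m \<in> carrier M; n \<in> carrier M\<rbrakk>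
         \<Longrightarrow> a \<odot>\<^bsub>M\<^esub> (m \<oplus>\<^bsub>M\<^esub> n) = a \<odot>\<^bsub>M\<^esub> m \<oplus>\<^bsub>M\<^esub> a \<odot>\<^bsub>M\<^esub> n"
    and smult_assoc:
      "\<lbrakk>a \<in> carrier R; b \<in> carrier R; m \<in> carrier M\<rbrakk>
         \<Longrightarrow> (a \<otimes>\<^bsub>R\<^esub> b) \<odot>\<^bsub>M\<^esub> m = a \<odot>\<^bsub>M\<^esub> (b \<odot>\<^bsub>M\<^esub> m)"

locale unital_left_module = left_module +
  assumes smult_one: "m \<in> carrier M \<Longrightarrow> \<one>\<^bsub>R\<^esub> \<odot>\<^bsub>M\<^esub> m = m"

definition simple_left_module ::
  "('r, 'x) ring_scheme \<Rightarrow> ('r, 'm, 'y) module_scheme \<Rightarrow> bool" where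
  "simple_left_module R N \<longleftrightarrow>
     left_module R N \<and>
     (\<exists>a \<in> carrier R. \<exists>n \<in> carrier N. a \<odot>\<^bsub>N\<^esub> n \<noteq> \<zero>\<^bsub>N\<^esub>) \<and>
     (\<forall>H. submodule H R N \<longrightarrow> H = {\<zero>\<^bsub>N\<^esub>} \<or> H = carrier N)"

definition annihilator ::
  "('r, 'x) ring_scheme \<Rightarrow> ('r, 'm, 'y) module_scheme \<Rightarrow> 'r set" where
  "annihilator R N = {a \<in> carrier R. \<forall>n \<in> carrier N. a \<odot>\<^bsub>N\<^esub> n = \<zero>\<^bsub>N\<^esub>}"

text \<open>The type argument only names the type carrying the simple module; results about
  \<open>left_primitive_ideal TYPE('n)\<close> with \<open>'n\<close> free cover all simple modules.\<close>

definition left_primitive_ideal ::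
  "'n itself \<Rightarrow> ('r, 'x) ring_scheme \<Rightarrow> 'r set \<Rightarrow> bool" where
  "left_primitive_ideal TYPE('n) R I \<longleftrightarrow>
     (\<exists>N :: ('r, 'n) module. simple_left_module R N \<and> I = annihilator R N)"

text \<open>In what follows abelian groups are often given as \<^typ>\<open>'a monoid\<close> records, hence written
  multiplicatively. A ring or module with prescribed additive group:\<close>

definition ring_on :: "'a monoid \<Rightarrow> ('a \<Rightarrow> 'a \<Rightarrow> 'a) \<Rightarrow> 'a \<Rightarrow> 'a ring" where
  "ring_on A m u =
     \<lparr>carrier = carrier A, monoid.mult = m, one = u, ring.zero = \<one>\<^bsub>A\<^esub>, ring.add = monoid.mult A\<rparr>"

definition module_on :: "'a monoid \<Rightarrow> ('r \<Rightarrow> 'a \<Rightarrow> 'a) \<Rightarrow> ('r, 'a) module" where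
  "module_on A s =
     \<lparr>carrier = carrier A, monoid.mult = undefined, one = undefined, ring.zero = \<one>\<^bsub>A\<^esub>, ring.add = monoid.mult A,
      smult = s\<rparr>"

text \<open>The sum, in the abelian group \<open>A\<close>, of a family with only finitely many nonzero terms.
  (The operator \<^const>\<open>finprod\<close> is trivial on infinite index sets.)\<close>

definition support_sum :: "('a, 'x) monoid_scheme \<Rightarrow> ('i \<Rightarrow> 'a) \<Rightarrow> 'i set \<Rightarrow> 'a" where
  "support_sum A h J = finprod A h {j \<in> J. h j \<noteq> \<one>\<^bsub>A\<^esub>}"

text \<open>The element of \<^term>\<open>sum_group J A\<close> with entry \<open>a\<close> at \<open>i\<close> and zero elsewhere.\<close>

definition single :: "'i set \<Rightarrow> ('i \<Rightarrow> 'a monoid) \<Rightarrow> 'i \<Rightarrow> 'a \<Rightarrow> 'i \<Rightarrow> 'a" where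
  "single J A i a = (\<lambda>j\<in>J. if j = i then a else \<one>\<^bsub>A j\<^esub>)"

text \<open>Tensor product of a right \<open>B\<close>-module, with additive group \<open>L\<close> and action \<open>ract\<close>, and a left
  \<open>B\<close>-module \<open>M\<close>, as a quotient of the free abelian group on pairs.\<close>

definition tensor_relations ::
  "'l monoid \<Rightarrow> ('l \<Rightarrow> 'b \<Rightarrow> 'l) \<Rightarrow> ('b, 'x) ring_scheme \<Rightarrow> ('b, 'm, 'y) module_scheme
     \<Rightarrow> ('l \<times> 'm \<Rightarrow>\<^sub>0 int) set" where
  "tensor_relations L ract B M =
     generate (free_Abelian_group (carrier L \<times> carrier M))
       ({frag_of (l \<otimes>\<^bsub>L\<^esub> l', m) - frag_of (l, m) - frag_of (l', m) | l l' m.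
           l \<in> carrier L \<and> l' \<in> carrier L \<and> m \<in> carrier M} \<union>
        {frag_of (l, m \<oplus>\<^bsub>M\<^esub> m') - frag_of (l, m) - frag_of (l, m') | l m m'.
           l \<in> carrier L \<and> m \<in> carrier M \<and> m' \<in> carrier M} \<union>
        {frag_of (ract l b, m) - frag_of (l, b \<odot>\<^bsub>M\<^esub> m) | l b m.
           l \<in> carrier L \<and> b \<in> carrier B \<and> m \<in> carrier M})"

definition tensor_product ::
  "'l monoid \<Rightarrow> ('l \<Rightarrow> 'b \<Rightarrow> 'l) \<Rightarrow> ('b, 'x) ring_scheme \<Rightarrow> ('b, 'm, 'y) module_scheme
     \<Rightarrow> ('l \<times> 'm \<Rightarrow>\<^sub>0 int) set monoid" where
  "tensor_product L ract B M =
     free_Abelian_group (carrier L \<times> carrier M) Mod tensor_relations L ract B M"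

text \<open>For an endomorphism \<open>\<phi>\<close> of the right module, the map \<open>l \<otimes> m \<mapsto> \<phi> l \<otimes> m\<close> on cosets of
  \<^const>\<open>tensor_relations\<close>: the union is over representatives of the coset \<open>C\<close>, and all of them
  contribute the same coset.\<close>

definition tensor_map ::
  "'l monoid \<Rightarrow> ('l \<Rightarrow> 'b \<Rightarrow> 'l) \<Rightarrow> ('b, 'x) ring_scheme \<Rightarrow> ('b, 'm, 'y) module_scheme
     \<Rightarrow> ('l \<Rightarrow> 'l) \<Rightarrow> ('l \<times> 'm \<Rightarrow>\<^sub>0 int) set \<Rightarrow> ('l \<times> 'm \<Rightarrow>\<^sub>0 int) set" where
  "tensor_map L ract B M \<phi> C =
     (\<Union>c\<in>C. tensor_relations L ract B M
               #>\<^bsub>free_Abelian_group (carrier L \<times> carrier M)\<^esub>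
             frag_extend (\<lambda>(l, m). frag_of (\<phi> l, m)) c)"


section \<open>The convolution ring\<close>

text \<open>Maps \<open>f\<close> on arrows with \<open>sheaf_proj \<O> (f \<gamma>) = gran \<G> \<gamma>\<close>, under pointwise addition. They are
  extensional, that is, \<^const>\<open>undefined\<close> outside \<^term>\<open>arrows \<G>\<close>.\<close>

definition arrow_sections ::
  "'g top_groupoid \<Rightarrow> ('g, 'e) ring_gsheaf \<Rightarrow> ('g \<Rightarrow> 'e) monoid" where
  "arrow_sections \<G> \<O> = product_group (arrows \<G>) (\<lambda>\<gamma>. add_monoid (stalk \<O> (gran \<G> \<gamma>)))"

definition elementary_sections ::
  "'g top_groupoid \<Rightarrow> ('g, 'e) ring_gsheaf \<Rightarrow> ('g \<Rightarrow> 'e) set" where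
  "elementary_sections \<G> \<O> =
     {f \<in> carrier (arrow_sections \<G> \<O>). \<exists>U. compact_open_bisection \<G> U \<and>
        continuous_map (subtopology (arrow_space \<G>) U) (sheaf_space \<O>) f \<and>
        (\<forall>\<gamma> \<in> arrows \<G> - U. f \<gamma> = \<zero>\<^bsub>stalk \<O> (gran \<G> \<gamma>)\<^esub>)}"

definition convolution ::
  "'g top_groupoid \<Rightarrow> ('g, 'e) ring_gsheaf \<Rightarrow> ('g \<Rightarrow> 'e) \<Rightarrow> ('g \<Rightarrow> 'e) \<Rightarrow> 'g \<Rightarrow> 'e" where
  "convolution \<G> \<O> f g =
     (\<lambda>\<gamma>\<in>arrows \<G>.
        support_sum (add_monoid (stalk \<O> (gran \<G> \<gamma>)))
          (\<lambda>(\<beta>, \<rho>). f \<beta> \<otimes>\<^bsub>stalk \<O> (gran \<G> \<gamma>)\<^esub> sheaf_act \<O> \<beta> (g \<rho>))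
          {(\<beta>, \<rho>) \<in> composable \<G>. \<beta> \<cdot>\<^bsub>\<G>\<^esub> \<rho> = \<gamma>})"

text \<open>This ring is not unital in general, so its field \<open>one\<close> is a dummy.\<close>

definition Gamma_c :: "'g top_groupoid \<Rightarrow> ('g, 'e) ring_gsheaf \<Rightarrow> ('g \<Rightarrow> 'e) ring" where
  "Gamma_c \<G> \<O> =
     ring_on (subgroup_generated (arrow_sections \<G> \<O>) (elementary_sections \<G> \<O>))
       (convolution \<G> \<O>) undefined"


section \<open>Induction from isotropy\<close>

definition skew_group ::
  "'g top_groupoid \<Rightarrow> ('g, 'e) ring_gsheaf \<Rightarrow> 'g \<Rightarrow> ('g \<Rightarrow> 'e) monoid" where
  "skew_group \<G> \<O> x = sum_group (isotropy \<G> x) (\<lambda>_. add_monoid (stalk \<O> x))"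

definition skew_single ::
  "'g top_groupoid \<Rightarrow> ('g, 'e) ring_gsheaf \<Rightarrow> 'g \<Rightarrow> 'e \<Rightarrow> 'g \<Rightarrow> 'g \<Rightarrow> 'e" where
  "skew_single \<G> \<O> x b \<delta> = single (isotropy \<G> x) (\<lambda>_. add_monoid (stalk \<O> x)) \<delta> b"

definition skew_mult ::
  "'g top_groupoid \<Rightarrow> ('g, 'e) ring_gsheaf \<Rightarrow> 'g \<Rightarrow> ('g \<Rightarrow> 'e) \<Rightarrow> ('g \<Rightarrow> 'e) \<Rightarrow> 'g \<Rightarrow> 'e" where
  "skew_mult \<G> \<O> x b c =
     support_sum (skew_group \<G> \<O> x)
       (\<lambda>(\<delta>, \<eta>). skew_single \<G> \<O> x (b \<delta> \<otimes>\<^bsub>stalk \<O> x\<^esub> sheaf_act \<O> \<delta> (c \<eta>)) (\<delta> \<cdot>\<^bsub>\<G>\<^esub> \<eta>))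
       (isotropy \<G> x \<times> isotropy \<G> x)"

definition skew_group_ring ::
  "'g top_groupoid \<Rightarrow> ('g, 'e) ring_gsheaf \<Rightarrow> 'g \<Rightarrow> ('g \<Rightarrow> 'e) ring" where
  "skew_group_ring \<G> \<O> x =
     ring_on (skew_group \<G> \<O> x) (skew_mult \<G> \<O> x)
       (skew_single \<G> \<O> x \<one>\<^bsub>stalk \<O> x\<^esub> x)"

text \<open>The bimodule \<open>\<L>\<^sub>x\<close>: its additive group, the elements \<open>a 1\<^sub>\<gamma>\<close>, and the two actions,
  extended biadditively from generators.\<close>

definition L_group ::
  "'g top_groupoid \<Rightarrow> ('g, 'e) ring_gsheaf \<Rightarrow> 'g \<Rightarrow> ('g \<Rightarrow> 'e) monoid" where
  "L_group \<G> \<O> x =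
     sum_group (gdom_fiber \<G> x) (\<lambda>\<gamma>. add_monoid (stalk \<O> (gran \<G> \<gamma>)))"

definition L_single ::
  "'g top_groupoid \<Rightarrow> ('g, 'e) ring_gsheaf \<Rightarrow> 'g \<Rightarrow> 'e \<Rightarrow> 'g \<Rightarrow> 'g \<Rightarrow> 'e" where
  "L_single \<G> \<O> x a \<gamma> =
     single (gdom_fiber \<G> x) (\<lambda>\<gamma>. add_monoid (stalk \<O> (gran \<G> \<gamma>))) \<gamma> a"

definition L_right_act ::
  "'g top_groupoid \<Rightarrow> ('g, 'e) ring_gsheaf \<Rightarrow> 'g \<Rightarrow> ('g \<Rightarrow> 'e) \<Rightarrow> ('g \<Rightarrow> 'e) \<Rightarrow> 'g \<Rightarrow> 'e" where
  "L_right_act \<G> \<O> x \<xi> b =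
     support_sum (L_group \<G> \<O> x)
       (\<lambda>(\<gamma>, \<delta>). L_single \<G> \<O> x
          (\<xi> \<gamma> \<otimes>\<^bsub>stalk \<O> (gran \<G> \<gamma>)\<^esub> sheaf_act \<O> \<gamma> (b \<delta>)) (\<gamma> \<cdot>\<^bsub>\<G>\<^esub> \<delta>))
       (gdom_fiber \<G> x \<times> isotropy \<G> x)"

definition L_left_act ::
  "'g top_groupoid \<Rightarrow> ('g, 'e) ring_gsheaf \<Rightarrow> 'g \<Rightarrow> ('g \<Rightarrow> 'e) \<Rightarrow> ('g \<Rightarrow> 'e) \<Rightarrow> 'g \<Rightarrow> 'e" where
  "L_left_act \<G> \<O> x f \<xi> =
     support_sum (L_group \<G> \<O> x)
       (\<lambda>(\<beta>, \<gamma>). L_single \<G> \<O> x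
          (f \<beta> \<otimes>\<^bsub>stalk \<O> (gran \<G> \<beta>)\<^esub> sheaf_act \<O> \<beta> (\<xi> \<gamma>)) (\<beta> \<cdot>\<^bsub>\<G>\<^esub> \<gamma>))
       {(\<beta>, \<gamma>) \<in> composable \<G>. \<gamma> \<in> gdom_fiber \<G> x}"

definition Ind ::
  "'g top_groupoid \<Rightarrow> ('g, 'e) ring_gsheaf \<Rightarrow> 'g \<Rightarrow> ('g \<Rightarrow> 'e, 'm) module
     \<Rightarrow> ('g \<Rightarrow> 'e, (('g \<Rightarrow> 'e) \<times> 'm \<Rightarrow>\<^sub>0 int) set) module" where
  "Ind \<G> \<O> x M =
     module_on
       (tensor_product (L_group \<G> \<O> x) (L_right_act \<G> \<O> x) (skew_group_ring \<G> \<O> x) M)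
       (\<lambda>f. tensor_map (L_group \<G> \<O> x) (L_right_act \<G> \<O> x) (skew_group_ring \<G> \<O> x) M
              (L_left_act \<G> \<O> x f))"

end

theory Submission
  imports Defs
begin

text \<open>Let \<open>N\<close> be a simple module over the convolution ring \<open>\<Gamma>\<close>. Write \<open>1\<^sub>U\<close> for the indicator
  section of a compact open set \<open>U\<close> of units. The germs of \<open>N\<close> at a unit \<open>x\<close> form the quotient \<open>N\<^sub>x\<close> of
  \<open>N\<close> by the elements annihilated by some \<open>1\<^sub>U\<close> with \<open>x \<in> U\<close>. An element of \<open>\<Gamma>\<close> acts modulo germs at \<open>x\<close>
  only through its values on the arrows with range \<open>x\<close>, so \<open>N\<^sub>x\<close> is a module over the skew group ring \<open>B\<^sub>x\<close>.
  Some \<open>N\<^sub>x\<close> is nonzero, because compact supports allow patching finitely many \<open>1\<^sub>U\<close>; fix such an \<open>x\<close>.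

  The tensor product \<open>\<L>\<^sub>x \<otimes> N\<^sub>x\<close> is the direct sum of the stalks of \<open>N\<close> over the orbit of \<open>x\<close>, and \<open>f \<in> \<Gamma>\<close>
  acts on it by the same finite sums that compute the germs of \<open>f n\<close>. Hence whatever annihilates \<open>N\<close> annihilates the induced
  module. Conversely, if \<open>a\<close> annihilates the induced module, then all germs of \<open>a n\<close> over the orbit of \<open>x\<close>
  vanish, so every element of \<open>\<Gamma> a n\<close> has zero germ at \<open>x\<close>. As \<open>N\<close> is simple with \<open>N\<^sub>x \<noteq> 0\<close>, this forces
  \<open>a n = 0\<close>.\<close>

section \<open>Ample groupoids\<close>

text \<open>The elements of zero germ at \<open>x\<close> form a subgroup of the simple module, not
  a submodule: an arrow from another unit of the orbit carries a germ into \<open>x\<close>. Two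
  consequences shape the construction. The skew group ring acts on germs only through lifts whose
  row at \<open>x\<close>, the arrows of range \<open>x\<close>, lives on the isotropy group; a lift
  is brought into this form by multiplying with a small indicator on the right, which works because
  each row has finitely many nonzero entries. And the submodule generated by \<open>a n\<close> can
  be caught inside the germ kernel at \<open>x\<close> only by controlling the germs of
  \<open>a n\<close> over the whole orbit, which is exactly what the induced module sees.

  The direct sum decomposition of the tensor product is never built. Annihilation is tested on
  elements l \<otimes> m, and such an element is zero exactly when every coordinate of l, an element
  of the skew group ring, annihilates m.\<close>

context groupoid
begin

abbreviation ginverse ("_\<^sup>-" [1000] 999) where "\<gamma>\<^sup>- \<equiv> ginv \<G> \<gamma>"

lemma composable_iff [simp]:
  "(\<beta>, \<gamma>) \<in> composable \<G> \<longleftrightarrow> \<beta> \<in> arrows \<G> \<and> \<gamma> \<in> arrows \<G> \<and> gdom \<G> \<beta> = gran \<G> \<gamma>"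
  by (auto simp: composable_def)

lemma gmult_arrow:
  "\<lbrakk>\<beta> \<in> arrows \<G>; \<gamma> \<in> arrows \<G>; gdom \<G> \<beta> = gran \<G> \<gamma>\<rbrakk> \<Longrightarrow> \<beta> \<cdot> \<gamma> \<in> arrows \<G>"
  using mult_closed by simp

lemma gdom_gmult:
  "\<lbrakk>\<beta> \<in> arrows \<G>; \<gamma> \<in> arrows \<G>; gdom \<G> \<beta> = gran \<G> \<gamma>\<rbrakk> \<Longrightarrow> gdom \<G> (\<beta> \<cdot> \<gamma>) = gdom \<G> \<gamma>"
  using gdom_mult by simp

lemma gran_gmult:
  "\<lbrakk>\<beta> \<in> arrows \<G>; \<gamma> \<in> arrows \<G>; gdom \<G> \<beta> = gran \<G> \<gamma>\<rbrakk> \<Longrightarrow> gran \<G> (\<beta> \<cdot> \<gamma>) = gran \<G> \<beta>"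
  using gran_mult by simp

lemma gmult_assoc:
  "\<lbrakk>\<beta> \<in> arrows \<G>; \<gamma> \<in> arrows \<G>; \<rho> \<in> arrows \<G>; gdom \<G> \<beta> = gran \<G> \<gamma>; gdom \<G> \<gamma> = gran \<G> \<rho>\<rbrakk>
     \<Longrightarrow> \<beta> \<cdot> \<gamma> \<cdot> \<rho> = \<beta> \<cdot> (\<gamma> \<cdot> \<rho>)"
  using mult_assoc by simp

lemma ginv_gmult_self: "\<gamma>\<^sup>- \<cdot> \<gamma> = gdom \<G> \<gamma>"
  by (simp add: gdom_def)

lemma gmult_ginv_self: "\<gamma> \<cdot> \<gamma>\<^sup>- = gran \<G> \<gamma>"
  by (simp add: gran_def)

lemma gdom_arrow: "\<gamma> \<in> arrows \<G> \<Longrightarrow> gdom \<G> \<gamma> \<in> arrows \<G>"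
  unfolding ginv_gmult_self[symmetric] by (rule gmult_arrow) (auto simp: inv_closed gdom_inv)

lemma gran_arrow: "\<gamma> \<in> arrows \<G> \<Longrightarrow> gran \<G> \<gamma> \<in> arrows \<G>"
  using gdom_arrow[OF inv_closed] gdom_inv by metis

lemma gdom_gdom: "\<gamma> \<in> arrows \<G> \<Longrightarrow> gdom \<G> (gdom \<G> \<gamma>) = gdom \<G> \<gamma>"
  using gdom_gmult[of "\<gamma>\<^sup>-" \<gamma>] by (simp add: inv_closed gdom_inv ginv_gmult_self)

lemma gran_gdom: "\<gamma> \<in> arrows \<G> \<Longrightarrow> gran \<G> (gdom \<G> \<gamma>) = gdom \<G> \<gamma>"
  using gran_gmult[of "\<gamma>\<^sup>-" \<gamma>] by (simp add: inv_closed gdom_inv gran_inv ginv_gmult_self)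

lemma gdom_units: "\<gamma> \<in> arrows \<G> \<Longrightarrow> gdom \<G> \<gamma> \<in> units \<G>"
  by (simp add: units_def)

lemma gran_units: "\<gamma> \<in> arrows \<G> \<Longrightarrow> gran \<G> \<gamma> \<in> units \<G>"
  using gdom_units[OF inv_closed] gdom_inv by metis

lemma units_arrow: "u \<in> units \<G> \<Longrightarrow> u \<in> arrows \<G>"
  by (auto simp: units_def gdom_arrow)

lemma gdom_unit: "u \<in> units \<G> \<Longrightarrow> gdom \<G> u = u"
  by (auto simp: units_def gdom_gdom)

lemma gran_unit: "u \<in> units \<G> \<Longrightarrow> gran \<G> u = u"
  by (auto simp: units_def gran_gdom)

lemma gmult_unit_right: "\<lbrakk>u \<in> units \<G>; \<gamma> \<in> arrows \<G>; gdom \<G> \<gamma> = u\<rbrakk> \<Longrightarrow> \<gamma> \<cdot> u = \<gamma>"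
  using mult_gdom by auto

lemma ginv_gmult_cancel:
  assumes "\<beta> \<in> arrows \<G>" "\<gamma> \<in> arrows \<G>" "gdom \<G> \<beta> = gran \<G> \<gamma>"
  shows "\<beta>\<^sup>- \<cdot> (\<beta> \<cdot> \<gamma>) = \<gamma>"
proof -
  have "\<beta>\<^sup>- \<cdot> (\<beta> \<cdot> \<gamma>) = \<beta>\<^sup>- \<cdot> \<beta> \<cdot> \<gamma>"
    by (rule gmult_assoc[symmetric]) (use assms in \<open>auto simp: inv_closed gdom_inv\<close>)
  then show ?thesis
    using assms by (simp add: ginv_gmult_self gran_mult_self)
qed

lemma gmult_ginv_cancel:
  assumes "\<beta> \<in> arrows \<G>" "\<gamma> \<in> arrows \<G>" "gran \<G> \<beta> = gran \<G> \<gamma>"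
  shows "\<beta> \<cdot> (\<beta>\<^sup>- \<cdot> \<gamma>) = \<gamma>"
proof -
  have "\<beta> \<cdot> (\<beta>\<^sup>- \<cdot> \<gamma>) = \<beta> \<cdot> \<beta>\<^sup>- \<cdot> \<gamma>"
    by (rule gmult_assoc[symmetric]) (use assms in \<open>auto simp: inv_closed gdom_inv gran_inv\<close>)
  then show ?thesis
    using assms by (simp add: gmult_ginv_self gran_mult_self)
qed

lemma ginv_ginv: "\<gamma> \<in> arrows \<G> \<Longrightarrow> (\<gamma>\<^sup>-)\<^sup>- = \<gamma>"
  using ginv_gmult_cancel[of "\<gamma>\<^sup>-" \<gamma>] gmult_unit_right[of "gran \<G> (\<gamma>\<^sup>-)" "(\<gamma>\<^sup>-)\<^sup>-"]
  by (simp add: inv_closed gdom_inv gran_inv ginv_gmult_self gdom_units)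

lemma ginv_unit: "u \<in> units \<G> \<Longrightarrow> u\<^sup>- = u"
  using gmult_unit_right[of u "u\<^sup>-"] ginv_gmult_self[of u]
  by (simp add: units_arrow inv_closed gdom_inv gdom_unit gran_unit)

end

section \<open>Local homeomorphisms and their local inverses\<close>

lemma local_homeomorphism_openin_image:
  assumes "local_homeomorphism X Y f" "openin X U"
  shows "openin Y (f ` U)"
proof (subst openin_subopen, intro ballI)
  fix y assume "y \<in> f ` U"
  then obtain x where x: "x \<in> U" "y = f x" by blast
  then obtain V where V: "openin X V" "x \<in> V" "openin Y (f ` V)"
      "homeomorphic_map (subtopology X V) (subtopology Y (f ` V)) f"
    using assms unfolding local_homeomorphism_def by (meson openin_subset subsetD)
  have "openin (subtopology X V) (U \<inter> V)"
    using assms(2) by (simp add: openin_subtopology_Int)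
  then have "openin (subtopology Y (f ` V)) (f ` (U \<inter> V))"
    using V(4) homeomorphic_imp_open_map unfolding open_map_def by blast
  then have "openin Y (f ` (U \<inter> V))"
    using V(3) openin_trans_full by blast
  then show "\<exists>T. openin Y T \<and> y \<in> T \<and> T \<subseteq> f ` U"
    using x V(2) by (intro exI[of _ "f ` (U \<inter> V)"]) auto
qed

lemma continuous_map_locallyI:
  assumes "\<And>x. x \<in> topspace X \<Longrightarrow> \<exists>U. openin X U \<and> x \<in> U \<and> continuous_map (subtopology X U) Y f"
  shows "continuous_map X Y f"
  unfolding continuous_map_eq_topcontinuous_at topcontinuous_at_def
proof (intro ballI conjI allI impI)
  fix x W assume x: "x \<in> topspace X" and W: "openin Y W \<and> f x \<in> W"
  obtain V where V: "openin X V" "x \<in> V" "continuous_map (subtopology X V) Y f"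
    using assms[OF x] by blast
  have "openin (subtopology X V) {a \<in> topspace (subtopology X V). f a \<in> W}"
    using V(3) W openin_continuous_map_preimage by blast
  then have "openin X {a \<in> topspace (subtopology X V). f a \<in> W}"
    using V(1) openin_trans_full by blast
  then show "\<exists>U. openin X U \<and> x \<in> U \<and> (\<forall>y\<in>U. f y \<in> W)"
    using V x W by (intro exI[of _ "{a \<in> topspace (subtopology X V). f a \<in> W}"]) auto
qed (use assms in \<open>force simp: continuous_map_def Pi_iff\<close>)+

lemma local_homeomorphism_continuous:
  assumes "local_homeomorphism X Y f"
  shows "continuous_map X Y f"
proof (rule continuous_map_locallyI)
  fix x assume "x \<in> topspace X"
  then obtain V where V: "openin X V" "x \<in> V"
      "homeomorphic_map (subtopology X V) (subtopology Y (f ` V)) f"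
    using assms unfolding local_homeomorphism_def by meson
  then show "\<exists>U. openin X U \<and> x \<in> U \<and> continuous_map (subtopology X U) Y f"
    using homeomorphic_imp_continuous_map[OF V(3)] continuous_map_in_subtopology by blast
qed

text \<open>Injectivity turns the open continuous map into an open bijection onto its image. Applied
  to the range map on bisections and to the projection of the sheaf, this supplies continuous local
  sections of both.\<close>

lemma local_homeomorphism_homeomorphic_map:
  assumes "local_homeomorphism X Y f" "openin X U" "inj_on f U"
  shows "homeomorphic_map (subtopology X U) (subtopology Y (f ` U)) f"
proof (rule bijective_open_imp_homeomorphic_map)
  have UX: "U \<subseteq> topspace X" using assms(2) openin_subset by blast
  show "continuous_map (subtopology X U) (subtopology Y (f ` U)) f"
    using local_homeomorphism_continuous[OF assms(1)]
    by (auto simp: continuous_map_in_subtopology continuous_map_from_subtopology)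
  show "open_map (subtopology X U) (subtopology Y (f ` U)) f"
    unfolding open_map_def
  proof (intro allI impI)
    fix T assume "openin (subtopology X U) T"
    then have "openin X T" "T \<subseteq> U"
      using assms(2) openin_trans_full openin_imp_subset by blast+
    then show "openin (subtopology Y (f ` U)) (f ` T)"
      using local_homeomorphism_openin_image[OF assms(1)]
      by (metis image_mono inf.absorb1 openin_subtopology_Int)
  qed
  show "f ` topspace (subtopology X U) = topspace (subtopology Y (f ` U))"
    using UX local_homeomorphism_openin_image[OF assms(1,2), THEN openin_subset] by auto
  show "inj_on f (topspace (subtopology X U))"
    using assms(3) by (simp add: inj_on_Int)
qed

text \<open>Naming the inverse as \<open>inv_into\<close> makes it a term that can be composed and
  evaluated.\<close>

lemma homeomorphic_map_imp_continuous_inv_into: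
  assumes "homeomorphic_map X Y f"
  shows "continuous_map Y X (inv_into (topspace X) f)"
proof -
  obtain g where g: "homeomorphic_maps X Y f g"
    using assms homeomorphic_map_maps by blast
  have "inv_into (topspace X) f y = g y" if "y \<in> topspace Y" for y
  proof (rule inv_into_f_eq)
    show "inj_on f (topspace X)"
      using assms homeomorphic_imp_injective_map by blast
    show "g y \<in> topspace X" "f (g y) = y"
      using that g by (auto simp: homeomorphic_maps_def continuous_map_def)
  qed
  moreover have "continuous_map Y X g"
    using g by (simp add: homeomorphic_maps_def)
  ultimately show ?thesis
    using continuous_map_eq by metis
qed

section \<open>Compact open sets of units, bisections and their products\<close>

context ample_groupoid
begin

lemma topspace_unit_space: "topspace (unit_space \<G>) = units \<G>"
  using units_arrow by (auto simp: unit_space_def arrows_def)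

lemma topspace_arrow_space: "topspace (arrow_space \<G>) = arrows \<G>"
  by (simp add: arrows_def)

lemma continuous_gran: "continuous_map (arrow_space \<G>) (unit_space \<G>) (gran \<G>)"
  using local_homeomorphism_gran local_homeomorphism_continuous by blast

lemma continuous_gdom: "continuous_map (arrow_space \<G>) (unit_space \<G>) (gdom \<G>)"
proof -
  have "continuous_map (arrow_space \<G>) (unit_space \<G>) (gran \<G> \<circ> ginv \<G>)"
    using continuous_inv continuous_gran by (rule continuous_map_compose)
  then show ?thesis
    by (rule continuous_map_eq) (simp add: topspace_arrow_space gran_inv)
qed

lemma openin_gran_image: "openin (arrow_space \<G>) U \<Longrightarrow> openin (unit_space \<G>) (gran \<G> ` U)"
  using local_homeomorphism_gran local_homeomorphism_openin_image by blast

lemma gran_locally_injective: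
  assumes "\<gamma> \<in> arrows \<G>"
  obtains U where "openin (arrow_space \<G>) U" "\<gamma> \<in> U" "inj_on (gran \<G>) U"
proof -
  obtain U where U: "openin (arrow_space \<G>) U" "\<gamma> \<in> U"
    "homeomorphic_map (subtopology (arrow_space \<G>) U) (subtopology (unit_space \<G>) (gran \<G> ` U)) (gran \<G>)"
    using local_homeomorphism_gran assms unfolding local_homeomorphism_def topspace_arrow_space by metis
  have "inj_on (gran \<G>) (topspace (arrow_space \<G>) \<inter> U)"
    using homeomorphic_imp_injective_map[OF U(3)] by simp
  then have "inj_on (gran \<G>) U"
    using openin_subset[OF U(1)] by (simp add: Int_absorb1)
  then show thesis
    using U that by blast
qed

text \<open>Near a unit take an open \<open>U\<close> on which the range map is injective. If
  \<gamma> and its range both lie in \<open>U\<close>, they have the same range, hence coincide, and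
  \<gamma> is a unit. Open sets of units are therefore open sets of arrows.\<close>

lemma units_open: "openin (arrow_space \<G>) (units \<G>)"
proof (subst openin_subopen, intro ballI)
  fix u assume u: "u \<in> units \<G>"
  then obtain U where U: "openin (arrow_space \<G>) U" "u \<in> U" "inj_on (gran \<G>) U"
    using gran_locally_injective units_arrow by metis
  have Usub: "U \<subseteq> arrows \<G>"
    using openin_subset[OF U(1)] by (simp add: topspace_arrow_space)
  have "continuous_map (arrow_space \<G>) (arrow_space \<G>) (gran \<G>)"
    using continuous_gran by (auto simp: unit_space_def continuous_map_in_subtopology)
  then have "openin (arrow_space \<G>) {\<gamma> \<in> topspace (arrow_space \<G>). gran \<G> \<gamma> \<in> U}"
    using U(1) openin_continuous_map_preimage by blast
  with U(1) have "openin (arrow_space \<G>) (U \<inter> {\<gamma> \<in> topspace (arrow_space \<G>). gran \<G> \<gamma> \<in> U})"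
    by blast
  moreover have "\<gamma> \<in> units \<G>" if "\<gamma> \<in> U" "gran \<G> \<gamma> \<in> U" for \<gamma>
  proof -
    have "gran \<G> \<gamma> = \<gamma>"
      using U(3) that Usub by (metis gran_unit gran_units inj_onD subsetD)
    then show ?thesis
      using that Usub gran_units by (metis subsetD)
  qed
  ultimately show "\<exists>T. openin (arrow_space \<G>) T \<and> u \<in> T \<and> T \<subseteq> units \<G>"
    using U u gran_unit[OF u] units_arrow[OF u]
    by (intro exI[of _ "U \<inter> {\<gamma> \<in> topspace (arrow_space \<G>). gran \<G> \<gamma> \<in> U}"])
      (auto simp: topspace_arrow_space)
qed

lemma openin_unit_space_iff:
  "openin (unit_space \<G>) U \<longleftrightarrow> openin (arrow_space \<G>) U \<and> U \<subseteq> units \<G>"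
  unfolding unit_space_def using openin_open_subtopology[OF units_open] by blast

definition compact_open_units :: "'a set \<Rightarrow> bool" where
  "compact_open_units K \<longleftrightarrow> openin (unit_space \<G>) K \<and> compactin (unit_space \<G>) K"

lemma compact_open_units_subset: "compact_open_units K \<Longrightarrow> K \<subseteq> units \<G>"
  unfolding compact_open_units_def using openin_unit_space_iff by blast

lemma compact_open_units_Un:
  "\<lbrakk>compact_open_units K; compact_open_units L\<rbrakk> \<Longrightarrow> compact_open_units (K \<union> L)"
  unfolding compact_open_units_def by (auto intro: compactin_Un)

lemma compact_open_units_Int:
  "\<lbrakk>compact_open_units K; compact_open_units L\<rbrakk> \<Longrightarrow> compact_open_units (K \<inter> L)"
  unfolding compact_open_units_def
  using compactin_imp_closedin[OF Hausdorff_units] by (auto intro: closed_Int_compactin)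

lemma compact_open_units_empty: "compact_open_units {}"
  unfolding compact_open_units_def by auto

lemma compact_open_units_basis:
  assumes "openin (unit_space \<G>) U" "x \<in> U"
  obtains K where "compact_open_units K" "x \<in> K" "K \<subseteq> U"
  using compact_open_basis[OF assms] unfolding compact_open_units_def compact_Hausdorff_in_def by blast

text \<open>Finite sets of units are closed. The lemma separates \<open>x\<close> from finitely many
  other units, in practice from the domains of the nonzero entries of a section along one
  row.\<close>

lemma compact_open_units_avoid:
  assumes "openin (unit_space \<G>) U" "x \<in> U" "finite F"
  obtains K where "compact_open_units K" "x \<in> K" "K \<subseteq> U" "K \<inter> F \<subseteq> {x}"
proof -
  have "closedin (unit_space \<G>) (F \<inter> units \<G> - {x})"
    using Hausdorff_imp_t1_space[OF Hausdorff_units] assms(3)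
    by (simp add: t1_space_closedin_finite topspace_unit_space subset_iff)
  then have "openin (unit_space \<G>) (U - (F \<inter> units \<G> - {x}))"
    using assms(1) by (rule openin_diff[rotated])
  then obtain K where K: "compact_open_units K" "x \<in> K" "K \<subseteq> U - (F \<inter> units \<G> - {x})"
    using assms(2) by (elim compact_open_units_basis[where x=x]) auto
  then show thesis
    using that[of K] compact_open_units_subset[of K] by blast
qed

lemma gran_homeomorphic_map:
  assumes "openin (arrow_space \<G>) U" "inj_on (gran \<G>) U"
  shows "homeomorphic_map (subtopology (arrow_space \<G>) U) (subtopology (unit_space \<G>) (gran \<G> ` U)) (gran \<G>)"
  using local_homeomorphism_homeomorphic_map[OF local_homeomorphism_gran assms] .

text \<open>The range map is a homeomorphism from an open bisection onto a subset of the Hausdorff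
  unit space, so compactness and separation can both be tested on the range.\<close>

lemma compact_open_bisection_iff:
  "compact_open_bisection \<G> U \<longleftrightarrow>
     bisection \<G> U \<and> openin (arrow_space \<G>) U \<and> compactin (unit_space \<G>) (gran \<G> ` U)"
proof
  assume "compact_open_bisection \<G> U"
  then show "bisection \<G> U \<and> openin (arrow_space \<G>) U \<and> compactin (unit_space \<G>) (gran \<G> ` U)"
    unfolding compact_open_bisection_def compact_Hausdorff_in_def
    using image_compactin continuous_gran by blast
next
  assume U: "bisection \<G> U \<and> openin (arrow_space \<G>) U \<and> compactin (unit_space \<G>) (gran \<G> ` U)"
  then have "homeomorphic_map (subtopology (arrow_space \<G>) U) (subtopology (unit_space \<G>) (gran \<G> ` U)) (gran \<G>)"
    using gran_homeomorphic_map by (auto simp: bisection_def)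
  then have hs: "subtopology (arrow_space \<G>) U homeomorphic_space subtopology (unit_space \<G>) (gran \<G> ` U)"
    using homeomorphic_map_imp_homeomorphic_space by blast
  have "compactin (arrow_space \<G>) U"
    using U homeomorphic_compact_space[OF hs]
    by (metis compactin_subspace openin_subset)
  moreover have "Hausdorff_space (subtopology (arrow_space \<G>) U)"
    using homeomorphic_Hausdorff_space[OF hs] Hausdorff_space_subtopology[OF Hausdorff_units] by blast
  ultimately show "compact_open_bisection \<G> U"
    using U unfolding compact_open_bisection_def compact_Hausdorff_in_def by blast
qed

lemma compact_open_bisection_gran:
  "compact_open_bisection \<G> U \<Longrightarrow> compact_open_units (gran \<G> ` U)"
  unfolding compact_open_bisection_iff compact_open_units_def using openin_gran_image by blast

lemma compact_open_units_bisection: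
  assumes "compact_open_units K"
  shows "compact_open_bisection \<G> K"
proof -
  have K: "K \<subseteq> units \<G>" "openin (unit_space \<G>) K" "compactin (unit_space \<G>) K"
    using assms compact_open_units_subset by (auto simp: compact_open_units_def)
  then have "gran \<G> x = x" "gdom \<G> x = x" "x \<in> arrows \<G>" if "x \<in> K" for x
    using that by (auto simp: gran_unit gdom_unit units_arrow)
  then show ?thesis
    using K by (auto simp: compact_open_bisection_iff bisection_def openin_unit_space_iff inj_on_def
      cong: image_cong)
qed

text \<open>The domain map is injective near \<gamma> because the range map is injective near
  \<open>\<gamma>\<^sup>-\<close>; the neighbourhood of the inverse is pulled back along inversion.
  Compactness is then arranged by shrinking the range to a compact open \<open>K\<close>.\<close>

lemma compact_open_bisection_basis:
  assumes "openin (arrow_space \<G>) W" "\<gamma> \<in> W"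
  obtains U where "compact_open_bisection \<G> U" "\<gamma> \<in> U" "U \<subseteq> W"
proof -
  have \<gamma>: "\<gamma> \<in> arrows \<G>"
    using assms openin_subset topspace_arrow_space by blast
  obtain A where A: "openin (arrow_space \<G>) A" "\<gamma> \<in> A" "inj_on (gran \<G>) A"
    using gran_locally_injective \<gamma> by blast
  obtain B where B: "openin (arrow_space \<G>) B" "\<gamma>\<^sup>- \<in> B" "inj_on (gran \<G>) B"
    using gran_locally_injective inv_closed[OF \<gamma>] by blast
  define C where "C = W \<inter> A \<inter> {\<gamma> \<in> topspace (arrow_space \<G>). \<gamma>\<^sup>- \<in> B}"
  have C: "openin (arrow_space \<G>) C" "\<gamma> \<in> C"
    unfolding C_def using assms A B \<gamma> openin_continuous_map_preimage[OF continuous_inv]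
    by (auto simp: topspace_arrow_space)
  have Csub: "C \<subseteq> arrows \<G>" by (auto simp: C_def topspace_arrow_space)
  have "inj_on (gran \<G>) C" using A(3) by (auto simp: C_def inj_on_def)
  moreover have "inj_on (gdom \<G>) C"
  proof (rule inj_onI)
    fix a b assume ab: "a \<in> C" "b \<in> C" "gdom \<G> a = gdom \<G> b"
    then have "a\<^sup>- = b\<^sup>-"
      using Csub inj_onD[OF B(3), of "a\<^sup>-" "b\<^sup>-"] gran_inv by (auto simp: C_def topspace_arrow_space)
    then show "a = b" using ab Csub ginv_ginv by (metis subsetD)
  qed
  ultimately have biC: "bisection \<G> C" using Csub by (auto simp: bisection_def)
  obtain K where K: "compact_open_units K" "gran \<G> \<gamma> \<in> K" "K \<subseteq> gran \<G> ` C"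
    using compact_open_units_basis[OF openin_gran_image[OF C(1)]] C(2) by blast
  define U where "U = C \<inter> {\<eta> \<in> topspace (arrow_space \<G>). gran \<G> \<eta> \<in> K}"
  have "openin (arrow_space \<G>) U"
    unfolding U_def using C(1) openin_continuous_map_preimage[OF continuous_gran] K(1)
    by (auto simp: compact_open_units_def)
  moreover have "gran \<G> ` U = K"
    using K(3) Csub by (fastforce simp: U_def topspace_arrow_space)
  moreover have "bisection \<G> U"
    using biC by (auto simp: U_def bisection_def inj_on_def)
  ultimately have "compact_open_bisection \<G> U"
    using K(1) by (auto simp: compact_open_bisection_iff compact_open_units_def)
  then show thesis
    using that[of U] C(2) K(2) \<gamma> by (auto simp: U_def C_def topspace_arrow_space)
qed

lemma continuous_inv_into_gran:
  assumes "openin (arrow_space \<G>) U" "inj_on (gran \<G>) U"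
  shows "continuous_map (subtopology (unit_space \<G>) (gran \<G> ` U)) (subtopology (arrow_space \<G>) U)
           (inv_into U (gran \<G>))"
proof -
  have "topspace (subtopology (arrow_space \<G>) U) = U"
    using openin_subset[OF assms(1)] by auto
  then show ?thesis
    using homeomorphic_map_imp_continuous_inv_into[OF gran_homeomorphic_map[OF assms]] by simp
qed

text \<open>If \<gamma> factors with a first factor in the bisection \<open>U\<close>, that factor
  is determined by the range of \<gamma>; this is the second factor, as a continuous function of
  \<gamma>.\<close>

definition bisection_translate :: "'a set \<Rightarrow> 'a \<Rightarrow> 'a" where
  "bisection_translate U \<gamma> = (inv_into U (gran \<G>) (gran \<G> \<gamma>))\<^sup>- \<cdot> \<gamma>"

lemma continuous_inv_into_gran_gran:
  assumes "openin (arrow_space \<G>) U" "inj_on (gran \<G>) U"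
  shows "continuous_map (subtopology (arrow_space \<G>) {\<gamma> \<in> arrows \<G>. gran \<G> \<gamma> \<in> gran \<G> ` U})
           (arrow_space \<G>) (\<lambda>\<gamma>. inv_into U (gran \<G>) (gran \<G> \<gamma>))"
proof -
  have "continuous_map (subtopology (arrow_space \<G>) {\<gamma> \<in> arrows \<G>. gran \<G> \<gamma> \<in> gran \<G> ` U})
     (subtopology (unit_space \<G>) (gran \<G> ` U)) (gran \<G>)"
    using continuous_gran by (auto simp: continuous_map_in_subtopology continuous_map_from_subtopology)
  then have "continuous_map (subtopology (arrow_space \<G>) {\<gamma> \<in> arrows \<G>. gran \<G> \<gamma> \<in> gran \<G> ` U})
     (subtopology (arrow_space \<G>) U) (inv_into U (gran \<G>) \<circ> gran \<G>)"
    using continuous_map_compose continuous_inv_into_gran[OF assms] by blast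
  then show ?thesis
    by (simp add: continuous_map_in_subtopology comp_def)
qed

lemma continuous_bisection_translate:
  assumes "openin (arrow_space \<G>) U" "inj_on (gran \<G>) U"
  shows "continuous_map (subtopology (arrow_space \<G>) {\<gamma> \<in> arrows \<G>. gran \<G> \<gamma> \<in> gran \<G> ` U})
           (arrow_space \<G>) (bisection_translate U)"
proof -
  let ?X = "subtopology (arrow_space \<G>) {\<gamma> \<in> arrows \<G>. gran \<G> \<gamma> \<in> gran \<G> ` U}"
  let ?s = "\<lambda>\<gamma>. inv_into U (gran \<G>) (gran \<G> \<gamma>)"
  have Usub: "U \<subseteq> arrows \<G>"
    using openin_subset[OF assms(1)] by (simp add: topspace_arrow_space)
  have s: "?s \<gamma> \<in> arrows \<G>" "gran \<G> (?s \<gamma>) = gran \<G> \<gamma>" if "gran \<G> \<gamma> \<in> gran \<G> ` U" for \<gamma>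
    using that Usub inv_into_into[OF that] f_inv_into_f[OF that] by auto
  have "continuous_map ?X (arrow_space \<G>) (ginv \<G> \<circ> ?s)"
    using continuous_inv_into_gran_gran[OF assms] continuous_inv by (rule continuous_map_compose)
  moreover have "continuous_map ?X (arrow_space \<G>) id"
    by (simp add: continuous_map_from_subtopology)
  ultimately have "continuous_map ?X (prod_topology (arrow_space \<G>) (arrow_space \<G>)) (\<lambda>\<gamma>. ((?s \<gamma>)\<^sup>-, \<gamma>))"
    by (simp add: continuous_map_pairwise comp_def id_def)
  moreover have "(\<lambda>\<gamma>. ((?s \<gamma>)\<^sup>-, \<gamma>)) \<in> topspace ?X \<rightarrow> composable \<G>"
    using s by (auto simp: inv_closed gdom_inv)
  ultimately have "continuous_map ?X (subtopology (prod_topology (arrow_space \<G>) (arrow_space \<G>)) (composable \<G>))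
      (\<lambda>\<gamma>. ((?s \<gamma>)\<^sup>-, \<gamma>))"
    by (simp add: continuous_map_in_subtopology image_subset_iff_funcset)
  from continuous_map_compose[OF this continuous_mult] show ?thesis
    by (simp add: comp_def bisection_translate_def[abs_def])
qed

definition bisection_mult :: "'a set \<Rightarrow> 'a set \<Rightarrow> 'a set" where
  "bisection_mult U V = {\<beta> \<cdot> \<rho> | \<beta> \<rho>. \<beta> \<in> U \<and> \<rho> \<in> V \<and> gdom \<G> \<beta> = gran \<G> \<rho>}"

lemma bisection_mult_unique:
  assumes "bisection \<G> U" "V \<subseteq> arrows \<G>" "\<beta> \<in> U" "\<rho> \<in> V" "gdom \<G> \<beta> = gran \<G> \<rho>"
  shows "inv_into U (gran \<G>) (gran \<G> (\<beta> \<cdot> \<rho>)) = \<beta>" "bisection_translate U (\<beta> \<cdot> \<rho>) = \<rho>"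
proof -
  show 1: "inv_into U (gran \<G>) (gran \<G> (\<beta> \<cdot> \<rho>)) = \<beta>"
    using assms by (subst gran_gmult) (auto simp: bisection_def)
  show "bisection_translate U (\<beta> \<cdot> \<rho>) = \<rho>"
    unfolding bisection_translate_def 1
    using assms by (intro ginv_gmult_cancel) (auto simp: bisection_def)
qed

text \<open>Presents the product as a preimage under the continuous translation, from which openness
  follows.\<close>

lemma bisection_mult_alt:
  assumes "bisection \<G> U" "V \<subseteq> arrows \<G>"
  shows "bisection_mult U V = {\<gamma> \<in> arrows \<G>. gran \<G> \<gamma> \<in> gran \<G> ` U \<and> bisection_translate U \<gamma> \<in> V}"
proof (intro equalityI subsetI)
  fix \<gamma> assume "\<gamma> \<in> bisection_mult U V"
  then obtain \<beta> \<rho> where "\<gamma> = \<beta> \<cdot> \<rho>" "\<beta> \<in> U" "\<rho> \<in> V" "gdom \<G> \<beta> = gran \<G> \<rho>"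
    unfolding bisection_mult_def by blast
  then show "\<gamma> \<in> {\<gamma> \<in> arrows \<G>. gran \<G> \<gamma> \<in> gran \<G> ` U \<and> bisection_translate U \<gamma> \<in> V}"
    using assms bisection_mult_unique[OF assms, of \<beta> \<rho>]
    by (auto simp: bisection_def gmult_arrow gran_gmult subset_iff)
next
  fix \<gamma> assume \<gamma>: "\<gamma> \<in> {\<gamma> \<in> arrows \<G>. gran \<G> \<gamma> \<in> gran \<G> ` U \<and> bisection_translate U \<gamma> \<in> V}"
  define \<beta> where "\<beta> = inv_into U (gran \<G>) (gran \<G> \<gamma>)"
  have \<beta>: "\<beta> \<in> U" "gran \<G> \<beta> = gran \<G> \<gamma>" "\<beta> \<in> arrows \<G>"
    using \<gamma> assms inv_into_into[of _ "gran \<G>" U] f_inv_into_f[of _ "gran \<G>" U]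
    by (auto simp: \<beta>_def bisection_def subset_iff)
  then have "\<gamma> = \<beta> \<cdot> bisection_translate U \<gamma>" "gran \<G> (bisection_translate U \<gamma>) = gdom \<G> \<beta>"
    using \<gamma> by (auto simp: bisection_translate_def \<beta>_def[symmetric] gmult_ginv_cancel gran_gmult
       inv_closed gdom_inv gran_inv)
  then show "\<gamma> \<in> bisection_mult U V"
    unfolding bisection_mult_def mem_Collect_eq using \<gamma> \<beta>(1)
    by (intro exI[of _ \<beta>] exI[of _ "bisection_translate U \<gamma>"] conjI) simp_all
qed

text \<open>Openness comes from \<open>bisection_mult_alt\<close>. For compactness, the range of the
  product is the range of those arrows of \<open>U\<close> whose domain lies in the range of
  \<open>V\<close>; that range is compact, hence closed among the Hausdorff units, so these arrows
  form a relatively closed part of the compact set \<open>U\<close>.\<close>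

lemma compact_open_bisection_mult:
  assumes "compact_open_bisection \<G> U" "compact_open_bisection \<G> V"
  shows "compact_open_bisection \<G> (bisection_mult U V)"
proof -
  have U: "bisection \<G> U" "openin (arrow_space \<G>) U" "compactin (arrow_space \<G>) U" "inj_on (gran \<G>) U" "U \<subseteq> arrows \<G>"
    using assms(1) by (auto simp: compact_open_bisection_def compact_Hausdorff_in_def bisection_def)
  have V: "bisection \<G> V" "openin (arrow_space \<G>) V" "compactin (unit_space \<G>) (gran \<G> ` V)" "V \<subseteq> arrows \<G>"
    using assms(2) by (auto simp: compact_open_bisection_iff bisection_def)
  note alt = bisection_mult_alt[OF U(1) V(4)]
  let ?R = "{\<gamma> \<in> arrows \<G>. gran \<G> \<gamma> \<in> gran \<G> ` U}"
  have openR: "openin (arrow_space \<G>) ?R"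
    using openin_continuous_map_preimage[OF continuous_gran openin_gran_image[OF U(2)]]
    by (simp add: topspace_arrow_space)
  have "openin (subtopology (arrow_space \<G>) ?R)
     {\<gamma> \<in> topspace (subtopology (arrow_space \<G>) ?R). bisection_translate U \<gamma> \<in> V}"
    by (rule openin_continuous_map_preimage[OF continuous_bisection_translate[OF U(2,4)] V(2)])
  then have "openin (arrow_space \<G>) {\<gamma> \<in> topspace (subtopology (arrow_space \<G>) ?R). bisection_translate U \<gamma> \<in> V}"
    using openR openin_trans_full by blast
  moreover have "{\<gamma> \<in> topspace (subtopology (arrow_space \<G>) ?R). bisection_translate U \<gamma> \<in> V} = bisection_mult U V"
    by (auto simp: alt topspace_arrow_space)
  ultimately have op: "openin (arrow_space \<G>) (bisection_mult U V)" by simp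
  have inj: "\<beta> = \<beta>' \<and> \<rho> = \<rho>'" if "\<beta> \<in> U" "\<rho> \<in> V" "gdom \<G> \<beta> = gran \<G> \<rho>" "\<beta>' \<in> U" "\<rho>' \<in> V" "gdom \<G> \<beta>' = gran \<G> \<rho>'"
     "gran \<G> \<beta> = gran \<G> \<beta>' \<or> gdom \<G> \<rho> = gdom \<G> \<rho>'" for \<beta> \<rho> \<beta>' \<rho>'
    using that U(1) V(1) unfolding bisection_def inj_on_def by metis
  have "bisection \<G> (bisection_mult U V)"
    unfolding bisection_def
  proof (intro conjI inj_onI)
    show "bisection_mult U V \<subseteq> arrows \<G>"
      unfolding alt by blast
    fix a b assume "a \<in> bisection_mult U V" "b \<in> bisection_mult U V"
    then obtain \<beta> \<rho> \<beta>' \<rho>' where ab: "a = \<beta> \<cdot> \<rho>" "b = \<beta>' \<cdot> \<rho>'" "\<beta> \<in> U" "\<rho> \<in> V" "gdom \<G> \<beta> = gran \<G> \<rho>"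
        "\<beta>' \<in> U" "\<rho>' \<in> V" "gdom \<G> \<beta>' = gran \<G> \<rho>'"
      unfolding bisection_mult_def by blast
    then have eqs: "gran \<G> a = gran \<G> \<beta>" "gran \<G> b = gran \<G> \<beta>'" "gdom \<G> a = gdom \<G> \<rho>" "gdom \<G> b = gdom \<G> \<rho>'"
      using U(5) V(4) by (auto simp: gran_gmult gdom_gmult subset_iff)
    then show "a = b" if "gran \<G> a = gran \<G> b"
      using that inj[OF ab(3-8)] ab(1,2) by simp
    show "a = b" if "gdom \<G> a = gdom \<G> b"
      using that eqs inj[OF ab(3-8)] ab(1,2) by simp
  qed
  moreover have "gran \<G> ` bisection_mult U V = gran \<G> ` (U \<inter> {\<gamma> \<in> topspace (arrow_space \<G>). gdom \<G> \<gamma> \<in> gran \<G> ` V})"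
    unfolding bisection_mult_def using U(5) V(4)
    by (auto simp: gran_gmult subset_iff image_iff topspace_arrow_space) (metis gran_gmult)
  moreover have "compactin (arrow_space \<G>) (U \<inter> {\<gamma> \<in> topspace (arrow_space \<G>). gdom \<G> \<gamma> \<in> gran \<G> ` V})"
    using compactin_imp_closedin[OF Hausdorff_units V(3)] closedin_continuous_map_preimage[OF continuous_gdom]
    by (intro compact_Int_closedin U) auto
  ultimately show ?thesis
    using op continuous_gran by (auto simp: compact_open_bisection_iff intro: image_compactin)
qed

end

section \<open>Sections and their convolution\<close>

text \<open>A factorisation \<open>\<beta> \<cdot> \<rho> = \<eta>\<close> is determined by \<open>\<beta>\<close>, so that sums over factorisations become
  sums over finite sets of arrows with the same range as \<open>\<eta>\<close>.\<close>

lemma (in groupoid) support_sum_factorisations: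
  assumes "comm_monoid A" and \<eta>: "\<eta> \<in> arrows \<G>" and fin: "finite S" and P: "P \<subseteq> composable \<G>"
    and S: "\<And>\<beta>. \<beta> \<in> S \<Longrightarrow> \<beta> \<in> arrows \<G> \<and> gran \<G> \<beta> = gran \<G> \<eta>"
    and SP: "\<And>\<beta>. \<beta> \<in> S \<Longrightarrow> (\<beta>, \<beta>\<^sup>- \<cdot> \<eta>) \<in> P \<or> w \<beta> (\<beta>\<^sup>- \<cdot> \<eta>) = \<one>\<^bsub>A\<^esub>"
    and PS: "\<And>\<beta>. \<lbrakk>(\<beta>, \<beta>\<^sup>- \<cdot> \<eta>) \<in> P; gran \<G> \<beta> = gran \<G> \<eta>; w \<beta> (\<beta>\<^sup>- \<cdot> \<eta>) \<noteq> \<one>\<^bsub>A\<^esub>\<rbrakk> \<Longrightarrow> \<beta> \<in> S"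
    and w: "\<And>\<beta>. \<beta> \<in> S \<Longrightarrow> w \<beta> (\<beta>\<^sup>- \<cdot> \<eta>) \<in> carrier A"
  shows "support_sum A (\<lambda>(\<beta>, \<rho>). w \<beta> \<rho>) {(\<beta>, \<rho>) \<in> P. \<beta> \<cdot> \<rho> = \<eta>} = finprod A (\<lambda>\<beta>. w \<beta> (\<beta>\<^sup>- \<cdot> \<eta>)) S"
proof -
  interpret A: comm_monoid A by fact
  let ?T = "{\<beta> \<in> S. w \<beta> (\<beta>\<^sup>- \<cdot> \<eta>) \<noteq> \<one>\<^bsub>A\<^esub>}"
  let ?h = "\<lambda>\<beta>. (\<beta>, \<beta>\<^sup>- \<cdot> \<eta>)"
  have "{j \<in> {(\<beta>, \<rho>) \<in> P. \<beta> \<cdot> \<rho> = \<eta>}. (case j of (\<beta>, \<rho>) \<Rightarrow> w \<beta> \<rho>) \<noteq> \<one>\<^bsub>A\<^esub>} = ?h ` ?T"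
  proof (intro equalityI subsetI)
    fix j assume "j \<in> {j \<in> {(\<beta>, \<rho>) \<in> P. \<beta> \<cdot> \<rho> = \<eta>}. (case j of (\<beta>, \<rho>) \<Rightarrow> w \<beta> \<rho>) \<noteq> \<one>\<^bsub>A\<^esub>}"
    then obtain \<beta> \<rho> where j: "j = (\<beta>, \<rho>)" "(\<beta>, \<rho>) \<in> P" "\<beta> \<cdot> \<rho> = \<eta>" "w \<beta> \<rho> \<noteq> \<one>\<^bsub>A\<^esub>"
      by auto
    then have c: "\<beta> \<in> arrows \<G>" "\<rho> \<in> arrows \<G>" "gdom \<G> \<beta> = gran \<G> \<rho>"
      using P composable_iff by blast+
    then have "\<rho> = \<beta>\<^sup>- \<cdot> \<eta>" "gran \<G> \<beta> = gran \<G> \<eta>"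
      using ginv_gmult_cancel gran_gmult j(3) by metis+
    then show "j \<in> ?h ` ?T"
      using j PS by blast
  next
    fix j assume "j \<in> ?h ` ?T"
    then obtain \<beta> where "j = ?h \<beta>" "\<beta> \<in> S" "w \<beta> (\<beta>\<^sup>- \<cdot> \<eta>) \<noteq> \<one>\<^bsub>A\<^esub>" by blast
    then show "j \<in> {j \<in> {(\<beta>, \<rho>) \<in> P. \<beta> \<cdot> \<rho> = \<eta>}. (case j of (\<beta>, \<rho>) \<Rightarrow> w \<beta> \<rho>) \<noteq> \<one>\<^bsub>A\<^esub>}"
      using S[of \<beta>] SP[of \<beta>] gmult_ginv_cancel[OF _ \<eta>, of \<beta>] by auto
  qed
  then have "support_sum A (\<lambda>(\<beta>, \<rho>). w \<beta> \<rho>) {(\<beta>, \<rho>) \<in> P. \<beta> \<cdot> \<rho> = \<eta>}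
      = finprod A (\<lambda>(\<beta>, \<rho>). w \<beta> \<rho>) (?h ` ?T)"
    by (simp only: support_sum_def)
  also have "\<dots> = finprod A (\<lambda>\<beta>. w \<beta> (\<beta>\<^sup>- \<cdot> \<eta>)) ?T"
    using w by (subst A.finprod_reindex) (auto simp: inj_on_def)
  also have "\<dots> = finprod A (\<lambda>\<beta>. w \<beta> (\<beta>\<^sup>- \<cdot> \<eta>)) S"
    by (rule A.finprod_mono_neutral_cong_left) (use fin w in auto)
  finally show ?thesis .
qed

section \<open>Stalks, the action on them, and the summands of a convolution\<close>

locale ample_ring_sheaf = ample_groupoid \<G> + groupoid_ring_sheaf \<G> \<O>
  for \<G> :: "'g top_groupoid" (structure) and \<O> :: "('g, 'e) ring_gsheaf"
begin

abbreviation stalk_zero ("\<zero>\<langle>_\<rangle>") where "\<zero>\<langle>x\<rangle> \<equiv> \<zero>\<^bsub>stalk \<O> x\<^esub>"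

abbreviation act where "act \<equiv> sheaf_act \<O>"

lemma stalk_simps:
  "carrier (stalk \<O> x) = {e \<in> topspace (sheaf_space \<O>). sheaf_proj \<O> e = x}"
  "a \<oplus>\<^bsub>stalk \<O> x\<^esub> b = fiber_add \<O> a b"
  "a \<otimes>\<^bsub>stalk \<O> x\<^esub> b = fiber_mult \<O> a b"
  "\<one>\<^bsub>stalk \<O> x\<^esub> = fiber_one \<O> x"
  by (auto simp: stalk_def)

lemma stalk_group: "x \<in> units \<G> \<Longrightarrow> comm_group (add_monoid (stalk \<O> x))"
  using ring_stalk ring.is_abelian_group abelian_group.a_comm_group by blast

lemma act_closed:
  "\<lbrakk>\<gamma> \<in> arrows \<G>; a \<in> carrier (stalk \<O> (gdom \<G> \<gamma>))\<rbrakk> \<Longrightarrow> act \<gamma> a \<in> carrier (stalk \<O> (gran \<G> \<gamma>))"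
  using act_ring_hom ring_hom_closed by metis

lemma act_add:
  "\<lbrakk>\<gamma> \<in> arrows \<G>; a \<in> carrier (stalk \<O> (gdom \<G> \<gamma>)); b \<in> carrier (stalk \<O> (gdom \<G> \<gamma>))\<rbrakk>
     \<Longrightarrow> act \<gamma> (a \<oplus>\<^bsub>stalk \<O> (gdom \<G> \<gamma>)\<^esub> b) = act \<gamma> a \<oplus>\<^bsub>stalk \<O> (gran \<G> \<gamma>)\<^esub> act \<gamma> b"
  by (rule ring_hom_add[OF act_ring_hom])

lemma act_mult:
  "\<lbrakk>\<gamma> \<in> arrows \<G>; a \<in> carrier (stalk \<O> (gdom \<G> \<gamma>)); b \<in> carrier (stalk \<O> (gdom \<G> \<gamma>))\<rbrakk>
     \<Longrightarrow> act \<gamma> (a \<otimes>\<^bsub>stalk \<O> (gdom \<G> \<gamma>)\<^esub> b) = act \<gamma> a \<otimes>\<^bsub>stalk \<O> (gran \<G> \<gamma>)\<^esub> act \<gamma> b"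
  by (rule ring_hom_mult[OF act_ring_hom])

lemma act_one: "\<gamma> \<in> arrows \<G> \<Longrightarrow> act \<gamma> \<one>\<^bsub>stalk \<O> (gdom \<G> \<gamma>)\<^esub> = \<one>\<^bsub>stalk \<O> (gran \<G> \<gamma>)\<^esub>"
  using act_ring_hom ring_hom_one by metis

lemma act_zero:
  assumes "\<gamma> \<in> arrows \<G>"
  shows "act \<gamma> \<zero>\<langle>gdom \<G> \<gamma>\<rangle> = \<zero>\<langle>gran \<G> \<gamma>\<rangle>"
  using act_ring_hom[OF assms] ring_stalk gdom_units[OF assms] gran_units[OF assms]
    ring_hom_zero by blast

lemma act_gmult:
  "\<lbrakk>\<beta> \<in> arrows \<G>; \<gamma> \<in> arrows \<G>; gdom \<G> \<beta> = gran \<G> \<gamma>; e \<in> carrier (stalk \<O> (gdom \<G> \<gamma>))\<rbrakk>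
     \<Longrightarrow> act (\<beta> \<cdot> \<gamma>) e = act \<beta> (act \<gamma> e)"
  using act_act by (simp add: stalk_simps)

lemma act_on_unit: "\<lbrakk>u \<in> units \<G>; e \<in> carrier (stalk \<O> u)\<rbrakk> \<Longrightarrow> act u e = e"
  using act_unit by (auto simp: stalk_simps)

lemma act_ginv_act:
  assumes "\<gamma> \<in> arrows \<G>" "e \<in> carrier (stalk \<O> (gdom \<G> \<gamma>))"
  shows "act (\<gamma>\<^sup>-) (act \<gamma> e) = e"
  using act_gmult[of "\<gamma>\<^sup>-" \<gamma> e] assms
  by (simp add: inv_closed gdom_inv ginv_gmult_self act_on_unit gdom_units)

lemma act_act_ginv:
  assumes "\<gamma> \<in> arrows \<G>" "e \<in> carrier (stalk \<O> (gran \<G> \<gamma>))"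
  shows "act \<gamma> (act (\<gamma>\<^sup>-) e) = e"
  using act_gmult[of \<gamma> "\<gamma>\<^sup>-" e] assms
  by (simp add: inv_closed gdom_inv gran_inv gmult_ginv_self act_on_unit gran_units)

lemma act_finsum:
  assumes "\<gamma> \<in> arrows \<G>" "\<And>i. i \<in> A \<Longrightarrow> h i \<in> carrier (stalk \<O> (gdom \<G> \<gamma>))"
  shows "act \<gamma> (\<Oplus>\<^bsub>stalk \<O> (gdom \<G> \<gamma>)\<^esub>i\<in>A. h i) = (\<Oplus>\<^bsub>stalk \<O> (gran \<G> \<gamma>)\<^esub>i\<in>A. act \<gamma> (h i))"
proof -
  interpret D: ring "stalk \<O> (gdom \<G> \<gamma>)" using ring_stalk gdom_units assms(1) by blast
  interpret R: ring "stalk \<O> (gran \<G> \<gamma>)" using ring_stalk gran_units assms(1) by blast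
  show ?thesis
    using assms
  proof (induction A rule: infinite_finite_induct)
    case (insert i A)
    then have "act \<gamma> \<circ> h \<in> A \<rightarrow> carrier (stalk \<O> (gran \<G> \<gamma>))"
      using act_closed by auto
    then show ?case
      using insert act_closed by (simp add: act_add Pi_def)
  qed (simp_all add: act_zero)
qed

lemma carrier_arrow_sections:
  "carrier (arrow_sections \<G> \<O>) = (\<Pi>\<^sub>E \<gamma>\<in>arrows \<G>. carrier (stalk \<O> (gran \<G> \<gamma>)))"
  by (simp add: arrow_sections_def)

lemma section_closed:
  "\<lbrakk>f \<in> carrier (arrow_sections \<G> \<O>); \<gamma> \<in> arrows \<G>\<rbrakk> \<Longrightarrow> f \<gamma> \<in> carrier (stalk \<O> (gran \<G> \<gamma>))"
  by (auto simp: carrier_arrow_sections)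

lemma section_eqI:
  "\<lbrakk>f \<in> carrier (arrow_sections \<G> \<O>); g \<in> carrier (arrow_sections \<G> \<O>);
     \<And>\<gamma>. \<gamma> \<in> arrows \<G> \<Longrightarrow> f \<gamma> = g \<gamma>\<rbrakk> \<Longrightarrow> f = g"
  unfolding carrier_arrow_sections by (rule PiE_ext)

lemma group_arrow_sections: "group (arrow_sections \<G> \<O>)"
  unfolding arrow_sections_def
  by (rule product_group) (use stalk_group gran_units comm_group.axioms(2) in blast)

lemma mult_arrow_sections:
  "f \<otimes>\<^bsub>arrow_sections \<G> \<O>\<^esub> g = (\<lambda>\<gamma>\<in>arrows \<G>. f \<gamma> \<oplus>\<^bsub>stalk \<O> (gran \<G> \<gamma>)\<^esub> g \<gamma>)"
  by (simp add: arrow_sections_def)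

lemma inv_arrow_sections:
  assumes "f \<in> carrier (arrow_sections \<G> \<O>)"
  shows "inv\<^bsub>arrow_sections \<G> \<O>\<^esub> f = (\<lambda>\<gamma>\<in>arrows \<G>. \<ominus>\<^bsub>stalk \<O> (gran \<G> \<gamma>)\<^esub> f \<gamma>)"
  unfolding arrow_sections_def a_inv_def
  by (rule inv_product_group) (use stalk_group gran_units comm_group.axioms(2) assms in \<open>auto simp: carrier_arrow_sections\<close>)

lemma one_arrow_sections: "\<one>\<^bsub>arrow_sections \<G> \<O>\<^esub> = (\<lambda>\<gamma>\<in>arrows \<G>. \<zero>\<langle>gran \<G> \<gamma>\<rangle>)"
  by (simp add: arrow_sections_def)

text \<open>A summand of \<open>(f * g)(\<eta>)\<close>: the one belonging to the factorisation \<open>\<eta> = \<beta> \<cdot> (\<beta>\<^sup>- \<cdot> \<eta>)\<close>.\<close>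

definition conv_term :: "('g \<Rightarrow> 'e) \<Rightarrow> ('g \<Rightarrow> 'e) \<Rightarrow> 'g \<Rightarrow> 'g \<Rightarrow> 'e" where
  "conv_term f g \<eta> \<beta> = f \<beta> \<otimes>\<^bsub>stalk \<O> (gran \<G> \<eta>)\<^esub> act \<beta> (g (\<beta>\<^sup>- \<cdot> \<eta>))"

text \<open>Sections are best pictured as matrices: a row is the set of arrows with a given range, a
  column the set of arrows with a given domain. The factorisations of \<eta> are indexed by the row
  of \<eta>.\<close>

lemma ginv_gmult_row:
  assumes "\<beta> \<in> arrows \<G>" "\<eta> \<in> arrows \<G>" "gran \<G> \<beta> = gran \<G> \<eta>"
  shows "\<beta>\<^sup>- \<cdot> \<eta> \<in> arrows \<G>" "gran \<G> (\<beta>\<^sup>- \<cdot> \<eta>) = gdom \<G> \<beta>" "gdom \<G> (\<beta>\<^sup>- \<cdot> \<eta>) = gdom \<G> \<eta>"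
  using assms by (auto simp: gmult_arrow gran_gmult gdom_gmult inv_closed gdom_inv gran_inv)

lemma conv_term_closed:
  assumes "\<eta> \<in> arrows \<G>" "\<beta> \<in> arrows \<G>" "gran \<G> \<beta> = gran \<G> \<eta>"
    "f \<beta> \<in> carrier (stalk \<O> (gran \<G> \<beta>))" "g (\<beta>\<^sup>- \<cdot> \<eta>) \<in> carrier (stalk \<O> (gdom \<G> \<beta>))"
  shows "conv_term f g \<eta> \<beta> \<in> carrier (stalk \<O> (gran \<G> \<eta>))"
proof -
  interpret ring "stalk \<O> (gran \<G> \<eta>)" using ring_stalk gran_units assms(1) by blast
  show ?thesis
    using assms act_closed[of \<beta> "g (\<beta>\<^sup>- \<cdot> \<eta>)"] by (simp add: conv_term_def)
qed

lemma conv_term_section_closed: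
  assumes "f \<in> carrier (arrow_sections \<G> \<O>)" "g \<in> carrier (arrow_sections \<G> \<O>)"
    "\<eta> \<in> arrows \<G>" "\<beta> \<in> arrows \<G>" "gran \<G> \<beta> = gran \<G> \<eta>"
  shows "conv_term f g \<eta> \<beta> \<in> carrier (stalk \<O> (gran \<G> \<eta>))"
  using assms section_closed ginv_gmult_row[of \<beta> \<eta>] by (metis conv_term_closed)

lemma conv_term_zero_left:
  assumes "\<eta> \<in> arrows \<G>" "\<beta> \<in> arrows \<G>" "gran \<G> \<beta> = gran \<G> \<eta>" "f \<beta> = \<zero>\<langle>gran \<G> \<beta>\<rangle>"
    "g (\<beta>\<^sup>- \<cdot> \<eta>) \<in> carrier (stalk \<O> (gdom \<G> \<beta>))"
  shows "conv_term f g \<eta> \<beta> = \<zero>\<langle>gran \<G> \<eta>\<rangle>"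
proof -
  interpret ring "stalk \<O> (gran \<G> \<eta>)" using ring_stalk gran_units assms(1) by blast
  show ?thesis
    using assms act_closed[of \<beta> "g (\<beta>\<^sup>- \<cdot> \<eta>)"] by (simp add: conv_term_def)
qed

lemma conv_term_zero_right:
  assumes "\<eta> \<in> arrows \<G>" "\<beta> \<in> arrows \<G>" "gran \<G> \<beta> = gran \<G> \<eta>" "f \<beta> \<in> carrier (stalk \<O> (gran \<G> \<beta>))"
    "g (\<beta>\<^sup>- \<cdot> \<eta>) = \<zero>\<langle>gdom \<G> \<beta>\<rangle>"
  shows "conv_term f g \<eta> \<beta> = \<zero>\<langle>gran \<G> \<eta>\<rangle>"
proof -
  interpret ring "stalk \<O> (gran \<G> \<eta>)" using ring_stalk gran_units assms(1) by blast
  show ?thesis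
    using assms by (simp add: conv_term_def act_zero)
qed

lemma convolution_section:
  assumes "f \<in> carrier (arrow_sections \<G> \<O>)" "g \<in> carrier (arrow_sections \<G> \<O>)"
  shows "convolution \<G> \<O> f g \<in> carrier (arrow_sections \<G> \<O>)"
proof -
  have "convolution \<G> \<O> f g \<eta> \<in> carrier (stalk \<O> (gran \<G> \<eta>))" if \<eta>: "\<eta> \<in> arrows \<G>" for \<eta>
  proof -
    interpret ring "stalk \<O> (gran \<G> \<eta>)" using ring_stalk gran_units \<eta> by blast
    have "f \<beta> \<otimes>\<^bsub>stalk \<O> (gran \<G> \<eta>)\<^esub> act \<beta> (g \<rho>) \<in> carrier (stalk \<O> (gran \<G> \<eta>))"
      if "(\<beta>, \<rho>) \<in> composable \<G>" "\<beta> \<cdot> \<rho> = \<eta>" for \<beta> \<rho>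
    proof (rule m_closed)
      have c: "\<beta> \<in> arrows \<G>" "\<rho> \<in> arrows \<G>" "gdom \<G> \<beta> = gran \<G> \<rho>" "gran \<G> \<eta> = gran \<G> \<beta>"
        using that gran_gmult by auto
      show "f \<beta> \<in> carrier (stalk \<O> (gran \<G> \<eta>))" "act \<beta> (g \<rho>) \<in> carrier (stalk \<O> (gran \<G> \<eta>))"
        using c assms section_closed[of f \<beta>] section_closed[of g \<rho>] act_closed[of \<beta> "g \<rho>"] by simp_all
    qed
    then show ?thesis
      using \<eta> unfolding convolution_def support_sum_def finsum_def[symmetric]
      by (auto intro!: finsum_closed)
  qed
  then show ?thesis
    by (simp add: carrier_arrow_sections convolution_def)
qed

text \<open>The index set may be any finite part of the row that contains the nonzero summands. This
  freedom allows several convolutions to be compared over one common set.\<close>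

lemma convolution_eq_finsum:
  assumes f: "f \<in> carrier (arrow_sections \<G> \<O>)" and g: "g \<in> carrier (arrow_sections \<G> \<O>)"
    and \<eta>: "\<eta> \<in> arrows \<G>" and fin: "finite S"
    and S: "\<And>\<beta>. \<beta> \<in> S \<Longrightarrow> \<beta> \<in> arrows \<G> \<and> gran \<G> \<beta> = gran \<G> \<eta>"
    and nz: "\<And>\<beta>. \<lbrakk>\<beta> \<in> arrows \<G>; gran \<G> \<beta> = gran \<G> \<eta>; conv_term f g \<eta> \<beta> \<noteq> \<zero>\<langle>gran \<G> \<eta>\<rangle>\<rbrakk> \<Longrightarrow> \<beta> \<in> S"
  shows "convolution \<G> \<O> f g \<eta> = (\<Oplus>\<^bsub>stalk \<O> (gran \<G> \<eta>)\<^esub>\<beta>\<in>S. conv_term f g \<eta> \<beta>)"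
proof -
  have "convolution \<G> \<O> f g \<eta> = support_sum (add_monoid (stalk \<O> (gran \<G> \<eta>)))
      (\<lambda>(\<beta>, \<rho>). f \<beta> \<otimes>\<^bsub>stalk \<O> (gran \<G> \<eta>)\<^esub> act \<beta> (g \<rho>)) {(\<beta>, \<rho>) \<in> composable \<G>. \<beta> \<cdot> \<rho> = \<eta>}"
    using \<eta> by (simp add: convolution_def)
  also have "\<dots> = finprod (add_monoid (stalk \<O> (gran \<G> \<eta>)))
      (\<lambda>\<beta>. f \<beta> \<otimes>\<^bsub>stalk \<O> (gran \<G> \<eta>)\<^esub> act \<beta> (g (\<beta>\<^sup>- \<cdot> \<eta>))) S"
  proof (rule support_sum_factorisations[OF _ \<eta> fin order_refl S])
    show "comm_monoid (add_monoid (stalk \<O> (gran \<G> \<eta>)))"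
      using stalk_group gran_units \<eta> comm_group.axioms(1) by blast
    show "\<beta> \<in> S" if "(\<beta>, \<beta>\<^sup>- \<cdot> \<eta>) \<in> composable \<G>" "gran \<G> \<beta> = gran \<G> \<eta>"
      "f \<beta> \<otimes>\<^bsub>stalk \<O> (gran \<G> \<eta>)\<^esub> act \<beta> (g (\<beta>\<^sup>- \<cdot> \<eta>)) \<noteq> \<one>\<^bsub>add_monoid (stalk \<O> (gran \<G> \<eta>))\<^esub>" for \<beta>
      using nz[of \<beta>] that by (auto simp: conv_term_def)
    show "(\<beta>, \<beta>\<^sup>- \<cdot> \<eta>) \<in> composable \<G> \<or>
         f \<beta> \<otimes>\<^bsub>stalk \<O> (gran \<G> \<eta>)\<^esub> act \<beta> (g (\<beta>\<^sup>- \<cdot> \<eta>)) = \<one>\<^bsub>add_monoid (stalk \<O> (gran \<G> \<eta>))\<^esub>" if "\<beta> \<in> S" for \<beta>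
      using S[OF that] ginv_gmult_row[OF _ \<eta>] by simp
    show "f \<beta> \<otimes>\<^bsub>stalk \<O> (gran \<G> \<eta>)\<^esub> act \<beta> (g (\<beta>\<^sup>- \<cdot> \<eta>)) \<in> carrier (add_monoid (stalk \<O> (gran \<G> \<eta>)))"
      if "\<beta> \<in> S" for \<beta>
      using conv_term_section_closed[OF f g \<eta>] S[OF that] by (simp add: conv_term_def)
  qed
  finally show ?thesis
    by (simp add: finsum_def conv_term_def)
qed

lemma convolution_zero:
  assumes "f \<in> carrier (arrow_sections \<G> \<O>)" "g \<in> carrier (arrow_sections \<G> \<O>)" "\<eta> \<in> arrows \<G>"
    and "\<And>\<beta>. \<lbrakk>\<beta> \<in> arrows \<G>; gran \<G> \<beta> = gran \<G> \<eta>\<rbrakk> \<Longrightarrow> f \<beta> = \<zero>\<langle>gran \<G> \<beta>\<rangle> \<or> g (\<beta>\<^sup>- \<cdot> \<eta>) = \<zero>\<langle>gdom \<G> \<beta>\<rangle>"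
  shows "convolution \<G> \<O> f g \<eta> = \<zero>\<langle>gran \<G> \<eta>\<rangle>"
proof -
  interpret ring "stalk \<O> (gran \<G> \<eta>)" using ring_stalk gran_units assms(3) by blast
  have "conv_term f g \<eta> \<beta> = \<zero>\<langle>gran \<G> \<eta>\<rangle>" if "\<beta> \<in> arrows \<G>" "gran \<G> \<beta> = gran \<G> \<eta>" for \<beta>
    using assms that conv_term_zero_left conv_term_zero_right section_closed ginv_gmult_row(1,2)[OF that(1) assms(3) that(2)]
    by metis
  then show ?thesis
    using convolution_eq_finsum[OF assms(1-3), of "{}"] by simp
qed

lemma convolution_single:
  assumes "f \<in> carrier (arrow_sections \<G> \<O>)" "g \<in> carrier (arrow_sections \<G> \<O>)" "\<eta> \<in> arrows \<G>"
    and "\<beta> \<in> arrows \<G>" "gran \<G> \<beta> = gran \<G> \<eta>"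
    and "\<And>\<beta>'. \<lbrakk>\<beta>' \<in> arrows \<G>; gran \<G> \<beta>' = gran \<G> \<eta>; \<beta>' \<noteq> \<beta>\<rbrakk>
          \<Longrightarrow> f \<beta>' = \<zero>\<langle>gran \<G> \<beta>'\<rangle> \<or> g (\<beta>'\<^sup>- \<cdot> \<eta>) = \<zero>\<langle>gdom \<G> \<beta>'\<rangle>"
  shows "convolution \<G> \<O> f g \<eta> = f \<beta> \<otimes>\<^bsub>stalk \<O> (gran \<G> \<eta>)\<^esub> act \<beta> (g (\<beta>\<^sup>- \<cdot> \<eta>))"
proof -
  interpret ring "stalk \<O> (gran \<G> \<eta>)" using ring_stalk gran_units assms(3) by blast
  have "conv_term f g \<eta> \<beta>' = \<zero>\<langle>gran \<G> \<eta>\<rangle>" if "\<beta>' \<in> arrows \<G>" "gran \<G> \<beta>' = gran \<G> \<eta>" "\<beta>' \<noteq> \<beta>" for \<beta>'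
    using assms that conv_term_zero_left conv_term_zero_right section_closed
      ginv_gmult_row(1,2)[OF that(1) assms(3) that(2)]
    by metis
  then have "convolution \<G> \<O> f g \<eta> = (\<Oplus>\<^bsub>stalk \<O> (gran \<G> \<eta>)\<^esub>\<beta>\<in>{\<beta>}. conv_term f g \<eta> \<beta>)"
    by (intro convolution_eq_finsum assms) (use assms(4,5) in auto)
  also have "\<dots> = conv_term f g \<eta> \<beta>"
    using conv_term_section_closed[OF assms(1-5)] by simp
  finally show ?thesis by (simp add: conv_term_def)
qed

text \<open>Row finiteness of the left factor bounds the nonzero summands at every arrow, whatever
  the right factor is. Column finiteness is what the action on the bimodule uses.\<close>

definition row_finite :: "('g \<Rightarrow> 'e) \<Rightarrow> bool" where
  "row_finite f \<longleftrightarrow> (\<forall>x\<in>units \<G>. finite {\<gamma> \<in> arrows \<G>. gran \<G> \<gamma> = x \<and> f \<gamma> \<noteq> \<zero>\<langle>x\<rangle>})"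

definition column_finite :: "('g \<Rightarrow> 'e) \<Rightarrow> bool" where
  "column_finite f \<longleftrightarrow> (\<forall>x\<in>units \<G>. finite {\<gamma> \<in> arrows \<G>. gdom \<G> \<gamma> = x \<and> f \<gamma> \<noteq> \<zero>\<langle>gran \<G> \<gamma>\<rangle>})"

lemma convolution_row_finite:
  assumes "f \<in> carrier (arrow_sections \<G> \<O>)" "g \<in> carrier (arrow_sections \<G> \<O>)"
    and \<eta>: "\<eta> \<in> arrows \<G>" and "finite S"
    and S: "{\<beta> \<in> arrows \<G>. gran \<G> \<beta> = gran \<G> \<eta> \<and> f \<beta> \<noteq> \<zero>\<langle>gran \<G> \<eta>\<rangle>} \<subseteq> S"
      "S \<subseteq> {\<beta> \<in> arrows \<G>. gran \<G> \<beta> = gran \<G> \<eta>}"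
  shows "convolution \<G> \<O> f g \<eta> = (\<Oplus>\<^bsub>stalk \<O> (gran \<G> \<eta>)\<^esub>\<beta>\<in>S. conv_term f g \<eta> \<beta>)"
proof (rule convolution_eq_finsum[OF assms(1-4)])
  show "\<beta> \<in> S" if "\<beta> \<in> arrows \<G>" "gran \<G> \<beta> = gran \<G> \<eta>" "conv_term f g \<eta> \<beta> \<noteq> \<zero>\<langle>gran \<G> \<eta>\<rangle>" for \<beta>
  proof -
    have "g (\<beta>\<^sup>- \<cdot> \<eta>) \<in> carrier (stalk \<O> (gdom \<G> \<beta>))"
      using section_closed[OF assms(2)] ginv_gmult_row[OF that(1) \<eta> that(2)] by metis
    then have "f \<beta> \<noteq> \<zero>\<langle>gran \<G> \<eta>\<rangle>"
      using conv_term_zero_left[OF \<eta> that(1,2)] that by auto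
    then show ?thesis using S(1) that by auto
  qed
qed (use S in auto)

lemma convolution_distrib_left:
  assumes f: "f \<in> carrier (arrow_sections \<G> \<O>)" "row_finite f"
    and g: "g \<in> carrier (arrow_sections \<G> \<O>)" "h \<in> carrier (arrow_sections \<G> \<O>)"
  shows "convolution \<G> \<O> f (g \<otimes>\<^bsub>arrow_sections \<G> \<O>\<^esub> h) =
           convolution \<G> \<O> f g \<otimes>\<^bsub>arrow_sections \<G> \<O>\<^esub> convolution \<G> \<O> f h"
proof (rule section_eqI)
  interpret A: group "arrow_sections \<G> \<O>" by (rule group_arrow_sections)
  fix \<eta> assume \<eta>: "\<eta> \<in> arrows \<G>"
  interpret ring "stalk \<O> (gran \<G> \<eta>)" using ring_stalk gran_units \<eta> by blast
  define S where "S = {\<beta> \<in> arrows \<G>. gran \<G> \<beta> = gran \<G> \<eta> \<and> f \<beta> \<noteq> \<zero>\<langle>gran \<G> \<eta>\<rangle>}"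
  have S: "finite S" "\<And>\<beta>. \<beta> \<in> S \<Longrightarrow> \<beta> \<in> arrows \<G> \<and> gran \<G> \<beta> = gran \<G> \<eta>"
    using f(2) gran_units[OF \<eta>] by (auto simp: S_def row_finite_def)
  have m: "g \<otimes>\<^bsub>arrow_sections \<G> \<O>\<^esub> h \<in> carrier (arrow_sections \<G> \<O>)"
    using g by (rule A.m_closed)
  have conv: "convolution \<G> \<O> f k \<eta> = (\<Oplus>\<^bsub>stalk \<O> (gran \<G> \<eta>)\<^esub>\<beta>\<in>S. conv_term f k \<eta> \<beta>)"
    if "k \<in> carrier (arrow_sections \<G> \<O>)" for k
    by (rule convolution_row_finite[OF f(1) that \<eta> S(1)]) (auto simp: S_def)
  have "conv_term f (g \<otimes>\<^bsub>arrow_sections \<G> \<O>\<^esub> h) \<eta> \<beta> = conv_term f g \<eta> \<beta> \<oplus>\<^bsub>stalk \<O> (gran \<G> \<eta>)\<^esub> conv_term f h \<eta> \<beta>"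
    if "\<beta> \<in> S" for \<beta>
  proof -
    have \<beta>: "\<beta> \<in> arrows \<G>" "gran \<G> \<beta> = gran \<G> \<eta>" using S that by auto
    note row = ginv_gmult_row[OF \<beta>(1) \<eta> \<beta>(2)]
    have c: "g (\<beta>\<^sup>- \<cdot> \<eta>) \<in> carrier (stalk \<O> (gdom \<G> \<beta>))" "h (\<beta>\<^sup>- \<cdot> \<eta>) \<in> carrier (stalk \<O> (gdom \<G> \<beta>))"
      using section_closed[OF g(1) row(1)] section_closed[OF g(2) row(1)] row(2) by auto
    then show ?thesis
      using \<beta> row act_closed[of \<beta>] section_closed[OF f(1), of \<beta>]
      by (simp add: conv_term_def mult_arrow_sections act_add r_distr)
  qed
  then have "convolution \<G> \<O> f (g \<otimes>\<^bsub>arrow_sections \<G> \<O>\<^esub> h) \<eta> =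
     (\<Oplus>\<^bsub>stalk \<O> (gran \<G> \<eta>)\<^esub>\<beta>\<in>S. conv_term f g \<eta> \<beta> \<oplus>\<^bsub>stalk \<O> (gran \<G> \<eta>)\<^esub> conv_term f h \<eta> \<beta>)"
    using S conv_term_section_closed[OF f(1) g(1) \<eta>] conv_term_section_closed[OF f(1) g(2) \<eta>]
    unfolding conv[OF m] by (intro finsum_cong') auto
  also have "\<dots> = convolution \<G> \<O> f g \<eta> \<oplus>\<^bsub>stalk \<O> (gran \<G> \<eta>)\<^esub> convolution \<G> \<O> f h \<eta>"
    using S conv_term_section_closed[OF f(1) g(1) \<eta>] conv_term_section_closed[OF f(1) g(2) \<eta>]
    unfolding conv[OF g(1)] conv[OF g(2)] by (intro finsum_addf) auto
  finally show "convolution \<G> \<O> f (g \<otimes>\<^bsub>arrow_sections \<G> \<O>\<^esub> h) \<eta> =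
     (convolution \<G> \<O> f g \<otimes>\<^bsub>arrow_sections \<G> \<O>\<^esub> convolution \<G> \<O> f h) \<eta>"
    using \<eta> by (simp add: mult_arrow_sections)
qed (use group.is_monoid[OF group_arrow_sections] f g convolution_section monoid.m_closed in metis)+

lemma convolution_distrib_right:
  assumes f: "f \<in> carrier (arrow_sections \<G> \<O>)" "row_finite f"
    and g: "g \<in> carrier (arrow_sections \<G> \<O>)" "row_finite g" and h: "h \<in> carrier (arrow_sections \<G> \<O>)"
  shows "convolution \<G> \<O> (f \<otimes>\<^bsub>arrow_sections \<G> \<O>\<^esub> g) h =
           convolution \<G> \<O> f h \<otimes>\<^bsub>arrow_sections \<G> \<O>\<^esub> convolution \<G> \<O> g h"
proof (rule section_eqI)
  interpret A: group "arrow_sections \<G> \<O>" by (rule group_arrow_sections)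
  fix \<eta> assume \<eta>: "\<eta> \<in> arrows \<G>"
  interpret ring "stalk \<O> (gran \<G> \<eta>)" using ring_stalk gran_units \<eta> by blast
  \<comment> \<open>One index set for the convolutions of \<open>f\<close>, of \<open>g\<close> and
    of their sum, so that they can be added term by term.\<close>
  define S where "S = {\<beta> \<in> arrows \<G>. gran \<G> \<beta> = gran \<G> \<eta> \<and> f \<beta> \<noteq> \<zero>\<langle>gran \<G> \<eta>\<rangle>} \<union>
      {\<beta> \<in> arrows \<G>. gran \<G> \<beta> = gran \<G> \<eta> \<and> g \<beta> \<noteq> \<zero>\<langle>gran \<G> \<eta>\<rangle>}"
  have S: "finite S" "\<And>\<beta>. \<beta> \<in> S \<Longrightarrow> \<beta> \<in> arrows \<G> \<and> gran \<G> \<beta> = gran \<G> \<eta>"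
    using f(2) g(2) gran_units[OF \<eta>] by (auto simp: S_def row_finite_def)
  have conv: "convolution \<G> \<O> k h \<eta> = (\<Oplus>\<^bsub>stalk \<O> (gran \<G> \<eta>)\<^esub>\<beta>\<in>S. conv_term k h \<eta> \<beta>)"
    if "k \<in> {f, g, f \<otimes>\<^bsub>arrow_sections \<G> \<O>\<^esub> g}" for k
  proof (rule convolution_row_finite[OF _ h \<eta> S(1)])
    show "k \<in> carrier (arrow_sections \<G> \<O>)"
      using that f(1) g(1) A.m_closed by blast
    show "{\<beta> \<in> arrows \<G>. gran \<G> \<beta> = gran \<G> \<eta> \<and> k \<beta> \<noteq> \<zero>\<langle>gran \<G> \<eta>\<rangle>} \<subseteq> S"
      using that by (auto simp: S_def mult_arrow_sections)
  qed (auto simp: S_def)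
  have "conv_term (f \<otimes>\<^bsub>arrow_sections \<G> \<O>\<^esub> g) h \<eta> \<beta> = conv_term f h \<eta> \<beta> \<oplus>\<^bsub>stalk \<O> (gran \<G> \<eta>)\<^esub> conv_term g h \<eta> \<beta>"
    if "\<beta> \<in> S" for \<beta>
  proof -
    have \<beta>: "\<beta> \<in> arrows \<G>" "gran \<G> \<beta> = gran \<G> \<eta>" using S that by auto
    note row = ginv_gmult_row[OF \<beta>(1) \<eta> \<beta>(2)]
    have c: "h (\<beta>\<^sup>- \<cdot> \<eta>) \<in> carrier (stalk \<O> (gdom \<G> \<beta>))"
      using section_closed[OF h row(1)] row(2) by auto
    then show ?thesis
      using \<beta> row act_closed[of \<beta>] section_closed[OF f(1), of \<beta>] section_closed[OF g(1), of \<beta>]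
      by (simp add: conv_term_def mult_arrow_sections l_distr)
  qed
  then have "convolution \<G> \<O> (f \<otimes>\<^bsub>arrow_sections \<G> \<O>\<^esub> g) h \<eta> =
     (\<Oplus>\<^bsub>stalk \<O> (gran \<G> \<eta>)\<^esub>\<beta>\<in>S. conv_term f h \<eta> \<beta> \<oplus>\<^bsub>stalk \<O> (gran \<G> \<eta>)\<^esub> conv_term g h \<eta> \<beta>)"
    using S conv_term_section_closed[OF f(1) h \<eta>] conv_term_section_closed[OF g(1) h \<eta>]
    unfolding conv[OF insertI2[OF insertI2[OF singletonI]]] by - (rule finsum_cong', auto)
  also have "\<dots> = convolution \<G> \<O> f h \<eta> \<oplus>\<^bsub>stalk \<O> (gran \<G> \<eta>)\<^esub> convolution \<G> \<O> g h \<eta>"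
    using S conv_term_section_closed[OF f(1) h \<eta>] conv_term_section_closed[OF g(1) h \<eta>]
    by (simp add: conv)
  finally show "convolution \<G> \<O> (f \<otimes>\<^bsub>arrow_sections \<G> \<O>\<^esub> g) h \<eta> =
     (convolution \<G> \<O> f h \<otimes>\<^bsub>arrow_sections \<G> \<O>\<^esub> convolution \<G> \<O> g h) \<eta>"
    using \<eta> by (simp add: mult_arrow_sections)
qed (use group.is_monoid[OF group_arrow_sections] f g h convolution_section monoid.m_closed in metis)+

section \<open>Indicator sections\<close>

definition idem :: "'g set \<Rightarrow> 'g \<Rightarrow> 'e" where
  "idem K = (\<lambda>\<gamma>\<in>arrows \<G>. if \<gamma> \<in> K then \<one>\<^bsub>stalk \<O> (gran \<G> \<gamma>)\<^esub> else \<zero>\<langle>gran \<G> \<gamma>\<rangle>)"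

lemma idem_section: "idem K \<in> carrier (arrow_sections \<G> \<O>)"
proof -
  have "\<one>\<^bsub>stalk \<O> (gran \<G> \<gamma>)\<^esub> \<in> carrier (stalk \<O> (gran \<G> \<gamma>))" "\<zero>\<langle>gran \<G> \<gamma>\<rangle> \<in> carrier (stalk \<O> (gran \<G> \<gamma>))"
    if "\<gamma> \<in> arrows \<G>" for \<gamma>
  proof -
    interpret ring "stalk \<O> (gran \<G> \<gamma>)" using ring_stalk gran_units that by blast
    show "\<one>\<^bsub>stalk \<O> (gran \<G> \<gamma>)\<^esub> \<in> carrier (stalk \<O> (gran \<G> \<gamma>))" "\<zero>\<langle>gran \<G> \<gamma>\<rangle> \<in> carrier (stalk \<O> (gran \<G> \<gamma>))"
      by simp_all
  qed
  then show ?thesis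
    by (auto simp: idem_def carrier_arrow_sections)
qed

text \<open>The only factorisation of \<eta> whose first factor is a unit starts with
  \<open>gran \<G> \<eta>\<close>. Left multiplication thus selects rows.\<close>

lemma convolution_idem_left:
  assumes "K \<subseteq> units \<G>" "f \<in> carrier (arrow_sections \<G> \<O>)" and \<eta>: "\<eta> \<in> arrows \<G>"
  shows "convolution \<G> \<O> (idem K) f \<eta> = (if gran \<G> \<eta> \<in> K then f \<eta> else \<zero>\<langle>gran \<G> \<eta>\<rangle>)"
proof -
  interpret ring "stalk \<O> (gran \<G> \<eta>)" using ring_stalk gran_units \<eta> by blast
  have r: "gran \<G> (gran \<G> \<eta>) = gran \<G> \<eta>" "gran \<G> \<eta> \<in> arrows \<G>" "(gran \<G> \<eta>)\<^sup>- \<cdot> \<eta> = \<eta>"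
    using \<eta> gran_units gran_unit gran_arrow ginv_unit gran_mult_self by auto
  have "convolution \<G> \<O> (idem K) f \<eta> = idem K (gran \<G> \<eta>) \<otimes>\<^bsub>stalk \<O> (gran \<G> \<eta>)\<^esub> act (gran \<G> \<eta>) (f ((gran \<G> \<eta>)\<^sup>- \<cdot> \<eta>))"
    by (rule convolution_single) (use assms idem_section r gran_unit in \<open>auto simp: idem_def\<close>)
  also have "\<dots> = idem K (gran \<G> \<eta>) \<otimes>\<^bsub>stalk \<O> (gran \<G> \<eta>)\<^esub> f \<eta>"
    using r act_on_unit[OF gran_units section_closed] assms by simp
  finally show ?thesis
    using section_closed[OF assms(2,3)] r by (simp add: idem_def)
qed

text \<open>\<open>\<beta>\<^sup>- \<cdot> \<eta>\<close> is a unit only for \<beta> = \<eta>, so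
  one summand survives. Right multiplication thus selects columns.\<close>

lemma convolution_idem_right:
  assumes "K \<subseteq> units \<G>" "f \<in> carrier (arrow_sections \<G> \<O>)" and \<eta>: "\<eta> \<in> arrows \<G>"
  shows "convolution \<G> \<O> f (idem K) \<eta> = (if gdom \<G> \<eta> \<in> K then f \<eta> else \<zero>\<langle>gran \<G> \<eta>\<rangle>)"
proof -
  interpret ring "stalk \<O> (gran \<G> \<eta>)" using ring_stalk gran_units \<eta> by blast
  have z: "idem K (\<beta>\<^sup>- \<cdot> \<eta>) = \<zero>\<langle>gdom \<G> \<beta>\<rangle>" if \<beta>: "\<beta> \<in> arrows \<G>" "gran \<G> \<beta> = gran \<G> \<eta>" "\<beta> \<noteq> \<eta>" for \<beta>
  proof -
    note row = ginv_gmult_row[OF \<beta>(1) \<eta> \<beta>(2)]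
    have "\<beta>\<^sup>- \<cdot> \<eta> \<notin> units \<G>"
    proof
      assume u: "\<beta>\<^sup>- \<cdot> \<eta> \<in> units \<G>"
      then have "\<beta> \<cdot> (\<beta>\<^sup>- \<cdot> \<eta>) = \<beta>"
        using row gran_unit gmult_unit_right \<beta>(1) by metis
      then show False
        using gmult_ginv_cancel[OF \<beta>(1) \<eta> \<beta>(2)] \<beta>(3) by simp
    qed
    then show ?thesis
      using assms(1) row by (auto simp: idem_def)
  qed
  have "convolution \<G> \<O> f (idem K) \<eta> = f \<eta> \<otimes>\<^bsub>stalk \<O> (gran \<G> \<eta>)\<^esub> act \<eta> (idem K (\<eta>\<^sup>- \<cdot> \<eta>))"
    by (rule convolution_single) (use assms idem_section z in auto)
  also have "idem K (\<eta>\<^sup>- \<cdot> \<eta>) = (if gdom \<G> \<eta> \<in> K then \<one>\<^bsub>stalk \<O> (gdom \<G> \<eta>)\<^esub> else \<zero>\<langle>gdom \<G> \<eta>\<rangle>)"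
    using \<eta> by (simp add: ginv_gmult_self idem_def gdom_arrow gran_gdom)
  finally show ?thesis
    using section_closed[OF assms(2,3)] \<eta> by (simp add: act_one act_zero)
qed

end

section \<open>Continuity of stalkwise operations\<close>

context ample_ring_sheaf
begin

abbreviation proj where "proj \<equiv> sheaf_proj \<O>"
abbreviation total_space where "total_space \<equiv> sheaf_space \<O>"

lemma continuous_proj: "continuous_map total_space (unit_space \<G>) proj"
  using local_homeomorphism_proj local_homeomorphism_continuous by blast

lemma proj_units: "e \<in> topspace total_space \<Longrightarrow> proj e \<in> units \<G>"
  using continuous_map_funspace[OF continuous_proj] by (auto simp: topspace_unit_space)

lemma continuous_map_into_fiber_product:
  assumes "continuous_map X Y s" "continuous_map X Z t" "\<And>x. x \<in> topspace X \<Longrightarrow> P (s x) (t x)"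
  shows "continuous_map X (subtopology (prod_topology Y Z) {(a, b). P a b}) (\<lambda>x. (s x, t x))"
  using assms by (auto simp: continuous_map_in_subtopology continuous_map_pairwise comp_def)

lemma continuous_map_stalk_add:
  assumes "continuous_map X total_space s" "continuous_map X total_space t"
    "\<And>x. x \<in> topspace X \<Longrightarrow> proj (s x) = proj (t x)"
  shows "continuous_map X total_space (\<lambda>x. s x \<oplus>\<^bsub>stalk \<O> (q x)\<^esub> t x)"
  using continuous_map_compose[OF continuous_map_into_fiber_product[OF assms(1,2), of "\<lambda>a b. proj a = proj b"] continuous_fiber_add] assms(3)
  by (simp add: comp_def stalk_simps)

lemma continuous_map_stalk_mult:
  assumes "continuous_map X total_space s" "continuous_map X total_space t"
    "\<And>x. x \<in> topspace X \<Longrightarrow> proj (s x) = proj (t x)"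
  shows "continuous_map X total_space (\<lambda>x. s x \<otimes>\<^bsub>stalk \<O> (q x)\<^esub> t x)"
  using continuous_map_compose[OF continuous_map_into_fiber_product[OF assms(1,2), of "\<lambda>a b. proj a = proj b"] continuous_fiber_mult] assms(3)
  by (simp add: comp_def stalk_simps)

lemma continuous_map_act:
  assumes "continuous_map X (arrow_space \<G>) b" "continuous_map X total_space s"
    "\<And>x. x \<in> topspace X \<Longrightarrow> gdom \<G> (b x) = proj (s x)"
  shows "continuous_map X total_space (\<lambda>x. act (b x) (s x))"
  using continuous_map_compose[OF continuous_map_into_fiber_product[OF assms(1,2), of "\<lambda>\<gamma> e. gdom \<G> \<gamma> = proj e"]
      continuous_act] assms(3)
  by (simp add: comp_def)

lemma proj_locally_injective:
  assumes "e \<in> topspace total_space"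
  obtains S where "openin total_space S" "e \<in> S" "inj_on proj S"
proof -
  obtain S where S: "openin total_space S" "e \<in> S"
    "homeomorphic_map (subtopology total_space S) (subtopology (unit_space \<G>) (proj ` S)) proj"
    using local_homeomorphism_proj assms unfolding local_homeomorphism_def by metis
  have "inj_on proj (topspace total_space \<inter> S)"
    using homeomorphic_imp_injective_map[OF S(3)] by simp
  then have "inj_on proj S"
    using openin_subset[OF S(1)] by (simp add: Int_absorb1)
  then show thesis
    using S that by blast
qed

text \<open>The common value at \<open>x\<close> lies in an open set on which the projection is
  injective; near \<open>x\<close> both maps stay in it and have the same projection. This turns an
  identity at one point into an identity on a neighbourhood.\<close>

lemma sections_agree_locally:
  assumes s: "continuous_map X total_space s" and t: "continuous_map X total_space t"
    and st: "\<And>y. y \<in> topspace X \<Longrightarrow> proj (s y) = proj (t y)" and x: "x \<in> topspace X" "s x = t x"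
  obtains U where "openin X U" "x \<in> U" "\<And>y. y \<in> U \<Longrightarrow> s y = t y"
proof -
  have "s x \<in> topspace total_space"
    using s x(1) by (auto simp: continuous_map_def)
  then obtain S where S: "openin total_space S" "s x \<in> S" "inj_on proj S"
    using proj_locally_injective by blast
  define U where "U = {y \<in> topspace X. s y \<in> S} \<inter> {y \<in> topspace X. t y \<in> S}"
  have "openin X U"
    unfolding U_def using openin_continuous_map_preimage[OF s S(1)] openin_continuous_map_preimage[OF t S(1)]
    by blast
  moreover have "s y = t y" if "y \<in> U" for y
    using that S(3) st by (auto simp: U_def inj_on_def)
  moreover have "x \<in> U"
    using x S(2) by (simp add: U_def)
  ultimately show thesis
    using that by metis
qed

lemma local_section:
  assumes "e \<in> topspace total_space"
  obtains V t where "openin (unit_space \<G>) V" "proj e \<in> V"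
    "continuous_map (subtopology (unit_space \<G>) V) total_space t"
    "\<And>x. x \<in> V \<Longrightarrow> t x \<in> carrier (stalk \<O> x)" "t (proj e) = e" "openin total_space (t ` V)"
proof -
  obtain S where S: "openin total_space S" "e \<in> S" "inj_on proj S"
    using proj_locally_injective assms by blast
  have ts: "topspace (subtopology total_space S) = S"
    using openin_subset[OF S(1)] by auto
  define t where "t = inv_into S proj"
  have "continuous_map (subtopology (unit_space \<G>) (proj ` S)) (subtopology total_space S) t"
    using homeomorphic_map_imp_continuous_inv_into[OF
      local_homeomorphism_homeomorphic_map[OF local_homeomorphism_proj S(1,3)]]
    unfolding ts t_def .
  then have t: "continuous_map (subtopology (unit_space \<G>) (proj ` S)) total_space t"
    by (simp add: continuous_map_in_subtopology)
  show thesis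
  proof
    show "openin (unit_space \<G>) (proj ` S)"
      using local_homeomorphism_openin_image[OF local_homeomorphism_proj S(1)] .
    show "t x \<in> carrier (stalk \<O> x)" if "x \<in> proj ` S" for x
      using that S openin_subset[OF S(1)] inv_into_into[OF that] f_inv_into_f[OF that]
      by (auto simp: stalk_simps t_def)
    show "t (proj e) = e"
      using S by (simp add: t_def)
    have "t ` proj ` S = S"
      unfolding t_def using S(3) by (simp add: image_image)
    then show "openin total_space (t ` proj ` S)"
      using S(1) by simp
  qed (use t S in auto)
qed

text \<open>Continuity is postulated for addition, multiplication and the unit section; the zero
  section inherits it from addition. A local section \<open>t\<close> through the zero at
  \<open>x\<close> satisfies \<open>t + t = t\<close> at \<open>x\<close>, hence nearby, and this
  identity forces \<open>t\<close> to be zero there.\<close>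

lemma continuous_stalk_zero: "continuous_map (unit_space \<G>) total_space stalk_zero"
proof (rule continuous_map_locallyI)
  fix x assume "x \<in> topspace (unit_space \<G>)"
  then have x: "x \<in> units \<G>" by (simp add: topspace_unit_space)
  interpret X: ring "stalk \<O> x" using ring_stalk x .
  have "\<zero>\<langle>x\<rangle> \<in> topspace total_space" and px: "proj \<zero>\<langle>x\<rangle> = x"
    using X.zero_closed by (auto simp: stalk_simps)
  then obtain V t where V: "openin (unit_space \<G>) V" "x \<in> V"
    and t: "continuous_map (subtopology (unit_space \<G>) V) total_space t"
    "\<And>y. y \<in> V \<Longrightarrow> t y \<in> carrier (stalk \<O> y)" "t x = \<zero>\<langle>x\<rangle>"
    using local_section by metis
  have Vu: "V \<subseteq> units \<G>"
    using V(1) openin_unit_space_iff by blast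
  have tsV: "topspace (subtopology (unit_space \<G>) V) = V"
    using Vu by (auto simp: topspace_unit_space)
  have pt: "proj (t y) = y" "t y \<in> topspace total_space" if "y \<in> V" for y
    using t(2)[OF that] by (auto simp: stalk_simps)
  have tt: "continuous_map (subtopology (unit_space \<G>) V) total_space (\<lambda>y. t y \<oplus>\<^bsub>stalk \<O> y\<^esub> t y)"
    by (rule continuous_map_stalk_add[OF t(1) t(1)]) simp
  obtain U where U: "openin (subtopology (unit_space \<G>) V) U" "x \<in> U"
     "\<And>y. y \<in> U \<Longrightarrow> t y \<oplus>\<^bsub>stalk \<O> y\<^esub> t y = t y"
  proof (rule sections_agree_locally[OF tt t(1)])
    fix y assume "y \<in> topspace (subtopology (unit_space \<G>) V)"
    then have y: "y \<in> V" using tsV by blast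
    interpret Y: ring "stalk \<O> y" using ring_stalk y Vu by blast
    have "t y \<oplus>\<^bsub>stalk \<O> y\<^esub> t y \<in> carrier (stalk \<O> y)" using t(2)[OF y] by simp
    then show "proj (t y \<oplus>\<^bsub>stalk \<O> y\<^esub> t y) = proj (t y)"
      using pt[OF y] by (auto simp: stalk_simps)
  qed (use V tsV t(3) in auto)
  have UV: "U \<subseteq> V" using U(1) openin_imp_subset by blast
  have z: "t y = \<zero>\<langle>y\<rangle>" if "y \<in> U" for y
  proof -
    interpret Y: ring "stalk \<O> y" using ring_stalk that UV Vu by blast
    show ?thesis
      using U(3)[OF that] t(2)[of y] that UV Y.add.l_cancel_one by blast
  qed
  have "openin (unit_space \<G>) U"
    using U(1) V(1) openin_trans_full by blast
  moreover have "continuous_map (subtopology (unit_space \<G>) U) total_space stalk_zero"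
  proof (rule continuous_map_eq)
    show "continuous_map (subtopology (unit_space \<G>) U) total_space t"
      using t(1) UV continuous_map_from_subtopology_mono by blast
  qed (use z in auto)
  ultimately show "\<exists>U. openin (unit_space \<G>) U \<and> x \<in> U \<and> continuous_map (subtopology (unit_space \<G>) U) total_space stalk_zero"
    using U(2) by blast
qed

text \<open>Take a local section \<open>t\<close> of the projection through the negative of
  \<open>e\<close>. The maps sending a point to its sum with \<open>t\<close> and to the zero of its
  stalk agree at \<open>e\<close>, hence near \<open>e\<close>, so negation is \<open>t\<close>
  after the projection there.\<close>

lemma continuous_stalk_neg: "continuous_map total_space total_space (\<lambda>e. \<ominus>\<^bsub>stalk \<O> (proj e)\<^esub> e)"
proof (rule continuous_map_locallyI)
  fix e assume e: "e \<in> topspace total_space"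
  define x where "x = proj e"
  have x: "x \<in> units \<G>" using proj_units[OF e] by (simp add: x_def)
  interpret X: ring "stalk \<O> x" using ring_stalk x .
  have ex: "e \<in> carrier (stalk \<O> x)" by (simp add: stalk_simps e x_def)
  then have "\<ominus>\<^bsub>stalk \<O> x\<^esub> e \<in> topspace total_space" "proj (\<ominus>\<^bsub>stalk \<O> x\<^esub> e) = x"
    using X.a_inv_closed[OF ex] by (auto simp: stalk_simps)
  then obtain V t where V: "openin (unit_space \<G>) V" "x \<in> V"
    and t: "continuous_map (subtopology (unit_space \<G>) V) total_space t"
    "\<And>y. y \<in> V \<Longrightarrow> t y \<in> carrier (stalk \<O> y)" "t x = \<ominus>\<^bsub>stalk \<O> x\<^esub> e"
    using local_section by metis
  have Vu: "V \<subseteq> units \<G>"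
    using V(1) openin_unit_space_iff by blast
  define W where "W = {e \<in> topspace total_space. proj e \<in> V}"
  have W: "openin total_space W"
    unfolding W_def using openin_continuous_map_preimage[OF continuous_proj V(1)] .
  let ?W = "subtopology total_space W"
  have pt: "proj (t y) = y" "t y \<in> topspace total_space" if "y \<in> V" for y
    using t(2)[OF that] by (auto simp: stalk_simps)
  have "continuous_map ?W (subtopology (unit_space \<G>) V) proj"
    using continuous_proj by (auto simp: continuous_map_in_subtopology continuous_map_from_subtopology W_def)
  then have tp: "continuous_map ?W total_space (t \<circ> proj)"
    using t(1) continuous_map_compose by blast
  have id: "continuous_map ?W total_space (\<lambda>e. e)"
    using continuous_map_from_subtopology[OF continuous_map_id] by (simp add: id_def)
  have sum: "continuous_map ?W total_space (\<lambda>e. e \<oplus>\<^bsub>stalk \<O> (proj e)\<^esub> (t \<circ> proj) e)"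
    by (rule continuous_map_stalk_add[OF id tp]) (use pt in \<open>auto simp: W_def\<close>)
  have zero: "continuous_map ?W total_space (stalk_zero \<circ> proj)"
    using continuous_map_compose[OF continuous_map_from_subtopology[OF continuous_proj] continuous_stalk_zero] .
  obtain U where U: "openin ?W U" "e \<in> U" "\<And>e. e \<in> U \<Longrightarrow> e \<oplus>\<^bsub>stalk \<O> (proj e)\<^esub> (t \<circ> proj) e = (stalk_zero \<circ> proj) e"
  proof (rule sections_agree_locally[OF sum zero])
    fix d assume "d \<in> topspace ?W"
    then have d: "d \<in> topspace total_space" "proj d \<in> V" by (auto simp: W_def)
    interpret Y: ring "stalk \<O> (proj d)" using ring_stalk proj_units[OF d(1)] by blast
    have "d \<in> carrier (stalk \<O> (proj d))"
      using d by (auto simp: stalk_simps)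
    then have "d \<oplus>\<^bsub>stalk \<O> (proj d)\<^esub> t (proj d) \<in> carrier (stalk \<O> (proj d))" "\<zero>\<langle>proj d\<rangle> \<in> carrier (stalk \<O> (proj d))"
      using t(2)[OF d(2)] by simp_all
    then show "proj (d \<oplus>\<^bsub>stalk \<O> (proj d)\<^esub> (t \<circ> proj) d) = proj ((stalk_zero \<circ> proj) d)"
      by (simp add: stalk_simps)
  next
    show "e \<in> topspace ?W" using e V(2) by (simp add: W_def x_def)
    show "e \<oplus>\<^bsub>stalk \<O> (proj e)\<^esub> (t \<circ> proj) e = (stalk_zero \<circ> proj) e"
      using X.r_neg[OF ex] t(3) by (simp add: x_def[symmetric])
  qed blast
  have UW: "U \<subseteq> W" using U(1) openin_imp_subset by blast
  have neg: "t (proj d) = \<ominus>\<^bsub>stalk \<O> (proj d)\<^esub> d" if "d \<in> U" for d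
  proof -
    have d: "d \<in> topspace total_space" "proj d \<in> V" using that UW by (auto simp: W_def)
    interpret Y: ring "stalk \<O> (proj d)" using ring_stalk proj_units[OF d(1)] by blast
    have "d \<in> carrier (stalk \<O> (proj d))"
      using d by (auto simp: stalk_simps)
    then show ?thesis
      using U(3)[OF that] t(2)[OF d(2)] Y.minus_equality Y.a_comm by (metis comp_apply)
  qed
  have "openin total_space U"
    using U(1) W openin_trans_full by blast
  moreover have "continuous_map (subtopology total_space U) total_space (\<lambda>e. \<ominus>\<^bsub>stalk \<O> (proj e)\<^esub> e)"
  proof (rule continuous_map_eq)
    show "continuous_map (subtopology total_space U) total_space (t \<circ> proj)"
      using tp UW continuous_map_from_subtopology_mono by blast
  qed (use neg in auto)
  ultimately show "\<exists>U. openin total_space U \<and> e \<in> U \<and> continuous_map (subtopology total_space U) total_space (\<lambda>e. \<ominus>\<^bsub>stalk \<O> (proj e)\<^esub> e)"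
    using U(2) by blast
qed

text \<open>The empty sum is the zero section along \<open>q\<close>, so the induction starts from
  \<open>continuous_stalk_zero\<close>. The result is applied to groups of summands in
  \<open>Gamma_zero_near_row\<close>.\<close>

lemma continuous_map_stalk_finsum:
  assumes "finite I" "continuous_map X (unit_space \<G>) q"
    "\<And>i. i \<in> I \<Longrightarrow> continuous_map X total_space (s i)"
    "\<And>i x. \<lbrakk>i \<in> I; x \<in> topspace X\<rbrakk> \<Longrightarrow> proj (s i x) = q x"
  shows "continuous_map X total_space (\<lambda>x. \<Oplus>\<^bsub>stalk \<O> (q x)\<^esub>i\<in>I. s i x)"
  using assms(1,3,4)
proof (induction I)
  case empty
  have "continuous_map X total_space (stalk_zero \<circ> q)"
    using continuous_map_compose[OF assms(2) continuous_stalk_zero] .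
  then show ?case
  proof (rule continuous_map_eq)
    fix x assume "x \<in> topspace X"
    then interpret ring "stalk \<O> (q x)"
      using ring_stalk continuous_map_funspace[OF assms(2)] by (auto simp: topspace_unit_space)
    show "(stalk_zero \<circ> q) x = (\<Oplus>\<^bsub>stalk \<O> (q x)\<^esub>i\<in>{}. s i x)"
      by simp
  qed
next
  case (insert i I)
  have q: "q x \<in> units \<G>" if "x \<in> topspace X" for x
    using continuous_map_funspace[OF assms(2)] that by (auto simp: topspace_unit_space)
  have c: "s j x \<in> carrier (stalk \<O> (q x))" if "j \<in> insert i I" "x \<in> topspace X" for j x
    using insert.prems that by (auto simp: stalk_simps continuous_map_def)
  have cs: "(\<Oplus>\<^bsub>stalk \<O> (q x)\<^esub>i\<in>I. s i x) \<in> carrier (stalk \<O> (q x))" if "x \<in> topspace X" for x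
  proof -
    interpret ring "stalk \<O> (q x)" using ring_stalk q[OF that] .
    show ?thesis using c that by (intro finsum_closed) auto
  qed
  have "continuous_map X total_space (\<lambda>x. s i x \<oplus>\<^bsub>stalk \<O> (q x)\<^esub> (\<Oplus>\<^bsub>stalk \<O> (q x)\<^esub>i\<in>I. s i x))"
    by (rule continuous_map_stalk_add) (use insert c cs in \<open>auto simp: stalk_simps\<close>)
  then show ?case
  proof (rule continuous_map_eq)
    fix x assume x: "x \<in> topspace X"
    interpret ring "stalk \<O> (q x)" using ring_stalk q[OF x] .
    show "s i x \<oplus>\<^bsub>stalk \<O> (q x)\<^esub> (\<Oplus>\<^bsub>stalk \<O> (q x)\<^esub>i\<in>I. s i x) = (\<Oplus>\<^bsub>stalk \<O> (q x)\<^esub>i\<in>insert i I. s i x)"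
      using insert.hyps c[OF _ x] by (subst finsum_insert) auto
  qed
qed

section \<open>Elementary sections\<close>

lemma elementary_section: "f \<in> elementary_sections \<G> \<O> \<Longrightarrow> f \<in> carrier (arrow_sections \<G> \<O>)"
  by (simp add: elementary_sections_def)

lemma elementary_sectionE:
  assumes "f \<in> elementary_sections \<G> \<O>"
  obtains U where "compact_open_bisection \<G> U" "bisection \<G> U" "openin (arrow_space \<G>) U"
    "continuous_map (subtopology (arrow_space \<G>) U) total_space f"
    "\<And>\<gamma>. \<lbrakk>\<gamma> \<in> arrows \<G>; \<gamma> \<notin> U\<rbrakk> \<Longrightarrow> f \<gamma> = \<zero>\<langle>gran \<G> \<gamma>\<rangle>"
  using assms unfolding elementary_sections_def compact_open_bisection_def by fast

text \<open>A bisection meets each row, and likewise each column, in at most one arrow.\<close>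

lemma elementary_row_finite:
  assumes "f \<in> elementary_sections \<G> \<O>"
  shows "row_finite f"
proof -
  obtain U where U: "bisection \<G> U" "\<And>\<gamma>. \<lbrakk>\<gamma> \<in> arrows \<G>; \<gamma> \<notin> U\<rbrakk> \<Longrightarrow> f \<gamma> = \<zero>\<langle>gran \<G> \<gamma>\<rangle>"
    using assms elementary_sectionE by metis
  have "finite {\<gamma> \<in> arrows \<G>. gran \<G> \<gamma> = x \<and> f \<gamma> \<noteq> \<zero>\<langle>x\<rangle>}" for x
  proof (rule inj_on_finite)
    have "{\<gamma> \<in> arrows \<G>. gran \<G> \<gamma> = x \<and> f \<gamma> \<noteq> \<zero>\<langle>x\<rangle>} \<subseteq> U" using U(2) by auto
    then show "inj_on (gran \<G>) {\<gamma> \<in> arrows \<G>. gran \<G> \<gamma> = x \<and> f \<gamma> \<noteq> \<zero>\<langle>x\<rangle>}"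
      using U(1) inj_on_subset unfolding bisection_def by blast
    show "gran \<G> ` {\<gamma> \<in> arrows \<G>. gran \<G> \<gamma> = x \<and> f \<gamma> \<noteq> \<zero>\<langle>x\<rangle>} \<subseteq> {x}" "finite {x}" by auto
  qed
  then show ?thesis by (simp add: row_finite_def)
qed

lemma elementary_column_finite:
  assumes "f \<in> elementary_sections \<G> \<O>"
  shows "column_finite f"
proof -
  obtain U where U: "bisection \<G> U" "\<And>\<gamma>. \<lbrakk>\<gamma> \<in> arrows \<G>; \<gamma> \<notin> U\<rbrakk> \<Longrightarrow> f \<gamma> = \<zero>\<langle>gran \<G> \<gamma>\<rangle>"
    using assms elementary_sectionE by metis
  have "finite {\<gamma> \<in> arrows \<G>. gdom \<G> \<gamma> = x \<and> f \<gamma> \<noteq> \<zero>\<langle>gran \<G> \<gamma>\<rangle>}" for x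
  proof (rule inj_on_finite)
    have "{\<gamma> \<in> arrows \<G>. gdom \<G> \<gamma> = x \<and> f \<gamma> \<noteq> \<zero>\<langle>gran \<G> \<gamma>\<rangle>} \<subseteq> U" using U(2) by auto
    then show "inj_on (gdom \<G>) {\<gamma> \<in> arrows \<G>. gdom \<G> \<gamma> = x \<and> f \<gamma> \<noteq> \<zero>\<langle>gran \<G> \<gamma>\<rangle>}"
      using U(1) inj_on_subset unfolding bisection_def by blast
    show "gdom \<G> ` {\<gamma> \<in> arrows \<G>. gdom \<G> \<gamma> = x \<and> f \<gamma> \<noteq> \<zero>\<langle>gran \<G> \<gamma>\<rangle>} \<subseteq> {x}" "finite {x}" by auto
  qed
  then show ?thesis by (simp add: column_finite_def)
qed

text \<open>Closure under negation allows every element of \<Gamma> to be reached by adding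
  elementary sections alone.\<close>

lemma elementary_inv:
  assumes "f \<in> elementary_sections \<G> \<O>"
  shows "inv\<^bsub>arrow_sections \<G> \<O>\<^esub> f \<in> elementary_sections \<G> \<O>"
proof -
  interpret A: group "arrow_sections \<G> \<O>" by (rule group_arrow_sections)
  have f: "f \<in> carrier (arrow_sections \<G> \<O>)" using assms elementary_section by blast
  obtain U where U: "compact_open_bisection \<G> U"
    "continuous_map (subtopology (arrow_space \<G>) U) total_space f"
    "\<And>\<gamma>. \<lbrakk>\<gamma> \<in> arrows \<G>; \<gamma> \<notin> U\<rbrakk> \<Longrightarrow> f \<gamma> = \<zero>\<langle>gran \<G> \<gamma>\<rangle>"
    using assms elementary_sectionE by metis
  have "continuous_map (subtopology (arrow_space \<G>) U) total_space ((\<lambda>e. \<ominus>\<^bsub>stalk \<O> (proj e)\<^esub> e) \<circ> f)"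
    using continuous_map_compose[OF U(2) continuous_stalk_neg] .
  then have "continuous_map (subtopology (arrow_space \<G>) U) total_space (inv\<^bsub>arrow_sections \<G> \<O>\<^esub> f)"
  proof (rule continuous_map_eq)
    fix \<gamma> assume "\<gamma> \<in> topspace (subtopology (arrow_space \<G>) U)"
    then show "((\<lambda>e. \<ominus>\<^bsub>stalk \<O> (proj e)\<^esub> e) \<circ> f) \<gamma> = (inv\<^bsub>arrow_sections \<G> \<O>\<^esub> f) \<gamma>"
      using section_closed[OF f, of \<gamma>] by (simp add: inv_arrow_sections[OF f] topspace_arrow_space stalk_simps)
  qed
  moreover have "(inv\<^bsub>arrow_sections \<G> \<O>\<^esub> f) \<gamma> = \<zero>\<langle>gran \<G> \<gamma>\<rangle>" if "\<gamma> \<in> arrows \<G>" "\<gamma> \<notin> U" for \<gamma>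
  proof -
    interpret ring "stalk \<O> (gran \<G> \<gamma>)" using ring_stalk gran_units that(1) by blast
    show ?thesis using that U(3) by (simp add: inv_arrow_sections[OF f])
  qed
  ultimately show ?thesis
    unfolding elementary_sections_def using A.inv_closed[OF f] U(1) by blast
qed

lemma elementary_idem:
  assumes "compact_open_units K"
  shows "idem K \<in> elementary_sections \<G> \<O>"
proof -
  have K: "K \<subseteq> units \<G>" using compact_open_units_subset assms .
  have "subtopology (arrow_space \<G>) K = subtopology (unit_space \<G>) K"
    using K by (simp add: unit_space_def subtopology_subtopology Int_absorb1)
  then have "continuous_map (subtopology (arrow_space \<G>) K) total_space (fiber_one \<O>)"
    using continuous_fiber_one continuous_map_from_subtopology by metis
  then have "continuous_map (subtopology (arrow_space \<G>) K) total_space (idem K)"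
    by (rule continuous_map_eq) (use K in \<open>auto simp: idem_def topspace_arrow_space stalk_simps gran_unit subset_iff\<close>)
  moreover have "idem K \<gamma> = \<zero>\<langle>gran \<G> \<gamma>\<rangle>" if "\<gamma> \<in> arrows \<G>" "\<gamma> \<notin> K" for \<gamma>
    using that by (simp add: idem_def)
  ultimately show ?thesis
    unfolding elementary_sections_def using idem_section compact_open_units_bisection[OF assms] by blast
qed

text \<open>A local section of the sheaf through \<open>a\<close>, pulled back along the range map
  to a small bisection around \<gamma>. As the support is a bisection, no other arrow of the row or
  of the column of \<gamma> can carry a nonzero value.\<close>

lemma elementary_section_through:
  assumes \<gamma>: "\<gamma> \<in> arrows \<G>" and a: "a \<in> carrier (stalk \<O> (gran \<G> \<gamma>))"
  obtains s where "s \<in> elementary_sections \<G> \<O>" "s \<gamma> = a"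
    "\<And>\<eta>. \<lbrakk>\<eta> \<in> arrows \<G>; gran \<G> \<eta> = gran \<G> \<gamma> \<or> gdom \<G> \<eta> = gdom \<G> \<gamma>; \<eta> \<noteq> \<gamma>\<rbrakk> \<Longrightarrow> s \<eta> = \<zero>\<langle>gran \<G> \<eta>\<rangle>"
proof -
  have "a \<in> topspace total_space" "proj a = gran \<G> \<gamma>"
    using a by (auto simp: stalk_simps)
  then obtain V t where V: "openin (unit_space \<G>) V" "gran \<G> \<gamma> \<in> V"
    and t: "continuous_map (subtopology (unit_space \<G>) V) total_space t"
    "\<And>x. x \<in> V \<Longrightarrow> t x \<in> carrier (stalk \<O> x)" "t (gran \<G> \<gamma>) = a"
    using local_section by metis
  have "openin (arrow_space \<G>) {\<eta> \<in> topspace (arrow_space \<G>). gran \<G> \<eta> \<in> V}"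
    using openin_continuous_map_preimage[OF continuous_gran V(1)] .
  then obtain U where U: "compact_open_bisection \<G> U" "\<gamma> \<in> U" "U \<subseteq> {\<eta> \<in> topspace (arrow_space \<G>). gran \<G> \<eta> \<in> V}"
    using compact_open_bisection_basis \<gamma> V(2) by (metis (mono_tags, lifting) mem_Collect_eq topspace_arrow_space)
  have bi: "inj_on (gran \<G>) U" "inj_on (gdom \<G>) U"
    using U(1) by (auto simp: compact_open_bisection_def bisection_def)
  define s where "s = (\<lambda>\<eta>\<in>arrows \<G>. if \<eta> \<in> U then t (gran \<G> \<eta>) else \<zero>\<langle>gran \<G> \<eta>\<rangle>)"
  have z: "\<zero>\<langle>gran \<G> \<eta>\<rangle> \<in> carrier (stalk \<O> (gran \<G> \<eta>))" if "\<eta> \<in> arrows \<G>" for \<eta>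
    using abelian_groupE(2)[OF ring.is_abelian_group[OF ring_stalk[OF gran_units[OF that]]]] .
  have s: "s \<in> carrier (arrow_sections \<G> \<O>)"
    using t(2) U(3) z by (auto simp: carrier_arrow_sections s_def)
  have "continuous_map (subtopology (arrow_space \<G>) U) (subtopology (unit_space \<G>) V) (gran \<G>)"
    using U(3) continuous_gran by (auto simp: continuous_map_in_subtopology continuous_map_from_subtopology)
  then have "continuous_map (subtopology (arrow_space \<G>) U) total_space (t \<circ> gran \<G>)"
    using t(1) continuous_map_compose by blast
  then have "continuous_map (subtopology (arrow_space \<G>) U) total_space s"
    by (rule continuous_map_eq) (use U(3) in \<open>auto simp: s_def topspace_arrow_space\<close>)
  moreover have "s \<eta> = \<zero>\<langle>gran \<G> \<eta>\<rangle>" if "\<eta> \<in> arrows \<G> - U" for \<eta>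
    using that by (simp add: s_def)
  ultimately have "s \<in> elementary_sections \<G> \<O>"
    unfolding elementary_sections_def using s U(1) by blast
  then show thesis
  proof (rule that)
    show "s \<gamma> = a" using \<gamma> U(2) t(3) by (simp add: s_def)
    show "s \<eta> = \<zero>\<langle>gran \<G> \<eta>\<rangle>" if "\<eta> \<in> arrows \<G>" "gran \<G> \<eta> = gran \<G> \<gamma> \<or> gdom \<G> \<eta> = gdom \<G> \<gamma>" "\<eta> \<noteq> \<gamma>" for \<eta>
      using that bi U(2) by (auto simp: s_def inj_on_def)
  qed
qed

text \<open>Over the product \<open>W\<close> of the two supports exactly one factorisation has its
  first factor in \<open>U\<close>, and both factors depend continuously on the product; the
  convolution is then a composite of continuous maps. At an arrow outside \<open>W\<close> every
  factorisation meets a zero.\<close>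

lemma elementary_convolution:
  assumes "f \<in> elementary_sections \<G> \<O>" "g \<in> elementary_sections \<G> \<O>"
  shows "convolution \<G> \<O> f g \<in> elementary_sections \<G> \<O>"
proof -
  have f: "f \<in> carrier (arrow_sections \<G> \<O>)" and g: "g \<in> carrier (arrow_sections \<G> \<O>)"
    using assms elementary_section by auto
  obtain U where U: "compact_open_bisection \<G> U" "bisection \<G> U" "openin (arrow_space \<G>) U"
    "continuous_map (subtopology (arrow_space \<G>) U) total_space f"
    "\<And>\<gamma>. \<lbrakk>\<gamma> \<in> arrows \<G>; \<gamma> \<notin> U\<rbrakk> \<Longrightarrow> f \<gamma> = \<zero>\<langle>gran \<G> \<gamma>\<rangle>"
    using assms(1) elementary_sectionE by metis
  obtain V where V: "compact_open_bisection \<G> V" "bisection \<G> V"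
    "continuous_map (subtopology (arrow_space \<G>) V) total_space g"
    "\<And>\<gamma>. \<lbrakk>\<gamma> \<in> arrows \<G>; \<gamma> \<notin> V\<rbrakk> \<Longrightarrow> g \<gamma> = \<zero>\<langle>gran \<G> \<gamma>\<rangle>"
    using assms(2) elementary_sectionE by metis
  have injU: "inj_on (gran \<G>) U" and Usub: "U \<subseteq> arrows \<G>" and Vsub: "V \<subseteq> arrows \<G>"
    using U(2) V(2) by (auto simp: bisection_def)
  define W where "W = bisection_mult U V"
  have W: "compact_open_bisection \<G> W"
    unfolding W_def using compact_open_bisection_mult U(1) V(1) .
  have Walt: "W = {\<gamma> \<in> arrows \<G>. gran \<G> \<gamma> \<in> gran \<G> ` U \<and> bisection_translate U \<gamma> \<in> V}"
    unfolding W_def using bisection_mult_alt U(2) Vsub .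
  let ?\<sigma> = "\<lambda>\<gamma>. inv_into U (gran \<G>) (gran \<G> \<gamma>)"
  have \<sigma>: "?\<sigma> \<gamma> \<in> U" "?\<sigma> \<gamma> \<in> arrows \<G>" "gran \<G> (?\<sigma> \<gamma>) = gran \<G> \<gamma>" if "gran \<G> \<gamma> \<in> gran \<G> ` U" for \<gamma>
    using Usub inv_into_into[OF that] f_inv_into_f[OF that] by auto
  have conv: "convolution \<G> \<O> f g \<eta> = f (?\<sigma> \<eta>) \<otimes>\<^bsub>stalk \<O> (gran \<G> \<eta>)\<^esub> act (?\<sigma> \<eta>) (g (bisection_translate U \<eta>))"
    if \<eta>: "\<eta> \<in> arrows \<G>" "gran \<G> \<eta> \<in> gran \<G> ` U" for \<eta>
    unfolding bisection_translate_def
  proof (rule convolution_single[OF f g \<eta>(1)])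
    fix \<beta>' assume "\<beta>' \<in> arrows \<G>" "gran \<G> \<beta>' = gran \<G> \<eta>" "\<beta>' \<noteq> ?\<sigma> \<eta>"
    then show "f \<beta>' = \<zero>\<langle>gran \<G> \<beta>'\<rangle> \<or> g (\<beta>'\<^sup>- \<cdot> \<eta>) = \<zero>\<langle>gdom \<G> \<beta>'\<rangle>"
      using U(5)[of \<beta>'] injU inv_into_f_f[OF injU, of \<beta>'] by auto
  qed (use \<sigma>[OF \<eta>(2)] in auto)
  have off: "convolution \<G> \<O> f g \<eta> = \<zero>\<langle>gran \<G> \<eta>\<rangle>" if \<eta>: "\<eta> \<in> arrows \<G>" "\<eta> \<notin> W" for \<eta>
  proof (rule convolution_zero[OF f g \<eta>(1)])
    fix \<beta> assume \<beta>: "\<beta> \<in> arrows \<G>" "gran \<G> \<beta> = gran \<G> \<eta>"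
    show "f \<beta> = \<zero>\<langle>gran \<G> \<beta>\<rangle> \<or> g (\<beta>\<^sup>- \<cdot> \<eta>) = \<zero>\<langle>gdom \<G> \<beta>\<rangle>"
    proof (cases "\<beta> \<in> U \<and> \<beta>\<^sup>- \<cdot> \<eta> \<in> V")
      case True
      then have "\<beta> \<cdot> (\<beta>\<^sup>- \<cdot> \<eta>) \<in> W"
        unfolding W_def bisection_mult_def using ginv_gmult_row(2)[OF \<beta>(1) \<eta>(1) \<beta>(2)] by force
      then show ?thesis
        using gmult_ginv_cancel[OF \<beta>(1) \<eta>(1) \<beta>(2)] \<eta>(2) by simp
    next
      case False
      then show ?thesis
        using U(5)[OF \<beta>(1)] V(4)[OF ginv_gmult_row(1)[OF \<beta>(1) \<eta>(1) \<beta>(2)]] ginv_gmult_row(2)[OF \<beta>(1) \<eta>(1) \<beta>(2)] by auto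
    qed
  qed
  let ?X = "subtopology (arrow_space \<G>) W"
  have WR: "W \<subseteq> {\<gamma> \<in> arrows \<G>. gran \<G> \<gamma> \<in> gran \<G> ` U}" by (auto simp: Walt)
  have "continuous_map ?X (arrow_space \<G>) ?\<sigma>"
    using continuous_inv_into_gran_gran[OF U(3) injU] WR continuous_map_from_subtopology_mono by blast
  moreover have "?\<sigma> \<in> topspace ?X \<rightarrow> U" using \<sigma>(1) by (auto simp: Walt)
  ultimately have \<sigma>U: "continuous_map ?X (subtopology (arrow_space \<G>) U) ?\<sigma>" and \<sigma>c: "continuous_map ?X (arrow_space \<G>) ?\<sigma>"
    by (auto simp: continuous_map_in_subtopology)
  have "continuous_map ?X (arrow_space \<G>) (bisection_translate U)"
    using continuous_bisection_translate[OF U(3) injU] WR continuous_map_from_subtopology_mono by blast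
  moreover have "bisection_translate U \<in> topspace ?X \<rightarrow> V" by (auto simp: Walt)
  ultimately have \<theta>V: "continuous_map ?X (subtopology (arrow_space \<G>) V) (bisection_translate U)"
    by (auto simp: continuous_map_in_subtopology)
  have fs: "continuous_map ?X total_space (\<lambda>\<gamma>. f (?\<sigma> \<gamma>))"
    using continuous_map_compose[OF \<sigma>U U(4)] by (simp add: comp_def)
  have gt: "continuous_map ?X total_space (\<lambda>\<gamma>. g (bisection_translate U \<gamma>))"
    using continuous_map_compose[OF \<theta>V V(3)] by (simp add: comp_def)
  have pf: "proj (f (?\<sigma> \<gamma>)) = gran \<G> \<gamma>" if "\<gamma> \<in> W" for \<gamma>
    using section_closed[OF f, of "?\<sigma> \<gamma>"] \<sigma>[of \<gamma>] that by (auto simp: Walt stalk_simps)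
  have pg: "proj (g (bisection_translate U \<gamma>)) = gdom \<G> (?\<sigma> \<gamma>)"
           "g (bisection_translate U \<gamma>) \<in> carrier (stalk \<O> (gdom \<G> (?\<sigma> \<gamma>)))" if "\<gamma> \<in> W" for \<gamma>
  proof -
    have \<gamma>: "\<gamma> \<in> arrows \<G>" "gran \<G> \<gamma> \<in> gran \<G> ` U" using that by (auto simp: Walt)
    have "gran \<G> (bisection_translate U \<gamma>) = gdom \<G> (?\<sigma> \<gamma>)" "bisection_translate U \<gamma> \<in> arrows \<G>"
      unfolding bisection_translate_def using ginv_gmult_row[OF \<sigma>(2)[OF \<gamma>(2)] \<gamma>(1) \<sigma>(3)[OF \<gamma>(2)]] by auto
    then show "proj (g (bisection_translate U \<gamma>)) = gdom \<G> (?\<sigma> \<gamma>)"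
           "g (bisection_translate U \<gamma>) \<in> carrier (stalk \<O> (gdom \<G> (?\<sigma> \<gamma>)))"
      using section_closed[OF g, of "bisection_translate U \<gamma>"] by (auto simp: stalk_simps)
  qed
  have ag: "continuous_map ?X total_space (\<lambda>\<gamma>. act (?\<sigma> \<gamma>) (g (bisection_translate U \<gamma>)))"
    by (rule continuous_map_act[OF \<sigma>c gt]) (use pg in auto)
  have "continuous_map ?X total_space (\<lambda>\<gamma>. f (?\<sigma> \<gamma>) \<otimes>\<^bsub>stalk \<O> (gran \<G> \<gamma>)\<^esub> act (?\<sigma> \<gamma>) (g (bisection_translate U \<gamma>)))"
  proof (rule continuous_map_stalk_mult[OF fs ag])
    fix \<gamma> assume "\<gamma> \<in> topspace ?X"
    then have \<gamma>: "\<gamma> \<in> W" by simp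
    then have "act (?\<sigma> \<gamma>) (g (bisection_translate U \<gamma>)) \<in> carrier (stalk \<O> (gran \<G> \<gamma>))"
      using act_closed[OF \<sigma>(2) pg(2)] \<sigma>(3) by (auto simp: Walt)
    then show "proj (f (?\<sigma> \<gamma>)) = proj (act (?\<sigma> \<gamma>) (g (bisection_translate U \<gamma>)))"
      using pf[OF \<gamma>] by (simp add: stalk_simps)
  qed
  then have "continuous_map ?X total_space (convolution \<G> \<O> f g)"
    by (rule continuous_map_eq) (use conv in \<open>auto simp: Walt\<close>)
  then show ?thesis
    unfolding elementary_sections_def using convolution_section[OF f g] W off by blast
qed

section \<open>The convolution ring\<close>

abbreviation \<Gamma> where "\<Gamma> \<equiv> Gamma_c \<G> \<O>"

lemma Gamma_simps:
  "carrier \<Gamma> = generate (arrow_sections \<G> \<O>) (elementary_sections \<G> \<O>)"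
  "f \<oplus>\<^bsub>\<Gamma>\<^esub> g = f \<otimes>\<^bsub>arrow_sections \<G> \<O>\<^esub> g"
  "f \<otimes>\<^bsub>\<Gamma>\<^esub> g = convolution \<G> \<O> f g"
  "\<zero>\<^bsub>\<Gamma>\<^esub> = \<one>\<^bsub>arrow_sections \<G> \<O>\<^esub>"
proof -
  have "carrier (arrow_sections \<G> \<O>) \<inter> elementary_sections \<G> \<O> = elementary_sections \<G> \<O>"
    using elementary_section by blast
  then show "carrier \<Gamma> = generate (arrow_sections \<G> \<O>) (elementary_sections \<G> \<O>)"
    by (simp add: Gamma_c_def ring_on_def carrier_subgroup_generated)
qed (simp_all add: Gamma_c_def ring_on_def)

lemma Gamma_subgroup: "subgroup (carrier \<Gamma>) (arrow_sections \<G> \<O>)"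
  unfolding Gamma_simps using group.generate_is_subgroup[OF group_arrow_sections] elementary_section by blast

lemma Gamma_section: "f \<in> carrier \<Gamma> \<Longrightarrow> f \<in> carrier (arrow_sections \<G> \<O>)"
  using subgroup.subset[OF Gamma_subgroup] by blast

lemma Gamma_elementary: "f \<in> elementary_sections \<G> \<O> \<Longrightarrow> f \<in> carrier \<Gamma>"
  unfolding Gamma_simps by (rule generate.incl)

lemma Gamma_idem: "compact_open_units K \<Longrightarrow> idem K \<in> carrier \<Gamma>"
  using Gamma_elementary elementary_idem by blast

lemma Gamma_add_closed: "\<lbrakk>f \<in> carrier \<Gamma>; g \<in> carrier \<Gamma>\<rbrakk> \<Longrightarrow> f \<oplus>\<^bsub>\<Gamma>\<^esub> g \<in> carrier \<Gamma>"
  using subgroup.m_closed[OF Gamma_subgroup] by (simp add: Gamma_simps(2))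

lemma Gamma_zero_closed: "\<zero>\<^bsub>\<Gamma>\<^esub> \<in> carrier \<Gamma>"
  using subgroup.one_closed[OF Gamma_subgroup] by (simp add: Gamma_simps(4))

lemma Gamma_add_apply: "\<gamma> \<in> arrows \<G> \<Longrightarrow> (f \<oplus>\<^bsub>\<Gamma>\<^esub> g) \<gamma> = f \<gamma> \<oplus>\<^bsub>stalk \<O> (gran \<G> \<gamma>)\<^esub> g \<gamma>"
  by (simp add: Gamma_simps(2) mult_arrow_sections)

lemma Gamma_zero_apply: "\<gamma> \<in> arrows \<G> \<Longrightarrow> \<zero>\<^bsub>\<Gamma>\<^esub> \<gamma> = \<zero>\<langle>gran \<G> \<gamma>\<rangle>"
  by (simp add: Gamma_simps(4) one_arrow_sections)

lemma Gamma_abelian_group: "abelian_group \<Gamma>"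
proof (rule abelian_groupI)
  interpret A: group "arrow_sections \<G> \<O>" by (rule group_arrow_sections)
  interpret S: subgroup "carrier \<Gamma>" "arrow_sections \<G> \<O>" by (rule Gamma_subgroup)
  show "f \<oplus>\<^bsub>\<Gamma>\<^esub> g \<oplus>\<^bsub>\<Gamma>\<^esub> h = f \<oplus>\<^bsub>\<Gamma>\<^esub> (g \<oplus>\<^bsub>\<Gamma>\<^esub> h)"
    if "f \<in> carrier \<Gamma>" "g \<in> carrier \<Gamma>" "h \<in> carrier \<Gamma>" for f g h
    using that Gamma_section A.m_assoc by (simp add: Gamma_simps(2))
  show "f \<oplus>\<^bsub>\<Gamma>\<^esub> g = g \<oplus>\<^bsub>\<Gamma>\<^esub> f" if "f \<in> carrier \<Gamma>" "g \<in> carrier \<Gamma>" for f g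
  proof (rule section_eqI)
    fix \<gamma> assume \<gamma>: "\<gamma> \<in> arrows \<G>"
    interpret ring "stalk \<O> (gran \<G> \<gamma>)" using ring_stalk gran_units \<gamma> by blast
    show "(f \<oplus>\<^bsub>\<Gamma>\<^esub> g) \<gamma> = (g \<oplus>\<^bsub>\<Gamma>\<^esub> f) \<gamma>"
      using \<gamma> that Gamma_section section_closed a_comm by (simp add: Gamma_add_apply)
  qed (use that Gamma_add_closed Gamma_section in auto)
  show "\<zero>\<^bsub>\<Gamma>\<^esub> \<oplus>\<^bsub>\<Gamma>\<^esub> f = f" if "f \<in> carrier \<Gamma>" for f
    using that Gamma_section by (simp add: Gamma_simps(2,4))
  show "\<exists>g\<in>carrier \<Gamma>. g \<oplus>\<^bsub>\<Gamma>\<^esub> f = \<zero>\<^bsub>\<Gamma>\<^esub>" if "f \<in> carrier \<Gamma>" for f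
    unfolding Gamma_simps(2,4) using S.m_inv_closed[OF that] A.l_inv[OF Gamma_section[OF that]] by blast
qed (auto simp: Gamma_add_closed Gamma_zero_closed)

text \<open>Membership in a generated subgroup is a tree of products, whereas proofs about sections
  want a list of elementary summands.\<close>

lemma Gamma_induct [consumes 1, case_names zero add]:
  assumes "f \<in> carrier \<Gamma>" and "P \<zero>\<^bsub>\<Gamma>\<^esub>"
    and step: "\<And>e g. \<lbrakk>e \<in> elementary_sections \<G> \<O>; g \<in> carrier \<Gamma>; P g\<rbrakk> \<Longrightarrow> P (e \<oplus>\<^bsub>\<Gamma>\<^esub> g)"
  shows "P f"
proof -
  interpret \<Gamma>: abelian_group \<Gamma> by (rule Gamma_abelian_group)
  have "f \<in> generate (arrow_sections \<G> \<O>) (elementary_sections \<G> \<O>)"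
    using assms(1) by (simp add: Gamma_simps)
  \<comment> \<open>The claim that adding \<open>f\<close> preserves \<open>P\<close> is stable
    under products, which flattens the tree.\<close>
  then have "\<forall>g\<in>carrier \<Gamma>. P g \<longrightarrow> P (f \<oplus>\<^bsub>\<Gamma>\<^esub> g)"
  proof induction
    case one
    then show ?case by (simp flip: Gamma_simps(4))
  next
    case (eng h1 h2)
    then have c: "h1 \<in> carrier \<Gamma>" "h2 \<in> carrier \<Gamma>" by (simp_all add: Gamma_simps(1))
    show ?case
    proof (intro ballI impI)
      fix g assume "g \<in> carrier \<Gamma>" "P g"
      then have "P (h1 \<oplus>\<^bsub>\<Gamma>\<^esub> (h2 \<oplus>\<^bsub>\<Gamma>\<^esub> g))" using eng.IH c by simp
      then show "P (h1 \<otimes>\<^bsub>arrow_sections \<G> \<O>\<^esub> h2 \<oplus>\<^bsub>\<Gamma>\<^esub> g)"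
        using c \<open>g \<in> carrier \<Gamma>\<close> \<Gamma>.a_assoc by (simp flip: Gamma_simps(2))
    qed
  qed (use step elementary_inv in auto)
  then have "P (f \<oplus>\<^bsub>\<Gamma>\<^esub> \<zero>\<^bsub>\<Gamma>\<^esub>)"
    using assms(2) by blast
  then show ?thesis
    using assms(1) by simp
qed

lemma Gamma_row_finite:
  assumes "f \<in> carrier \<Gamma>"
  shows "row_finite f"
  using assms
proof (induction rule: Gamma_induct)
  case zero
  have "{\<gamma> \<in> arrows \<G>. gran \<G> \<gamma> = x \<and> \<zero>\<^bsub>\<Gamma>\<^esub> \<gamma> \<noteq> \<zero>\<langle>x\<rangle>} = {}" for x
    by (auto simp: Gamma_zero_apply)
  then show ?case by (simp only: row_finite_def finite.emptyI) simp
next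
  case (add e g)
  show ?case
    unfolding row_finite_def
  proof
    fix x assume x: "x \<in> units \<G>"
    interpret ring "stalk \<O> x" using ring_stalk x .
    have "(e \<oplus>\<^bsub>\<Gamma>\<^esub> g) \<gamma> = \<zero>\<langle>x\<rangle>" if "\<gamma> \<in> arrows \<G>" "gran \<G> \<gamma> = x" "e \<gamma> = \<zero>\<langle>x\<rangle>" "g \<gamma> = \<zero>\<langle>x\<rangle>" for \<gamma>
      unfolding Gamma_add_apply[OF that(1)] that(2-4) by simp
    then have "{\<gamma> \<in> arrows \<G>. gran \<G> \<gamma> = x \<and> (e \<oplus>\<^bsub>\<Gamma>\<^esub> g) \<gamma> \<noteq> \<zero>\<langle>x\<rangle>} \<subseteq>
       {\<gamma> \<in> arrows \<G>. gran \<G> \<gamma> = x \<and> e \<gamma> \<noteq> \<zero>\<langle>x\<rangle>} \<union> {\<gamma> \<in> arrows \<G>. gran \<G> \<gamma> = x \<and> g \<gamma> \<noteq> \<zero>\<langle>x\<rangle>}"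
      by blast
    then show "finite {\<gamma> \<in> arrows \<G>. gran \<G> \<gamma> = x \<and> (e \<oplus>\<^bsub>\<Gamma>\<^esub> g) \<gamma> \<noteq> \<zero>\<langle>x\<rangle>}"
      using add.IH elementary_row_finite[OF add.hyps(1)] x unfolding row_finite_def
      by (meson finite_UnI finite_subset)
  qed
qed

lemma Gamma_column_finite:
  assumes "f \<in> carrier \<Gamma>"
  shows "column_finite f"
  using assms
proof (induction rule: Gamma_induct)
  case zero
  have "{\<gamma> \<in> arrows \<G>. gdom \<G> \<gamma> = x \<and> \<zero>\<^bsub>\<Gamma>\<^esub> \<gamma> \<noteq> \<zero>\<langle>gran \<G> \<gamma>\<rangle>} = {}" for x
    by (auto simp: Gamma_zero_apply)
  then show ?case by (simp only: column_finite_def finite.emptyI) simp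
next
  case (add e g)
  show ?case
    unfolding column_finite_def
  proof
    fix x assume x: "x \<in> units \<G>"
    have "(e \<oplus>\<^bsub>\<Gamma>\<^esub> g) \<gamma> = \<zero>\<langle>gran \<G> \<gamma>\<rangle>" if "\<gamma> \<in> arrows \<G>" "e \<gamma> = \<zero>\<langle>gran \<G> \<gamma>\<rangle>" "g \<gamma> = \<zero>\<langle>gran \<G> \<gamma>\<rangle>" for \<gamma>
    proof -
      interpret ring "stalk \<O> (gran \<G> \<gamma>)" using ring_stalk gran_units that(1) by blast
      show ?thesis using that by (simp add: Gamma_add_apply)
    qed
    then have "{\<gamma> \<in> arrows \<G>. gdom \<G> \<gamma> = x \<and> (e \<oplus>\<^bsub>\<Gamma>\<^esub> g) \<gamma> \<noteq> \<zero>\<langle>gran \<G> \<gamma>\<rangle>} \<subseteq>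
       {\<gamma> \<in> arrows \<G>. gdom \<G> \<gamma> = x \<and> e \<gamma> \<noteq> \<zero>\<langle>gran \<G> \<gamma>\<rangle>} \<union> {\<gamma> \<in> arrows \<G>. gdom \<G> \<gamma> = x \<and> g \<gamma> \<noteq> \<zero>\<langle>gran \<G> \<gamma>\<rangle>}"
      by blast
    then show "finite {\<gamma> \<in> arrows \<G>. gdom \<G> \<gamma> = x \<and> (e \<oplus>\<^bsub>\<Gamma>\<^esub> g) \<gamma> \<noteq> \<zero>\<langle>gran \<G> \<gamma>\<rangle>}"
      using add.IH elementary_column_finite[OF add.hyps(1)] x unfolding column_finite_def
      by (meson finite_UnI finite_subset)
  qed
qed

lemma Gamma_distrib_left:
  assumes "f \<in> carrier \<Gamma>" "g \<in> carrier \<Gamma>" "h \<in> carrier \<Gamma>"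
  shows "f \<otimes>\<^bsub>\<Gamma>\<^esub> (g \<oplus>\<^bsub>\<Gamma>\<^esub> h) = f \<otimes>\<^bsub>\<Gamma>\<^esub> g \<oplus>\<^bsub>\<Gamma>\<^esub> f \<otimes>\<^bsub>\<Gamma>\<^esub> h"
  using assms Gamma_section Gamma_row_finite by (simp add: Gamma_simps(2,3) convolution_distrib_left)

lemma Gamma_distrib_right:
  assumes "f \<in> carrier \<Gamma>" "g \<in> carrier \<Gamma>" "h \<in> carrier \<Gamma>"
  shows "(f \<oplus>\<^bsub>\<Gamma>\<^esub> g) \<otimes>\<^bsub>\<Gamma>\<^esub> h = f \<otimes>\<^bsub>\<Gamma>\<^esub> h \<oplus>\<^bsub>\<Gamma>\<^esub> g \<otimes>\<^bsub>\<Gamma>\<^esub> h"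
  using assms Gamma_section Gamma_row_finite by (simp add: Gamma_simps(2,3) convolution_distrib_right)

text \<open>Distributivity reduces to products of elementary sections, first in the right factor and
  then in the left one.\<close>

lemma Gamma_mult_closed:
  assumes "f \<in> carrier \<Gamma>" "g \<in> carrier \<Gamma>"
  shows "f \<otimes>\<^bsub>\<Gamma>\<^esub> g \<in> carrier \<Gamma>"
proof -
  have zl: "\<zero>\<^bsub>\<Gamma>\<^esub> \<otimes>\<^bsub>\<Gamma>\<^esub> g = \<zero>\<^bsub>\<Gamma>\<^esub>" "g \<otimes>\<^bsub>\<Gamma>\<^esub> \<zero>\<^bsub>\<Gamma>\<^esub> = \<zero>\<^bsub>\<Gamma>\<^esub>" if g: "g \<in> carrier \<Gamma>" for g
  proof -
    have c: "g \<in> carrier (arrow_sections \<G> \<O>)" "\<zero>\<^bsub>\<Gamma>\<^esub> \<in> carrier (arrow_sections \<G> \<O>)"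
      using g Gamma_section Gamma_zero_closed by auto
    show "\<zero>\<^bsub>\<Gamma>\<^esub> \<otimes>\<^bsub>\<Gamma>\<^esub> g = \<zero>\<^bsub>\<Gamma>\<^esub>" "g \<otimes>\<^bsub>\<Gamma>\<^esub> \<zero>\<^bsub>\<Gamma>\<^esub> = \<zero>\<^bsub>\<Gamma>\<^esub>"
      unfolding Gamma_simps(3)
      by (rule section_eqI; use c ginv_gmult_row in \<open>simp add: convolution_section convolution_zero Gamma_zero_apply\<close>)+
  qed
  have e: "e \<otimes>\<^bsub>\<Gamma>\<^esub> g \<in> carrier \<Gamma>" if "e \<in> elementary_sections \<G> \<O>" for e
    using assms(2)
  proof (induction rule: Gamma_induct)
    case zero
    then show ?case using zl Gamma_elementary[OF that] Gamma_zero_closed by simp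
  next
    case (add e' g)
    then have "e \<otimes>\<^bsub>\<Gamma>\<^esub> e' \<in> carrier \<Gamma>"
      using Gamma_elementary elementary_convolution that by (simp add: Gamma_simps(3))
    then show ?case
      using add that Gamma_elementary Gamma_distrib_left Gamma_add_closed by simp
  qed
  show ?thesis
    using assms(1)
  proof (induction rule: Gamma_induct)
    case zero
    then show ?case using zl assms(2) Gamma_zero_closed by simp
  next
    case (add e' f)
    then show ?case
      using e assms(2) Gamma_elementary Gamma_distrib_right Gamma_add_closed by simp
  qed
qed

text \<open>Stated for values at arrows, so that the summands can later be regrouped differently at
  different arrows.\<close>

lemma Gamma_finsum_elementary:
  assumes "f \<in> carrier \<Gamma>"
  shows "\<exists>(k::nat) s. (\<forall>i<k. s i \<in> elementary_sections \<G> \<O>) \<and>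
     (\<forall>\<eta>\<in>arrows \<G>. f \<eta> = (\<Oplus>\<^bsub>stalk \<O> (gran \<G> \<eta>)\<^esub>i\<in>{..<k}. s i \<eta>))"
  using assms
proof (induction rule: Gamma_induct)
  case zero
  have "\<zero>\<^bsub>\<Gamma>\<^esub> \<eta> = (\<Oplus>\<^bsub>stalk \<O> (gran \<G> \<eta>)\<^esub>i\<in>{..<0::nat}. s i \<eta>)" if "\<eta> \<in> arrows \<G>" for \<eta> s
  proof -
    interpret ring "stalk \<O> (gran \<G> \<eta>)" using ring_stalk gran_units that by blast
    show ?thesis using that by (simp add: Gamma_zero_apply)
  qed
  then show ?case
    by (intro exI[of _ 0]) simp
next
  case (add e g)
  then obtain k s where s: "\<And>i. i < k \<Longrightarrow> s i \<in> elementary_sections \<G> \<O>"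
    and g: "\<And>\<eta>. \<eta> \<in> arrows \<G> \<Longrightarrow> g \<eta> = (\<Oplus>\<^bsub>stalk \<O> (gran \<G> \<eta>)\<^esub>i\<in>{..<k::nat}. s i \<eta>)"
    by blast
  have "(e \<oplus>\<^bsub>\<Gamma>\<^esub> g) \<eta> = (\<Oplus>\<^bsub>stalk \<O> (gran \<G> \<eta>)\<^esub>i\<in>{..<Suc k}. (s(k := e)) i \<eta>)" if \<eta>: "\<eta> \<in> arrows \<G>" for \<eta>
  proof -
    interpret ring "stalk \<O> (gran \<G> \<eta>)" using ring_stalk gran_units \<eta> by blast
    have c: "e \<eta> \<in> carrier (stalk \<O> (gran \<G> \<eta>))" "\<And>i. i < k \<Longrightarrow> s i \<eta> \<in> carrier (stalk \<O> (gran \<G> \<eta>))"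
      using s add.hyps(1) elementary_section section_closed \<eta> by blast+
    have "(\<Oplus>\<^bsub>stalk \<O> (gran \<G> \<eta>)\<^esub>i\<in>{..<k}. (s(k := e)) i \<eta>) = (\<Oplus>\<^bsub>stalk \<O> (gran \<G> \<eta>)\<^esub>i\<in>{..<k}. s i \<eta>)"
      using c by (intro finsum_cong') auto
    then show ?thesis
      using c \<eta> g[OF \<eta>] by (simp add: lessThan_Suc finsum_insert Gamma_add_apply Pi_def)
  qed
  then show ?case
    using s add.hyps(1) by (intro exI[of _ "Suc k"] exI[of _ "s(k := e)"]) (auto simp: less_Suc_eq)
qed

end

text \<open>In its application \<open>q\<close> sends a summand to the arrow of range
  \<open>x\<close> in its bisection.\<close>

lemma (in abelian_monoid) finsum_zero_on_fibers:
  assumes "finite J" "\<And>j. j \<in> J \<Longrightarrow> h j \<in> carrier G"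
    and "\<And>c. c \<in> q ` J \<Longrightarrow> (\<Oplus>j\<in>{j \<in> J. q j = c}. h j) = \<zero>"
  shows "(\<Oplus>j\<in>J. h j) = \<zero>"
proof -
  have "(\<Oplus>j\<in>(\<Union>c\<in>q ` J. {j \<in> J. q j = c}). h j) = (\<Oplus>c\<in>q ` J. \<Oplus>j\<in>{j \<in> J. q j = c}. h j)"
    using assms(1,2) by (intro add.finprod_UN_disjoint) (auto simp: pairwise_def disjnt_def)
  also have "\<dots> = \<zero>"
    by (rule add.finprod_one_eqI) (rule assms(3))
  also have "(\<Union>c\<in>q ` J. {j \<in> J. q j = c}) = J" by auto
  finally show ?thesis .
qed

section \<open>Local vanishing, local units and identities between indicators\<close>

context ample_ring_sheaf
begin

text \<open>Arrows may fail to be separated, so \<open>f\<close> need not be continuous near an arrow of range \<open>x\<close>.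
  Instead, the elementary summands of \<open>f\<close> are grouped according to the arrow of range \<open>x\<close> in their
  bisections: the bisections in one group agree near \<open>x\<close>, and the group sums to a continuous section
  that vanishes at \<open>x\<close>.\<close>

lemma Gamma_zero_near_row:
  assumes f: "f \<in> carrier \<Gamma>" and x: "x \<in> units \<G>"
    and zero: "\<And>\<gamma>. \<lbrakk>\<gamma> \<in> arrows \<G>; gran \<G> \<gamma> = x\<rbrakk> \<Longrightarrow> f \<gamma> = \<zero>\<langle>x\<rangle>"
  obtains K where "compact_open_units K" "x \<in> K" "\<And>\<gamma>. \<lbrakk>\<gamma> \<in> arrows \<G>; gran \<G> \<gamma> \<in> K\<rbrakk> \<Longrightarrow> f \<gamma> = \<zero>\<langle>gran \<G> \<gamma>\<rangle>"
proof -
  obtain k :: nat and s where s: "\<And>i. i < k \<Longrightarrow> s i \<in> elementary_sections \<G> \<O>"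
    and fs: "\<And>\<eta>. \<eta> \<in> arrows \<G> \<Longrightarrow> f \<eta> = (\<Oplus>\<^bsub>stalk \<O> (gran \<G> \<eta>)\<^esub>i\<in>{..<k}. s i \<eta>)"
    using Gamma_finsum_elementary[OF f] by blast
  have "\<exists>U. compact_open_bisection \<G> U \<and> bisection \<G> U \<and> openin (arrow_space \<G>) U \<and>
    continuous_map (subtopology (arrow_space \<G>) U) total_space (s i) \<and>
    (\<forall>\<gamma>\<in>arrows \<G>. \<gamma> \<notin> U \<longrightarrow> s i \<gamma> = \<zero>\<langle>gran \<G> \<gamma>\<rangle>)" if "i < k" for i
    using elementary_sectionE[OF s[OF that]] by metis
  then obtain U where "\<And>i. i < k \<Longrightarrow> compact_open_bisection \<G> (U i) \<and> bisection \<G> (U i) \<and> openin (arrow_space \<G>) (U i) \<and>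
    continuous_map (subtopology (arrow_space \<G>) (U i)) total_space (s i) \<and>
    (\<forall>\<gamma>\<in>arrows \<G>. \<gamma> \<notin> U i \<longrightarrow> s i \<gamma> = \<zero>\<langle>gran \<G> \<gamma>\<rangle>)"
    by metis
  then have U: "\<And>i. i < k \<Longrightarrow> compact_open_bisection \<G> (U i)"
    "\<And>i. i < k \<Longrightarrow> bisection \<G> (U i)" "\<And>i. i < k \<Longrightarrow> openin (arrow_space \<G>) (U i)"
    "\<And>i. i < k \<Longrightarrow> continuous_map (subtopology (arrow_space \<G>) (U i)) total_space (s i)"
    "\<And>i \<gamma>. \<lbrakk>i < k; \<gamma> \<in> arrows \<G>; \<gamma> \<notin> U i\<rbrakk> \<Longrightarrow> s i \<gamma> = \<zero>\<langle>gran \<G> \<gamma>\<rangle>"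
    by blast+
  have injU: "inj_on (gran \<G>) (U i)" "U i \<subseteq> arrows \<G>" if "i < k" for i
    using U(2)[OF that] by (auto simp: bisection_def)
  \<comment> \<open>The arrow of the bisection \<open>U i\<close> over the unit \<open>y\<close>,
    when there is one.\<close>
  define \<sigma> where "\<sigma> i y = inv_into (U i) (gran \<G>) y" for i y
  have \<sigma>: "\<sigma> i y \<in> U i" "\<sigma> i y \<in> arrows \<G>" "gran \<G> (\<sigma> i y) = y" if "i < k" "y \<in> gran \<G> ` U i" for i y
    using inv_into_into[OF that(2)] f_inv_into_f[OF that(2)] injU(2)[OF that(1)] by (auto simp: \<sigma>_def)
  have \<sigma>_eq: "\<sigma> i (gran \<G> \<gamma>) = \<gamma>" if "i < k" "\<gamma> \<in> U i" for i \<gamma>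
    using inv_into_f_f[OF injU(1)[OF that(1)] that(2)] by (simp add: \<sigma>_def)
  have sc: "s i \<gamma> \<in> carrier (stalk \<O> (gran \<G> \<gamma>))" if "i < k" "\<gamma> \<in> arrows \<G>" for i \<gamma>
    using elementary_section s section_closed that by blast
  \<comment> \<open>The indices whose bisection meets row \<open>x\<close>.\<close>
  define I where "I = {i. i < k \<and> x \<in> gran \<G> ` U i}"
  have I: "finite I" "\<And>i. i \<in> I \<Longrightarrow> i < k" by (auto simp: I_def)
  let ?cls = "\<lambda>i. {j \<in> I. \<sigma> j x = \<sigma> i x}"
  \<comment> \<open>Outside the range of \<open>U i\<close> the value of \<open>inv_into\<close> is
    arbitrary and may happen to be \<eta>; the extra summand is harmless, because \<open>s i\<close>
    vanishes off \<open>U i\<close>.\<close>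
  have sum_at: "f \<eta> = (\<Oplus>\<^bsub>stalk \<O> (gran \<G> \<eta>)\<^esub>i\<in>{i \<in> J. \<sigma> i (gran \<G> \<eta>) = \<eta>}. s i \<eta>)"
    if \<eta>: "\<eta> \<in> arrows \<G>" and J: "J \<subseteq> {..<k}" "\<And>i. \<lbrakk>i < k; \<eta> \<in> U i\<rbrakk> \<Longrightarrow> i \<in> J" for \<eta> J
  proof -
    interpret ring "stalk \<O> (gran \<G> \<eta>)" using ring_stalk gran_units \<eta> by blast
    have "s i \<eta> = \<zero>\<langle>gran \<G> \<eta>\<rangle>" if "i \<in> {..<k} - {i \<in> J. \<sigma> i (gran \<G> \<eta>) = \<eta>}" for i
      using that J U(5)[OF _ \<eta>] \<sigma>_eq by blast
    then have "(\<Oplus>\<^bsub>stalk \<O> (gran \<G> \<eta>)\<^esub>i\<in>{i \<in> J. \<sigma> i (gran \<G> \<eta>) = \<eta>}. s i \<eta>) = (\<Oplus>\<^bsub>stalk \<O> (gran \<G> \<eta>)\<^esub>i\<in>{..<k}. s i \<eta>)"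
      using J(1) sc \<eta> by (intro add.finprod_mono_neutral_cong_left) auto
    then show ?thesis using fs[OF \<eta>] by simp
  qed
  \<comment> \<open>A neighbourhood of \<open>x\<close> on which all the sections
    \<open>\<sigma> i\<close> with \<open>i\<close> in \<open>I\<close> are defined.\<close>
  define V0 where "V0 = (\<Inter>i\<in>I. gran \<G> ` U i) \<inter> units \<G>"
  have V0: "openin (unit_space \<G>) V0" "x \<in> V0"
  proof -
    have "openin (unit_space \<G>) (\<Inter>(insert (units \<G>) ((\<lambda>i. gran \<G> ` U i) ` I)))"
      using I U(3) openin_gran_image openin_topspace[of "unit_space \<G>"]
      by (intro openin_Inter) (auto simp: topspace_unit_space)
    moreover have "\<Inter>(insert (units \<G>) ((\<lambda>i. gran \<G> ` U i) ` I)) = V0" by (auto simp: V0_def)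
    ultimately show "openin (unit_space \<G>) V0" by simp
    show "x \<in> V0" using x by (auto simp: V0_def I_def)
  qed
  let ?X = "subtopology (unit_space \<G>) V0"
  have tsX: "topspace ?X = V0" by (auto simp: V0_def topspace_unit_space)
  have csig: "continuous_map ?X total_space (\<lambda>y. s j (\<sigma> j y))" if "j \<in> I" for j
  proof -
    have j: "j < k" using I that by blast
    have "continuous_map (subtopology (unit_space \<G>) (gran \<G> ` U j)) (subtopology (arrow_space \<G>) (U j)) (\<sigma> j)"
      using continuous_inv_into_gran[OF U(3)[OF j] injU(1)[OF j]] by (simp add: \<sigma>_def[abs_def])
    then have "continuous_map ?X (subtopology (arrow_space \<G>) (U j)) (\<sigma> j)"
      by (rule continuous_map_from_subtopology_mono) (use that in \<open>auto simp: V0_def\<close>)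
    from continuous_map_compose[OF this U(4)[OF j]] show ?thesis
      by (simp add: comp_def)
  qed
  \<comment> \<open>The sum of one group, read as a section over units: every member is evaluated on
    its own bisection.\<close>
  define F where "F i y = (\<Oplus>\<^bsub>stalk \<O> y\<^esub>j\<in>?cls i. s j (\<sigma> j y))" for i y
  have psig: "s j (\<sigma> j y) \<in> carrier (stalk \<O> y)" if "j \<in> I" "y \<in> V0" for j y
    using sc[of j "\<sigma> j y"] \<sigma>[of j y] that I by (auto simp: V0_def)
  have cF: "continuous_map ?X total_space (F i)" for i
    unfolding F_def
  proof (rule continuous_map_stalk_finsum)
    show "continuous_map ?X (unit_space \<G>) (\<lambda>y. y)"
      using continuous_map_from_subtopology[OF continuous_map_id] by (simp add: id_def)
    show "proj (s j (\<sigma> j y)) = y" if "j \<in> ?cls i" "y \<in> topspace ?X" for j y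
      using psig[of j y] that by (auto simp: stalk_simps tsX)
  qed (use I csig in auto)
  \<comment> \<open>At \<open>x\<close> the bisections of a group pass through the same arrow, so
    the group sum is the value of \<open>f\<close> at that arrow.\<close>
  have F0: "F i x = \<zero>\<langle>x\<rangle>" if "i \<in> I" for i
  proof -
    have i: "i < k" "x \<in> gran \<G> ` U i" using that by (auto simp: I_def)
    let ?\<eta> = "\<sigma> i x"
    have \<eta>: "?\<eta> \<in> arrows \<G>" "gran \<G> ?\<eta> = x" using \<sigma>[OF i] by auto
    have "f ?\<eta> = (\<Oplus>\<^bsub>stalk \<O> (gran \<G> ?\<eta>)\<^esub>j\<in>{j \<in> I. \<sigma> j (gran \<G> ?\<eta>) = ?\<eta>}. s j ?\<eta>)"
    proof (rule sum_at[OF \<eta>(1)])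
      show "j \<in> I" if "j < k" "\<sigma> i x \<in> U j" for j
        using that \<eta>(2) image_eqI[of x "gran \<G>" "\<sigma> i x" "U j"] by (simp add: I_def)
    qed (use I in auto)
    also have "\<dots> = (\<Oplus>\<^bsub>stalk \<O> x\<^esub>j\<in>?cls i. s j ?\<eta>)" unfolding \<eta>(2) ..
    also have "\<dots> = F i x"
    proof -
      interpret ring "stalk \<O> x" using ring_stalk x .
      show ?thesis unfolding F_def
        using psig[OF _ V0(2)] by (intro finsum_cong') auto
    qed
    finally show ?thesis using zero[OF \<eta>] by simp
  qed
  have "\<exists>W. openin (unit_space \<G>) W \<and> x \<in> W \<and> W \<subseteq> V0 \<and> (\<forall>y\<in>W. F i y = \<zero>\<langle>y\<rangle>)" if iI: "i \<in> I" for i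
  proof -
    have cz: "continuous_map ?X total_space stalk_zero"
      using continuous_stalk_zero continuous_map_from_subtopology by blast
    obtain W where W: "openin ?X W" "x \<in> W" "\<And>y. y \<in> W \<Longrightarrow> F i y = \<zero>\<langle>y\<rangle>"
    proof (rule sections_agree_locally[OF cF cz])
      fix y assume "y \<in> topspace ?X"
      then have y: "y \<in> V0" "y \<in> units \<G>" using tsX by (auto simp: V0_def)
      interpret ring "stalk \<O> y" using ring_stalk y(2) .
      have "F i y \<in> carrier (stalk \<O> y)" "\<zero>\<langle>y\<rangle> \<in> carrier (stalk \<O> y)"
        unfolding F_def using psig y(1) by (auto intro!: finsum_closed)
      then show "proj (F i y) = proj \<zero>\<langle>y\<rangle>" by (simp add: stalk_simps)
    qed (use V0 tsX F0[OF iI] in auto)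
    then show ?thesis
      using V0(1) openin_trans_full openin_imp_subset by meson
  qed
  then obtain W where W: "\<And>i. i \<in> I \<Longrightarrow> openin (unit_space \<G>) (W i)" "\<And>i. i \<in> I \<Longrightarrow> x \<in> W i"
    "\<And>i y. \<lbrakk>i \<in> I; y \<in> W i\<rbrakk> \<Longrightarrow> F i y = \<zero>\<langle>y\<rangle>"
    by metis
  \<comment> \<open>For an index of \<open>I\<close>, a neighbourhood on which its group sum
    vanishes. For any other index, a neighbourhood over which its bisection has no arrows; ranges of
    compact bisections are closed, so their complements are open.\<close>
  define A where "A i = (if i \<in> I then W i else units \<G> - gran \<G> ` U i)" for i
  have A: "openin (unit_space \<G>) (A i)" "x \<in> A i" if "i < k" for i
  proof -
    have "closedin (unit_space \<G>) (gran \<G> ` U i)"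
      using U(1)[OF that] compactin_imp_closedin[OF Hausdorff_units] by (auto simp: compact_open_bisection_iff)
    then have "openin (unit_space \<G>) (units \<G> - gran \<G> ` U i)"
      using openin_diff[OF openin_topspace] topspace_unit_space by metis
    then show "openin (unit_space \<G>) (A i)" using W(1) by (simp add: A_def)
    show "x \<in> A i" using W(2) x that by (auto simp: A_def I_def)
  qed
  \<comment> \<open>Two bisections through the same arrow of row \<open>x\<close> share an arrow
    over every unit of this neighbourhood.\<close>
  define B where "B = (\<lambda>(i, j). if \<sigma> i x = \<sigma> j x then gran \<G> ` (U i \<inter> U j) else units \<G>)"
  have B: "openin (unit_space \<G>) (B p)" "x \<in> B p" if pI: "p \<in> I \<times> I" for p
  proof -
    obtain i j where p: "p = (i, j)" "i \<in> I" "j \<in> I" using pI by auto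
    then have ij: "i < k" "j < k" "x \<in> gran \<G> ` U i" "x \<in> gran \<G> ` U j" by (auto simp: I_def)
    show "openin (unit_space \<G>) (B p)"
      using openin_gran_image[OF openin_Int[OF U(3) U(3)], OF ij(1,2)] openin_topspace[of "unit_space \<G>"]
      by (simp add: B_def p(1) topspace_unit_space)
    show "x \<in> B p"
      using \<sigma>[OF ij(1,3)] \<sigma>[OF ij(2,4)] x by (auto simp: B_def p(1) image_iff intro!: bexI[of _ "\<sigma> i x"])
  qed
  define V where "V = \<Inter>(insert V0 (A ` {..<k} \<union> B ` (I \<times> I)))"
  have "openin (unit_space \<G>) V"
    unfolding V_def using V0(1) A(1) B(1) I(1) by (intro openin_Inter) auto
  moreover have "x \<in> V"
    unfolding V_def using V0(2) A(2) B(2) by auto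
  ultimately obtain K where K: "compact_open_units K" "x \<in> K" "K \<subseteq> V"
    using compact_open_units_basis by blast
  have "f \<eta> = \<zero>\<langle>gran \<G> \<eta>\<rangle>" if \<eta>: "\<eta> \<in> arrows \<G>" "gran \<G> \<eta> \<in> K" for \<eta>
  proof -
    define y where "y = gran \<G> \<eta>"
    have yV: "y \<in> V" using \<eta>(2) K(3) by (auto simp: y_def)
    then have y0: "y \<in> V0" by (simp add: V_def)
    interpret ring "stalk \<O> y" using ring_stalk gran_units \<eta>(1) by (simp add: y_def)
    define J where "J = {i \<in> I. \<sigma> i y = \<eta>}"
    have "f \<eta> = (\<Oplus>\<^bsub>stalk \<O> y\<^esub>i\<in>J. s i \<eta>)"
      unfolding J_def y_def
    proof (rule sum_at[OF \<eta>(1)])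
      show "i \<in> I" if "i < k" "\<eta> \<in> U i" for i
      proof (rule ccontr)
        assume "i \<notin> I"
        then have "A i \<in> A ` {..<k}" "A i = units \<G> - gran \<G> ` U i" using that(1) by (auto simp: A_def)
        then have "y \<notin> gran \<G> ` U i" using yV unfolding V_def by blast
        then show False using that(2) by (simp add: y_def)
      qed
    qed (use I in auto)
    also have "\<dots> = \<zero>\<langle>y\<rangle>"
    proof (rule finsum_zero_on_fibers[where q = "\<lambda>j. \<sigma> j x"])
      fix c assume "c \<in> (\<lambda>j. \<sigma> j x) ` J"
      then obtain i where i: "i \<in> J" "c = \<sigma> i x" by blast
      \<comment> \<open>Thanks to \<open>B\<close>, the indices contributing at \<eta> form complete
        groups: if one member passes through \<eta>, so do all others. The sum at \<eta> is then a
        sum of values of \<open>F\<close>.\<close>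
      have cls: "{j \<in> J. \<sigma> j x = c} = ?cls i"
      proof -
        have "\<sigma> j y = \<eta>" if j: "j \<in> I" "\<sigma> j x = \<sigma> i x" for j
        proof -
          have "B (i, j) \<in> B ` (I \<times> I)" using i(1) j(1) by (auto simp: J_def)
          then have "y \<in> B (i, j)" using yV by (auto simp: V_def)
          then obtain \<gamma> where "y = gran \<G> \<gamma>" "\<gamma> \<in> U i" "\<gamma> \<in> U j"
            using j(2) by (auto simp: B_def)
          then have "\<sigma> i y = \<gamma>" "\<sigma> j y = \<gamma>"
            using \<sigma>_eq[of i \<gamma>] \<sigma>_eq[of j \<gamma>] i(1) j(1) I by (auto simp: J_def)
          then show ?thesis using i(1) by (simp add: J_def)
        qed
        then show ?thesis by (auto simp: J_def i(2))
      qed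
      have "(\<Oplus>\<^bsub>stalk \<O> y\<^esub>j\<in>{j \<in> J. \<sigma> j x = c}. s j \<eta>) = (\<Oplus>\<^bsub>stalk \<O> y\<^esub>j\<in>{j \<in> J. \<sigma> j x = c}. s j (\<sigma> j y))"
        using psig[OF _ y0] by (intro finsum_cong') (auto simp: J_def)
      also have "\<dots> = F i y"
        unfolding cls F_def ..
      also have "\<dots> = \<zero>\<langle>y\<rangle>"
      proof (rule W(3))
        show "i \<in> I" using i(1) by (simp add: J_def)
        then have "A i \<in> A ` {..<k}" "A i = W i" using I by (auto simp: A_def)
        then show "y \<in> W i" using yV unfolding V_def by blast
      qed
      finally show "(\<Oplus>\<^bsub>stalk \<O> y\<^esub>j\<in>{j \<in> J. \<sigma> j x = c}. s j \<eta>) = \<zero>\<langle>y\<rangle>" .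
    qed (use I sc \<eta>(1) in \<open>auto simp: J_def y_def\<close>)
    finally show ?thesis by (simp add: y_def)
  qed
  then show thesis using that K by blast
qed

text \<open>Row \<open>z\<close> has finitely many nonzero entries, hence finitely many domains to
  avoid. Multiplying by \<open>idem K\<close> on the right then leaves, within row \<open>z\<close>,
  only entries in column \<open>x\<close>.\<close>

lemma Gamma_row_isolate:
  assumes "f \<in> carrier \<Gamma>" "z \<in> units \<G>" "openin (unit_space \<G>) V" "x \<in> V"
  obtains K where "compact_open_units K" "x \<in> K" "K \<subseteq> V"
    "\<And>\<gamma>. \<lbrakk>\<gamma> \<in> arrows \<G>; gran \<G> \<gamma> = z; gdom \<G> \<gamma> \<in> K; gdom \<G> \<gamma> \<noteq> x\<rbrakk> \<Longrightarrow> f \<gamma> = \<zero>\<langle>z\<rangle>"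
proof -
  have fin: "finite (gdom \<G> ` {\<gamma> \<in> arrows \<G>. gran \<G> \<gamma> = z \<and> f \<gamma> \<noteq> \<zero>\<langle>z\<rangle>})"
    using Gamma_row_finite[OF assms(1)] assms(2) by (simp add: row_finite_def)
  show thesis
    using compact_open_units_avoid[OF assms(3,4) fin] that by (smt (verit) IntI empty_iff image_eqI mem_Collect_eq singletonD subsetD)
qed

text \<open>The support of each elementary summand has a compact open range, and finitely many such
  ranges have a compact open union.\<close>

lemma Gamma_local_unit:
  assumes "f \<in> carrier \<Gamma>"
  obtains K where "compact_open_units K" "idem K \<otimes>\<^bsub>\<Gamma>\<^esub> f = f"
proof -
  have "\<exists>K. compact_open_units K \<and> (\<forall>\<gamma>\<in>arrows \<G>. gran \<G> \<gamma> \<notin> K \<longrightarrow> f \<gamma> = \<zero>\<langle>gran \<G> \<gamma>\<rangle>)"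
    using assms
  proof (induction rule: Gamma_induct)
    case zero
    show ?case using compact_open_units_empty by (auto simp: Gamma_zero_apply)
  next
    case (add e g)
    then obtain K where K: "compact_open_units K" "\<And>\<gamma>. \<lbrakk>\<gamma> \<in> arrows \<G>; gran \<G> \<gamma> \<notin> K\<rbrakk> \<Longrightarrow> g \<gamma> = \<zero>\<langle>gran \<G> \<gamma>\<rangle>"
      by blast
    obtain U where U: "compact_open_bisection \<G> U" "\<And>\<gamma>. \<lbrakk>\<gamma> \<in> arrows \<G>; \<gamma> \<notin> U\<rbrakk> \<Longrightarrow> e \<gamma> = \<zero>\<langle>gran \<G> \<gamma>\<rangle>"
      using elementary_sectionE[OF add.hyps(1)] by metis
    have "(e \<oplus>\<^bsub>\<Gamma>\<^esub> g) \<gamma> = \<zero>\<langle>gran \<G> \<gamma>\<rangle>" if "\<gamma> \<in> arrows \<G>" "gran \<G> \<gamma> \<notin> K \<union> gran \<G> ` U" for \<gamma>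
    proof -
      interpret ring "stalk \<O> (gran \<G> \<gamma>)" using ring_stalk gran_units that(1) by blast
      have "e \<gamma> = \<zero>\<langle>gran \<G> \<gamma>\<rangle>" "g \<gamma> = \<zero>\<langle>gran \<G> \<gamma>\<rangle>" using that K(2) U(2) by auto
      then show ?thesis by (simp add: Gamma_add_apply that(1))
    qed
    then show ?case
      using compact_open_units_Un[OF K(1) compact_open_bisection_gran[OF U(1)]] by blast
  qed
  then obtain K where K: "compact_open_units K" "\<And>\<gamma>. \<lbrakk>\<gamma> \<in> arrows \<G>; gran \<G> \<gamma> \<notin> K\<rbrakk> \<Longrightarrow> f \<gamma> = \<zero>\<langle>gran \<G> \<gamma>\<rangle>"
    by blast
  have "idem K \<otimes>\<^bsub>\<Gamma>\<^esub> f = f"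
  proof (rule section_eqI)
    show "(idem K \<otimes>\<^bsub>\<Gamma>\<^esub> f) \<gamma> = f \<gamma>" if "\<gamma> \<in> arrows \<G>" for \<gamma>
      using that convolution_idem_left[OF compact_open_units_subset[OF K(1)] Gamma_section[OF assms]] K(2)
      by (simp add: Gamma_simps(3))
  qed (use Gamma_section Gamma_mult_closed Gamma_idem K assms in auto)
  then show thesis using that K(1) by blast
qed

lemma idem_mult_idem:
  assumes "compact_open_units K" "compact_open_units L"
  shows "idem K \<otimes>\<^bsub>\<Gamma>\<^esub> idem L = idem (K \<inter> L)"
proof (rule section_eqI)
  show "(idem K \<otimes>\<^bsub>\<Gamma>\<^esub> idem L) \<gamma> = idem (K \<inter> L) \<gamma>" if "\<gamma> \<in> arrows \<G>" for \<gamma>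
    using that compact_open_units_subset[OF assms(1)] compact_open_units_subset[OF assms(2)]
    by (auto simp: Gamma_simps(3) convolution_idem_left idem_section)
      (auto simp: idem_def subset_iff gran_unit)
qed (use Gamma_section Gamma_mult_closed Gamma_idem assms idem_section in auto)

text \<open>Inclusion and exclusion in a form free of subtraction, for patching over covers with
  overlaps.\<close>

lemma idem_Un_add_Int:
  assumes "compact_open_units K" "compact_open_units L"
  shows "idem (K \<union> L) \<oplus>\<^bsub>\<Gamma>\<^esub> idem (K \<inter> L) = idem K \<oplus>\<^bsub>\<Gamma>\<^esub> idem L"
proof (rule section_eqI)
  show "(idem (K \<union> L) \<oplus>\<^bsub>\<Gamma>\<^esub> idem (K \<inter> L)) \<gamma> = (idem K \<oplus>\<^bsub>\<Gamma>\<^esub> idem L) \<gamma>" if "\<gamma> \<in> arrows \<G>" for \<gamma>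
  proof -
    interpret ring "stalk \<O> (gran \<G> \<gamma>)" using ring_stalk gran_units that by blast
    show ?thesis using that by (auto simp: Gamma_add_apply idem_def)
  qed
qed (use Gamma_section Gamma_add_closed Gamma_idem assms compact_open_units_Un compact_open_units_Int in auto)

end

section \<open>The skew group ring and the bimodule as convolutions\<close>

lemma support_sum_eq:
  assumes "comm_monoid A"
    and "\<And>j. \<lbrakk>j \<in> J'; j \<notin> J\<rbrakk> \<Longrightarrow> h' j = \<one>\<^bsub>A\<^esub>" "J \<subseteq> J'"
    and "\<And>j. j \<in> J \<Longrightarrow> h j = h' j" "\<And>j. j \<in> J \<Longrightarrow> h' j \<in> carrier A"
  shows "support_sum A h J = support_sum A h' J'"
proof -
  interpret A: comm_monoid A by fact
  have "{j \<in> J. h j \<noteq> \<one>\<^bsub>A\<^esub>} = {j \<in> J'. h' j \<noteq> \<one>\<^bsub>A\<^esub>}"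
  proof (intro equalityI subsetI)
    show "j \<in> {j \<in> J'. h' j \<noteq> \<one>\<^bsub>A\<^esub>}" if "j \<in> {j \<in> J. h j \<noteq> \<one>\<^bsub>A\<^esub>}" for j
      using that assms(3,4) by auto
    show "j \<in> {j \<in> J. h j \<noteq> \<one>\<^bsub>A\<^esub>}" if "j \<in> {j \<in> J'. h' j \<noteq> \<one>\<^bsub>A\<^esub>}" for j
      using that assms(2)[of j] assms(4)[of j] by (cases "j \<in> J") auto
  qed
  then show ?thesis
    unfolding support_sum_def using assms(2,4,5) by (intro A.finprod_cong') auto
qed

lemma single_in_sum_group:
  assumes "\<And>j. j \<in> D \<Longrightarrow> comm_group (A j)" "i \<in> D" "a \<in> carrier (A i)"
  shows "single D A i a \<in> carrier (sum_group D A)"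
proof -
  have g: "group (A j)" if "j \<in> D" for j using assms(1)[OF that] comm_group.axioms(2) by blast
  have "finite {j \<in> D. single D A i a j \<noteq> \<one>\<^bsub>A j\<^esub>}"
    by (rule finite_subset[of _ "{i}"]) (auto simp: single_def)
  moreover have "\<one>\<^bsub>A j\<^esub> \<in> carrier (A j)" if "j \<in> D" for j
    using g[OF that] group.is_monoid monoid.one_closed by blast
  ultimately show ?thesis
    using assms(2,3) g by (subst carrier_sum_group) (auto simp: single_def)
qed

lemma comm_group_sum_group:
  assumes "\<And>j. j \<in> D \<Longrightarrow> comm_group (A j)"
  shows "comm_group (sum_group D A)"
proof -
  have g: "group (A j)" if "j \<in> D" for j using assms that comm_group.axioms(2) by blast
  show ?thesis
  proof (rule group.group_comm_groupI)
    show "group (sum_group D A)" using g by simp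
    show "b \<otimes>\<^bsub>sum_group D A\<^esub> c = c \<otimes>\<^bsub>sum_group D A\<^esub> b"
      if "b \<in> carrier (sum_group D A)" "c \<in> carrier (sum_group D A)" for b c
      using that assms g comm_monoid.m_comm[OF comm_group.axioms(1)]
      by (fastforce simp: carrier_sum_group intro!: restrict_ext)
  qed
qed

lemma finprod_sum_group_apply:
  assumes "\<And>j. j \<in> D \<Longrightarrow> comm_group (A j)" "\<And>p. p \<in> T \<Longrightarrow> h p \<in> carrier (sum_group D A)" "i \<in> D"
  shows "finprod (sum_group D A) h T i = finprod (A i) (\<lambda>p. h p i) T"
proof -
  interpret S: comm_group "sum_group D A" using comm_group_sum_group assms(1) by blast
  interpret I: comm_group "A i" using assms(1,3) by blast
  have g: "group (A j)" if "j \<in> D" for j using assms(1) that comm_group.axioms(2) by blast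
  have c: "h p i \<in> carrier (A i)" if "p \<in> T" for p
    using assms(2)[OF that] assms(3) carrier_sum_group[of D A, OF g] by auto
  show ?thesis
    using assms(2) c
  proof (induction T rule: infinite_finite_induct)
    case (insert p T)
    then show ?case using assms(3) by (simp add: Pi_def)
  qed (use assms(3) in auto)
qed

text \<open>Products in the bimodule and in the skew group ring are defined as sums of generators.
  Coordinate \<open>i\<close> of such a sum collects the terms whose generator sits at
  \<open>i\<close>; finiteness of the set of nonzero terms makes \<open>support_sum\<close> a
  genuine sum.\<close>

lemma support_sum_single:
  assumes A: "\<And>j. j \<in> D \<Longrightarrow> comm_group (A j)"
    and k: "\<And>p. p \<in> P \<Longrightarrow> k p \<in> D" and v: "\<And>p. p \<in> P \<Longrightarrow> v p \<in> carrier (A (k p))"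
    and fin: "finite {p \<in> P. v p \<noteq> \<one>\<^bsub>A (k p)\<^esub>}"
  shows "support_sum (sum_group D A) (\<lambda>p. single D A (k p) (v p)) P \<in> carrier (sum_group D A)"
    and "i \<in> D \<Longrightarrow> support_sum (sum_group D A) (\<lambda>p. single D A (k p) (v p)) P i =
           support_sum (A i) v {p \<in> P. k p = i}"
proof -
  interpret S: comm_group "sum_group D A" using comm_group_sum_group A by blast
  let ?h = "\<lambda>p. single D A (k p) (v p)"
  have "?h p = \<one>\<^bsub>sum_group D A\<^esub> \<longleftrightarrow> v p = \<one>\<^bsub>A (k p)\<^esub>" if "p \<in> P" for p
    using k[OF that] by (auto simp: single_def fun_eq_iff)
  then have T: "{p \<in> P. ?h p \<noteq> \<one>\<^bsub>sum_group D A\<^esub>} = {p \<in> P. v p \<noteq> \<one>\<^bsub>A (k p)\<^esub>}" (is "_ = ?T")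
    by blast
  have hc: "?h p \<in> carrier (sum_group D A)" if "p \<in> P" for p
    using that A k v by (intro single_in_sum_group) auto
  show "support_sum (sum_group D A) ?h P \<in> carrier (sum_group D A)"
    unfolding support_sum_def using hc by (intro S.finprod_closed) auto
  assume i: "i \<in> D"
  interpret I: comm_group "A i" using A i by blast
  have "support_sum (sum_group D A) ?h P i = finprod (A i) (\<lambda>p. ?h p i) ?T"
    unfolding support_sum_def T using hc A i by (intro finprod_sum_group_apply) auto
  also have "\<dots> = finprod (A i) v {p \<in> {p \<in> P. k p = i}. v p \<noteq> \<one>\<^bsub>A i\<^esub>}"
    using fin i v by (intro I.finprod_mono_neutral_cong_right) (auto simp: single_def)
  finally show "support_sum (sum_group D A) ?h P i = support_sum (A i) v {p \<in> P. k p = i}"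
    unfolding support_sum_def .
qed

section \<open>Bimodule vectors and skew group ring elements as sections\<close>

context ample_ring_sheaf
begin

text \<open>Makes a vector indexed by a column or by an isotropy group a section on all arrows, so
  that products become convolutions. The result is in general not continuous and lies only in
  \<open>arrow_sections\<close>.\<close>

definition extend_zero :: "'g set \<Rightarrow> ('g \<Rightarrow> 'e) \<Rightarrow> 'g \<Rightarrow> 'e" where
  "extend_zero D l = (\<lambda>\<gamma>\<in>arrows \<G>. if \<gamma> \<in> D then l \<gamma> else \<zero>\<langle>gran \<G> \<gamma>\<rangle>)"

lemma extend_zero_section:
  assumes "\<And>\<gamma>. \<lbrakk>\<gamma> \<in> D; \<gamma> \<in> arrows \<G>\<rbrakk> \<Longrightarrow> l \<gamma> \<in> carrier (stalk \<O> (gran \<G> \<gamma>))"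
  shows "extend_zero D l \<in> carrier (arrow_sections \<G> \<O>)"
proof -
  have "\<zero>\<langle>gran \<G> \<eta>\<rangle> \<in> carrier (stalk \<O> (gran \<G> \<eta>))" if "\<eta> \<in> arrows \<G>" for \<eta>
    using abelian_groupE(2)[OF ring.is_abelian_group[OF ring_stalk[OF gran_units[OF that]]]] .
  then show ?thesis
    using assms by (auto simp: carrier_arrow_sections extend_zero_def)
qed

lemma isotropy_fiber: "isotropy \<G> x \<subseteq> gdom_fiber \<G> x"
  by (auto simp: isotropy_def gdom_fiber_def)

lemma isotropy_iff: "\<delta> \<in> isotropy \<G> x \<longleftrightarrow> \<delta> \<in> arrows \<G> \<and> gdom \<G> \<delta> = x \<and> gran \<G> \<delta> = x"
  by (simp add: isotropy_def)

lemma gdom_fiber_iff: "\<gamma> \<in> gdom_fiber \<G> x \<longleftrightarrow> \<gamma> \<in> arrows \<G> \<and> gdom \<G> \<gamma> = x"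
  by (simp add: gdom_fiber_def)

lemma fiber_group: "\<gamma> \<in> gdom_fiber \<G> x \<Longrightarrow> comm_group (add_monoid (stalk \<O> (gran \<G> \<gamma>)))"
  using stalk_group gran_units gdom_fiber_iff by blast

lemma carrier_L_group:
  "l \<in> carrier (L_group \<G> \<O> x) \<longleftrightarrow> l \<in> (\<Pi>\<^sub>E \<gamma>\<in>gdom_fiber \<G> x. carrier (stalk \<O> (gran \<G> \<gamma>))) \<and>
     finite {\<gamma> \<in> gdom_fiber \<G> x. l \<gamma> \<noteq> \<zero>\<langle>gran \<G> \<gamma>\<rangle>}"
  unfolding L_group_def using fiber_group comm_group.axioms(2)
  by (subst carrier_sum_group) auto

lemma L_group_comm: "comm_group (L_group \<G> \<O> x)"
  unfolding L_group_def using fiber_group by (intro comm_group_sum_group) auto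

lemma L_group_simps:
  "\<gamma> \<in> gdom_fiber \<G> x \<Longrightarrow> (l \<otimes>\<^bsub>L_group \<G> \<O> x\<^esub> l') \<gamma> = l \<gamma> \<oplus>\<^bsub>stalk \<O> (gran \<G> \<gamma>)\<^esub> l' \<gamma>"
  "\<gamma> \<in> gdom_fiber \<G> x \<Longrightarrow> \<one>\<^bsub>L_group \<G> \<O> x\<^esub> \<gamma> = \<zero>\<langle>gran \<G> \<gamma>\<rangle>"
  by (auto simp: L_group_def)

lemma L_closed:
  "\<lbrakk>l \<in> carrier (L_group \<G> \<O> x); \<gamma> \<in> gdom_fiber \<G> x\<rbrakk> \<Longrightarrow> l \<gamma> \<in> carrier (stalk \<O> (gran \<G> \<gamma>))"
  by (auto simp: carrier_L_group)

lemma L_eqI: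
  assumes "l \<in> carrier (L_group \<G> \<O> x)" "l' \<in> carrier (L_group \<G> \<O> x)"
    "\<And>\<gamma>. \<gamma> \<in> gdom_fiber \<G> x \<Longrightarrow> l \<gamma> = l' \<gamma>"
  shows "l = l'"
  by (rule PiE_ext[where k = "gdom_fiber \<G> x" and s = "\<lambda>\<gamma>. carrier (stalk \<O> (gran \<G> \<gamma>))"])
    (use assms in \<open>auto simp: carrier_L_group\<close>)

lemma carrier_skew:
  assumes "x \<in> units \<G>"
  shows "b \<in> carrier (skew_group_ring \<G> \<O> x) \<longleftrightarrow> b \<in> (\<Pi>\<^sub>E \<delta>\<in>isotropy \<G> x. carrier (stalk \<O> x)) \<and>
     finite {\<delta> \<in> isotropy \<G> x. b \<delta> \<noteq> \<zero>\<langle>x\<rangle>}"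
  unfolding skew_group_ring_def ring_on_def skew_group_def
  using stalk_group[OF assms] comm_group.axioms(2)
  by (simp, subst carrier_sum_group) auto

lemma skew_simps:
  "b \<oplus>\<^bsub>skew_group_ring \<G> \<O> x\<^esub> c = (\<lambda>\<delta>\<in>isotropy \<G> x. b \<delta> \<oplus>\<^bsub>stalk \<O> x\<^esub> c \<delta>)"
  "b \<otimes>\<^bsub>skew_group_ring \<G> \<O> x\<^esub> c = skew_mult \<G> \<O> x b c"
  "\<one>\<^bsub>skew_group_ring \<G> \<O> x\<^esub> = (\<lambda>\<delta>\<in>isotropy \<G> x. if \<delta> = x then \<one>\<^bsub>stalk \<O> x\<^esub> else \<zero>\<langle>x\<rangle>)"
  by (auto simp: skew_group_ring_def ring_on_def skew_group_def skew_single_def single_def)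

lemma skew_closed:
  "\<lbrakk>x \<in> units \<G>; b \<in> carrier (skew_group_ring \<G> \<O> x); \<delta> \<in> isotropy \<G> x\<rbrakk> \<Longrightarrow> b \<delta> \<in> carrier (stalk \<O> x)"
  by (auto simp: carrier_skew)

lemma extend_L_section:
  "l \<in> carrier (L_group \<G> \<O> x) \<Longrightarrow> extend_zero (gdom_fiber \<G> x) l \<in> carrier (arrow_sections \<G> \<O>)"
  using L_closed by (intro extend_zero_section)

lemma extend_skew_section:
  assumes "x \<in> units \<G>" "b \<in> carrier (skew_group_ring \<G> \<O> x)"
  shows "extend_zero (isotropy \<G> x) b \<in> carrier (arrow_sections \<G> \<O>)"
  using skew_closed[OF assms] by (intro extend_zero_section) (auto simp: isotropy_iff)

lemma stalk_zero_closed: "x \<in> units \<G> \<Longrightarrow> \<zero>\<langle>x\<rangle> \<in> carrier (stalk \<O> x)"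
  using abelian_groupE(2)[OF ring.is_abelian_group[OF ring_stalk]] .

lemma composable_term_closed:
  assumes "f \<beta> \<in> carrier (stalk \<O> (gran \<G> \<beta>))" "g \<rho> \<in> carrier (stalk \<O> (gran \<G> \<rho>))"
    "\<beta> \<in> arrows \<G>" "\<rho> \<in> arrows \<G>" "gdom \<G> \<beta> = gran \<G> \<rho>"
  shows "f \<beta> \<otimes>\<^bsub>stalk \<O> (gran \<G> \<beta>)\<^esub> act \<beta> (g \<rho>) \<in> carrier (stalk \<O> (gran \<G> \<beta>))"
    "f \<beta> = \<zero>\<langle>gran \<G> \<beta>\<rangle> \<or> g \<rho> = \<zero>\<langle>gran \<G> \<rho>\<rangle> \<Longrightarrow> f \<beta> \<otimes>\<^bsub>stalk \<O> (gran \<G> \<beta>)\<^esub> act \<beta> (g \<rho>) = \<zero>\<langle>gran \<G> \<beta>\<rangle>"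
proof -
  interpret ring "stalk \<O> (gran \<G> \<beta>)" using ring_stalk gran_units assms(3) by blast
  have "act \<beta> (g \<rho>) \<in> carrier (stalk \<O> (gran \<G> \<beta>))"
    using act_closed assms by metis
  then show "f \<beta> \<otimes>\<^bsub>stalk \<O> (gran \<G> \<beta>)\<^esub> act \<beta> (g \<rho>) \<in> carrier (stalk \<O> (gran \<G> \<beta>))"
    "f \<beta> = \<zero>\<langle>gran \<G> \<beta>\<rangle> \<or> g \<rho> = \<zero>\<langle>gran \<G> \<rho>\<rangle> \<Longrightarrow> f \<beta> \<otimes>\<^bsub>stalk \<O> (gran \<G> \<beta>)\<^esub> act \<beta> (g \<rho>) = \<zero>\<langle>gran \<G> \<beta>\<rangle>"
    using assms act_zero[OF assms(3)] by auto
qed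

text \<open>Reads a sum over a restricted set of pairs, such as pairs of isotropy arrows, as a value
  of a convolution: every factorisation outside \<open>J\<close> meets a zero in one of the
  factors.\<close>

lemma support_sum_convolution:
  assumes f: "f \<in> carrier (arrow_sections \<G> \<O>)" and g: "g \<in> carrier (arrow_sections \<G> \<O>)"
    and \<eta>: "\<eta> \<in> arrows \<G>" and x: "gran \<G> \<eta> = x"
    and J: "J \<subseteq> {(\<beta>, \<rho>) \<in> composable \<G>. \<beta> \<cdot> \<rho> = \<eta>}"
    and off: "\<And>\<beta> \<rho>. \<lbrakk>\<beta> \<in> arrows \<G>; \<rho> \<in> arrows \<G>; gdom \<G> \<beta> = gran \<G> \<rho>; \<beta> \<cdot> \<rho> = \<eta>; (\<beta>, \<rho>) \<notin> J\<rbrakk>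
      \<Longrightarrow> f \<beta> = \<zero>\<langle>gran \<G> \<beta>\<rangle> \<or> g \<rho> = \<zero>\<langle>gran \<G> \<rho>\<rangle>"
    and h: "\<And>\<beta> \<rho>. (\<beta>, \<rho>) \<in> J \<Longrightarrow> h (\<beta>, \<rho>) = f \<beta> \<otimes>\<^bsub>stalk \<O> (gran \<G> \<beta>)\<^esub> act \<beta> (g \<rho>)"
  shows "support_sum (add_monoid (stalk \<O> x)) h J = convolution \<G> \<O> f g \<eta>"
proof -
  have "support_sum (add_monoid (stalk \<O> x)) h J = support_sum (add_monoid (stalk \<O> x))
      (\<lambda>(\<beta>, \<rho>). f \<beta> \<otimes>\<^bsub>stalk \<O> x\<^esub> act \<beta> (g \<rho>)) {(\<beta>, \<rho>) \<in> composable \<G>. \<beta> \<cdot> \<rho> = \<eta>}"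
  proof (rule support_sum_eq[OF _ _ J])
    show "comm_monoid (add_monoid (stalk \<O> x))"
      using stalk_group gran_units \<eta> x comm_group.axioms(1) by blast
  next
    fix j assume j: "j \<in> {(\<beta>, \<rho>) \<in> composable \<G>. \<beta> \<cdot> \<rho> = \<eta>}" "j \<notin> J"
    then obtain \<beta> \<rho> where *: "j = (\<beta>, \<rho>)" "\<beta> \<in> arrows \<G>" "\<rho> \<in> arrows \<G>" "gdom \<G> \<beta> = gran \<G> \<rho>" "\<beta> \<cdot> \<rho> = \<eta>"
      by auto
    then have "gran \<G> \<beta> = x" using gran_gmult x by auto
    then show "(case j of (\<beta>, \<rho>) \<Rightarrow> f \<beta> \<otimes>\<^bsub>stalk \<O> x\<^esub> act \<beta> (g \<rho>)) = \<one>\<^bsub>add_monoid (stalk \<O> x)\<^esub>"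
      using composable_term_closed(2)[of f \<beta> g \<rho>] section_closed[OF f *(2)] section_closed[OF g *(3)] off[OF *(2-5)] j(2) * by auto
  next
    fix j assume jJ: "j \<in> J"
    then obtain \<beta> \<rho> where *: "j = (\<beta>, \<rho>)" "\<beta> \<in> arrows \<G>" "\<rho> \<in> arrows \<G>" "gdom \<G> \<beta> = gran \<G> \<rho>" "\<beta> \<cdot> \<rho> = \<eta>"
      using J by auto
    then have r: "gran \<G> \<beta> = x" using gran_gmult x by auto
    then show "h j = (case j of (\<beta>, \<rho>) \<Rightarrow> f \<beta> \<otimes>\<^bsub>stalk \<O> x\<^esub> act \<beta> (g \<rho>))"
      using h[of \<beta> \<rho>] jJ *(1) by simp
    show "(case j of (\<beta>, \<rho>) \<Rightarrow> f \<beta> \<otimes>\<^bsub>stalk \<O> x\<^esub> act \<beta> (g \<rho>)) \<in> carrier (add_monoid (stalk \<O> x))"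
      using composable_term_closed(1)[of f \<beta> g \<rho>] section_closed[OF f *(2)] section_closed[OF g *(3)] r * by simp
  qed
  then show ?thesis
    using \<eta> x by (simp add: convolution_def)
qed

lemma gmult_fiber:
  "\<lbrakk>\<beta> \<in> arrows \<G>; \<gamma> \<in> gdom_fiber \<G> x; gdom \<G> \<beta> = gran \<G> \<gamma>\<rbrakk> \<Longrightarrow> \<beta> \<cdot> \<gamma> \<in> gdom_fiber \<G> x"
  by (simp add: gdom_fiber_iff gmult_arrow gdom_gmult)

text \<open>The nonzero terms are found by choosing \<gamma> in the finite support of
  \<open>l\<close> and then \<beta> among the finitely many nonzero entries of \<open>f\<close> in
  column \<open>gran \<G> \<gamma>\<close>.\<close>

lemma L_left_act_convolution:
  assumes x: "x \<in> units \<G>" and f: "f \<in> carrier \<Gamma>" and l: "l \<in> carrier (L_group \<G> \<O> x)"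
  shows "L_left_act \<G> \<O> x f l \<in> carrier (L_group \<G> \<O> x)"
    and "\<eta> \<in> gdom_fiber \<G> x \<Longrightarrow> L_left_act \<G> \<O> x f l \<eta> = convolution \<G> \<O> f (extend_zero (gdom_fiber \<G> x) l) \<eta>"
proof -
  let ?P = "{(\<beta>, \<gamma>) \<in> composable \<G>. \<gamma> \<in> gdom_fiber \<G> x}"
  let ?A = "\<lambda>\<gamma>. add_monoid (stalk \<O> (gran \<G> \<gamma>))"
  let ?k = "\<lambda>(\<beta>, \<gamma>). \<beta> \<cdot> \<gamma>"
  let ?v = "\<lambda>(\<beta>, \<gamma>). f \<beta> \<otimes>\<^bsub>stalk \<O> (gran \<G> \<beta>)\<^esub> act \<beta> (l \<gamma>)"
  have fs: "f \<in> carrier (arrow_sections \<G> \<O>)" using Gamma_section f .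
  have eq: "L_left_act \<G> \<O> x f l = support_sum (sum_group (gdom_fiber \<G> x) ?A) (\<lambda>p. single (gdom_fiber \<G> x) ?A (?k p) (?v p)) ?P"
    by (simp add: L_left_act_def L_single_def L_group_def case_prod_unfold)
  have k: "?k p \<in> gdom_fiber \<G> x" if "p \<in> ?P" for p
    using that gmult_fiber by auto
  have v: "?v p \<in> carrier (?A (?k p))" if "p \<in> ?P" for p
    using that composable_term_closed(1)[of f _ l] section_closed[OF fs] L_closed[OF l] by (auto simp: gran_gmult)
  have "{p \<in> ?P. ?v p \<noteq> \<one>\<^bsub>?A (?k p)\<^esub>} \<subseteq> (\<Union>\<gamma>\<in>{\<gamma> \<in> gdom_fiber \<G> x. l \<gamma> \<noteq> \<zero>\<langle>gran \<G> \<gamma>\<rangle>}.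
      {\<beta> \<in> arrows \<G>. gdom \<G> \<beta> = gran \<G> \<gamma> \<and> f \<beta> \<noteq> \<zero>\<langle>gran \<G> \<beta>\<rangle>} \<times> {\<gamma>})"
    using composable_term_closed(2)[of f _ l] section_closed[OF fs] L_closed[OF l] by (fastforce simp: gran_gmult)
  moreover have "finite (\<Union>\<gamma>\<in>{\<gamma> \<in> gdom_fiber \<G> x. l \<gamma> \<noteq> \<zero>\<langle>gran \<G> \<gamma>\<rangle>}.
      {\<beta> \<in> arrows \<G>. gdom \<G> \<beta> = gran \<G> \<gamma> \<and> f \<beta> \<noteq> \<zero>\<langle>gran \<G> \<beta>\<rangle>} \<times> {\<gamma>})"
    using l Gamma_column_finite[OF f] gran_units
    by (intro finite_UN_I) (auto simp: carrier_L_group column_finite_def gdom_fiber_iff)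
  ultimately have fin: "finite {p \<in> ?P. ?v p \<noteq> \<one>\<^bsub>?A (?k p)\<^esub>}"
    using finite_subset by blast
  show "L_left_act \<G> \<O> x f l \<in> carrier (L_group \<G> \<O> x)"
    unfolding eq L_group_def using support_sum_single(1)[OF fiber_group k v fin] .
  assume \<eta>: "\<eta> \<in> gdom_fiber \<G> x"
  have "L_left_act \<G> \<O> x f l \<eta> = support_sum (?A \<eta>) ?v {p \<in> ?P. ?k p = \<eta>}"
    unfolding eq using support_sum_single(2)[OF fiber_group k v fin \<eta>] .
  also have "\<dots> = convolution \<G> \<O> f (extend_zero (gdom_fiber \<G> x) l) \<eta>"
    by (rule support_sum_convolution[OF fs extend_L_section[OF l]])
      (use \<eta> in \<open>auto simp: gdom_fiber_iff extend_zero_def gdom_gmult\<close>)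
  finally show "L_left_act \<G> \<O> x f l \<eta> = convolution \<G> \<O> f (extend_zero (gdom_fiber \<G> x) l) \<eta>" .
qed

text \<open>Both factors have finite support. If an arrow of domain \<open>x\<close> factors with a
  first factor of domain \<open>x\<close>, the second factor is an isotropy arrow, so the pairs in
  the definition are the only factorisations that count.\<close>

lemma L_right_act_convolution:
  assumes x: "x \<in> units \<G>" and b: "b \<in> carrier (skew_group_ring \<G> \<O> x)" and l: "l \<in> carrier (L_group \<G> \<O> x)"
  shows "L_right_act \<G> \<O> x l b \<in> carrier (L_group \<G> \<O> x)"
    and "\<eta> \<in> gdom_fiber \<G> x \<Longrightarrow> L_right_act \<G> \<O> x l b \<eta> =
      convolution \<G> \<O> (extend_zero (gdom_fiber \<G> x) l) (extend_zero (isotropy \<G> x) b) \<eta>"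
proof -
  let ?P = "gdom_fiber \<G> x \<times> isotropy \<G> x"
  let ?A = "\<lambda>\<gamma>. add_monoid (stalk \<O> (gran \<G> \<gamma>))"
  let ?k = "\<lambda>(\<beta>, \<gamma>). \<beta> \<cdot> \<gamma>"
  let ?v = "\<lambda>(\<beta>, \<gamma>). l \<beta> \<otimes>\<^bsub>stalk \<O> (gran \<G> \<beta>)\<^esub> act \<beta> (b \<gamma>)"
  have bc: "b \<delta> \<in> carrier (stalk \<O> (gran \<G> \<delta>))" if "\<delta> \<in> isotropy \<G> x" for \<delta>
    using skew_closed[OF x b that] that by (simp add: isotropy_iff)
  have eq: "L_right_act \<G> \<O> x l b = support_sum (sum_group (gdom_fiber \<G> x) ?A) (\<lambda>p. single (gdom_fiber \<G> x) ?A (?k p) (?v p)) ?P"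
    by (simp add: L_right_act_def L_single_def L_group_def case_prod_unfold)
  have k: "?k p \<in> gdom_fiber \<G> x" if "p \<in> ?P" for p
    using that by (auto simp: gdom_fiber_iff isotropy_iff gmult_arrow gdom_gmult)
  have v: "?v p \<in> carrier (?A (?k p))" if "p \<in> ?P" for p
    using that composable_term_closed(1)[of l _ b] bc L_closed[OF l]
    by (auto simp: gran_gmult gdom_fiber_iff isotropy_iff)
  have "{p \<in> ?P. ?v p \<noteq> \<one>\<^bsub>?A (?k p)\<^esub>} \<subseteq> {\<gamma> \<in> gdom_fiber \<G> x. l \<gamma> \<noteq> \<zero>\<langle>gran \<G> \<gamma>\<rangle>} \<times> {\<delta> \<in> isotropy \<G> x. b \<delta> \<noteq> \<zero>\<langle>x\<rangle>}"
  proof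
    fix p assume "p \<in> {p \<in> ?P. ?v p \<noteq> \<one>\<^bsub>?A (?k p)\<^esub>}"
    then obtain \<beta> \<delta> where p: "p = (\<beta>, \<delta>)" "\<beta> \<in> gdom_fiber \<G> x" "\<delta> \<in> isotropy \<G> x"
        "?v (\<beta>, \<delta>) \<noteq> \<zero>\<langle>gran \<G> (\<beta> \<cdot> \<delta>)\<rangle>"
      by auto
    then have a: "\<beta> \<in> arrows \<G>" "\<delta> \<in> arrows \<G>" "gdom \<G> \<beta> = gran \<G> \<delta>" "gran \<G> \<delta> = x"
      by (auto simp: gdom_fiber_iff isotropy_iff)
    then have "l \<beta> \<noteq> \<zero>\<langle>gran \<G> \<beta>\<rangle> \<and> b \<delta> \<noteq> \<zero>\<langle>x\<rangle>"
      using composable_term_closed(2)[of l \<beta> b \<delta>, OF L_closed[OF l p(2)] bc[OF p(3)] a(1-3)] p(4) gran_gmult[OF a(1-3)] by auto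
    then show "p \<in> {\<gamma> \<in> gdom_fiber \<G> x. l \<gamma> \<noteq> \<zero>\<langle>gran \<G> \<gamma>\<rangle>} \<times> {\<delta> \<in> isotropy \<G> x. b \<delta> \<noteq> \<zero>\<langle>x\<rangle>}"
      using p(1-3) by simp
  qed
  then have fin: "finite {p \<in> ?P. ?v p \<noteq> \<one>\<^bsub>?A (?k p)\<^esub>}"
    using b l by (elim finite_subset) (auto simp: carrier_L_group carrier_skew[OF x])
  show "L_right_act \<G> \<O> x l b \<in> carrier (L_group \<G> \<O> x)"
    unfolding eq L_group_def using support_sum_single(1)[OF fiber_group k v fin] .
  assume \<eta>: "\<eta> \<in> gdom_fiber \<G> x"
  have "L_right_act \<G> \<O> x l b \<eta> = support_sum (?A \<eta>) ?v {p \<in> ?P. ?k p = \<eta>}"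
    unfolding eq using support_sum_single(2)[OF fiber_group k v fin \<eta>] .
  also have "\<dots> = convolution \<G> \<O> (extend_zero (gdom_fiber \<G> x) l) (extend_zero (isotropy \<G> x) b) \<eta>"
  proof (rule support_sum_convolution[OF extend_L_section[OF l] extend_skew_section[OF x b]])
    fix \<beta> \<rho> assume *: "\<beta> \<in> arrows \<G>" "\<rho> \<in> arrows \<G>" "gdom \<G> \<beta> = gran \<G> \<rho>" "\<beta> \<cdot> \<rho> = \<eta>"
      "(\<beta>, \<rho>) \<notin> {p \<in> ?P. ?k p = \<eta>}"
    then have "gdom \<G> \<rho> = x" using \<eta> gdom_gmult gdom_fiber_iff by metis
    then have "\<beta> \<notin> gdom_fiber \<G> x \<or> \<rho> \<notin> isotropy \<G> x" using * by simp
    then show "extend_zero (gdom_fiber \<G> x) l \<beta> = \<zero>\<langle>gran \<G> \<beta>\<rangle> \<or> extend_zero (isotropy \<G> x) b \<rho> = \<zero>\<langle>gran \<G> \<rho>\<rangle>"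
      using * by (auto simp: extend_zero_def)
  next
    fix \<beta> \<rho> assume "(\<beta>, \<rho>) \<in> {p \<in> ?P. ?k p = \<eta>}"
    then show "?v (\<beta>, \<rho>) = extend_zero (gdom_fiber \<G> x) l \<beta> \<otimes>\<^bsub>stalk \<O> (gran \<G> \<beta>)\<^esub> act \<beta> (extend_zero (isotropy \<G> x) b \<rho>)"
      by (simp add: extend_zero_def gdom_fiber_iff isotropy_iff)
  qed (use \<eta> in \<open>auto simp: gdom_fiber_iff isotropy_iff\<close>)
  finally show "L_right_act \<G> \<O> x l b \<eta> =
    convolution \<G> \<O> (extend_zero (gdom_fiber \<G> x) l) (extend_zero (isotropy \<G> x) b) \<eta>" .
qed

text \<open>The same computation with isotropy arrows in both places. It makes the product of the
  skew group ring comparable with products of lifts in \<Gamma>.\<close>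

lemma skew_mult_convolution:
  assumes x: "x \<in> units \<G>" and b: "b \<in> carrier (skew_group_ring \<G> \<O> x)" and c: "c \<in> carrier (skew_group_ring \<G> \<O> x)"
  shows "b \<otimes>\<^bsub>skew_group_ring \<G> \<O> x\<^esub> c \<in> carrier (skew_group_ring \<G> \<O> x)"
    and "\<eta> \<in> isotropy \<G> x \<Longrightarrow> (b \<otimes>\<^bsub>skew_group_ring \<G> \<O> x\<^esub> c) \<eta> =
      convolution \<G> \<O> (extend_zero (isotropy \<G> x) b) (extend_zero (isotropy \<G> x) c) \<eta>"
proof -
  let ?P = "isotropy \<G> x \<times> isotropy \<G> x"
  let ?A = "\<lambda>\<gamma>. add_monoid (stalk \<O> x)"
  let ?k = "\<lambda>(\<beta>, \<gamma>). \<beta> \<cdot> \<gamma>"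
  let ?v = "\<lambda>(\<beta>, \<gamma>). b \<beta> \<otimes>\<^bsub>stalk \<O> x\<^esub> act \<beta> (c \<gamma>)"
  have bc: "b \<delta> \<in> carrier (stalk \<O> (gran \<G> \<delta>))" "c \<delta> \<in> carrier (stalk \<O> (gran \<G> \<delta>))" if "\<delta> \<in> isotropy \<G> x" for \<delta>
    using skew_closed[OF x b that] skew_closed[OF x c that] that by (simp_all add: isotropy_iff)
  have eq: "b \<otimes>\<^bsub>skew_group_ring \<G> \<O> x\<^esub> c = support_sum (sum_group (isotropy \<G> x) ?A) (\<lambda>p. single (isotropy \<G> x) ?A (?k p) (?v p)) ?P"
    by (simp add: skew_simps skew_mult_def skew_single_def skew_group_def case_prod_unfold)
  have k: "?k p \<in> isotropy \<G> x" if "p \<in> ?P" for p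
    using that by (auto simp: isotropy_iff gmult_arrow gdom_gmult gran_gmult)
  have v: "?v p \<in> carrier (?A (?k p))" if p: "p \<in> ?P" for p
  proof -
    obtain \<beta> \<delta> where "p = (\<beta>, \<delta>)" "\<beta> \<in> isotropy \<G> x" "\<delta> \<in> isotropy \<G> x" using p by auto
    then show ?thesis
      using composable_term_closed(1)[of b \<beta> c \<delta>] bc by (simp add: isotropy_iff)
  qed
  have "{p \<in> ?P. ?v p \<noteq> \<one>\<^bsub>?A (?k p)\<^esub>} \<subseteq> {\<gamma> \<in> isotropy \<G> x. b \<gamma> \<noteq> \<zero>\<langle>x\<rangle>} \<times> {\<delta> \<in> isotropy \<G> x. c \<delta> \<noteq> \<zero>\<langle>x\<rangle>}"
  proof
    fix p assume "p \<in> {p \<in> ?P. ?v p \<noteq> \<one>\<^bsub>?A (?k p)\<^esub>}"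
    then obtain \<beta> \<delta> where p: "p = (\<beta>, \<delta>)" "\<beta> \<in> isotropy \<G> x" "\<delta> \<in> isotropy \<G> x" "?v (\<beta>, \<delta>) \<noteq> \<zero>\<langle>x\<rangle>"
      by auto
    then have "b \<beta> \<noteq> \<zero>\<langle>x\<rangle> \<and> c \<delta> \<noteq> \<zero>\<langle>x\<rangle>"
      using composable_term_closed(2)[of b \<beta> c \<delta>] bc by (auto simp: isotropy_iff)
    then show "p \<in> {\<gamma> \<in> isotropy \<G> x. b \<gamma> \<noteq> \<zero>\<langle>x\<rangle>} \<times> {\<delta> \<in> isotropy \<G> x. c \<delta> \<noteq> \<zero>\<langle>x\<rangle>}"
      using p(1-3) by simp
  qed
  then have fin: "finite {p \<in> ?P. ?v p \<noteq> \<one>\<^bsub>?A (?k p)\<^esub>}"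
    using b c by (elim finite_subset) (auto simp: carrier_skew[OF x])
  have comm: "comm_group (?A j)" for j using stalk_group[OF x] .
  have "b \<otimes>\<^bsub>skew_group_ring \<G> \<O> x\<^esub> c \<in> carrier (sum_group (isotropy \<G> x) ?A)"
    unfolding eq by (rule support_sum_single(1)[OF comm k v fin])
  then show "b \<otimes>\<^bsub>skew_group_ring \<G> \<O> x\<^esub> c \<in> carrier (skew_group_ring \<G> \<O> x)"
    by (simp add: skew_group_ring_def ring_on_def skew_group_def)
  assume \<eta>: "\<eta> \<in> isotropy \<G> x"
  have "(b \<otimes>\<^bsub>skew_group_ring \<G> \<O> x\<^esub> c) \<eta> = support_sum (?A \<eta>) ?v {p \<in> ?P. ?k p = \<eta>}"
    unfolding eq by (rule support_sum_single(2)[OF comm k v fin \<eta>])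
  also have "\<dots> = convolution \<G> \<O> (extend_zero (isotropy \<G> x) b) (extend_zero (isotropy \<G> x) c) \<eta>"
  proof (rule support_sum_convolution[OF extend_skew_section[OF x b] extend_skew_section[OF x c]])
    fix \<beta> \<rho> assume *: "\<beta> \<in> arrows \<G>" "\<rho> \<in> arrows \<G>" "gdom \<G> \<beta> = gran \<G> \<rho>" "\<beta> \<cdot> \<rho> = \<eta>"
      "(\<beta>, \<rho>) \<notin> {p \<in> ?P. ?k p = \<eta>}"
    then have "\<beta> \<notin> isotropy \<G> x \<or> \<rho> \<notin> isotropy \<G> x" by simp
    then show "extend_zero (isotropy \<G> x) b \<beta> = \<zero>\<langle>gran \<G> \<beta>\<rangle> \<or> extend_zero (isotropy \<G> x) c \<rho> = \<zero>\<langle>gran \<G> \<rho>\<rangle>"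
      using * by (auto simp: extend_zero_def)
  next
    fix \<beta> \<rho> assume "(\<beta>, \<rho>) \<in> {p \<in> ?P. ?k p = \<eta>}"
    then show "?v (\<beta>, \<rho>) = extend_zero (isotropy \<G> x) b \<beta> \<otimes>\<^bsub>stalk \<O> (gran \<G> \<beta>)\<^esub> act \<beta> (extend_zero (isotropy \<G> x) c \<rho>)"
      by (simp add: extend_zero_def isotropy_iff)
  qed (use \<eta> in \<open>auto simp: isotropy_iff\<close>)
  finally show "(b \<otimes>\<^bsub>skew_group_ring \<G> \<O> x\<^esub> c) \<eta> =
    convolution \<G> \<O> (extend_zero (isotropy \<G> x) b) (extend_zero (isotropy \<G> x) c) \<eta>" .
qed

end

section \<open>Modules over the convolution ring\<close>

context ample_ring_sheaf
begin

text \<open>The value at \<eta> sees only the row of the left factor, and of the right factor only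
  the values that meet a nonzero entry of that row. Sections known on a single row or column can
  therefore be exchanged.\<close>

lemma convolution_cong:
  assumes f: "f \<in> carrier (arrow_sections \<G> \<O>)" "f' \<in> carrier (arrow_sections \<G> \<O>)"
    and g: "g \<in> carrier (arrow_sections \<G> \<O>)" "g' \<in> carrier (arrow_sections \<G> \<O>)" and \<eta>: "\<eta> \<in> arrows \<G>"
    and fin: "finite {\<beta> \<in> arrows \<G>. gran \<G> \<beta> = gran \<G> \<eta> \<and> f \<beta> \<noteq> \<zero>\<langle>gran \<G> \<eta>\<rangle>}"
    and ff: "\<And>\<beta>. \<lbrakk>\<beta> \<in> arrows \<G>; gran \<G> \<beta> = gran \<G> \<eta>\<rbrakk> \<Longrightarrow> f \<beta> = f' \<beta>"
    and gg: "\<And>\<beta>. \<lbrakk>\<beta> \<in> arrows \<G>; gran \<G> \<beta> = gran \<G> \<eta>; f \<beta> \<noteq> \<zero>\<langle>gran \<G> \<eta>\<rangle>\<rbrakk> \<Longrightarrow> g (\<beta>\<^sup>- \<cdot> \<eta>) = g' (\<beta>\<^sup>- \<cdot> \<eta>)"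
  shows "convolution \<G> \<O> f g \<eta> = convolution \<G> \<O> f' g' \<eta>"
proof -
  interpret ring "stalk \<O> (gran \<G> \<eta>)" using ring_stalk gran_units \<eta> by blast
  let ?S = "{\<beta> \<in> arrows \<G>. gran \<G> \<beta> = gran \<G> \<eta> \<and> f \<beta> \<noteq> \<zero>\<langle>gran \<G> \<eta>\<rangle>}"
  have "convolution \<G> \<O> f g \<eta> = (\<Oplus>\<^bsub>stalk \<O> (gran \<G> \<eta>)\<^esub>\<beta>\<in>?S. conv_term f g \<eta> \<beta>)"
    by (rule convolution_row_finite[OF f(1) g(1) \<eta> fin]) auto
  also have "\<dots> = (\<Oplus>\<^bsub>stalk \<O> (gran \<G> \<eta>)\<^esub>\<beta>\<in>?S. conv_term f' g' \<eta> \<beta>)"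
    using conv_term_section_closed[OF f(2) g(2) \<eta>] ff gg by (intro finsum_cong') (auto simp: conv_term_def)
  also have "\<dots> = convolution \<G> \<O> f' g' \<eta>"
    using ff by (intro convolution_row_finite[OF f(2) g(2) \<eta> fin, symmetric]) auto
  finally show ?thesis .
qed

lemma Gamma_row_fin:
  "\<lbrakk>f \<in> carrier \<Gamma>; x \<in> units \<G>\<rbrakk> \<Longrightarrow> finite {\<beta> \<in> arrows \<G>. gran \<G> \<beta> = x \<and> f \<beta> \<noteq> \<zero>\<langle>x\<rangle>}"
  using Gamma_row_finite by (simp add: row_finite_def)

lemma units_compact_open:
  assumes "x \<in> units \<G>"
  obtains K where "compact_open_units K" "x \<in> K"
  using compact_open_units_basis[OF openin_topspace] assms topspace_unit_space by metis

text \<open>The elements of \<Gamma> that can stand for an element of the skew group ring at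
  \<open>x\<close>. Entries elsewhere in row \<open>x\<close> would import germs from other units of
  the orbit.\<close>

definition isotropy_row :: "'g \<Rightarrow> ('g \<Rightarrow> 'e) \<Rightarrow> bool" where
  "isotropy_row x f \<longleftrightarrow> f \<in> carrier \<Gamma> \<and> (\<forall>\<gamma>\<in>arrows \<G>. gran \<G> \<gamma> = x \<and> gdom \<G> \<gamma> \<noteq> x \<longrightarrow> f \<gamma> = \<zero>\<langle>x\<rangle>)"

lemma isotropy_row_cong:
  assumes "isotropy_row x f" "isotropy_row x g" "\<And>\<delta>. \<delta> \<in> isotropy \<G> x \<Longrightarrow> f \<delta> = g \<delta>"
    "\<gamma> \<in> arrows \<G>" "gran \<G> \<gamma> = x"
  shows "f \<gamma> = g \<gamma>"
  using assms unfolding isotropy_row_def isotropy_iff by metis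

lemma isotropy_row_add:
  assumes "x \<in> units \<G>" "isotropy_row x f" "isotropy_row x g"
  shows "isotropy_row x (f \<oplus>\<^bsub>\<Gamma>\<^esub> g)"
proof -
  interpret ring "stalk \<O> x" using ring_stalk assms(1) .
  show ?thesis
    using assms(2,3) by (auto simp: isotropy_row_def Gamma_add_apply Gamma_add_closed)
qed

lemma isotropy_row_mult:
  assumes "isotropy_row x f" "isotropy_row x g"
  shows "isotropy_row x (f \<otimes>\<^bsub>\<Gamma>\<^esub> g)"
proof -
  have fg: "f \<in> carrier \<Gamma>" "g \<in> carrier \<Gamma>" using assms by (auto simp: isotropy_row_def)
  have "convolution \<G> \<O> f g \<gamma> = \<zero>\<langle>gran \<G> \<gamma>\<rangle>" if \<gamma>: "\<gamma> \<in> arrows \<G>" "gran \<G> \<gamma> = x" "gdom \<G> \<gamma> \<noteq> x" for \<gamma>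
  proof (rule convolution_zero[OF Gamma_section Gamma_section, OF fg \<gamma>(1)])
    fix \<beta> assume \<beta>: "\<beta> \<in> arrows \<G>" "gran \<G> \<beta> = gran \<G> \<gamma>"
    then show "f \<beta> = \<zero>\<langle>gran \<G> \<beta>\<rangle> \<or> g (\<beta>\<^sup>- \<cdot> \<gamma>) = \<zero>\<langle>gdom \<G> \<beta>\<rangle>"
      using ginv_gmult_row[OF \<beta>(1) \<gamma>(1) \<beta>(2)] assms \<gamma> by (cases "gdom \<G> \<beta> = x") (auto simp: isotropy_row_def)
  qed
  then show ?thesis
    using Gamma_mult_closed[OF fg] by (auto simp: isotropy_row_def Gamma_simps(3))
qed

lemma isotropy_row_idem:
  assumes "compact_open_units K"
  shows "isotropy_row x (idem K)"
  using Gamma_idem[OF assms] compact_open_units_subset[OF assms] gran_unit gdom_unit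
  by (auto simp: isotropy_row_def idem_def subset_iff)

text \<open>A nonzero summand at the isotropy arrow \<delta> needs a nonzero entry of
  \<open>f\<close>, hence an isotropy arrow \<beta>, and then
  \<open>\<beta>\<^sup>- \<cdot> \<delta>\<close> is isotropy as well.\<close>

lemma isotropy_row_mult_apply:
  assumes x: "x \<in> units \<G>" and f: "isotropy_row x f" and g: "isotropy_row x g"
    and b: "b \<in> carrier (skew_group_ring \<G> \<O> x)" and c: "c \<in> carrier (skew_group_ring \<G> \<O> x)"
    and fb: "\<forall>\<delta>\<in>isotropy \<G> x. f \<delta> = b \<delta>" and gc: "\<forall>\<delta>\<in>isotropy \<G> x. g \<delta> = c \<delta>"
    and \<delta>: "\<delta> \<in> isotropy \<G> x"
  shows "(f \<otimes>\<^bsub>\<Gamma>\<^esub> g) \<delta> = (b \<otimes>\<^bsub>skew_group_ring \<G> \<O> x\<^esub> c) \<delta>"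
proof -
  have \<delta>': "\<delta> \<in> arrows \<G>" "gran \<G> \<delta> = x" "gdom \<G> \<delta> = x" using \<delta> by (auto simp: isotropy_iff)
  have fg: "f \<in> carrier \<Gamma>" "g \<in> carrier \<Gamma>" using f g by (auto simp: isotropy_row_def)
  have "convolution \<G> \<O> f g \<delta> = convolution \<G> \<O> (extend_zero (isotropy \<G> x) b) (extend_zero (isotropy \<G> x) c) \<delta>"
  proof (rule convolution_cong[OF _ _ _ _ \<delta>'(1)])
    show "finite {\<beta> \<in> arrows \<G>. gran \<G> \<beta> = gran \<G> \<delta> \<and> f \<beta> \<noteq> \<zero>\<langle>gran \<G> \<delta>\<rangle>}"
      using Gamma_row_fin[OF fg(1) x] \<delta>' by simp
    fix \<beta> assume \<beta>: "\<beta> \<in> arrows \<G>" "gran \<G> \<beta> = gran \<G> \<delta>"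
    then show "f \<beta> = extend_zero (isotropy \<G> x) b \<beta>"
      using f fb \<delta>' by (auto simp: extend_zero_def isotropy_row_def isotropy_iff)
    assume "f \<beta> \<noteq> \<zero>\<langle>gran \<G> \<delta>\<rangle>"
    then have "gdom \<G> \<beta> = x" using f \<beta> \<delta>' by (auto simp: isotropy_row_def)
    then show "g (\<beta>\<^sup>- \<cdot> \<delta>) = extend_zero (isotropy \<G> x) c (\<beta>\<^sup>- \<cdot> \<delta>)"
      using ginv_gmult_row[OF \<beta>(1) \<delta>'(1) \<beta>(2)] gc \<delta>' by (auto simp: extend_zero_def isotropy_iff)
  qed (use fg Gamma_section extend_skew_section x b c in auto)
  then show ?thesis
    using skew_mult_convolution(2)[OF x b c \<delta>] by (simp add: Gamma_simps(3))
qed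

text \<open>Through each of the finitely many nonzero entries of \<open>l\<close> passes an
  elementary section that vanishes on the rest of column \<open>x\<close>. The sum of these is the
  lift; its other columns are uncontrolled.\<close>

lemma Gamma_column_lift:
  assumes l: "l \<in> carrier (L_group \<G> \<O> x)"
  obtains g where "g \<in> carrier \<Gamma>" "\<And>\<gamma>. \<gamma> \<in> gdom_fiber \<G> x \<Longrightarrow> g \<gamma> = l \<gamma>"
proof -
  have "\<exists>g\<in>carrier \<Gamma>. \<forall>\<gamma>\<in>gdom_fiber \<G> x. g \<gamma> = (if \<gamma> \<in> T then l \<gamma> else \<zero>\<langle>gran \<G> \<gamma>\<rangle>)"
    if "finite T" "T \<subseteq> gdom_fiber \<G> x" for T
    using that
  proof (induction T)
    case empty
    show ?case
      using Gamma_zero_closed by (intro bexI[of _ "\<zero>\<^bsub>\<Gamma>\<^esub>"]) (auto simp: Gamma_zero_apply gdom_fiber_iff)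
  next
    case (insert \<tau> T)
    then obtain g where g: "g \<in> carrier \<Gamma>" "\<forall>\<gamma>\<in>gdom_fiber \<G> x. g \<gamma> = (if \<gamma> \<in> T then l \<gamma> else \<zero>\<langle>gran \<G> \<gamma>\<rangle>)"
      by auto
    have \<tau>: "\<tau> \<in> arrows \<G>" "gdom \<G> \<tau> = x" "l \<tau> \<in> carrier (stalk \<O> (gran \<G> \<tau>))"
      using insert.prems L_closed[OF l] by (auto simp: gdom_fiber_iff)
    obtain s where s: "s \<in> elementary_sections \<G> \<O>" "s \<tau> = l \<tau>"
      "\<And>\<eta>. \<lbrakk>\<eta> \<in> arrows \<G>; gran \<G> \<eta> = gran \<G> \<tau> \<or> gdom \<G> \<eta> = gdom \<G> \<tau>; \<eta> \<noteq> \<tau>\<rbrakk> \<Longrightarrow> s \<eta> = \<zero>\<langle>gran \<G> \<eta>\<rangle>"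
      using elementary_section_through[OF \<tau>(1,3)] by metis
    have "(g \<oplus>\<^bsub>\<Gamma>\<^esub> s) \<gamma> = (if \<gamma> \<in> insert \<tau> T then l \<gamma> else \<zero>\<langle>gran \<G> \<gamma>\<rangle>)" if \<gamma>: "\<gamma> \<in> gdom_fiber \<G> x" for \<gamma>
    proof -
      have \<gamma>': "\<gamma> \<in> arrows \<G>" "gdom \<G> \<gamma> = x" using \<gamma> by (auto simp: gdom_fiber_iff)
      interpret ring "stalk \<O> (gran \<G> \<gamma>)" using ring_stalk gran_units \<gamma>'(1) by blast
      show ?thesis
      proof (cases "\<gamma> = \<tau>")
        case True
        then have "g \<gamma> = \<zero>\<langle>gran \<G> \<gamma>\<rangle>" "s \<gamma> = l \<gamma>" "\<gamma> \<in> insert \<tau> T" using g(2) \<gamma> insert.hyps(2) s(2) by simp_all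
        then show ?thesis using L_closed[OF l \<gamma>] \<gamma>'(1) by (simp only: Gamma_add_apply) simp
      next
        case False
        then have "s \<gamma> = \<zero>\<langle>gran \<G> \<gamma>\<rangle>" using s(3) \<gamma>' \<tau>(2) by simp
        then show ?thesis using False g(2) \<gamma> L_closed[OF l \<gamma>] \<gamma>'(1) by (simp add: Gamma_add_apply)
      qed
    qed
    then show ?case
      using Gamma_add_closed[OF g(1) Gamma_elementary[OF s(1)]] by blast
  qed
  from this[of "{\<gamma> \<in> gdom_fiber \<G> x. l \<gamma> \<noteq> \<zero>\<langle>gran \<G> \<gamma>\<rangle>}"] obtain g where
    "g \<in> carrier \<Gamma>" "\<forall>\<gamma>\<in>gdom_fiber \<G> x. g \<gamma> = (if \<gamma> \<in> {\<gamma> \<in> gdom_fiber \<G> x. l \<gamma> \<noteq> \<zero>\<langle>gran \<G> \<gamma>\<rangle>} then l \<gamma> else \<zero>\<langle>gran \<G> \<gamma>\<rangle>)"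
    using l by (auto simp: carrier_L_group)
  then show thesis
    using that by (metis (mono_tags, lifting) mem_Collect_eq)
qed

text \<open>First \<open>b\<close> is lifted as a vector in column \<open>x\<close>. Multiplying by
  a small \<open>idem K\<close> on the right keeps that column and removes all other nonzero entries
  of row \<open>x\<close>.\<close>

lemma isotropy_row_lift:
  assumes x: "x \<in> units \<G>" and b: "b \<in> carrier (skew_group_ring \<G> \<O> x)"
  obtains f where "isotropy_row x f" "\<forall>\<delta>\<in>isotropy \<G> x. f \<delta> = b \<delta>"
proof -
  define l where "l = (\<lambda>\<gamma>\<in>gdom_fiber \<G> x. if \<gamma> \<in> isotropy \<G> x then b \<gamma> else \<zero>\<langle>gran \<G> \<gamma>\<rangle>)"
  have "{\<gamma> \<in> gdom_fiber \<G> x. l \<gamma> \<noteq> \<zero>\<langle>gran \<G> \<gamma>\<rangle>} \<subseteq> {\<delta> \<in> isotropy \<G> x. b \<delta> \<noteq> \<zero>\<langle>x\<rangle>}"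
    by (auto simp: l_def isotropy_iff)
  then have "finite {\<gamma> \<in> gdom_fiber \<G> x. l \<gamma> \<noteq> \<zero>\<langle>gran \<G> \<gamma>\<rangle>}"
    using b finite_subset by (auto simp: carrier_skew[OF x])
  moreover have "l \<gamma> \<in> carrier (stalk \<O> (gran \<G> \<gamma>))" if "\<gamma> \<in> gdom_fiber \<G> x" for \<gamma>
    using that skew_closed[OF x b, of \<gamma>] stalk_zero_closed[OF gran_units, of \<gamma>]
    by (auto simp: l_def isotropy_iff gdom_fiber_iff)
  ultimately have "l \<in> carrier (L_group \<G> \<O> x)"
    unfolding carrier_L_group by (auto simp: l_def)
  then obtain g where g: "g \<in> carrier \<Gamma>" "\<And>\<gamma>. \<gamma> \<in> gdom_fiber \<G> x \<Longrightarrow> g \<gamma> = l \<gamma>"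
    using Gamma_column_lift by blast
  have "x \<in> topspace (unit_space \<G>)" using x by (simp add: topspace_unit_space)
  then obtain K where K: "compact_open_units K" "x \<in> K"
    "\<And>\<gamma>. \<lbrakk>\<gamma> \<in> arrows \<G>; gran \<G> \<gamma> = x; gdom \<G> \<gamma> \<in> K; gdom \<G> \<gamma> \<noteq> x\<rbrakk> \<Longrightarrow> g \<gamma> = \<zero>\<langle>x\<rangle>"
    using Gamma_row_isolate[OF g(1) x openin_topspace] by metis
  have app: "(g \<otimes>\<^bsub>\<Gamma>\<^esub> idem K) \<gamma> = (if gdom \<G> \<gamma> \<in> K then g \<gamma> else \<zero>\<langle>gran \<G> \<gamma>\<rangle>)" if "\<gamma> \<in> arrows \<G>" for \<gamma>
    using convolution_idem_right[OF compact_open_units_subset[OF K(1)] Gamma_section[OF g(1)] that] by (simp add: Gamma_simps(3))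
  show thesis
  proof
    show "isotropy_row x (g \<otimes>\<^bsub>\<Gamma>\<^esub> idem K)"
      using Gamma_mult_closed[OF g(1) Gamma_idem[OF K(1)]] K(3) by (auto simp: isotropy_row_def app)
    have "(g \<otimes>\<^bsub>\<Gamma>\<^esub> idem K) \<delta> = b \<delta>" if "\<delta> \<in> isotropy \<G> x" for \<delta>
      using that K(2) g(2)[of \<delta>] isotropy_fiber by (auto simp: app isotropy_iff l_def gdom_fiber_iff)
    then show "\<forall>\<delta>\<in>isotropy \<G> x. (g \<otimes>\<^bsub>\<Gamma>\<^esub> idem K) \<delta> = b \<delta>" by blast
  qed
qed

end

section \<open>Germs of a module at a unit\<close>

locale convolution_module = ample_ring_sheaf \<G> \<O> + N: left_module "Gamma_c \<G> \<O>" N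
  for \<G> :: "'g top_groupoid" (structure) and \<O> :: "('g, 'e) ring_gsheaf" and N :: "('g \<Rightarrow> 'e, 'n) module"
begin

abbreviation scalar (infixr "\<star>" 70) where "f \<star> n \<equiv> f \<odot>\<^bsub>N\<^esub> n"

lemma Gamma_mult_smult:
  "\<lbrakk>f \<in> carrier \<Gamma>; g \<in> carrier \<Gamma>; n \<in> carrier N\<rbrakk> \<Longrightarrow> (f \<otimes>\<^bsub>\<Gamma>\<^esub> g) \<star> n = f \<star> g \<star> n"
  by (rule N.smult_assoc)

lemma smult_zero_left:
  assumes "n \<in> carrier N" shows "\<zero>\<^bsub>\<Gamma>\<^esub> \<star> n = \<zero>\<^bsub>N\<^esub>"
proof -
  interpret \<Gamma>: abelian_group \<Gamma> by (rule Gamma_abelian_group)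
  have "\<zero>\<^bsub>\<Gamma>\<^esub> \<star> n \<oplus>\<^bsub>N\<^esub> \<zero>\<^bsub>\<Gamma>\<^esub> \<star> n = \<zero>\<^bsub>\<Gamma>\<^esub> \<star> n"
    using N.smult_l_distr[of "\<zero>\<^bsub>\<Gamma>\<^esub>" "\<zero>\<^bsub>\<Gamma>\<^esub>" n] assms by simp
  then show ?thesis
    using N.smult_closed[OF Gamma_zero_closed assms] N.add.l_cancel_one by blast
qed

lemma smult_zero_right:
  assumes "f \<in> carrier \<Gamma>" shows "f \<star> \<zero>\<^bsub>N\<^esub> = \<zero>\<^bsub>N\<^esub>"
proof -
  have "f \<star> \<zero>\<^bsub>N\<^esub> \<oplus>\<^bsub>N\<^esub> f \<star> \<zero>\<^bsub>N\<^esub> = f \<star> \<zero>\<^bsub>N\<^esub>"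
    using N.smult_r_distr[of f "\<zero>\<^bsub>N\<^esub>" "\<zero>\<^bsub>N\<^esub>"] assms by simp
  then show ?thesis
    using N.smult_closed[OF assms N.zero_closed] N.add.l_cancel_one by blast
qed

lemma smult_neg:
  assumes "f \<in> carrier \<Gamma>" "n \<in> carrier N" shows "f \<star> (\<ominus>\<^bsub>N\<^esub> n) = \<ominus>\<^bsub>N\<^esub> (f \<star> n)"
proof -
  have "f \<star> (\<ominus>\<^bsub>N\<^esub> n) \<oplus>\<^bsub>N\<^esub> f \<star> n = \<zero>\<^bsub>N\<^esub>"
    using N.smult_r_distr[of f "\<ominus>\<^bsub>N\<^esub> n" n] assms smult_zero_right N.l_neg by simp
  then show ?thesis
    using assms N.smult_closed N.minus_equality by simp
qed

text \<open>The germ at \<open>x\<close> of an element of \<open>N\<close>, viewed as a compactly supported section of a sheaf on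
  the unit space, vanishes exactly on this subgroup.\<close>

definition germ_kernel :: "'g \<Rightarrow> 'n set" where
  "germ_kernel x = {n \<in> carrier N. \<exists>K. compact_open_units K \<and> x \<in> K \<and> idem K \<star> n = \<zero>\<^bsub>N\<^esub>}"

lemma idem_smult_idem:
  assumes "compact_open_units K" "compact_open_units L" "n \<in> carrier N"
  shows "idem K \<star> idem L \<star> n = idem (K \<inter> L) \<star> n"
  using Gamma_mult_smult[of "idem K" "idem L" n] Gamma_idem assms idem_mult_idem by simp

lemma idem_smult_mono:
  assumes "compact_open_units K" "compact_open_units L" "L \<subseteq> K" "n \<in> carrier N" "idem K \<star> n = \<zero>\<^bsub>N\<^esub>"
  shows "idem L \<star> n = \<zero>\<^bsub>N\<^esub>"
  using idem_smult_idem[of L K n] assms smult_zero_right Gamma_idem by (simp add: Int_absorb2)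

lemma germ_kernel_carrier: "n \<in> germ_kernel x \<Longrightarrow> n \<in> carrier N"
  by (simp add: germ_kernel_def)

lemma germ_kernelI: "\<lbrakk>n \<in> carrier N; compact_open_units K; x \<in> K; idem K \<star> n = \<zero>\<^bsub>N\<^esub>\<rbrakk> \<Longrightarrow> n \<in> germ_kernel x"
  by (auto simp: germ_kernel_def)

lemma germ_kernelE:
  assumes "n \<in> germ_kernel x"
  obtains K where "compact_open_units K" "x \<in> K" "idem K \<star> n = \<zero>\<^bsub>N\<^esub>"
  using assms by (auto simp: germ_kernel_def)

lemma germ_kernel_zero: "x \<in> units \<G> \<Longrightarrow> \<zero>\<^bsub>N\<^esub> \<in> germ_kernel x"
  using units_compact_open smult_zero_right Gamma_idem germ_kernelI N.zero_closed by metis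

lemma germ_kernel_add:
  assumes "m \<in> germ_kernel x" "n \<in> germ_kernel x"
  shows "m \<oplus>\<^bsub>N\<^esub> n \<in> germ_kernel x"
proof -
  have c: "m \<in> carrier N" "n \<in> carrier N" using assms germ_kernel_carrier by auto
  obtain K L where K: "compact_open_units K" "x \<in> K" "idem K \<star> m = \<zero>\<^bsub>N\<^esub>"
    and L: "compact_open_units L" "x \<in> L" "idem L \<star> n = \<zero>\<^bsub>N\<^esub>"
    using assms germ_kernelE by metis
  have KL: "compact_open_units (K \<inter> L)" using compact_open_units_Int K L by blast
  have "idem (K \<inter> L) \<star> m = \<zero>\<^bsub>N\<^esub>" "idem (K \<inter> L) \<star> n = \<zero>\<^bsub>N\<^esub>"
    using idem_smult_mono[OF K(1) KL _ c(1) K(3)] idem_smult_mono[OF L(1) KL _ c(2) L(3)] by auto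
  then have "idem (K \<inter> L) \<star> (m \<oplus>\<^bsub>N\<^esub> n) = \<zero>\<^bsub>N\<^esub>"
    using N.smult_r_distr[OF Gamma_idem[OF KL] c] by simp
  then show ?thesis
    using c K(2) L(2) KL by (intro germ_kernelI[OF _ KL]) auto
qed

lemma germ_kernel_neg:
  assumes "n \<in> germ_kernel x"
  shows "\<ominus>\<^bsub>N\<^esub> n \<in> germ_kernel x"
proof -
  obtain K where K: "compact_open_units K" "x \<in> K" "idem K \<star> n = \<zero>\<^bsub>N\<^esub>"
    using germ_kernelE[OF assms] .
  have "idem K \<star> (\<ominus>\<^bsub>N\<^esub> n) = \<ominus>\<^bsub>N\<^esub> \<zero>\<^bsub>N\<^esub>"
    using smult_neg[OF Gamma_idem[OF K(1)] germ_kernel_carrier[OF assms]] K(3) by simp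
  then show ?thesis
    using germ_kernel_carrier[OF assms] K N.add.inv_one by (intro germ_kernelI) (auto simp: a_inv_def)
qed

lemma germ_kernel_subgroup:
  assumes "x \<in> units \<G>"
  shows "subgroup (germ_kernel x) (add_monoid N)"
  by (rule N.add.subgroupI)
    (use germ_kernel_carrier germ_kernel_zero[OF assms] germ_kernel_add germ_kernel_neg in
      \<open>auto simp: a_inv_def[symmetric]\<close>)

text \<open>Vanishing on row \<open>x\<close> spreads to all rows over some \<open>K\<close> around
  \<open>x\<close>, so \<open>idem K\<close> annihilates \<open>f\<close> from the left. Hence the
  germ of \<open>f n\<close> at \<open>x\<close> depends on row \<open>x\<close> of \<open>f\<close>
  alone.\<close>

lemma germ_kernel_zero_row:
  assumes f: "f \<in> carrier \<Gamma>" and x: "x \<in> units \<G>" and n: "n \<in> carrier N"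
    and zero: "\<And>\<gamma>. \<lbrakk>\<gamma> \<in> arrows \<G>; gran \<G> \<gamma> = x\<rbrakk> \<Longrightarrow> f \<gamma> = \<zero>\<langle>x\<rangle>"
  shows "f \<star> n \<in> germ_kernel x"
proof -
  obtain K where K: "compact_open_units K" "x \<in> K" "\<And>\<gamma>. \<lbrakk>\<gamma> \<in> arrows \<G>; gran \<G> \<gamma> \<in> K\<rbrakk> \<Longrightarrow> f \<gamma> = \<zero>\<langle>gran \<G> \<gamma>\<rangle>"
    using Gamma_zero_near_row[OF f x zero] by metis
  have "idem K \<otimes>\<^bsub>\<Gamma>\<^esub> f = \<zero>\<^bsub>\<Gamma>\<^esub>"
  proof (rule section_eqI)
    show "(idem K \<otimes>\<^bsub>\<Gamma>\<^esub> f) \<gamma> = \<zero>\<^bsub>\<Gamma>\<^esub> \<gamma>" if "\<gamma> \<in> arrows \<G>" for \<gamma>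
      using convolution_idem_left[OF compact_open_units_subset[OF K(1)] Gamma_section[OF f] that] K(3)[OF that] that
      by (simp add: Gamma_simps(3) Gamma_zero_apply)
  qed (use Gamma_section Gamma_mult_closed Gamma_idem K f Gamma_zero_closed in auto)
  then have "idem K \<star> f \<star> n = \<zero>\<^bsub>N\<^esub>"
    using Gamma_mult_smult[OF Gamma_idem[OF K(1)] f n] smult_zero_left[OF n] by simp
  then show ?thesis
    using K N.smult_closed[OF f n] by (intro germ_kernelI)
qed

text \<open>The difference of \<open>f\<close> and \<open>g\<close> falls under the previous case.
  Exhibiting the correction \<open>k\<close> matches the form of equality of cosets.\<close>

lemma germ_kernel_row_diff:
  assumes f: "f \<in> carrier \<Gamma>" and g: "g \<in> carrier \<Gamma>" and x: "x \<in> units \<G>" and n: "n \<in> carrier N"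
    and eq: "\<And>\<gamma>. \<lbrakk>\<gamma> \<in> arrows \<G>; gran \<G> \<gamma> = x\<rbrakk> \<Longrightarrow> f \<gamma> = g \<gamma>"
  obtains k where "k \<in> germ_kernel x" "f \<star> n = k \<oplus>\<^bsub>N\<^esub> g \<star> n"
proof -
  interpret \<Gamma>: abelian_group \<Gamma> by (rule Gamma_abelian_group)
  have fg: "f \<ominus>\<^bsub>\<Gamma>\<^esub> g \<in> carrier \<Gamma>" "f = (f \<ominus>\<^bsub>\<Gamma>\<^esub> g) \<oplus>\<^bsub>\<Gamma>\<^esub> g"
    using f g by (simp_all add: \<Gamma>.minus_eq \<Gamma>.a_assoc \<Gamma>.l_neg)
  have "(f \<ominus>\<^bsub>\<Gamma>\<^esub> g) \<gamma> = \<zero>\<langle>x\<rangle>" if "\<gamma> \<in> arrows \<G>" "gran \<G> \<gamma> = x" for \<gamma>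
  proof -
    interpret ring "stalk \<O> x" using ring_stalk x .
    have c: "(f \<ominus>\<^bsub>\<Gamma>\<^esub> g) \<gamma> \<in> carrier (stalk \<O> x)" "g \<gamma> \<in> carrier (stalk \<O> x)"
      using section_closed[OF Gamma_section that(1)] fg(1) g that(2) by auto
    have "(f \<ominus>\<^bsub>\<Gamma>\<^esub> g) \<gamma> \<oplus>\<^bsub>stalk \<O> x\<^esub> g \<gamma> = g \<gamma>"
      using fg(2) Gamma_add_apply[OF that(1), of "f \<ominus>\<^bsub>\<Gamma>\<^esub> g" g] eq[OF that] that(2) by metis
    then show ?thesis using c add.r_cancel_one by blast
  qed
  then have "(f \<ominus>\<^bsub>\<Gamma>\<^esub> g) \<star> n \<in> germ_kernel x"
    by (rule germ_kernel_zero_row[OF fg(1) x n])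
  moreover have "f \<star> n = (f \<ominus>\<^bsub>\<Gamma>\<^esub> g) \<star> n \<oplus>\<^bsub>N\<^esub> g \<star> n"
    using fg N.smult_l_distr[OF fg(1) g n] by simp
  ultimately show thesis by (rule that)
qed

lemma germ_kernel_row_cong:
  assumes f: "f \<in> carrier \<Gamma>" and g: "g \<in> carrier \<Gamma>" and x: "x \<in> units \<G>" and n: "n \<in> carrier N"
    and eq: "\<And>\<gamma>. \<lbrakk>\<gamma> \<in> arrows \<G>; gran \<G> \<gamma> = x\<rbrakk> \<Longrightarrow> f \<gamma> = g \<gamma>"
    and gn: "g \<star> n \<in> germ_kernel x"
  shows "f \<star> n \<in> germ_kernel x"
proof -
  obtain k where "k \<in> germ_kernel x" "f \<star> n = k \<oplus>\<^bsub>N\<^esub> g \<star> n"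
    using germ_kernel_row_diff[OF assms(1-5)] by blast
  then show ?thesis using gn germ_kernel_add by simp
qed

lemma germ_kernel_idem:
  assumes "compact_open_units K" "x \<in> K" "n \<in> carrier N" "idem K \<star> n \<in> germ_kernel x"
  shows "n \<in> germ_kernel x"
proof -
  obtain L where L: "compact_open_units L" "x \<in> L" "idem L \<star> idem K \<star> n = \<zero>\<^bsub>N\<^esub>"
    using germ_kernelE[OF assms(4)] .
  then show ?thesis
    using idem_smult_idem[OF L(1) assms(1,3)] compact_open_units_Int[OF L(1) assms(1)] assms(2,3)
    by (intro germ_kernelI[of n "L \<inter> K"]) auto
qed

lemma compact_open_units_Union:
  assumes "finite \<U>" "\<And>U. U \<in> \<U> \<Longrightarrow> compact_open_units U"
  shows "compact_open_units (\<Union>\<U>)"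
  using assms by (induction \<U>) (auto simp: compact_open_units_empty compact_open_units_Un)

text \<open>Overlaps are controlled by requiring the hypothesis for all smaller compact open sets, so
  that the cover need not be disjoint.\<close>

lemma smult_idem_Union:
  assumes \<phi>: "\<And>n. n \<in> carrier N \<Longrightarrow> \<phi> n \<in> carrier N"
      "\<And>m n. \<lbrakk>m \<in> carrier N; n \<in> carrier N\<rbrakk> \<Longrightarrow> \<phi> (m \<oplus>\<^bsub>N\<^esub> n) = \<phi> m \<oplus>\<^bsub>N\<^esub> \<phi> n"
    and H: "subgroup H (add_monoid N)" and n: "n \<in> carrier N" and "finite \<U>"
    and "\<And>U. U \<in> \<U> \<Longrightarrow> compact_open_units U"
    and "\<And>U V. \<lbrakk>U \<in> \<U>; compact_open_units V; V \<subseteq> U\<rbrakk> \<Longrightarrow> \<phi> (idem V \<star> n) \<in> H"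
    and "compact_open_units V" "V \<subseteq> \<Union>\<U>"
  shows "\<phi> (idem V \<star> n) \<in> H"
  using assms(5-)
proof (induction \<U> arbitrary: V)
  case empty
  interpret H: subgroup H "add_monoid N" by fact
  have "\<phi> \<zero>\<^bsub>N\<^esub> = \<zero>\<^bsub>N\<^esub>"
    using \<phi>(1)[OF N.zero_closed] \<phi>(2)[OF N.zero_closed N.zero_closed] N.add.l_cancel_one N.zero_closed N.l_zero by metis
  moreover have "idem {} = \<zero>\<^bsub>\<Gamma>\<^esub>"
    using Gamma_section[OF Gamma_idem[OF compact_open_units_empty]] Gamma_section[OF Gamma_zero_closed]
    by (intro section_eqI) (auto simp: idem_def Gamma_zero_apply)
  ultimately show ?case
    using empty H.one_closed smult_zero_left[OF n] by simp
next
  case (insert U \<U>)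
  interpret H: subgroup H "add_monoid N" by fact
  let ?A = "V \<inter> U" and ?B = "V \<inter> \<Union>\<U>"
  have c: "compact_open_units ?A" "compact_open_units ?B" "compact_open_units (?A \<inter> ?B)"
    using insert.prems insert.hyps compact_open_units_Union compact_open_units_Int by auto
  have AB: "?A \<union> ?B = V" using insert.prems by auto
  have nc: "idem W \<star> n \<in> carrier N" if "compact_open_units W" for W
    using N.smult_closed[OF Gamma_idem[OF that] n] .
  \<comment> \<open>Inclusion and exclusion for \<open>V\<close> split by \<open>U\<close> and the
    rest of the cover. The overlap term lies in \<open>H\<close> as well and is subtracted at the
    end, which is why \<open>H\<close> has to be a subgroup.\<close>
  have "\<phi> (idem V \<star> n) \<oplus>\<^bsub>N\<^esub> \<phi> (idem (?A \<inter> ?B) \<star> n) = \<phi> (idem ?A \<star> n) \<oplus>\<^bsub>N\<^esub> \<phi> (idem ?B \<star> n)"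
    using idem_Un_add_Int[OF c(1,2)] \<phi>(2) nc c N.smult_l_distr[OF Gamma_idem Gamma_idem n] insert.prems(3)
    unfolding AB by metis
  moreover have "\<phi> (idem ?A \<star> n) \<in> H" "\<phi> (idem (?A \<inter> ?B) \<star> n) \<in> H"
    using insert.prems(2)[OF insertI1] c by auto
  moreover have "\<phi> (idem ?B \<star> n) \<in> H"
  proof (rule insert.IH)
    show "\<phi> (idem W \<star> n) \<in> H" if "U' \<in> \<U>" "compact_open_units W" "W \<subseteq> U'" for U' W
      using insert.prems(2)[of U'] that by simp
  qed (use insert.prems(1) c(2) in simp_all)
  ultimately have "\<phi> (idem V \<star> n) \<oplus>\<^bsub>N\<^esub> \<phi> (idem (?A \<inter> ?B) \<star> n) \<in> H" "\<phi> (idem (?A \<inter> ?B) \<star> n) \<in> H"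
    using H.m_closed by auto
  moreover have "\<phi> (idem V \<star> n) \<in> carrier N" "\<phi> (idem (?A \<inter> ?B) \<star> n) \<in> carrier N"
    using \<phi>(1) nc c insert.prems(3) by auto
  ultimately have "\<phi> (idem V \<star> n) \<oplus>\<^bsub>N\<^esub> \<phi> (idem (?A \<inter> ?B) \<star> n) \<oplus>\<^bsub>N\<^esub> (\<ominus>\<^bsub>N\<^esub> \<phi> (idem (?A \<inter> ?B) \<star> n)) \<in> H"
    using H.m_closed H.m_inv_closed by (auto simp: a_inv_def)
  then show ?case
    using \<open>\<phi> (idem V \<star> n) \<in> carrier N\<close> \<open>\<phi> (idem (?A \<inter> ?B) \<star> n) \<in> carrier N\<close>
    by (simp add: N.a_assoc N.r_neg)
qed

lemma trivial_subgroup_add: "subgroup {\<zero>\<^bsub>N\<^esub>} (add_monoid N)"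
  using N.add.triv_subgroup by simp

text \<open>Compactness turns vanishing near each point of \<open>K\<close> into vanishing over a
  finite cover, so \<open>idem K\<close> annihilates \<open>f n\<close>. The form \<open>f n\<close>
  matters: \<open>f\<close> provides a \<open>K\<close> for which \<open>idem K\<close> fixes
  it.\<close>

lemma smult_zero_if_germs_zero:
  assumes f: "f \<in> carrier \<Gamma>" and n: "n \<in> carrier N" and germs: "\<And>x. x \<in> units \<G> \<Longrightarrow> f \<star> n \<in> germ_kernel x"
  shows "f \<star> n = \<zero>\<^bsub>N\<^esub>"
proof -
  obtain K where K: "compact_open_units K" "idem K \<otimes>\<^bsub>\<Gamma>\<^esub> f = f"
    using Gamma_local_unit[OF f] .
  have fn: "f \<star> n \<in> carrier N" using N.smult_closed[OF f n] .
  let ?C = "{U. compact_open_units U \<and> idem U \<star> f \<star> n = \<zero>\<^bsub>N\<^esub>}"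
  have "K \<subseteq> \<Union>?C"
  proof
    fix y assume "y \<in> K"
    then have "f \<star> n \<in> germ_kernel y" using germs compact_open_units_subset[OF K(1)] by blast
    then show "y \<in> \<Union>?C" by (elim germ_kernelE) blast
  qed
  moreover have "\<forall>U\<in>?C. openin (unit_space \<G>) U" "compactin (unit_space \<G>) K"
    using K(1) by (auto simp: compact_open_units_def)
  ultimately obtain \<F> where \<F>: "finite \<F>" "\<F> \<subseteq> ?C" "K \<subseteq> \<Union>\<F>"
    unfolding compactin_def by meson
  have "idem K \<star> f \<star> n \<in> {\<zero>\<^bsub>N\<^esub>}"
  proof (rule smult_idem_Union[where \<phi> = "\<lambda>n. n", OF _ _ trivial_subgroup_add fn \<F>(1) _ _ K(1) \<F>(3)])
    show "idem V \<star> f \<star> n \<in> {\<zero>\<^bsub>N\<^esub>}" if "U \<in> \<F>" "compact_open_units V" "V \<subseteq> U" for U V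
      using idem_smult_mono[of U V "f \<star> n"] that \<F>(2) fn by auto
  qed (use \<F> in auto)
  then show ?thesis
    using Gamma_mult_smult[OF Gamma_idem[OF K(1)] f n] K(2) by simp
qed

text \<open>The nonzero entries of row \<open>x\<close> have finitely many domains, and some compact
  open \<open>V\<close> containing them satisfies \<open>idem V \<star> n = 0\<close>. Cutting
  \<open>f\<close> by \<open>idem V\<close> on the right does not change row
  \<open>x\<close>.\<close>

lemma germ_kernel_smult:
  assumes f: "f \<in> carrier \<Gamma>" and x: "x \<in> units \<G>" and n: "n \<in> carrier N"
    and germs: "\<And>\<beta>. \<lbrakk>\<beta> \<in> arrows \<G>; gran \<G> \<beta> = x; f \<beta> \<noteq> \<zero>\<langle>x\<rangle>\<rbrakk> \<Longrightarrow> n \<in> germ_kernel (gdom \<G> \<beta>)"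
  shows "f \<star> n \<in> germ_kernel x"
proof -
  define D where "D = gdom \<G> ` {\<beta> \<in> arrows \<G>. gran \<G> \<beta> = x \<and> f \<beta> \<noteq> \<zero>\<langle>x\<rangle>}"
  have "\<exists>K. compact_open_units K \<and> y \<in> K \<and> idem K \<star> n = \<zero>\<^bsub>N\<^esub>" if "y \<in> D" for y
    using that germs germ_kernelE unfolding D_def by blast
  then obtain U where U: "\<And>y. y \<in> D \<Longrightarrow> compact_open_units (U y)" "\<And>y. y \<in> D \<Longrightarrow> y \<in> U y"
      "\<And>y. y \<in> D \<Longrightarrow> idem (U y) \<star> n = \<zero>\<^bsub>N\<^esub>"
    by metis
  have fin: "finite (U ` D)" using Gamma_row_fin[OF f x] by (simp add: D_def)
  define V where "V = \<Union>(U ` D)"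
  have V: "compact_open_units V" unfolding V_def using compact_open_units_Union[OF fin] U(1) by auto
  have "idem V \<star> n \<in> {\<zero>\<^bsub>N\<^esub>}"
  proof (rule smult_idem_Union[where \<phi> = "\<lambda>n. n", OF _ _ trivial_subgroup_add n fin _ _ V])
    show "idem W \<star> n \<in> {\<zero>\<^bsub>N\<^esub>}" if "K \<in> U ` D" "compact_open_units W" "W \<subseteq> K" for K W
      using idem_smult_mono[of K W n] that U n by auto
  qed (use U in \<open>auto simp: V_def\<close>)
  then have "(f \<otimes>\<^bsub>\<Gamma>\<^esub> idem V) \<star> n = \<zero>\<^bsub>N\<^esub>"
    using Gamma_mult_smult[OF f Gamma_idem[OF V] n] smult_zero_right[OF f] by simp
  then have "(f \<otimes>\<^bsub>\<Gamma>\<^esub> idem V) \<star> n \<in> germ_kernel x"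
    using germ_kernel_zero[OF x] by simp
  then show ?thesis
  proof (rule germ_kernel_row_cong[OF f Gamma_mult_closed[OF f Gamma_idem[OF V]] x n, rotated])
    fix \<gamma> assume \<gamma>: "\<gamma> \<in> arrows \<G>" "gran \<G> \<gamma> = x"
    have "gdom \<G> \<gamma> \<in> V" if "f \<gamma> \<noteq> \<zero>\<langle>x\<rangle>"
    proof -
      have "gdom \<G> \<gamma> \<in> D" using \<gamma> that by (auto simp: D_def)
      then show ?thesis using U(2) by (auto simp: V_def)
    qed
    then show "f \<gamma> = (f \<otimes>\<^bsub>\<Gamma>\<^esub> idem V) \<gamma>"
      using convolution_idem_right[OF compact_open_units_subset[OF V] Gamma_section[OF f] \<gamma>(1)] \<gamma>(2)
      by (auto simp: Gamma_simps(3))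
  qed
qed

text \<open>Such a row looks only at the germ at \<open>x\<close> itself. This makes the action of
  the skew group ring on germs well defined.\<close>

lemma germ_kernel_isotropy_row:
  assumes "isotropy_row x f" "x \<in> units \<G>" "n \<in> germ_kernel x"
  shows "f \<star> n \<in> germ_kernel x"
  using assms germ_kernel_carrier[OF assms(3)]
  by (intro germ_kernel_smult) (auto simp: isotropy_row_def)

end

section \<open>Sections concentrated at one arrow of a row\<close>

context ample_ring_sheaf
begin

text \<open>A stand-in for the delta at \<beta>, prescribed on the row of \<beta> only. Multiplying
  by it on the left moves row \<open>gdom \<G> \<beta>\<close> to row
  \<open>gran \<G> \<beta>\<close>.\<close>

definition row_delta :: "'g \<Rightarrow> ('g \<Rightarrow> 'e) \<Rightarrow> bool" where
  "row_delta \<beta> h \<longleftrightarrow> h \<in> carrier \<Gamma> \<and> h \<beta> = \<one>\<^bsub>stalk \<O> (gran \<G> \<beta>)\<^esub> \<and>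
     (\<forall>\<gamma>\<in>arrows \<G>. gran \<G> \<gamma> = gran \<G> \<beta> \<and> \<gamma> \<noteq> \<beta> \<longrightarrow> h \<gamma> = \<zero>\<langle>gran \<G> \<beta>\<rangle>)"

lemma row_delta_Gamma: "row_delta \<beta> h \<Longrightarrow> h \<in> carrier \<Gamma>"
  by (simp add: row_delta_def)

lemma row_delta_exists:
  assumes \<beta>: "\<beta> \<in> arrows \<G>"
  obtains h where "row_delta \<beta> h"
proof -
  interpret ring "stalk \<O> (gran \<G> \<beta>)" using ring_stalk gran_units[OF \<beta>] .
  obtain h where "h \<in> elementary_sections \<G> \<O>" "h \<beta> = \<one>\<^bsub>stalk \<O> (gran \<G> \<beta>)\<^esub>"
    "\<And>\<eta>. \<lbrakk>\<eta> \<in> arrows \<G>; gran \<G> \<eta> = gran \<G> \<beta> \<or> gdom \<G> \<eta> = gdom \<G> \<beta>; \<eta> \<noteq> \<beta>\<rbrakk> \<Longrightarrow> h \<eta> = \<zero>\<langle>gran \<G> \<eta>\<rangle>"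
    using elementary_section_through[OF \<beta> one_closed] by metis
  then have "row_delta \<beta> h" using Gamma_elementary by (auto simp: row_delta_def)
  then show thesis by (rule that)
qed

lemma row_delta_mult:
  assumes \<beta>: "\<beta> \<in> arrows \<G>" and h: "row_delta \<beta> h" and k: "k \<in> carrier \<Gamma>"
    and \<gamma>: "\<gamma> \<in> arrows \<G>" "gran \<G> \<gamma> = gran \<G> \<beta>"
  shows "(h \<otimes>\<^bsub>\<Gamma>\<^esub> k) \<gamma> = act \<beta> (k (\<beta>\<^sup>- \<cdot> \<gamma>))"
proof -
  interpret ring "stalk \<O> (gran \<G> \<beta>)" using ring_stalk gran_units[OF \<beta>] .
  note r = ginv_gmult_row[OF \<beta> \<gamma>(1) \<gamma>(2)[symmetric]]
  have "(h \<otimes>\<^bsub>\<Gamma>\<^esub> k) \<gamma> = h \<beta> \<otimes>\<^bsub>stalk \<O> (gran \<G> \<gamma>)\<^esub> act \<beta> (k (\<beta>\<^sup>- \<cdot> \<gamma>))"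
    unfolding Gamma_simps(3)
    by (rule convolution_single[OF Gamma_section[OF row_delta_Gamma[OF h]] Gamma_section[OF k] \<gamma>(1) \<beta> \<gamma>(2)[symmetric]])
      (use h \<gamma>(2) in \<open>auto simp: row_delta_def\<close>)
  also have "\<dots> = \<one>\<^bsub>stalk \<O> (gran \<G> \<beta>)\<^esub> \<otimes>\<^bsub>stalk \<O> (gran \<G> \<beta>)\<^esub> act \<beta> (k (\<beta>\<^sup>- \<cdot> \<gamma>))"
    using h \<gamma>(2) by (simp add: row_delta_def)
  also have "\<dots> = act \<beta> (k (\<beta>\<^sup>- \<cdot> \<gamma>))"
    using act_closed[OF \<beta>] section_closed[OF Gamma_section[OF k] r(1)] r(2) by simp
  finally show ?thesis .
qed

text \<open>Deltas at mutually inverse arrows are inverse to each other on one row. Agreement with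
  an indicator there is enough, because germs at a unit see only its row.\<close>

lemma row_delta_mult_ginv:
  assumes \<tau>: "\<tau> \<in> arrows \<G>" and s: "row_delta \<tau> s" and t: "row_delta (\<tau>\<^sup>-) t"
    and K: "compact_open_units K" "gran \<G> \<tau> \<in> K" and \<eta>: "\<eta> \<in> arrows \<G>" "gran \<G> \<eta> = gran \<G> \<tau>"
  shows "(s \<otimes>\<^bsub>\<Gamma>\<^esub> t) \<eta> = idem K \<eta>"
proof -
  note r = ginv_gmult_row[OF \<tau> \<eta>(1) \<eta>(2)[symmetric]]
  have eq: "(s \<otimes>\<^bsub>\<Gamma>\<^esub> t) \<eta> = act \<tau> (t (\<tau>\<^sup>- \<cdot> \<eta>))"
    using row_delta_mult[OF \<tau> s row_delta_Gamma[OF t] \<eta>] .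
  show ?thesis
  proof (cases "\<eta> = gran \<G> \<tau>")
    case True
    then have "\<tau>\<^sup>- \<cdot> \<eta> = \<tau>\<^sup>-"
      using gmult_unit_right[OF gran_units[OF \<tau>] inv_closed[OF \<tau>]] gdom_inv[OF \<tau>] by simp
    then show ?thesis
      unfolding eq using t act_one[OF \<tau>] True K(2) \<eta> gran_inv[OF \<tau>] by (simp add: idem_def row_delta_def)
  next
    case False
    have "\<tau>\<^sup>- \<cdot> \<eta> \<noteq> \<tau>\<^sup>-"
    proof
      assume "\<tau>\<^sup>- \<cdot> \<eta> = \<tau>\<^sup>-"
      then have "\<tau> \<cdot> \<tau>\<^sup>- = \<eta>" using gmult_ginv_cancel[OF \<tau> \<eta>(1) \<eta>(2)[symmetric]] by simp
      then show False using False by (simp add: gmult_ginv_self)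
    qed
    then have "t (\<tau>\<^sup>- \<cdot> \<eta>) = \<zero>\<langle>gdom \<G> \<tau>\<rangle>"
      using t r gran_inv[OF \<tau>] by (simp add: row_delta_def)
    moreover have "\<eta> \<notin> K"
      using False \<eta>(2) gran_unit compact_open_units_subset[OF K(1)] by auto
    ultimately show ?thesis
      unfolding eq using act_zero[OF \<tau>] \<eta> by (simp add: idem_def)
  qed
qed

end

context convolution_module
begin

text \<open>Modulo germs \<open>h\<close> is inverted by a delta \<open>s\<close> at \<tau>:
  \<open>s\<close> carries the zero germ of \<open>h n\<close> from the domain of \<tau> to its
  range, where \<open>s * h\<close> acts as an indicator.\<close>

lemma germ_kernel_translate:
  assumes \<tau>: "\<tau> \<in> arrows \<G>" and h: "row_delta (\<tau>\<^sup>-) h" and n: "n \<in> carrier N"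
    and hn: "h \<star> n \<in> germ_kernel (gdom \<G> \<tau>)"
  shows "n \<in> germ_kernel (gran \<G> \<tau>)"
proof -
  have z: "gran \<G> \<tau> \<in> units \<G>" using gran_units[OF \<tau>] .
  obtain s where s: "row_delta \<tau> s" using row_delta_exists[OF \<tau>] .
  obtain K where K: "compact_open_units K" "gran \<G> \<tau> \<in> K" using units_compact_open[OF z] .
  note sG = row_delta_Gamma[OF s] and hG = row_delta_Gamma[OF h]
  have "s \<star> h \<star> n \<in> germ_kernel (gran \<G> \<tau>)"
  proof (rule germ_kernel_smult[OF sG z N.smult_closed[OF hG n]])
    fix \<beta> assume "\<beta> \<in> arrows \<G>" "gran \<G> \<beta> = gran \<G> \<tau>" "s \<beta> \<noteq> \<zero>\<langle>gran \<G> \<tau>\<rangle>"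
    then have "\<beta> = \<tau>" using s by (auto simp: row_delta_def)
    then show "h \<star> n \<in> germ_kernel (gdom \<G> \<beta>)" using hn by simp
  qed
  then have sh: "(s \<otimes>\<^bsub>\<Gamma>\<^esub> h) \<star> n \<in> germ_kernel (gran \<G> \<tau>)"
    using Gamma_mult_smult[OF sG hG n] by simp
  have "idem K \<star> n \<in> germ_kernel (gran \<G> \<tau>)"
    by (rule germ_kernel_row_cong[OF Gamma_idem[OF K(1)] Gamma_mult_closed[OF sG hG] z n _ sh])
      (use row_delta_mult_ginv[OF \<tau> s h K] in simp)
  then show ?thesis
    by (rule germ_kernel_idem[OF K n])
qed

section \<open>The module of germs over the skew group ring\<close>

definition germ :: "'g \<Rightarrow> 'n \<Rightarrow> 'n set" where
  "germ x n = germ_kernel x #>\<^bsub>add_monoid N\<^esub> n"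

definition isotropy_lift :: "'g \<Rightarrow> ('g \<Rightarrow> 'e) \<Rightarrow> 'g \<Rightarrow> 'e" where
  "isotropy_lift x b = (SOME f. isotropy_row x f \<and> (\<forall>\<delta>\<in>isotropy \<G> x. f \<delta> = b \<delta>))"

text \<open>The action chooses a lift of the ring element and a representative of the coset;
  \<open>germ_smult\<close> shows that neither choice matters.\<close>

definition germ_module :: "'g \<Rightarrow> ('g \<Rightarrow> 'e, 'n set) module" where
  "germ_module x = module_on (add_monoid N Mod germ_kernel x)
     (\<lambda>b C. germ x (isotropy_lift x b \<star> (SOME n. n \<in> carrier N \<and> germ x n = C)))"

lemma germ_module_simps:
  "carrier (germ_module x) = germ x ` carrier N"
  "\<zero>\<^bsub>germ_module x\<^esub> = germ_kernel x"
  "C \<oplus>\<^bsub>germ_module x\<^esub> D = C <#>\<^bsub>add_monoid N\<^esub> D"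
  by (auto simp: germ_module_def module_on_def carrier_FactGroup germ_def)

context
  fixes x assumes x: "x \<in> units \<G>"
begin

interpretation gk: normal "germ_kernel x" "add_monoid N"
  using N.add.subgroup_imp_normal[OF germ_kernel_subgroup[OF x]] .

lemma germ_add:
  "\<lbrakk>m \<in> carrier N; n \<in> carrier N\<rbrakk> \<Longrightarrow> germ x m \<oplus>\<^bsub>germ_module x\<^esub> germ x n = germ x (m \<oplus>\<^bsub>N\<^esub> n)"
  using gk.rcos_sum by (simp add: germ_module_simps germ_def)

lemma germ_eq_iff:
  assumes "m \<in> carrier N" "n \<in> carrier N"
  shows "germ x m = germ x n \<longleftrightarrow> (\<exists>k\<in>germ_kernel x. m = k \<oplus>\<^bsub>N\<^esub> n)"
proof
  assume "germ x m = germ x n"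
  then have "m \<in> germ x n"
    using N.add.rcos_self[OF _ germ_kernel_subgroup[OF x]] assms(1) by (metis germ_def)
  then show "\<exists>k\<in>germ_kernel x. m = k \<oplus>\<^bsub>N\<^esub> n"
    by (auto simp: germ_def r_coset_def)
next
  assume "\<exists>k\<in>germ_kernel x. m = k \<oplus>\<^bsub>N\<^esub> n"
  then have "m \<in> germ x n" by (auto simp: germ_def r_coset_def)
  then show "germ x m = germ x n"
    using N.add.repr_independence[OF _ _ germ_kernel_subgroup[OF x], of m n] assms(2) by (simp add: germ_def)
qed

lemma germ_zero: "germ x \<zero>\<^bsub>N\<^esub> = \<zero>\<^bsub>germ_module x\<^esub>"
  using N.add.coset_mult_one[of "germ_kernel x"] germ_kernel_carrier by (simp add: subset_iff germ_def germ_module_simps)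

lemma germ_zero_iff: "n \<in> carrier N \<Longrightarrow> germ x n = \<zero>\<^bsub>germ_module x\<^esub> \<longleftrightarrow> n \<in> germ_kernel x"
  unfolding germ_zero[symmetric] using germ_eq_iff[OF _ N.zero_closed] germ_kernel_carrier by auto

text \<open>Another representative differs by an element of the germ kernel, which isotropy rows
  preserve. Another lift has the same row at \<open>x\<close>, hence the same effect on
  germs.\<close>

lemma germ_smult:
  assumes f: "isotropy_row x f" "\<forall>\<delta>\<in>isotropy \<G> x. f \<delta> = b \<delta>" and n: "n \<in> carrier N"
  shows "b \<odot>\<^bsub>germ_module x\<^esub> germ x n = germ x (f \<star> n)"
proof -
  define f0 where "f0 = isotropy_lift x b"
  have f0: "isotropy_row x f0 \<and> (\<forall>\<delta>\<in>isotropy \<G> x. f0 \<delta> = b \<delta>)"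
    unfolding f0_def isotropy_lift_def by (rule someI[where x = f]) (use f in blast)
  define n0 where "n0 = (SOME m. m \<in> carrier N \<and> germ x m = germ x n)"
  have n0: "n0 \<in> carrier N \<and> germ x n0 = germ x n"
    unfolding n0_def by (rule someI[where x = n]) (use n in blast)
  then obtain k where k: "k \<in> germ_kernel x" "n0 = k \<oplus>\<^bsub>N\<^esub> n"
    using germ_eq_iff n by blast
  have G: "f \<in> carrier \<Gamma>" "f0 \<in> carrier \<Gamma>" using f f0 by (auto simp: isotropy_row_def)
  have "f0 \<star> n0 = f0 \<star> k \<oplus>\<^bsub>N\<^esub> f0 \<star> n"
    unfolding k(2) using N.smult_r_distr[OF G(2) germ_kernel_carrier[OF k(1)] n] .
  moreover have "f0 \<star> k \<in> germ_kernel x"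
    using germ_kernel_isotropy_row f0 x k(1) by blast
  ultimately have "germ x (f0 \<star> n0) = germ x (f0 \<star> n)"
    using germ_eq_iff N.smult_closed[OF G(2)] n0 n by blast
  moreover have "f0 \<gamma> = f \<gamma>" if "\<gamma> \<in> arrows \<G>" "gran \<G> \<gamma> = x" for \<gamma>
    by (rule isotropy_row_cong[OF _ f(1) _ that]) (use f0 f(2) in auto)
  then obtain k' where "k' \<in> germ_kernel x" "f0 \<star> n = k' \<oplus>\<^bsub>N\<^esub> f \<star> n"
    using germ_kernel_row_diff[OF G(2,1) x n] by metis
  then have "germ x (f0 \<star> n) = germ x (f \<star> n)"
    using germ_eq_iff N.smult_closed G n by blast
  ultimately show ?thesis
    by (simp add: germ_module_def module_on_def f0_def n0_def)
qed

text \<open>Sums and products of lifts are lifts of sums and products, so the module laws come from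
  those of \<open>N\<close>. Unitality needs its own argument, since \<Gamma> in general has no
  unit.\<close>

lemma germ_module_unital: "unital_left_module (skew_group_ring \<G> \<O> x) (germ_module x)"
proof -
  interpret M: abelian_group "germ_module x"
  proof (rule abelian_groupI)
    show "\<exists>D\<in>carrier (germ_module x). D \<oplus>\<^bsub>germ_module x\<^esub> C = \<zero>\<^bsub>germ_module x\<^esub>" if C: "C \<in> carrier (germ_module x)" for C
    proof -
      obtain n where n: "n \<in> carrier N" "C = germ x n" using C by (auto simp: germ_module_simps)
      then have "germ x (\<ominus>\<^bsub>N\<^esub> n) \<oplus>\<^bsub>germ_module x\<^esub> C = \<zero>\<^bsub>germ_module x\<^esub>"
        by (simp add: germ_add N.l_neg germ_zero)
      then show ?thesis using n by (auto simp: germ_module_simps(1))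
    qed
    show "\<zero>\<^bsub>germ_module x\<^esub> \<in> carrier (germ_module x)"
      unfolding germ_zero[symmetric] by (simp add: germ_module_simps(1))
  qed (auto simp: germ_module_simps(1) germ_add N.a_ac simp flip: germ_zero)
  show ?thesis
  proof (unfold_locales)
    fix b C assume b: "b \<in> carrier (skew_group_ring \<G> \<O> x)" and "C \<in> carrier (germ_module x)"
    then obtain n where n: "n \<in> carrier N" "C = germ x n" by (auto simp: germ_module_simps)
    obtain f where f: "isotropy_row x f" "\<forall>\<delta>\<in>isotropy \<G> x. f \<delta> = b \<delta>"
      using isotropy_row_lift[OF x b] by blast
    then have fG: "f \<in> carrier \<Gamma>" by (simp add: isotropy_row_def)
    show "b \<odot>\<^bsub>germ_module x\<^esub> C \<in> carrier (germ_module x)"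
      unfolding n(2) germ_smult[OF f n(1)] using N.smult_closed[OF fG n(1)] by (simp add: germ_module_simps(1))
    {
      fix D assume "D \<in> carrier (germ_module x)"
      then obtain m where m: "m \<in> carrier N" "D = germ x m" by (auto simp: germ_module_simps)
      show "b \<odot>\<^bsub>germ_module x\<^esub> (C \<oplus>\<^bsub>germ_module x\<^esub> D) = b \<odot>\<^bsub>germ_module x\<^esub> C \<oplus>\<^bsub>germ_module x\<^esub> b \<odot>\<^bsub>germ_module x\<^esub> D"
        unfolding n(2) m(2) using n m fG N.smult_closed
        by (simp add: germ_add germ_smult[OF f] N.smult_r_distr)
    }
    fix c assume c: "c \<in> carrier (skew_group_ring \<G> \<O> x)"
    obtain g where g: "isotropy_row x g" "\<forall>\<delta>\<in>isotropy \<G> x. g \<delta> = c \<delta>"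
      using isotropy_row_lift[OF x c] by blast
    then have gG: "g \<in> carrier \<Gamma>" by (simp add: isotropy_row_def)
    have "\<forall>\<delta>\<in>isotropy \<G> x. (f \<oplus>\<^bsub>\<Gamma>\<^esub> g) \<delta> = (b \<oplus>\<^bsub>skew_group_ring \<G> \<O> x\<^esub> c) \<delta>"
      using f(2) g(2) by (simp add: skew_simps Gamma_add_apply isotropy_iff)
    from germ_smult[OF isotropy_row_add[OF x f(1) g(1)] this n(1)]
    show "(b \<oplus>\<^bsub>skew_group_ring \<G> \<O> x\<^esub> c) \<odot>\<^bsub>germ_module x\<^esub> C = b \<odot>\<^bsub>germ_module x\<^esub> C \<oplus>\<^bsub>germ_module x\<^esub> c \<odot>\<^bsub>germ_module x\<^esub> C"
      unfolding n(2) germ_smult[OF f n(1)] germ_smult[OF g n(1)]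
      using n fG gG N.smult_closed by (simp add: germ_add N.smult_l_distr)
    have "\<forall>\<delta>\<in>isotropy \<G> x. (f \<otimes>\<^bsub>\<Gamma>\<^esub> g) \<delta> = (b \<otimes>\<^bsub>skew_group_ring \<G> \<O> x\<^esub> c) \<delta>"
      using isotropy_row_mult_apply[OF x f(1) g(1) b c f(2) g(2)] by blast
    from germ_smult[OF isotropy_row_mult[OF f(1) g(1)] this n(1)]
    show "(b \<otimes>\<^bsub>skew_group_ring \<G> \<O> x\<^esub> c) \<odot>\<^bsub>germ_module x\<^esub> C = b \<odot>\<^bsub>germ_module x\<^esub> (c \<odot>\<^bsub>germ_module x\<^esub> C)"
      unfolding n(2) germ_smult[OF g n(1)] germ_smult[OF f N.smult_closed[OF gG n(1)]]
      using n fG gG by (simp add: Gamma_mult_smult)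
  next
    fix C assume "C \<in> carrier (germ_module x)"
    then obtain n where n: "n \<in> carrier N" "C = germ x n" by (auto simp: germ_module_simps)
    obtain K where K: "compact_open_units K" "x \<in> K" using units_compact_open[OF x] .
    have KG: "idem K \<in> carrier \<Gamma>" using Gamma_idem[OF K(1)] .
    have "\<forall>\<delta>\<in>isotropy \<G> x. idem K \<delta> = \<one>\<^bsub>skew_group_ring \<G> \<O> x\<^esub> \<delta>"
      using K(2) compact_open_units_subset[OF K(1)] gran_unit by (auto simp: idem_def skew_simps isotropy_iff)
    from germ_smult[OF isotropy_row_idem[OF K(1)] this n(1)]
    have "\<one>\<^bsub>skew_group_ring \<G> \<O> x\<^esub> \<odot>\<^bsub>germ_module x\<^esub> C = germ x (idem K \<star> n)"
      by (simp add: n(2))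
    moreover have "germ x n = germ x (idem K \<star> n)"
    proof -
      have c: "idem K \<star> n \<in> carrier N" using N.smult_closed[OF KG n(1)] .
      \<comment> \<open>The part of \<open>n\<close> that \<open>idem K\<close> removes is
        annihilated by \<open>idem K\<close>, hence has zero germ at \<open>x\<close>.\<close>
      define k where "k = n \<oplus>\<^bsub>N\<^esub> (\<ominus>\<^bsub>N\<^esub> (idem K \<star> n))"
      have "idem K \<star> idem K \<star> n = idem K \<star> n"
        using idem_smult_idem[OF K(1) K(1) n(1)] by simp
      then have "idem K \<star> k = \<zero>\<^bsub>N\<^esub>"
        unfolding k_def using c n(1) KG by (simp add: N.smult_r_distr smult_neg N.r_neg)
      then have "k \<in> germ_kernel x"
        using K c n(1) by (intro germ_kernelI[of k K]) (auto simp: k_def)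
      moreover have "n = k \<oplus>\<^bsub>N\<^esub> idem K \<star> n"
        unfolding k_def using c n(1) by (simp add: N.a_assoc N.l_neg)
      ultimately show ?thesis using germ_eq_iff[OF n(1) c] by blast
    qed
    ultimately show "\<one>\<^bsub>skew_group_ring \<G> \<O> x\<^esub> \<odot>\<^bsub>germ_module x\<^esub> C = C"
      by (simp add: n(2))
  qed
qed

end

end

section \<open>Tensor products\<close>

locale tensor_data =
  fixes L :: "'l monoid" and ract :: "'l \<Rightarrow> 'b \<Rightarrow> 'l" and B :: "('b, 'x) ring_scheme" and M :: "('b, 'm, 'y) module_scheme"
  assumes L_comm: "comm_group L" and ract_closed: "\<lbrakk>l \<in> carrier L; b \<in> carrier B\<rbrakk> \<Longrightarrow> ract l b \<in> carrier L"
    and M_module: "left_module B M"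
begin

sublocale L: comm_group L by (rule L_comm)
sublocale M: left_module B M by (rule M_module)

abbreviation pairs where "pairs \<equiv> free_Abelian_group (carrier L \<times> carrier M)"
abbreviation relations where "relations \<equiv> tensor_relations L ract B M"

sublocale pairs: comm_group pairs by (rule abelian_free_Abelian_group)

lemma relations_subgroup: "subgroup relations pairs"
  unfolding tensor_relations_def
proof (rule pairs.generate_is_subgroup)
  have k: "frag_of a - frag_of b \<in> carrier pairs"
    if "a \<in> carrier L \<times> carrier M" "b \<in> carrier L \<times> carrier M" for a b
    using keys_diff[of "frag_of a" "frag_of b"] that by auto
  have k3: "frag_of a - frag_of b - frag_of c \<in> carrier pairs"
    if "a \<in> carrier L \<times> carrier M" "b \<in> carrier L \<times> carrier M" "c \<in> carrier L \<times> carrier M" for a b c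
    using keys_diff[of "frag_of a - frag_of b" "frag_of c"] k[OF that(1,2)] that(3) by auto
  show "{frag_of (l \<otimes>\<^bsub>L\<^esub> l', m) - frag_of (l, m) - frag_of (l', m) |l l' m. l \<in> carrier L \<and> l' \<in> carrier L \<and> m \<in> carrier M} \<union>
    {frag_of (l, m \<oplus>\<^bsub>M\<^esub> m') - frag_of (l, m) - frag_of (l, m') |l m m'. l \<in> carrier L \<and> m \<in> carrier M \<and> m' \<in> carrier M} \<union>
    {frag_of (ract l b, m) - frag_of (l, b \<odot>\<^bsub>M\<^esub> m) |l b m. l \<in> carrier L \<and> b \<in> carrier B \<and> m \<in> carrier M} \<subseteq> carrier pairs"
  proof (intro Un_least subsetI)
    fix c assume "c \<in> {frag_of (l \<otimes>\<^bsub>L\<^esub> l', m) - frag_of (l, m) - frag_of (l', m) |l l' m.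
      l \<in> carrier L \<and> l' \<in> carrier L \<and> m \<in> carrier M}"
    then obtain l l' m where "c = frag_of (l \<otimes>\<^bsub>L\<^esub> l', m) - frag_of (l, m) - frag_of (l', m)"
      "l \<in> carrier L" "l' \<in> carrier L" "m \<in> carrier M" by blast
    then show "c \<in> carrier pairs" using k3[of "(l \<otimes>\<^bsub>L\<^esub> l', m)" "(l, m)" "(l', m)"] by simp
  next
    fix c assume "c \<in> {frag_of (l, m \<oplus>\<^bsub>M\<^esub> m') - frag_of (l, m) - frag_of (l, m') |l m m'.
      l \<in> carrier L \<and> m \<in> carrier M \<and> m' \<in> carrier M}"
    then obtain l m m' where "c = frag_of (l, m \<oplus>\<^bsub>M\<^esub> m') - frag_of (l, m) - frag_of (l, m')"
      "l \<in> carrier L" "m \<in> carrier M" "m' \<in> carrier M" by blast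
    then show "c \<in> carrier pairs" using k3[of "(l, m \<oplus>\<^bsub>M\<^esub> m')" "(l, m)" "(l, m')"] by simp
  next
    fix c assume "c \<in> {frag_of (ract l b, m) - frag_of (l, b \<odot>\<^bsub>M\<^esub> m) |l b m.
      l \<in> carrier L \<and> b \<in> carrier B \<and> m \<in> carrier M}"
    then obtain l b m where "c = frag_of (ract l b, m) - frag_of (l, b \<odot>\<^bsub>M\<^esub> m)"
      "l \<in> carrier L" "b \<in> carrier B" "m \<in> carrier M" by blast
    then show "c \<in> carrier pairs"
      using k[of "(ract l b, m)" "(l, b \<odot>\<^bsub>M\<^esub> m)"] ract_closed M.smult_closed by simp
  qed
qed

lemma relations_add: "\<lbrakk>c \<in> relations; d \<in> relations\<rbrakk> \<Longrightarrow> c + d \<in> relations"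
  using subgroup.m_closed[OF relations_subgroup] by simp

lemma relations_zero: "0 \<in> relations"
  using subgroup.one_closed[OF relations_subgroup] by simp

lemma relations_neg:
  assumes "c \<in> relations" shows "- c \<in> relations"
proof -
  have "Poly_Mapping.keys c \<subseteq> carrier L \<times> carrier M"
    using subgroup.mem_carrier[OF relations_subgroup assms] by simp
  then show ?thesis
    using subgroup.m_inv_closed[OF relations_subgroup assms] by simp
qed

lemma relations_diff: "\<lbrakk>c \<in> relations; d \<in> relations\<rbrakk> \<Longrightarrow> c - d \<in> relations"
  using relations_add[of c "- d"] relations_neg[of d] by simp

lemma relations_add_left:
  assumes "l \<in> carrier L" "l' \<in> carrier L" "m \<in> carrier M"
  shows "frag_of (l \<otimes>\<^bsub>L\<^esub> l', m) - frag_of (l, m) - frag_of (l', m) \<in> relations"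
  unfolding tensor_relations_def using assms by (intro generate.incl UnI1) blast

lemma relations_add_right:
  assumes "l \<in> carrier L" "m \<in> carrier M" "m' \<in> carrier M"
  shows "frag_of (l, m \<oplus>\<^bsub>M\<^esub> m') - frag_of (l, m) - frag_of (l, m') \<in> relations"
  unfolding tensor_relations_def using assms by (intro generate.incl UnI1 UnI2) blast

lemma relations_balanced:
  assumes "l \<in> carrier L" "b \<in> carrier B" "m \<in> carrier M"
  shows "frag_of (ract l b, m) - frag_of (l, b \<odot>\<^bsub>M\<^esub> m) \<in> relations"
  unfolding tensor_relations_def using assms by (intro generate.incl UnI2) blast

text \<open>Membership of \<open>frag_of (l, m)\<close> in \<open>relations\<close> says that l
  \<otimes> m is zero; the vanishing of tensors is handled in this form, without passing to
  cosets.\<close>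

lemma frag_add_in_relations:
  assumes "l \<in> carrier L" "l' \<in> carrier L" "m \<in> carrier M"
    "frag_of (l, m) \<in> relations" "frag_of (l', m) \<in> relations"
  shows "frag_of (l \<otimes>\<^bsub>L\<^esub> l', m) \<in> relations"
  using relations_add[OF relations_add[OF relations_add_left[OF assms(1-3)] assms(5)] assms(4)] by simp

lemma frag_zero_left_in_relations:
  assumes "m \<in> carrier M"
  shows "frag_of (\<one>\<^bsub>L\<^esub>, m) \<in> relations"
  using relations_neg[OF relations_add_left[of "\<one>\<^bsub>L\<^esub>" "\<one>\<^bsub>L\<^esub>" m]] assms by simp

lemma frag_zero_right_in_relations:
  assumes "l \<in> carrier L"
  shows "frag_of (l, \<zero>\<^bsub>M\<^esub>) \<in> relations"
  using relations_neg[OF relations_add_right[of l "\<zero>\<^bsub>M\<^esub>" "\<zero>\<^bsub>M\<^esub>"]] assms by simp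

text \<open>Moves \<open>b\<close> across the tensor sign. This is how a coordinate that annihilates
  \<open>m\<close> removes a whole row of a vector.\<close>

lemma frag_ract_in_relations:
  assumes "l \<in> carrier L" "b \<in> carrier B" "m \<in> carrier M" "b \<odot>\<^bsub>M\<^esub> m = \<zero>\<^bsub>M\<^esub>"
  shows "frag_of (ract l b, m) \<in> relations"
  using relations_add[OF relations_balanced[OF assms(1-3)] frag_zero_right_in_relations[OF assms(1)]] assms(4) by simp

text \<open>The universal property of the tensor product, for the map \<open>l \<otimes> m \<mapsto> \<rho> l \<cdot> m\<close> induced by a
  homomorphism \<open>\<rho>\<close> of right modules from \<open>L\<close> to \<open>B\<close>.\<close>

lemma relations_annihilated:
  assumes closed: "\<And>l. l \<in> carrier L \<Longrightarrow> \<rho> l \<in> carrier B"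
    and add: "\<And>l l'. \<lbrakk>l \<in> carrier L; l' \<in> carrier L\<rbrakk> \<Longrightarrow> \<rho> (l \<otimes>\<^bsub>L\<^esub> l') = \<rho> l \<oplus>\<^bsub>B\<^esub> \<rho> l'"
    and mult: "\<And>l b. \<lbrakk>l \<in> carrier L; b \<in> carrier B\<rbrakk> \<Longrightarrow> \<rho> (ract l b) = \<rho> l \<otimes>\<^bsub>B\<^esub> b"
    and l: "l \<in> carrier L" and m: "m \<in> carrier M" and rel: "frag_of (l, m) \<in> relations"
  shows "\<rho> l \<odot>\<^bsub>M\<^esub> m = \<zero>\<^bsub>M\<^esub>"
proof -
  have "(\<lambda>(l, m). \<rho> l \<odot>\<^bsub>M\<^esub> m) ` (carrier L \<times> carrier M) \<subseteq> carrier (add_monoid M)"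
    using closed M.smult_closed by auto
  then obtain h where h: "h \<in> hom pairs (add_monoid M)"
    and hf: "\<And>p. p \<in> carrier L \<times> carrier M \<Longrightarrow> h (frag_of p) = (case p of (l, m) \<Rightarrow> \<rho> l \<odot>\<^bsub>M\<^esub> m)"
    using comm_group.free_Abelian_group_universal[OF M.a_comm_group] by metis
  have hfrag: "h (frag_of (l, m)) = \<rho> l \<odot>\<^bsub>M\<^esub> m" if "l \<in> carrier L" "m \<in> carrier M" for l m
    using hf[of "(l, m)"] that by simp
  interpret h: group_hom pairs "add_monoid M" h
    by (simp add: group_hom_def group_hom_axioms_def h M.a_group)
  have hadd: "h (c + d) = h c \<oplus>\<^bsub>M\<^esub> h d" if "c \<in> carrier pairs" "d \<in> carrier pairs" for c d
    using h.hom_mult[OF that] by simp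
  have hdiff: "h (c - d) = \<zero>\<^bsub>M\<^esub> \<and> c - d \<in> carrier pairs" if "c \<in> carrier pairs" "d \<in> carrier pairs" "h c = h d" for c d
  proof
    show cd: "c - d \<in> carrier pairs"
      using that keys_diff[of c d] by auto
    have "h (c - d) \<oplus>\<^bsub>M\<^esub> h d = h d"
      using hadd[OF cd that(2)] that(3) by simp
    then show "h (c - d) = \<zero>\<^bsub>M\<^esub>"
      using h.hom_closed[OF cd] h.hom_closed[OF that(2)] M.add.r_cancel_one by simp
  qed
  have hdiff3: "h (c - d - e) = \<zero>\<^bsub>M\<^esub> \<and> c - d - e \<in> carrier pairs"
    if "c \<in> carrier pairs" "d \<in> carrier pairs" "e \<in> carrier pairs" "h c = h d \<oplus>\<^bsub>M\<^esub> h e" for c d e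
    using hdiff[of c "d + e"] pairs.m_closed[OF that(2,3)] hadd[OF that(2,3)] that(1,4) by (simp add: diff_diff_eq)
  have "relations \<subseteq> kernel pairs (add_monoid M) h"
    unfolding tensor_relations_def
  proof (intro pairs.generate_subgroup_incl h.subgroup_kernel Un_least subsetI)
    fix c assume "c \<in> {frag_of (l \<otimes>\<^bsub>L\<^esub> l', m) - frag_of (l, m) - frag_of (l', m) |l l' m.
      l \<in> carrier L \<and> l' \<in> carrier L \<and> m \<in> carrier M}"
    then obtain l l' m where c: "c = frag_of (l \<otimes>\<^bsub>L\<^esub> l', m) - frag_of (l, m) - frag_of (l', m)"
      "l \<in> carrier L" "l' \<in> carrier L" "m \<in> carrier M" by blast
    then show "c \<in> kernel pairs (add_monoid M) h"
      unfolding kernel_def using hdiff3[of "frag_of (l \<otimes>\<^bsub>L\<^esub> l', m)" "frag_of (l, m)" "frag_of (l', m)"]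
      by (simp add: hfrag add closed M.smult_l_distr)
  next
    fix c assume "c \<in> {frag_of (l, m \<oplus>\<^bsub>M\<^esub> m') - frag_of (l, m) - frag_of (l, m') |l m m'.
      l \<in> carrier L \<and> m \<in> carrier M \<and> m' \<in> carrier M}"
    then obtain l m m' where c: "c = frag_of (l, m \<oplus>\<^bsub>M\<^esub> m') - frag_of (l, m) - frag_of (l, m')"
      "l \<in> carrier L" "m \<in> carrier M" "m' \<in> carrier M" by blast
    then show "c \<in> kernel pairs (add_monoid M) h"
      unfolding kernel_def using hdiff3[of "frag_of (l, m \<oplus>\<^bsub>M\<^esub> m')" "frag_of (l, m)" "frag_of (l, m')"]
      by (simp add: hfrag closed M.smult_r_distr)
  next
    fix c assume "c \<in> {frag_of (ract l b, m) - frag_of (l, b \<odot>\<^bsub>M\<^esub> m) |l b m.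
      l \<in> carrier L \<and> b \<in> carrier B \<and> m \<in> carrier M}"
    then obtain l b m where c: "c = frag_of (ract l b, m) - frag_of (l, b \<odot>\<^bsub>M\<^esub> m)"
      "l \<in> carrier L" "b \<in> carrier B" "m \<in> carrier M" by blast
    then show "c \<in> kernel pairs (add_monoid M) h"
      unfolding kernel_def using hdiff[of "frag_of (ract l b, m)" "frag_of (l, b \<odot>\<^bsub>M\<^esub> m)"]
      by (simp add: hfrag closed mult ract_closed M.smult_closed M.smult_assoc)
  qed
  then show ?thesis
    using rel hfrag[OF l m] by (auto simp: kernel_def)
qed

text \<open>The pairs generate the tensor product, so that it suffices to follow them through
  \<phi>; this trades cosets for membership in \<open>relations\<close>.\<close>

lemma tensor_map_annihilates_iff:
  assumes \<phi>: "\<And>l. l \<in> carrier L \<Longrightarrow> \<phi> l \<in> carrier L"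
  shows "(\<forall>C\<in>carrier (tensor_product L ract B M). tensor_map L ract B M \<phi> C = \<one>\<^bsub>tensor_product L ract B M\<^esub>)
     \<longleftrightarrow> (\<forall>l\<in>carrier L. \<forall>m\<in>carrier M. frag_of (\<phi> l, m) \<in> relations)"
proof (intro iffI ballI)
  fix l m assume zero: "\<forall>C\<in>carrier (tensor_product L ract B M). tensor_map L ract B M \<phi> C = \<one>\<^bsub>tensor_product L ract B M\<^esub>"
    and lm: "l \<in> carrier L" "m \<in> carrier M"
  let ?c = "frag_of (l, m)" and ?d = "frag_of (\<phi> l, m)"
  have c: "?c \<in> carrier pairs" "?d \<in> carrier pairs" using lm \<phi> by auto
  have "relations #>\<^bsub>pairs\<^esub> ?c \<in> carrier (tensor_product L ract B M)"
    using c(1) by (auto simp: tensor_product_def carrier_FactGroup)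
  then have "tensor_map L ract B M \<phi> (relations #>\<^bsub>pairs\<^esub> ?c) = relations"
    using zero by (simp add: tensor_product_def)
  \<comment> \<open>The representative \<open>?c\<close> contributes the coset of \<open>?d\<close>
    to the union in \<open>tensor_map\<close>; as that union is \<open>relations\<close>, it
    contains \<open>?d\<close>.\<close>
  moreover have "?c \<in> relations #>\<^bsub>pairs\<^esub> ?c" "?d \<in> relations #>\<^bsub>pairs\<^esub> ?d"
    using pairs.rcos_self[OF _ relations_subgroup] c by auto
  ultimately show "?d \<in> relations"
    unfolding tensor_map_def by (force simp del: mult_free_Abelian_group)
next
  fix C assume rel: "\<forall>l\<in>carrier L. \<forall>m\<in>carrier M. frag_of (\<phi> l, m) \<in> relations"
    and C: "C \<in> carrier (tensor_product L ract B M)"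
  then obtain c0 where c0: "c0 \<in> carrier pairs" "C = relations #>\<^bsub>pairs\<^esub> c0"
    by (auto simp: tensor_product_def carrier_FactGroup)
  have CF: "C \<subseteq> carrier pairs"
    unfolding c0(2) using pairs.r_coset_subset_G[OF subgroup.subset[OF relations_subgroup] c0(1)] .
  have "relations #>\<^bsub>pairs\<^esub> frag_extend (\<lambda>(l, m). frag_of (\<phi> l, m)) c = relations" if "c \<in> C" for c
  proof -
    have "Poly_Mapping.keys c \<subseteq> carrier L \<times> carrier M"
      using subsetD[OF CF that] by simp
    \<comment> \<open>Formal sums are built from pairs by differences, and relations are closed
      under differences.\<close>
    then have "frag_extend (\<lambda>(l, m). frag_of (\<phi> l, m)) c \<in> relations"
      by (induction c rule: frag_induction) (use rel in \<open>auto simp: frag_extend_diff relations_zero relations_diff\<close>)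
    then show ?thesis
      using pairs.coset_join2[OF _ relations_subgroup] subgroup.mem_carrier[OF relations_subgroup] by blast
  qed
  moreover have "c0 \<in> C"
    unfolding c0(2) using pairs.rcos_self[OF c0(1) relations_subgroup] .
  ultimately have "tensor_map L ract B M \<phi> C = relations"
    unfolding tensor_map_def by auto
  then show "tensor_map L ract B M \<phi> C = \<one>\<^bsub>tensor_product L ract B M\<^esub>"
    by (simp add: tensor_product_def)
qed

end

section \<open>Induced modules\<close>

context ample_ring_sheaf
begin

text \<open>The coordinate of \<open>l\<close> at the basis element \<open>1\<close> at \<tau>. The
  arrows from \<open>x\<close> with the range of \<tau> are the products \<tau> \<cdot> \<delta>
  with \<delta> isotropy, and an entry \<open>a\<close> at such an arrow is \<open>1\<close> at
  \<tau> times the generator with entry \<open>act (\<tau>\<^sup>-) a\<close> at \<delta>.\<close>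

definition row_part :: "'g \<Rightarrow> 'g \<Rightarrow> ('g \<Rightarrow> 'e) \<Rightarrow> 'g \<Rightarrow> 'e" where
  "row_part x \<tau> l = (\<lambda>\<delta>\<in>isotropy \<G> x. act (\<tau>\<^sup>-) (l (\<tau> \<cdot> \<delta>)))"

lemma gmult_isotropy_fiber:
  assumes "\<tau> \<in> gdom_fiber \<G> x" "\<delta> \<in> isotropy \<G> x"
  shows "\<tau> \<cdot> \<delta> \<in> gdom_fiber \<G> x" "gran \<G> (\<tau> \<cdot> \<delta>) = gran \<G> \<tau>" "\<tau>\<^sup>- \<cdot> (\<tau> \<cdot> \<delta>) = \<delta>"
  using assms by (auto simp: gdom_fiber_iff isotropy_iff gmult_arrow gdom_gmult gran_gmult ginv_gmult_cancel)

lemma row_part_value: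
  assumes "\<tau> \<in> gdom_fiber \<G> x" "\<delta> \<in> isotropy \<G> x" "l \<in> carrier (L_group \<G> \<O> x)"
  shows "l (\<tau> \<cdot> \<delta>) \<in> carrier (stalk \<O> (gdom \<G> (\<tau>\<^sup>-)))" "act (\<tau>\<^sup>-) (l (\<tau> \<cdot> \<delta>)) \<in> carrier (stalk \<O> x)"
proof -
  have \<tau>: "\<tau> \<in> arrows \<G>" "gdom \<G> \<tau> = x" using assms(1) by (auto simp: gdom_fiber_iff)
  show 1: "l (\<tau> \<cdot> \<delta>) \<in> carrier (stalk \<O> (gdom \<G> (\<tau>\<^sup>-)))"
    using L_closed[OF assms(3) gmult_isotropy_fiber(1)[OF assms(1,2)]] gmult_isotropy_fiber(2)[OF assms(1,2)] \<tau>
    by (simp add: gdom_inv)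
  show "act (\<tau>\<^sup>-) (l (\<tau> \<cdot> \<delta>)) \<in> carrier (stalk \<O> x)"
    using act_closed[OF inv_closed[OF \<tau>(1)] 1] \<tau> by (simp add: gran_inv)
qed

text \<open>Left translation by \<tau> is injective, so the finite support is inherited from
  \<open>l\<close>.\<close>

lemma row_part_closed:
  assumes x: "x \<in> units \<G>" and \<tau>: "\<tau> \<in> gdom_fiber \<G> x" and l: "l \<in> carrier (L_group \<G> \<O> x)"
  shows "row_part x \<tau> l \<in> carrier (skew_group_ring \<G> \<O> x)"
proof -
  have \<tau>': "\<tau> \<in> arrows \<G>" "gdom \<G> \<tau> = x" using \<tau> by (auto simp: gdom_fiber_iff)
  have "inj_on (\<lambda>\<delta>. \<tau> \<cdot> \<delta>) {\<delta> \<in> isotropy \<G> x. row_part x \<tau> l \<delta> \<noteq> \<zero>\<langle>x\<rangle>}"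
    by (rule inj_on_inverseI[of _ "\<lambda>\<gamma>. \<tau>\<^sup>- \<cdot> \<gamma>"]) (use gmult_isotropy_fiber(3)[OF \<tau>] in auto)
  moreover have "l (\<tau> \<cdot> \<delta>) \<noteq> \<zero>\<langle>gran \<G> (\<tau> \<cdot> \<delta>)\<rangle>" if "\<delta> \<in> isotropy \<G> x" "row_part x \<tau> l \<delta> \<noteq> \<zero>\<langle>x\<rangle>" for \<delta>
    using that act_zero[OF inv_closed[OF \<tau>'(1)]] gmult_isotropy_fiber(2)[OF \<tau> that(1)] \<tau>'
    by (auto simp: row_part_def gdom_inv gran_inv)
  then have "(\<lambda>\<delta>. \<tau> \<cdot> \<delta>) ` {\<delta> \<in> isotropy \<G> x. row_part x \<tau> l \<delta> \<noteq> \<zero>\<langle>x\<rangle>} \<subseteq> {\<gamma> \<in> gdom_fiber \<G> x. l \<gamma> \<noteq> \<zero>\<langle>gran \<G> \<gamma>\<rangle>}"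
    using gmult_isotropy_fiber(1)[OF \<tau>] by blast
  ultimately have "finite {\<delta> \<in> isotropy \<G> x. row_part x \<tau> l \<delta> \<noteq> \<zero>\<langle>x\<rangle>}"
    using l inj_on_finite by (auto simp: carrier_L_group)
  then show ?thesis
    unfolding carrier_skew[OF x] using row_part_value(2)[OF \<tau> _ l] by (auto simp: row_part_def)
qed

lemma row_part_add:
  assumes \<tau>: "\<tau> \<in> gdom_fiber \<G> x" and l: "l \<in> carrier (L_group \<G> \<O> x)" "l' \<in> carrier (L_group \<G> \<O> x)"
  shows "row_part x \<tau> (l \<otimes>\<^bsub>L_group \<G> \<O> x\<^esub> l') = row_part x \<tau> l \<oplus>\<^bsub>skew_group_ring \<G> \<O> x\<^esub> row_part x \<tau> l'"
proof -
  have \<tau>': "\<tau> \<in> arrows \<G>" "gdom \<G> \<tau> = x" using \<tau> by (auto simp: gdom_fiber_iff)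
  have "act (\<tau>\<^sup>-) ((l \<otimes>\<^bsub>L_group \<G> \<O> x\<^esub> l') (\<tau> \<cdot> \<delta>)) = act (\<tau>\<^sup>-) (l (\<tau> \<cdot> \<delta>)) \<oplus>\<^bsub>stalk \<O> x\<^esub> act (\<tau>\<^sup>-) (l' (\<tau> \<cdot> \<delta>))"
    if \<delta>: "\<delta> \<in> isotropy \<G> x" for \<delta>
    using act_add[OF inv_closed[OF \<tau>'(1)] row_part_value(1)[OF \<tau> \<delta> l(1)] row_part_value(1)[OF \<tau> \<delta> l(2)]] \<tau>'
      gmult_isotropy_fiber[OF \<tau> \<delta>]
    by (simp add: L_group_simps gdom_inv gran_inv)
  then show ?thesis
    by (auto simp: row_part_def skew_simps intro!: restrict_ext)
qed

text \<open>Translation by \<tau> matches the factorisations of \<tau> \<cdot> \<delta> that start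
  in column \<open>x\<close> with the factorisations of \<delta> inside the isotropy group; the ring
  homomorphism \<open>act (\<tau>\<^sup>-)\<close> carries the summands along.\<close>

lemma row_part_mult:
  assumes x: "x \<in> units \<G>" and \<tau>: "\<tau> \<in> gdom_fiber \<G> x" and l: "l \<in> carrier (L_group \<G> \<O> x)"
    and b: "b \<in> carrier (skew_group_ring \<G> \<O> x)"
  shows "row_part x \<tau> (L_right_act \<G> \<O> x l b) = row_part x \<tau> l \<otimes>\<^bsub>skew_group_ring \<G> \<O> x\<^esub> b"
proof -
  let ?l = "extend_zero (gdom_fiber \<G> x) l" and ?r = "extend_zero (isotropy \<G> x) (row_part x \<tau> l)"
    and ?b = "extend_zero (isotropy \<G> x) b"
  note rc = row_part_closed[OF x \<tau> l]
  have \<tau>': "\<tau> \<in> arrows \<G>" "gdom \<G> \<tau> = x" using \<tau> by (auto simp: gdom_fiber_iff)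
  have ls: "?l \<in> carrier (arrow_sections \<G> \<O>)" "?b \<in> carrier (arrow_sections \<G> \<O>)" "?r \<in> carrier (arrow_sections \<G> \<O>)"
    using extend_L_section[OF l] extend_skew_section[OF x b] extend_skew_section[OF x rc] by auto
  have "act (\<tau>\<^sup>-) (L_right_act \<G> \<O> x l b (\<tau> \<cdot> \<delta>)) = (row_part x \<tau> l \<otimes>\<^bsub>skew_group_ring \<G> \<O> x\<^esub> b) \<delta>"
    if \<delta>: "\<delta> \<in> isotropy \<G> x" for \<delta>
  proof -
    interpret ring "stalk \<O> x" using ring_stalk x .
    have \<delta>': "\<delta> \<in> arrows \<G>" "gdom \<G> \<delta> = x" "gran \<G> \<delta> = x" using \<delta> by (auto simp: isotropy_iff)
    let ?\<eta> = "\<tau> \<cdot> \<delta>"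
    have \<eta>: "?\<eta> \<in> arrows \<G>" "gran \<G> ?\<eta> = gran \<G> \<tau>" "gdom \<G> ?\<eta> = x"
      using gmult_isotropy_fiber(1,2)[OF \<tau> \<delta>] by (auto simp: gdom_fiber_iff)
    \<comment> \<open>For \<epsilon> in this set, \<tau> \<cdot> \<epsilon> runs through the nonzero
      entries of \<open>l\<close> in the row of \<tau>.\<close>
    let ?S = "{\<epsilon> \<in> isotropy \<G> x. row_part x \<tau> l \<epsilon> \<noteq> \<zero>\<langle>x\<rangle>}"
    have fin: "finite ?S" using rc by (simp add: carrier_skew[OF x])
    have inj: "inj_on (\<lambda>\<epsilon>. \<tau> \<cdot> \<epsilon>) ?S"
      by (rule inj_on_inverseI[of _ "\<lambda>\<gamma>. \<tau>\<^sup>- \<cdot> \<gamma>"]) (use gmult_isotropy_fiber(3)[OF \<tau>] in auto)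
    have "L_right_act \<G> \<O> x l b ?\<eta> = convolution \<G> \<O> ?l ?b ?\<eta>"
      using L_right_act_convolution(2)[OF x b l gmult_isotropy_fiber(1)[OF \<tau> \<delta>]] .
    also have "\<dots> = (\<Oplus>\<^bsub>stalk \<O> (gran \<G> ?\<eta>)\<^esub>\<beta>\<in>(\<lambda>\<epsilon>. \<tau> \<cdot> \<epsilon>) ` ?S. conv_term ?l ?b ?\<eta> \<beta>)"
    proof (rule convolution_eq_finsum[OF ls(1,2) \<eta>(1)])
      show "finite ((\<lambda>\<epsilon>. \<tau> \<cdot> \<epsilon>) ` ?S)" using fin by simp
      show "\<beta> \<in> arrows \<G> \<and> gran \<G> \<beta> = gran \<G> ?\<eta>" if "\<beta> \<in> (\<lambda>\<epsilon>. \<tau> \<cdot> \<epsilon>) ` ?S" for \<beta>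
        using that gmult_isotropy_fiber[OF \<tau>] \<eta>(2) by (auto simp: gdom_fiber_iff)
      fix \<beta> assume \<beta>: "\<beta> \<in> arrows \<G>" "gran \<G> \<beta> = gran \<G> ?\<eta>" "conv_term ?l ?b ?\<eta> \<beta> \<noteq> \<zero>\<langle>gran \<G> ?\<eta>\<rangle>"
      have bc: "?b (\<beta>\<^sup>- \<cdot> ?\<eta>) \<in> carrier (stalk \<O> (gdom \<G> \<beta>))"
        using section_closed[OF ls(2)] ginv_gmult_row[OF \<beta>(1) \<eta>(1) \<beta>(2)] by metis
      then have lnz: "?l \<beta> \<noteq> \<zero>\<langle>gran \<G> \<beta>\<rangle>" using conv_term_zero_left[OF \<eta>(1) \<beta>(1,2)] \<beta>(3) by metis
      then have \<beta>x: "\<beta> \<in> gdom_fiber \<G> x" "l \<beta> \<noteq> \<zero>\<langle>gran \<G> \<beta>\<rangle>" using \<beta>(1) by (auto simp: extend_zero_def split: if_splits)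
      define \<epsilon> where "\<epsilon> = \<tau>\<^sup>- \<cdot> \<beta>"
      have r: "gran \<G> \<tau> = gran \<G> \<beta>" using \<beta>(2) \<eta>(2) by simp
      have \<epsilon>: "\<epsilon> \<in> isotropy \<G> x" "\<tau> \<cdot> \<epsilon> = \<beta>"
        using ginv_gmult_row[OF \<tau>'(1) \<beta>(1) r] gmult_ginv_cancel[OF \<tau>'(1) \<beta>(1) r] \<tau>' \<beta>x(1)
        by (auto simp: \<epsilon>_def isotropy_iff gdom_fiber_iff)
      have "row_part x \<tau> l \<epsilon> \<noteq> \<zero>\<langle>x\<rangle>"
      proof
        assume "row_part x \<tau> l \<epsilon> = \<zero>\<langle>x\<rangle>"
        then have "act \<tau> (act (\<tau>\<^sup>-) (l \<beta>)) = \<zero>\<langle>gran \<G> \<tau>\<rangle>"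
          using \<epsilon> act_zero[OF \<tau>'(1)] \<tau>'(2) by (simp add: row_part_def)
        then show False
          using act_act_ginv[OF \<tau>'(1), of "l \<beta>"] L_closed[OF l \<beta>x(1)] r \<beta>x(2) by simp
      qed
      then show "\<beta> \<in> (\<lambda>\<epsilon>. \<tau> \<cdot> \<epsilon>) ` ?S" using \<epsilon> by blast
    qed
    finally have "L_right_act \<G> \<O> x l b ?\<eta> = (\<Oplus>\<^bsub>stalk \<O> (gdom \<G> (\<tau>\<^sup>-))\<^esub>\<beta>\<in>(\<lambda>\<epsilon>. \<tau> \<cdot> \<epsilon>) ` ?S. conv_term ?l ?b ?\<eta> \<beta>)"
      using \<eta>(2) \<tau>' by (simp add: gdom_inv)
    moreover have tc: "conv_term ?l ?b ?\<eta> \<beta> \<in> carrier (stalk \<O> (gdom \<G> (\<tau>\<^sup>-)))" if "\<beta> \<in> (\<lambda>\<epsilon>. \<tau> \<cdot> \<epsilon>) ` ?S" for \<beta>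
      using conv_term_section_closed[OF ls(1,2) \<eta>(1), of \<beta>] that \<eta>(2) gmult_isotropy_fiber[OF \<tau>] \<tau>'
      by (auto simp: gdom_inv gdom_fiber_iff)
    ultimately have "act (\<tau>\<^sup>-) (L_right_act \<G> \<O> x l b ?\<eta>) =
        (\<Oplus>\<^bsub>stalk \<O> x\<^esub>\<beta>\<in>(\<lambda>\<epsilon>. \<tau> \<cdot> \<epsilon>) ` ?S. act (\<tau>\<^sup>-) (conv_term ?l ?b ?\<eta> \<beta>))"
      using act_finsum[OF inv_closed[OF \<tau>'(1)] tc] \<tau>' by (simp add: gran_inv)
    also have "\<dots> = (\<Oplus>\<^bsub>stalk \<O> x\<^esub>\<epsilon>\<in>?S. act (\<tau>\<^sup>-) (conv_term ?l ?b ?\<eta> (\<tau> \<cdot> \<epsilon>)))"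
    proof (rule finsum_reindex[OF _ inj])
      show "(\<lambda>\<beta>. act (\<tau>\<^sup>-) (conv_term ?l ?b ?\<eta> \<beta>)) \<in> (\<lambda>\<epsilon>. \<tau> \<cdot> \<epsilon>) ` ?S \<rightarrow> carrier (stalk \<O> x)"
      proof
        fix \<beta> assume "\<beta> \<in> (\<lambda>\<epsilon>. \<tau> \<cdot> \<epsilon>) ` ?S"
        from act_closed[OF inv_closed[OF \<tau>'(1)] tc[OF this]] show "act (\<tau>\<^sup>-) (conv_term ?l ?b ?\<eta> \<beta>) \<in> carrier (stalk \<O> x)"
          using \<tau>' by (simp add: gran_inv)
      qed
    qed
    also have "\<dots> = (\<Oplus>\<^bsub>stalk \<O> x\<^esub>\<epsilon>\<in>?S. conv_term ?r ?b \<delta> \<epsilon>)"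
    proof (rule finsum_cong')
      show "(\<lambda>\<epsilon>. conv_term ?r ?b \<delta> \<epsilon>) \<in> ?S \<rightarrow> carrier (stalk \<O> x)"
        using conv_term_section_closed[OF ls(3,2) \<delta>'(1)] \<delta>' by (auto simp: isotropy_iff)
      fix \<epsilon> assume "\<epsilon> \<in> ?S"
      then have \<epsilon>: "\<epsilon> \<in> isotropy \<G> x" "\<epsilon> \<in> arrows \<G>" "gdom \<G> \<epsilon> = x" "gran \<G> \<epsilon> = x" by (auto simp: isotropy_iff)
      let ?\<beta> = "\<tau> \<cdot> \<epsilon>"
      have \<beta>: "?\<beta> \<in> gdom_fiber \<G> x" "?\<beta> \<in> arrows \<G>" "gran \<G> ?\<beta> = gran \<G> \<tau>" "gdom \<G> ?\<beta> = x"
        using gmult_isotropy_fiber[OF \<tau> \<epsilon>(1)] by (auto simp: gdom_fiber_iff)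
      have \<epsilon>\<delta>: "\<epsilon>\<^sup>- \<cdot> \<delta> \<in> isotropy \<G> x"
        using ginv_gmult_row[OF \<epsilon>(2) \<delta>'(1)] \<epsilon> \<delta>' by (simp add: isotropy_iff)
      \<comment> \<open>The factorisation of \<tau> \<cdot> \<delta> starting with \<tau> \<cdot>
        \<epsilon> and that of \<delta> starting with \<epsilon> share their second factor.\<close>
      have "?\<beta>\<^sup>- \<cdot> ?\<eta> = \<epsilon>\<^sup>- \<cdot> \<delta>"
      proof -
        have "?\<beta> \<cdot> (\<epsilon>\<^sup>- \<cdot> \<delta>) = \<tau> \<cdot> (\<epsilon> \<cdot> (\<epsilon>\<^sup>- \<cdot> \<delta>))"
          using \<tau>' \<epsilon> \<epsilon>\<delta> by (intro gmult_assoc) (auto simp: isotropy_iff)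
        also have "\<dots> = ?\<eta>" using gmult_ginv_cancel[OF \<epsilon>(2) \<delta>'(1)] \<epsilon>(4) \<delta>'(3) by simp
        finally show ?thesis
          using ginv_gmult_cancel[OF \<beta>(2), of "\<epsilon>\<^sup>- \<cdot> \<delta>"] \<epsilon>\<delta> \<beta>(4) by (auto simp: isotropy_iff)
      qed
      then have "conv_term ?l ?b ?\<eta> ?\<beta> = l ?\<beta> \<otimes>\<^bsub>stalk \<O> (gran \<G> \<tau>)\<^esub> act ?\<beta> (b (\<epsilon>\<^sup>- \<cdot> \<delta>))"
        using \<beta> \<epsilon>\<delta> \<eta>(2) by (simp add: conv_term_def extend_zero_def isotropy_iff)
      also have "act ?\<beta> (b (\<epsilon>\<^sup>- \<cdot> \<delta>)) = act \<tau> (act \<epsilon> (b (\<epsilon>\<^sup>- \<cdot> \<delta>)))"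
        using skew_closed[OF x b \<epsilon>\<delta>] \<tau>' \<epsilon> by (intro act_gmult) auto
      finally have ct: "conv_term ?l ?b ?\<eta> ?\<beta> = l ?\<beta> \<otimes>\<^bsub>stalk \<O> (gran \<G> \<tau>)\<^esub> act \<tau> (act \<epsilon> (b (\<epsilon>\<^sup>- \<cdot> \<delta>)))" .
      have e1: "act \<epsilon> (b (\<epsilon>\<^sup>- \<cdot> \<delta>)) \<in> carrier (stalk \<O> x)"
        using act_closed[OF \<epsilon>(2)] skew_closed[OF x b \<epsilon>\<delta>] \<epsilon> by simp
      have "act (\<tau>\<^sup>-) (conv_term ?l ?b ?\<eta> ?\<beta>) = act (\<tau>\<^sup>-) (l ?\<beta>) \<otimes>\<^bsub>stalk \<O> x\<^esub> act (\<tau>\<^sup>-) (act \<tau> (act \<epsilon> (b (\<epsilon>\<^sup>- \<cdot> \<delta>))))"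
        unfolding ct using act_mult[OF inv_closed[OF \<tau>'(1)] row_part_value(1)[OF \<tau> \<epsilon>(1) l], of "act \<tau> (act \<epsilon> (b (\<epsilon>\<^sup>- \<cdot> \<delta>)))"]
          act_closed[OF \<tau>'(1)] e1 \<tau>' by (simp add: gdom_inv gran_inv)
      also have "\<dots> = act (\<tau>\<^sup>-) (l ?\<beta>) \<otimes>\<^bsub>stalk \<O> x\<^esub> act \<epsilon> (b (\<epsilon>\<^sup>- \<cdot> \<delta>))"
        using act_ginv_act[OF \<tau>'(1)] e1 \<tau>' by simp
      also have "\<dots> = conv_term ?r ?b \<delta> \<epsilon>"
        using \<epsilon> \<epsilon>\<delta> \<delta>' by (simp add: conv_term_def extend_zero_def row_part_def isotropy_iff)
      finally show "act (\<tau>\<^sup>-) (conv_term ?l ?b ?\<eta> ?\<beta>) = conv_term ?r ?b \<delta> \<epsilon>" .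
    qed simp
    also have "\<dots> = convolution \<G> \<O> ?r ?b \<delta>"
    proof -
      have "convolution \<G> \<O> ?r ?b \<delta> = (\<Oplus>\<^bsub>stalk \<O> (gran \<G> \<delta>)\<^esub>\<epsilon>\<in>?S. conv_term ?r ?b \<delta> \<epsilon>)"
        by (rule convolution_row_finite[OF ls(3,2) \<delta>'(1) fin])
          (use \<delta>' in \<open>auto simp: extend_zero_def isotropy_iff split: if_splits\<close>)
      then show ?thesis using \<delta>'(3) by simp
    qed
    also have "\<dots> = (row_part x \<tau> l \<otimes>\<^bsub>skew_group_ring \<G> \<O> x\<^esub> b) \<delta>"
      using skew_mult_convolution(2)[OF x rc b \<delta>] by simp
    finally show ?thesis .
  qed
  moreover have "row_part x \<tau> l \<otimes>\<^bsub>skew_group_ring \<G> \<O> x\<^esub> b \<in> extensional (isotropy \<G> x)"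
    using skew_mult_convolution(1)[OF x rc b] by (auto simp: carrier_skew[OF x] PiE_def)
  ultimately show ?thesis
    by (intro extensionalityI[where A = "isotropy \<G> x"]) (auto simp: row_part_def)
qed

text \<open>Row \<open>x\<close> of \<open>h * (a * g)\<close> is the row of \<tau> in
  \<open>a * g\<close> carried back along \<tau>, and column \<open>x\<close> of
  \<open>a * g\<close> depends only on column \<open>x\<close> of \<open>g\<close>, which is
  \<open>l\<close>. So the coordinate of \<open>a l\<close> is lifted by a product in \<Gamma> as
  soon as that product is an isotropy row.\<close>

lemma row_part_left_act:
  assumes x: "x \<in> units \<G>" and \<tau>: "\<tau> \<in> gdom_fiber \<G> x"
    and h: "row_delta (\<tau>\<^sup>-) h"
    and a: "a \<in> carrier \<Gamma>" and g: "g \<in> carrier \<Gamma>" and l: "l \<in> carrier (L_group \<G> \<O> x)"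
    and gl: "\<And>\<gamma>. \<gamma> \<in> gdom_fiber \<G> x \<Longrightarrow> g \<gamma> = l \<gamma>"
  shows "\<forall>\<delta>\<in>isotropy \<G> x. (h \<otimes>\<^bsub>\<Gamma>\<^esub> (a \<otimes>\<^bsub>\<Gamma>\<^esub> g)) \<delta> = row_part x \<tau> (L_left_act \<G> \<O> x a l) \<delta>"
proof
  fix \<delta> assume \<delta>: "\<delta> \<in> isotropy \<G> x"
  have \<tau>': "\<tau> \<in> arrows \<G>" "gdom \<G> \<tau> = x" using \<tau> by (auto simp: gdom_fiber_iff)
  have \<delta>': "\<delta> \<in> arrows \<G>" "gran \<G> \<delta> = x" using \<delta> by (auto simp: isotropy_iff)
  note \<tau>\<delta> = gmult_isotropy_fiber(1)[OF \<tau> \<delta>]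
  then have \<eta>: "\<tau> \<cdot> \<delta> \<in> arrows \<G>" "gdom \<G> (\<tau> \<cdot> \<delta>) = x" by (auto simp: gdom_fiber_iff)
  have "(a \<otimes>\<^bsub>\<Gamma>\<^esub> g) (\<tau> \<cdot> \<delta>) = convolution \<G> \<O> a (extend_zero (gdom_fiber \<G> x) l) (\<tau> \<cdot> \<delta>)"
    unfolding Gamma_simps(3)
  proof (rule convolution_cong[OF _ _ _ _ \<eta>(1)])
    show "finite {\<beta> \<in> arrows \<G>. gran \<G> \<beta> = gran \<G> (\<tau> \<cdot> \<delta>) \<and> a \<beta> \<noteq> \<zero>\<langle>gran \<G> (\<tau> \<cdot> \<delta>)\<rangle>}"
      using Gamma_row_fin[OF a gran_units[OF \<eta>(1)]] .
    fix \<beta> assume \<beta>: "\<beta> \<in> arrows \<G>" "gran \<G> \<beta> = gran \<G> (\<tau> \<cdot> \<delta>)"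
    show "g (\<beta>\<^sup>- \<cdot> (\<tau> \<cdot> \<delta>)) = extend_zero (gdom_fiber \<G> x) l (\<beta>\<^sup>- \<cdot> (\<tau> \<cdot> \<delta>))"
      using ginv_gmult_row[OF \<beta>(1) \<eta>(1) \<beta>(2)] \<eta>(2) gl by (simp add: extend_zero_def gdom_fiber_iff)
  qed (use a g l Gamma_section extend_L_section in auto)
  then have "(a \<otimes>\<^bsub>\<Gamma>\<^esub> g) (\<tau> \<cdot> \<delta>) = L_left_act \<G> \<O> x a l (\<tau> \<cdot> \<delta>)"
    using L_left_act_convolution(2)[OF x a l \<tau>\<delta>] by simp
  then show "(h \<otimes>\<^bsub>\<Gamma>\<^esub> (a \<otimes>\<^bsub>\<Gamma>\<^esub> g)) \<delta> = row_part x \<tau> (L_left_act \<G> \<O> x a l) \<delta>"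
    using row_delta_mult[OF inv_closed[OF \<tau>'(1)] h Gamma_mult_closed[OF a g] \<delta>'(1)] gran_inv[OF \<tau>'(1)] ginv_ginv[OF \<tau>'(1)] \<tau>' \<delta> \<delta>'
    by (simp add: row_part_def)
qed

text \<open>The delta at \<open>\<tau>\<^sup>-\<close> moves the row of \<tau> to row
  \<open>x\<close> without changing domains, so entries confined to column \<open>x\<close> end up
  in the isotropy group.\<close>

lemma isotropy_row_translate:
  assumes \<tau>: "\<tau> \<in> arrows \<G>" "gdom \<G> \<tau> = x"
    and h: "row_delta (\<tau>\<^sup>-) h"
    and k: "k \<in> carrier \<Gamma>" "\<And>\<eta>. \<lbrakk>\<eta> \<in> arrows \<G>; gran \<G> \<eta> = gran \<G> \<tau>; gdom \<G> \<eta> \<noteq> x\<rbrakk> \<Longrightarrow> k \<eta> = \<zero>\<langle>gran \<G> \<tau>\<rangle>"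
  shows "isotropy_row x (h \<otimes>\<^bsub>\<Gamma>\<^esub> k)"
  unfolding isotropy_row_def
proof (intro conjI ballI impI)
  show "h \<otimes>\<^bsub>\<Gamma>\<^esub> k \<in> carrier \<Gamma>" using Gamma_mult_closed[OF row_delta_Gamma[OF h] k(1)] .
  fix \<gamma> assume \<gamma>: "\<gamma> \<in> arrows \<G>" "gran \<G> \<gamma> = x \<and> gdom \<G> \<gamma> \<noteq> x"
  have "k (\<tau> \<cdot> \<gamma>) = \<zero>\<langle>gdom \<G> (\<tau>\<^sup>-)\<rangle>"
    using k(2)[of "\<tau> \<cdot> \<gamma>"] \<tau> \<gamma> by (simp add: gmult_arrow gran_gmult gdom_gmult gdom_inv)
  then show "(h \<otimes>\<^bsub>\<Gamma>\<^esub> k) \<gamma> = \<zero>\<langle>x\<rangle>"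
    using row_delta_mult[OF inv_closed[OF \<tau>(1)] h k(1) \<gamma>(1)] ginv_ginv[OF \<tau>(1)] \<gamma>(2) act_zero[OF inv_closed[OF \<tau>(1)]] gran_inv[OF \<tau>(1)] \<tau>(2)
    by simp
qed

definition restrict_rows :: "'g \<Rightarrow> 'g set \<Rightarrow> ('g \<Rightarrow> 'e) \<Rightarrow> 'g \<Rightarrow> 'e" where
  "restrict_rows x A l = (\<lambda>\<gamma>\<in>gdom_fiber \<G> x. if gran \<G> \<gamma> \<in> A then l \<gamma> else \<zero>\<langle>gran \<G> \<gamma>\<rangle>)"

lemma restrict_rows_closed:
  assumes l: "l \<in> carrier (L_group \<G> \<O> x)"
  shows "restrict_rows x A l \<in> carrier (L_group \<G> \<O> x)"
proof -
  have "finite {\<gamma> \<in> gdom_fiber \<G> x. restrict_rows x A l \<gamma> \<noteq> \<zero>\<langle>gran \<G> \<gamma>\<rangle>}"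
    by (rule finite_subset[of _ "{\<gamma> \<in> gdom_fiber \<G> x. l \<gamma> \<noteq> \<zero>\<langle>gran \<G> \<gamma>\<rangle>}"])
      (use l in \<open>auto simp: restrict_rows_def carrier_L_group split: if_splits\<close>)
  moreover have "\<zero>\<langle>gran \<G> \<gamma>\<rangle> \<in> carrier (stalk \<O> (gran \<G> \<gamma>))" if "\<gamma> \<in> gdom_fiber \<G> x" for \<gamma>
    using stalk_zero_closed gran_units that by (simp add: gdom_fiber_iff)
  ultimately show ?thesis
    using L_closed[OF l] unfolding carrier_L_group by (auto simp: restrict_rows_def)
qed

lemma restrict_rows_split:
  assumes l: "l \<in> carrier (L_group \<G> \<O> x)"
  shows "restrict_rows x A l \<otimes>\<^bsub>L_group \<G> \<O> x\<^esub> restrict_rows x (- A) l = l"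
proof (rule L_eqI)
  interpret L: comm_group "L_group \<G> \<O> x" by (rule L_group_comm)
  show "restrict_rows x A l \<otimes>\<^bsub>L_group \<G> \<O> x\<^esub> restrict_rows x (- A) l \<in> carrier (L_group \<G> \<O> x)"
    using restrict_rows_closed[OF l] by blast
  fix \<gamma> assume \<gamma>: "\<gamma> \<in> gdom_fiber \<G> x"
  then interpret ring "stalk \<O> (gran \<G> \<gamma>)" using ring_stalk gran_units by (simp add: gdom_fiber_iff)
  show "(restrict_rows x A l \<otimes>\<^bsub>L_group \<G> \<O> x\<^esub> restrict_rows x (- A) l) \<gamma> = l \<gamma>"
    using L_closed[OF l \<gamma>] \<gamma> by (simp add: L_group_simps restrict_rows_def)
qed (use l in auto)

lemma row_part_restrict_rows:
  assumes "\<tau> \<in> gdom_fiber \<G> x"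
  shows "row_part x \<tau> (restrict_rows x A l) = (if gran \<G> \<tau> \<in> A then row_part x \<tau> l else (\<lambda>\<delta>\<in>isotropy \<G> x. \<zero>\<langle>x\<rangle>))"
proof -
  have \<tau>: "\<tau> \<in> arrows \<G>" "gdom \<G> \<tau> = x" using assms by (auto simp: gdom_fiber_iff)
  have "act (\<tau>\<^sup>-) \<zero>\<langle>gran \<G> \<tau>\<rangle> = \<zero>\<langle>x\<rangle>"
    using act_zero[OF inv_closed[OF \<tau>(1)]] \<tau> by (simp add: gdom_inv gran_inv)
  then show ?thesis
    using gmult_isotropy_fiber[OF assms] by (auto simp: row_part_def restrict_rows_def intro!: restrict_ext)
qed

text \<open>One term of the expansion of \<open>l\<close> in the basis: each arrow of the row is
  \<tau> \<cdot> \<delta> for exactly one isotropy arrow \<delta>, and acting by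
  \<open>\<tau>\<^sup>-\<close> and then by \<tau> returns the entry.\<close>

lemma restrict_row_eq_right_act:
  assumes x: "x \<in> units \<G>" and \<tau>: "\<tau> \<in> gdom_fiber \<G> x" and l: "l \<in> carrier (L_group \<G> \<O> x)"
  shows "restrict_rows x {gran \<G> \<tau>} l = L_right_act \<G> \<O> x (L_single \<G> \<O> x \<one>\<^bsub>stalk \<O> (gran \<G> \<tau>)\<^esub> \<tau>) (row_part x \<tau> l)"
    "L_single \<G> \<O> x \<one>\<^bsub>stalk \<O> (gran \<G> \<tau>)\<^esub> \<tau> \<in> carrier (L_group \<G> \<O> x)"
proof -
  let ?s = "L_single \<G> \<O> x \<one>\<^bsub>stalk \<O> (gran \<G> \<tau>)\<^esub> \<tau>"
  have \<tau>': "\<tau> \<in> arrows \<G>" "gdom \<G> \<tau> = x" using \<tau> by (auto simp: gdom_fiber_iff)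
  interpret ring "stalk \<O> (gran \<G> \<tau>)" using ring_stalk gran_units \<tau>'(1) by blast
  show s: "?s \<in> carrier (L_group \<G> \<O> x)"
    unfolding L_single_def L_group_def using \<tau> fiber_group by (intro single_in_sum_group) auto
  note b = row_part_closed[OF x \<tau> l]
  show "restrict_rows x {gran \<G> \<tau>} l = L_right_act \<G> \<O> x ?s (row_part x \<tau> l)"
  proof (rule L_eqI[OF restrict_rows_closed[OF l] L_right_act_convolution(1)[OF x b s]])
    fix \<eta> assume \<eta>: "\<eta> \<in> gdom_fiber \<G> x"
    then have \<eta>': "\<eta> \<in> arrows \<G>" "gdom \<G> \<eta> = x" by (auto simp: gdom_fiber_iff)
    let ?s' = "extend_zero (gdom_fiber \<G> x) ?s" and ?b = "extend_zero (isotropy \<G> x) (row_part x \<tau> l)"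
    have sec: "?s' \<in> carrier (arrow_sections \<G> \<O>)" "?b \<in> carrier (arrow_sections \<G> \<O>)"
      using extend_L_section[OF s] extend_skew_section[OF x b] by auto
    have s': "?s' \<beta> = (if \<beta> = \<tau> then \<one>\<^bsub>stalk \<O> (gran \<G> \<tau>)\<^esub> else \<zero>\<langle>gran \<G> \<beta>\<rangle>)" if "\<beta> \<in> arrows \<G>" for \<beta>
      using that \<tau> by (auto simp: extend_zero_def L_single_def single_def)
    have "convolution \<G> \<O> ?s' ?b \<eta> = restrict_rows x {gran \<G> \<tau>} l \<eta>"
    proof (cases "gran \<G> \<eta> = gran \<G> \<tau>")
      case False
      have "convolution \<G> \<O> ?s' ?b \<eta> = \<zero>\<langle>gran \<G> \<eta>\<rangle>"
        by (rule convolution_zero[OF sec \<eta>'(1)]) (use s' False in auto)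
      then show ?thesis using False \<eta> by (simp add: restrict_rows_def)
    next
      case True
      have "convolution \<G> \<O> ?s' ?b \<eta> = ?s' \<tau> \<otimes>\<^bsub>stalk \<O> (gran \<G> \<eta>)\<^esub> act \<tau> (?b (\<tau>\<^sup>- \<cdot> \<eta>))"
        by (rule convolution_single[OF sec \<eta>'(1) \<tau>'(1)]) (use s' True in auto)
      also have "?b (\<tau>\<^sup>- \<cdot> \<eta>) = act (\<tau>\<^sup>-) (l \<eta>)"
      proof -
        have "\<tau>\<^sup>- \<cdot> \<eta> \<in> isotropy \<G> x"
          using ginv_gmult_row[OF \<tau>'(1) \<eta>'(1) True[symmetric]] \<tau>' \<eta>' by (simp add: isotropy_iff)
        then show ?thesis
          using gmult_ginv_cancel[OF \<tau>'(1) \<eta>'(1) True[symmetric]] by (simp add: extend_zero_def row_part_def isotropy_iff)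
      qed
      also have "act \<tau> (act (\<tau>\<^sup>-) (l \<eta>)) = l \<eta>"
        using act_act_ginv[OF \<tau>'(1)] L_closed[OF l \<eta>] True by simp
      also have "?s' \<tau> \<otimes>\<^bsub>stalk \<O> (gran \<G> \<eta>)\<^esub> l \<eta> = l \<eta>"
        unfolding True using s'[OF \<tau>'(1)] L_closed[OF l \<eta>] True by simp
      finally show ?thesis using True \<eta> by (simp add: restrict_rows_def)
    qed
    then show "restrict_rows x {gran \<G> \<tau>} l \<eta> = L_right_act \<G> \<O> x ?s (row_part x \<tau> l) \<eta>"
      using L_right_act_convolution(2)[OF x b s \<eta>] by simp
  qed
qed

lemma tensor_data_L:
  assumes "x \<in> units \<G>" "left_module (skew_group_ring \<G> \<O> x) M"
  shows "tensor_data (L_group \<G> \<O> x) (L_right_act \<G> \<O> x) (skew_group_ring \<G> \<O> x) M"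
  using assms L_group_comm L_right_act_convolution(1) by (intro tensor_data.intro) auto

text \<open>\<open>\<L>\<^sub>x\<close> is a free right module with one basis element for each unit in the orbit of \<open>x\<close>, and
  the maps \<^term>\<open>row_part x \<tau>\<close> are its coordinates.\<close>

lemma tensor_zero_iff_row_parts:
  assumes x: "x \<in> units \<G>" and M: "left_module (skew_group_ring \<G> \<O> x) M"
    and l: "l \<in> carrier (L_group \<G> \<O> x)" and m: "m \<in> carrier M"
    and zero_smult: "(\<lambda>\<delta>\<in>isotropy \<G> x. \<zero>\<langle>x\<rangle>) \<odot>\<^bsub>M\<^esub> m = \<zero>\<^bsub>M\<^esub>"
  shows "frag_of (l, m) \<in> tensor_relations (L_group \<G> \<O> x) (L_right_act \<G> \<O> x) (skew_group_ring \<G> \<O> x) M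
     \<longleftrightarrow> (\<forall>\<tau>\<in>gdom_fiber \<G> x. row_part x \<tau> l \<odot>\<^bsub>M\<^esub> m = \<zero>\<^bsub>M\<^esub>)"
proof -
  interpret T: tensor_data "L_group \<G> \<O> x" "L_right_act \<G> \<O> x" "skew_group_ring \<G> \<O> x" M
    using tensor_data_L[OF x M] .
  \<comment> \<open>Induction over a finite set of units that contains the ranges of the support;
    each step splits off one row of \<open>l\<close>.\<close>
  have "frag_of (l, m) \<in> T.relations"
    if "finite Z" "\<And>\<gamma>. \<lbrakk>\<gamma> \<in> gdom_fiber \<G> x; l \<gamma> \<noteq> \<zero>\<langle>gran \<G> \<gamma>\<rangle>\<rbrakk> \<Longrightarrow> gran \<G> \<gamma> \<in> Z" "l \<in> carrier (L_group \<G> \<O> x)"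
      "\<forall>\<tau>\<in>gdom_fiber \<G> x. row_part x \<tau> l \<odot>\<^bsub>M\<^esub> m = \<zero>\<^bsub>M\<^esub>" for Z l
    using that
  proof (induction Z arbitrary: l)
    case empty
    then have "l = \<one>\<^bsub>L_group \<G> \<O> x\<^esub>"
      by (intro L_eqI[OF _ T.L.one_closed]) (auto simp: L_group_simps)
    then show ?case using T.frag_zero_left_in_relations[OF m] by simp
  next
    case (insert z Z)
    show ?case
    \<comment> \<open>A unit \<open>z\<close> that no arrow reaches from \<open>x\<close> carries no
      row, and the smaller set already suffices.\<close>
    proof (cases "\<exists>\<tau>\<in>gdom_fiber \<G> x. gran \<G> \<tau> = z")
      case False
      then show ?thesis using insert by blast
    next
      case True
      then obtain \<tau> where \<tau>: "\<tau> \<in> gdom_fiber \<G> x" "z = gran \<G> \<tau>" by blast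
      note rc = restrict_rows_closed[OF insert.prems(2)]
      have "frag_of (restrict_rows x {z} l, m) \<in> T.relations"
        unfolding \<tau>(2) restrict_row_eq_right_act(1)[OF x \<tau>(1) insert.prems(2)]
        using restrict_row_eq_right_act(2)[OF x \<tau>(1) insert.prems(2)] row_part_closed[OF x \<tau>(1) insert.prems(2)]
          m insert.prems(3) \<tau>(1)
        by (intro T.frag_ract_in_relations) auto
      moreover have "frag_of (restrict_rows x (- {z}) l, m) \<in> T.relations"
      proof (rule insert.IH[OF _ rc])
        show "gran \<G> \<gamma> \<in> Z" if "\<gamma> \<in> gdom_fiber \<G> x" "restrict_rows x (- {z}) l \<gamma> \<noteq> \<zero>\<langle>gran \<G> \<gamma>\<rangle>" for \<gamma>
          using that insert.prems(1)[of \<gamma>] by (auto simp: restrict_rows_def split: if_splits)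
        show "\<forall>\<tau>\<in>gdom_fiber \<G> x. row_part x \<tau> (restrict_rows x (- {z}) l) \<odot>\<^bsub>M\<^esub> m = \<zero>\<^bsub>M\<^esub>"
          using insert.prems(3) zero_smult by (auto simp: row_part_restrict_rows)
      qed
      ultimately show ?thesis
        using T.frag_add_in_relations[OF rc rc m] restrict_rows_split[OF insert.prems(2)] by metis
    qed
  qed
  from this[of "gran \<G> ` {\<gamma> \<in> gdom_fiber \<G> x. l \<gamma> \<noteq> \<zero>\<langle>gran \<G> \<gamma>\<rangle>}" l]
  have "frag_of (l, m) \<in> T.relations" if "\<forall>\<tau>\<in>gdom_fiber \<G> x. row_part x \<tau> l \<odot>\<^bsub>M\<^esub> m = \<zero>\<^bsub>M\<^esub>"
    using that l by (auto simp: carrier_L_group)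
  moreover have "row_part x \<tau> l \<odot>\<^bsub>M\<^esub> m = \<zero>\<^bsub>M\<^esub>" if "frag_of (l, m) \<in> T.relations" "\<tau> \<in> gdom_fiber \<G> x" for \<tau>
    using T.relations_annihilated[of "row_part x \<tau>", OF row_part_closed[OF x that(2)] row_part_add[OF that(2)]
      row_part_mult[OF x that(2)] l m that(1)] by blast
  ultimately show ?thesis by blast
qed

end

section \<open>Comparison of the two annihilators\<close>

context convolution_module
begin

text \<open>Annihilation is tested on elements l \<otimes> m, and these through coordinates; no
  computation with tensors remains after this.\<close>

lemma annihilator_Ind_iff:
  assumes x: "x \<in> units \<G>" and a: "a \<in> carrier \<Gamma>"
  shows "a \<in> annihilator \<Gamma> (Ind \<G> \<O> x (germ_module x)) \<longleftrightarrow>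
    (\<forall>l\<in>carrier (L_group \<G> \<O> x). \<forall>n\<in>carrier N. \<forall>\<tau>\<in>gdom_fiber \<G> x.
       row_part x \<tau> (L_left_act \<G> \<O> x a l) \<odot>\<^bsub>germ_module x\<^esub> germ x n = \<zero>\<^bsub>germ_module x\<^esub>)"
proof -
  have M: "left_module (skew_group_ring \<G> \<O> x) (germ_module x)"
    using germ_module_unital[OF x] by (simp add: unital_left_module_def)
  interpret T: tensor_data "L_group \<G> \<O> x" "L_right_act \<G> \<O> x" "skew_group_ring \<G> \<O> x" "germ_module x"
    using tensor_data_L[OF x M] .
  have zero_smult: "(\<lambda>\<delta>\<in>isotropy \<G> x. \<zero>\<langle>x\<rangle>) \<odot>\<^bsub>germ_module x\<^esub> germ x n = \<zero>\<^bsub>germ_module x\<^esub>" if "n \<in> carrier N" for n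
  proof -
    have "isotropy_row x \<zero>\<^bsub>\<Gamma>\<^esub>" using Gamma_zero_closed by (auto simp: isotropy_row_def Gamma_zero_apply)
    moreover have "\<forall>\<delta>\<in>isotropy \<G> x. \<zero>\<^bsub>\<Gamma>\<^esub> \<delta> = (\<lambda>\<delta>\<in>isotropy \<G> x. \<zero>\<langle>x\<rangle>) \<delta>"
      by (auto simp: isotropy_iff Gamma_zero_apply)
    ultimately show ?thesis
      using germ_smult[OF x _ _ that] smult_zero_left[OF that] germ_zero[OF x] by simp
  qed
  have "a \<in> annihilator \<Gamma> (Ind \<G> \<O> x (germ_module x)) \<longleftrightarrow>
    (\<forall>l\<in>carrier (L_group \<G> \<O> x). \<forall>m\<in>carrier (germ_module x). frag_of (L_left_act \<G> \<O> x a l, m) \<in> T.relations)"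
    using T.tensor_map_annihilates_iff[of "L_left_act \<G> \<O> x a"] L_left_act_convolution(1)[OF x a] a
    by (simp add: annihilator_def Ind_def module_on_def)
  also have "\<dots> \<longleftrightarrow> (\<forall>l\<in>carrier (L_group \<G> \<O> x). \<forall>n\<in>carrier N. \<forall>\<tau>\<in>gdom_fiber \<G> x.
       row_part x \<tau> (L_left_act \<G> \<O> x a l) \<odot>\<^bsub>germ_module x\<^esub> germ x n = \<zero>\<^bsub>germ_module x\<^esub>)"
    using tensor_zero_iff_row_parts[OF x M L_left_act_convolution(1)[OF x a] _ zero_smult]
    by (auto simp: germ_module_simps(1))
  finally show ?thesis .
qed

text \<open>Lift \<open>l\<close> to some \<open>g\<close> in \<Gamma> and move the row of \<tau> to
  row \<open>x\<close> by a delta \<open>h\<close>. The coordinate of \<open>a l\<close> then acts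
  on the germ of \<open>n\<close> as \<open>h * (a * g)\<close> acts on \<open>n\<close>, and this
  passes through \<open>a (g n) = 0\<close>.\<close>

lemma annihilator_subset_Ind:
  assumes x: "x \<in> units \<G>" and a: "a \<in> annihilator \<Gamma> N"
  shows "a \<in> annihilator \<Gamma> (Ind \<G> \<O> x (germ_module x))"
proof -
  have aG: "a \<in> carrier \<Gamma>" and kill: "\<And>n. n \<in> carrier N \<Longrightarrow> a \<star> n = \<zero>\<^bsub>N\<^esub>"
    using a by (auto simp: annihilator_def)
  show ?thesis
    unfolding annihilator_Ind_iff[OF x aG]
  proof (intro ballI)
    fix l n \<tau> assume l: "l \<in> carrier (L_group \<G> \<O> x)" and n: "n \<in> carrier N" and \<tau>: "\<tau> \<in> gdom_fiber \<G> x"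
    have \<tau>': "\<tau> \<in> arrows \<G>" "gdom \<G> \<tau> = x" using \<tau> by (auto simp: gdom_fiber_iff)
    define z where "z = gran \<G> \<tau>"
    have z: "z \<in> units \<G>" using gran_units[OF \<tau>'(1)] by (simp add: z_def)
    obtain g0 where g0: "g0 \<in> carrier \<Gamma>" "\<And>\<gamma>. \<gamma> \<in> gdom_fiber \<G> x \<Longrightarrow> g0 \<gamma> = l \<gamma>"
      using Gamma_column_lift[OF l] by blast
    obtain h where h: "row_delta (\<tau>\<^sup>-) h"
    using row_delta_exists[OF inv_closed[OF \<tau>'(1)]] .
  note hG = row_delta_Gamma[OF h]
    \<comment> \<open>\<open>K\<close> isolates column \<open>x\<close> in row \<open>z\<close> of
      the product \<open>a * g0\<close> rather than of \<open>g0\<close>, because it is the product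
      that has to become an isotropy row after translation.\<close>
    have "x \<in> topspace (unit_space \<G>)" using x by (simp add: topspace_unit_space)
    then obtain K where K: "compact_open_units K" "x \<in> K"
      "\<And>\<gamma>. \<lbrakk>\<gamma> \<in> arrows \<G>; gran \<G> \<gamma> = z; gdom \<G> \<gamma> \<in> K; gdom \<G> \<gamma> \<noteq> x\<rbrakk> \<Longrightarrow> (a \<otimes>\<^bsub>\<Gamma>\<^esub> g0) \<gamma> = \<zero>\<langle>z\<rangle>"
      using Gamma_row_isolate[OF Gamma_mult_closed[OF aG g0(1)] z openin_topspace] by metis
    define g where "g = g0 \<otimes>\<^bsub>\<Gamma>\<^esub> idem K"
    have gG: "g \<in> carrier \<Gamma>" unfolding g_def using Gamma_mult_closed[OF g0(1) Gamma_idem[OF K(1)]] .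
    have g_app: "g \<gamma> = (if gdom \<G> \<gamma> \<in> K then g0 \<gamma> else \<zero>\<langle>gran \<G> \<gamma>\<rangle>)" if "\<gamma> \<in> arrows \<G>" for \<gamma>
      unfolding g_def using convolution_idem_right[OF compact_open_units_subset[OF K(1)] Gamma_section[OF g0(1)] that]
      by (simp add: Gamma_simps(3))
    have gl: "g \<gamma> = l \<gamma>" if "\<gamma> \<in> gdom_fiber \<G> x" for \<gamma>
      using that K(2) g0(2)[OF that] g_app by (auto simp: gdom_fiber_iff)
    \<comment> \<open>Cutting \<open>g0\<close> by \<open>idem K\<close> on the right cuts
      \<open>a * g0\<close> to the columns over \<open>K\<close>; the two cases are the two sides of
      the cut.\<close>
    have ag: "(a \<otimes>\<^bsub>\<Gamma>\<^esub> g) \<eta> = \<zero>\<langle>gran \<G> \<tau>\<rangle>" if \<eta>: "\<eta> \<in> arrows \<G>" "gran \<G> \<eta> = gran \<G> \<tau>" "gdom \<G> \<eta> \<noteq> x" for \<eta>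
    proof (cases "gdom \<G> \<eta> \<in> K")
      case True
      have "convolution \<G> \<O> a g \<eta> = convolution \<G> \<O> a g0 \<eta>"
      proof (rule convolution_cong[OF _ _ _ _ \<eta>(1) Gamma_row_fin[OF aG gran_units[OF \<eta>(1)]]])
        fix \<beta> assume \<beta>: "\<beta> \<in> arrows \<G>" "gran \<G> \<beta> = gran \<G> \<eta>"
        then show "g (\<beta>\<^sup>- \<cdot> \<eta>) = g0 (\<beta>\<^sup>- \<cdot> \<eta>)"
          using g_app ginv_gmult_row[OF \<beta>(1) \<eta>(1) \<beta>(2)] True by simp
      qed (use aG gG g0 Gamma_section in auto)
      then show ?thesis
        using K(3)[OF \<eta>(1) _ True \<eta>(3)] \<eta>(2) by (simp add: Gamma_simps(3) z_def)
    next
      case False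
      have "convolution \<G> \<O> a g \<eta> = \<zero>\<langle>gran \<G> \<eta>\<rangle>"
      proof (rule convolution_zero[OF Gamma_section Gamma_section, OF aG gG \<eta>(1)])
        fix \<beta> assume \<beta>: "\<beta> \<in> arrows \<G>" "gran \<G> \<beta> = gran \<G> \<eta>"
        then show "a \<beta> = \<zero>\<langle>gran \<G> \<beta>\<rangle> \<or> g (\<beta>\<^sup>- \<cdot> \<eta>) = \<zero>\<langle>gdom \<G> \<beta>\<rangle>"
          using g_app ginv_gmult_row[OF \<beta>(1) \<eta>(1) \<beta>(2)] False by simp
      qed
      then show ?thesis using \<eta>(2) by (simp add: Gamma_simps(3))
    qed
    note agG = Gamma_mult_closed[OF aG gG]
    have iso: "isotropy_row x (h \<otimes>\<^bsub>\<Gamma>\<^esub> (a \<otimes>\<^bsub>\<Gamma>\<^esub> g))"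
      by (rule isotropy_row_translate[OF \<tau>' h agG ag])
    have "(h \<otimes>\<^bsub>\<Gamma>\<^esub> (a \<otimes>\<^bsub>\<Gamma>\<^esub> g)) \<star> n = \<zero>\<^bsub>N\<^esub>"
      using Gamma_mult_smult[OF hG agG n] Gamma_mult_smult[OF aG gG n] kill[OF N.smult_closed[OF gG n]] smult_zero_right[OF hG]
      by simp
    then show "row_part x \<tau> (L_left_act \<G> \<O> x a l) \<odot>\<^bsub>germ_module x\<^esub> germ x n = \<zero>\<^bsub>germ_module x\<^esub>"
      using germ_smult[OF x iso row_part_left_act[OF x \<tau> h aG gG l gl] n] germ_zero[OF x] by simp
  qed
qed

text \<open>Cutting \<open>n\<close> by indicators reduces to one domain \<open>y\<close> of the row
  of \<open>a\<close> at \<open>z\<close>. An arrow \<gamma> from \<open>x\<close> to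
  \<open>y\<close> gives sections \<open>s\<close> and \<open>t\<close> whose product is an
  indicator on row \<open>y\<close>, so modulo germs at \<open>z\<close> the element
  \<open>a (idem V n)\<close> is \<open>(a * g) (t n)\<close> for some \<open>g\<close> that
  restricts to a vector of the bimodule. The hypothesis applies to this vector.\<close>

lemma annihilator_Ind_germ_kernel:
  assumes x: "x \<in> units \<G>" and aG: "a \<in> carrier \<Gamma>" and a: "a \<in> annihilator \<Gamma> (Ind \<G> \<O> x (germ_module x))"
    and \<tau>: "\<tau> \<in> gdom_fiber \<G> x" and n: "n \<in> carrier N"
  shows "a \<star> n \<in> germ_kernel (gran \<G> \<tau>)"
proof -
  have \<tau>': "\<tau> \<in> arrows \<G>" "gdom \<G> \<tau> = x" using \<tau> by (auto simp: gdom_fiber_iff)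
  define z where "z = gran \<G> \<tau>"
  have z: "z \<in> units \<G>" using gran_units[OF \<tau>'(1)] by (simp add: z_def)
  obtain h where h: "row_delta (\<tau>\<^sup>-) h"
    using row_delta_exists[OF inv_closed[OF \<tau>'(1)]] .
  note hG = row_delta_Gamma[OF h]
  have cut: "(a \<otimes>\<^bsub>\<Gamma>\<^esub> idem V) \<gamma> = (if gdom \<G> \<gamma> \<in> V then a \<gamma> else \<zero>\<langle>gran \<G> \<gamma>\<rangle>)"
    if "compact_open_units V" "\<gamma> \<in> arrows \<G>" for V \<gamma>
    using convolution_idem_right[OF compact_open_units_subset[OF that(1)] Gamma_section[OF aG] that(2)]
    by (simp add: Gamma_simps(3))
  \<comment> \<open>The domains of the nonzero entries of \<open>a\<close> in row \<open>z\<close>.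
    Each \<open>U y\<close> chosen below contains no other point of \<open>D\<close> than
    \<open>y\<close>.\<close>
  define D where "D = gdom \<G> ` {\<beta> \<in> arrows \<G>. gran \<G> \<beta> = z \<and> a \<beta> \<noteq> \<zero>\<langle>z\<rangle>}"
  have "\<exists>U. compact_open_units U \<and> y \<in> U \<and> (\<forall>\<gamma>\<in>arrows \<G>. gran \<G> \<gamma> = z \<and> gdom \<G> \<gamma> \<in> U \<and> gdom \<G> \<gamma> \<noteq> y \<longrightarrow> a \<gamma> = \<zero>\<langle>z\<rangle>)"
    if "y \<in> D" for y
  proof -
    have "y \<in> topspace (unit_space \<G>)" using that gdom_units by (auto simp: D_def topspace_unit_space)
    then show ?thesis
      using Gamma_row_isolate[OF aG z openin_topspace] by metis
  qed
  then obtain U where U: "\<And>y. y \<in> D \<Longrightarrow> compact_open_units (U y)" "\<And>y. y \<in> D \<Longrightarrow> y \<in> U y"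
    "\<And>y \<gamma>. \<lbrakk>y \<in> D; \<gamma> \<in> arrows \<G>; gran \<G> \<gamma> = z; gdom \<G> \<gamma> \<in> U y; gdom \<G> \<gamma> \<noteq> y\<rbrakk> \<Longrightarrow> a \<gamma> = \<zero>\<langle>z\<rangle>"
    by metis
  have local: "a \<star> idem V \<star> n \<in> germ_kernel z" if y: "y \<in> D" and V: "compact_open_units V" "V \<subseteq> U y" for y V
  proof -
    note VG = Gamma_idem[OF V(1)]
    note aVG = Gamma_mult_closed[OF aG VG]
    have iso: "dom = y" if "\<beta> \<in> arrows \<G>" "gran \<G> \<beta> = z" "dom = gdom \<G> \<beta>" "dom \<in> V" "a \<beta> \<noteq> \<zero>\<langle>z\<rangle>" for \<beta> dom
      using that U(3)[OF y, of \<beta>] V(2) by blast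
    show ?thesis
    \<comment> \<open>A subset of \<open>U y\<close> that misses \<open>y\<close> contains no domain
      of a nonzero entry, so row \<open>z\<close> of \<open>a * idem V\<close> is zero.\<close>
    proof (cases "y \<in> V")
      case False
      have "(a \<otimes>\<^bsub>\<Gamma>\<^esub> idem V) \<star> n \<in> germ_kernel z"
        by (rule germ_kernel_zero_row[OF aVG z n]) (use cut[OF V(1)] iso False in auto)
      then show ?thesis using Gamma_mult_smult[OF aG VG n] by simp
    next
      case True
      \<comment> \<open>Some arrow leads from \<open>y\<close> to \<open>z\<close>; its inverse
        composed with \<tau> connects \<open>x\<close> to \<open>y\<close>.\<close>
      obtain \<beta>0 where \<beta>0: "\<beta>0 \<in> arrows \<G>" "gran \<G> \<beta>0 = z" "gdom \<G> \<beta>0 = y" using y by (auto simp: D_def)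
      define \<gamma> where "\<gamma> = \<beta>0\<^sup>- \<cdot> \<tau>"
      have \<gamma>: "\<gamma> \<in> arrows \<G>" "gran \<G> \<gamma> = y" "gdom \<G> \<gamma> = x"
        using ginv_gmult_row[OF \<beta>0(1) \<tau>'(1)] \<beta>0 \<tau>' by (auto simp: \<gamma>_def z_def)
      obtain s where s: "row_delta \<gamma> s" using row_delta_exists[OF \<gamma>(1)] .
      obtain t where t: "row_delta (\<gamma>\<^sup>-) t" using row_delta_exists[OF inv_closed[OF \<gamma>(1)]] .
      note sG = row_delta_Gamma[OF s] and tG = row_delta_Gamma[OF t]
      note stG = Gamma_mult_closed[OF sG tG]
      have st: "(s \<otimes>\<^bsub>\<Gamma>\<^esub> t) \<eta> = idem V \<eta>" if "\<eta> \<in> arrows \<G>" "gran \<G> \<eta> = y" for \<eta>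
        using row_delta_mult_ginv[OF \<gamma>(1) s t V(1)] that True \<gamma>(2) by simp
      \<comment> \<open>\<open>s * t\<close> and \<open>idem V\<close> are known to agree on row
        \<open>y\<close>, and the nonzero entries of \<open>a * idem V\<close> in row
        \<open>z\<close> meet no other row.\<close>
      have row_eq: "(a \<otimes>\<^bsub>\<Gamma>\<^esub> idem V) \<eta> = ((a \<otimes>\<^bsub>\<Gamma>\<^esub> idem V) \<otimes>\<^bsub>\<Gamma>\<^esub> (s \<otimes>\<^bsub>\<Gamma>\<^esub> t)) \<eta>" if \<eta>: "\<eta> \<in> arrows \<G>" "gran \<G> \<eta> = z" for \<eta>
      proof -
        have "convolution \<G> \<O> (a \<otimes>\<^bsub>\<Gamma>\<^esub> idem V) (s \<otimes>\<^bsub>\<Gamma>\<^esub> t) \<eta> = convolution \<G> \<O> (a \<otimes>\<^bsub>\<Gamma>\<^esub> idem V) (idem V) \<eta>"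
        proof (rule convolution_cong[OF _ _ _ _ \<eta>(1) Gamma_row_fin[OF aVG gran_units[OF \<eta>(1)]]])
          fix \<beta> assume \<beta>: "\<beta> \<in> arrows \<G>" "gran \<G> \<beta> = gran \<G> \<eta>" and nz: "(a \<otimes>\<^bsub>\<Gamma>\<^esub> idem V) \<beta> \<noteq> \<zero>\<langle>gran \<G> \<eta>\<rangle>"
          then have "gdom \<G> \<beta> \<in> V" "a \<beta> \<noteq> \<zero>\<langle>z\<rangle>" using cut[OF V(1) \<beta>(1)] \<eta>(2) by (auto split: if_splits)
          then have "gdom \<G> \<beta> = y" using iso \<beta> \<eta>(2) by auto
          then show "(s \<otimes>\<^bsub>\<Gamma>\<^esub> t) (\<beta>\<^sup>- \<cdot> \<eta>) = idem V (\<beta>\<^sup>- \<cdot> \<eta>)"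
            using st ginv_gmult_row[OF \<beta>(1) \<eta>(1) \<beta>(2)] by simp
        qed (use aVG stG idem_section Gamma_section in auto)
        then show ?thesis
          using convolution_idem_right[OF compact_open_units_subset[OF V(1)] Gamma_section[OF aVG] \<eta>(1)] cut[OF V(1) \<eta>(1)]
          by (simp add: Gamma_simps(3))
      qed
      \<comment> \<open>\<open>t\<close> brings \<open>n\<close> from \<open>y\<close> to
        \<open>x\<close> and \<open>s\<close> brings it back; the cut by \<open>V\<close> is
        absorbed into \<open>g\<close>, which makes \<open>(a * g) n'\<close> equal to
        \<open>(a * idem V) (s * t) n\<close>.\<close>
      define n' where "n' = t \<star> n"
      have n': "n' \<in> carrier N" unfolding n'_def using N.smult_closed[OF tG n] .
      define g where "g = idem V \<otimes>\<^bsub>\<Gamma>\<^esub> s"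
      have gG: "g \<in> carrier \<Gamma>" unfolding g_def using Gamma_mult_closed[OF VG sG] .
      have g_app: "g \<eta> = (if gran \<G> \<eta> \<in> V then s \<eta> else \<zero>\<langle>gran \<G> \<eta>\<rangle>)" if "\<eta> \<in> arrows \<G>" for \<eta>
        unfolding g_def using convolution_idem_left[OF compact_open_units_subset[OF V(1)] Gamma_section[OF sG] that]
        by (simp add: Gamma_simps(3))
      note agG = Gamma_mult_closed[OF aG gG]
      \<comment> \<open>Every nonzero entry of \<open>a\<close> that meets \<open>g\<close> has
        domain \<open>y\<close>, and row \<open>y\<close> of \<open>g\<close> is concentrated at
        \<gamma>, whose domain is \<open>x\<close>.\<close>
      have ag: "(a \<otimes>\<^bsub>\<Gamma>\<^esub> g) \<eta> = \<zero>\<langle>gran \<G> \<tau>\<rangle>" if \<eta>: "\<eta> \<in> arrows \<G>" "gran \<G> \<eta> = gran \<G> \<tau>" "gdom \<G> \<eta> \<noteq> x" for \<eta>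
      proof -
        have "convolution \<G> \<O> a g \<eta> = \<zero>\<langle>gran \<G> \<eta>\<rangle>"
        proof (rule convolution_zero[OF Gamma_section Gamma_section, OF aG gG \<eta>(1)])
          fix \<beta> assume \<beta>: "\<beta> \<in> arrows \<G>" "gran \<G> \<beta> = gran \<G> \<eta>"
          note r = ginv_gmult_row[OF \<beta>(1) \<eta>(1) \<beta>(2)]
          have \<beta>z: "gran \<G> \<beta> = z" using \<beta>(2) \<eta>(2) by (simp add: z_def)
          show "a \<beta> = \<zero>\<langle>gran \<G> \<beta>\<rangle> \<or> g (\<beta>\<^sup>- \<cdot> \<eta>) = \<zero>\<langle>gdom \<G> \<beta>\<rangle>"
          proof (cases "gdom \<G> \<beta> \<in> V \<and> a \<beta> \<noteq> \<zero>\<langle>z\<rangle>")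
            case True
            then have "gdom \<G> \<beta> = y" using iso \<beta>(1) \<beta>z by auto
            moreover have "\<beta>\<^sup>- \<cdot> \<eta> \<noteq> \<gamma>" using r(3) \<eta>(3) \<gamma>(3) by auto
            ultimately show ?thesis using s r g_app \<gamma>(2) by (simp add: row_delta_def)
          next
            case False
            then show ?thesis using g_app[OF r(1)] r(2) \<beta>z by auto
          qed
        qed
        then show ?thesis using \<eta>(2) by (simp add: Gamma_simps(3))
      qed
      have iso_row: "isotropy_row x (h \<otimes>\<^bsub>\<Gamma>\<^esub> (a \<otimes>\<^bsub>\<Gamma>\<^esub> g))"
        by (rule isotropy_row_translate[OF \<tau>' h agG ag])
      \<comment> \<open>Column \<open>x\<close> of \<open>g\<close> is finite, hence a vector of the
        bimodule.\<close>
      define l where "l = restrict g (gdom_fiber \<G> x)"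
      have l: "l \<in> carrier (L_group \<G> \<O> x)"
      proof -
        have "{\<gamma> \<in> gdom_fiber \<G> x. l \<gamma> \<noteq> \<zero>\<langle>gran \<G> \<gamma>\<rangle>} = {\<gamma> \<in> arrows \<G>. gdom \<G> \<gamma> = x \<and> g \<gamma> \<noteq> \<zero>\<langle>gran \<G> \<gamma>\<rangle>}"
          by (auto simp: l_def gdom_fiber_iff)
        then have "finite {\<gamma> \<in> gdom_fiber \<G> x. l \<gamma> \<noteq> \<zero>\<langle>gran \<G> \<gamma>\<rangle>}"
          using Gamma_column_finite[OF gG] x by (simp add: column_finite_def)
        then show ?thesis
          unfolding carrier_L_group using section_closed[OF Gamma_section[OF gG]] by (auto simp: l_def gdom_fiber_iff)
      qed
      have gl: "g \<eta> = l \<eta>" if "\<eta> \<in> gdom_fiber \<G> x" for \<eta> using that by (simp add: l_def)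
      have "row_part x \<tau> (L_left_act \<G> \<O> x a l) \<odot>\<^bsub>germ_module x\<^esub> germ x n' = \<zero>\<^bsub>germ_module x\<^esub>"
        using a annihilator_Ind_iff[OF x aG] l n' \<tau> by blast
      then have "germ x ((h \<otimes>\<^bsub>\<Gamma>\<^esub> (a \<otimes>\<^bsub>\<Gamma>\<^esub> g)) \<star> n') = \<zero>\<^bsub>germ_module x\<^esub>"
        using germ_smult[OF x iso_row row_part_left_act[OF x \<tau> h aG gG l gl] n'] by simp
      then have "h \<star> (a \<otimes>\<^bsub>\<Gamma>\<^esub> g) \<star> n' \<in> germ_kernel x"
        using germ_zero_iff[OF x] N.smult_closed[OF Gamma_mult_closed[OF hG agG] n'] Gamma_mult_smult[OF hG agG n'] by simp
      then have "(a \<otimes>\<^bsub>\<Gamma>\<^esub> g) \<star> n' \<in> germ_kernel z"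
        unfolding z_def using germ_kernel_translate[OF \<tau>'(1) h N.smult_closed[OF agG n']] \<tau>'(2) by simp
      moreover have "(a \<otimes>\<^bsub>\<Gamma>\<^esub> g) \<star> n' = ((a \<otimes>\<^bsub>\<Gamma>\<^esub> idem V) \<otimes>\<^bsub>\<Gamma>\<^esub> (s \<otimes>\<^bsub>\<Gamma>\<^esub> t)) \<star> n"
        unfolding n'_def g_def
        using Gamma_mult_smult aG VG sG tG n N.smult_closed aVG stG gG g_def by simp
      ultimately have "((a \<otimes>\<^bsub>\<Gamma>\<^esub> idem V) \<otimes>\<^bsub>\<Gamma>\<^esub> (s \<otimes>\<^bsub>\<Gamma>\<^esub> t)) \<star> n \<in> germ_kernel z" by simp
      from germ_kernel_row_cong[OF aVG Gamma_mult_closed[OF aVG stG] z n _ this]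
      have "(a \<otimes>\<^bsub>\<Gamma>\<^esub> idem V) \<star> n \<in> germ_kernel z"
        using row_eq by blast
      then show ?thesis using Gamma_mult_smult[OF aG VG n] by simp
    qed
  qed
  have fin: "finite (U ` D)" using Gamma_row_fin[OF aG z] by (simp add: D_def)
  \<comment> \<open>The union covers \<open>D\<close>, so \<open>a * idem V\<close> has the same row
    at \<open>z\<close> as \<open>a\<close>.\<close>
  define V where "V = \<Union>(U ` D)"
  have V: "compact_open_units V" unfolding V_def using compact_open_units_Union[OF fin] U(1) by auto
  have "a \<star> idem V \<star> n \<in> germ_kernel z"
  proof (rule smult_idem_Union[where \<phi> = "\<lambda>n. a \<star> n", OF _ _ germ_kernel_subgroup[OF z] n fin _ _ V])
    show "a \<star> idem W \<star> n \<in> germ_kernel z" if "K \<in> U ` D" "compact_open_units W" "W \<subseteq> K" for K W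
      using local that by blast
  qed (use U(1) aG N.smult_closed N.smult_r_distr in \<open>auto simp: V_def\<close>)
  then have "(a \<otimes>\<^bsub>\<Gamma>\<^esub> idem V) \<star> n \<in> germ_kernel z"
    using Gamma_mult_smult[OF aG Gamma_idem[OF V] n] by simp
  then have "a \<star> n \<in> germ_kernel z"
  proof (rule germ_kernel_row_cong[OF aG Gamma_mult_closed[OF aG Gamma_idem[OF V]] z n, rotated])
    fix \<gamma> assume \<gamma>: "\<gamma> \<in> arrows \<G>" "gran \<G> \<gamma> = z"
    have "gdom \<G> \<gamma> \<in> V" if "a \<gamma> \<noteq> \<zero>\<langle>z\<rangle>"
    proof -
      have "gdom \<G> \<gamma> \<in> D" using \<gamma> that by (auto simp: D_def)
      then show ?thesis using U(2) by (auto simp: V_def)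
    qed
    then show "a \<gamma> = (a \<otimes>\<^bsub>\<Gamma>\<^esub> idem V) \<gamma>" using cut[OF V \<gamma>(1)] \<gamma>(2) by auto
  qed
  then show ?thesis by (simp add: z_def)
qed

lemma annihilator_Ind_subset:
  assumes simple: "simple_left_module \<Gamma> N" and x: "x \<in> units \<G>" and proper: "germ_kernel x \<noteq> carrier N"
    and a: "a \<in> annihilator \<Gamma> (Ind \<G> \<O> x (germ_module x))"
  shows "a \<in> annihilator \<Gamma> N"
proof -
  have aG: "a \<in> carrier \<Gamma>" using a by (simp add: annihilator_def)
  have sub: "H = {\<zero>\<^bsub>N\<^esub>} \<or> H = carrier N" if "submodule H \<Gamma> N" for H
    using simple that by (simp add: simple_left_module_def)
  have "a \<star> n = \<zero>\<^bsub>N\<^esub>" if n: "n \<in> carrier N" for n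
  proof (rule ccontr)
    assume nz: "a \<star> n \<noteq> \<zero>\<^bsub>N\<^esub>"
    define m where "m = a \<star> n"
    have m: "m \<in> carrier N" unfolding m_def using N.smult_closed[OF aG n] .
    interpret \<Gamma>: abelian_group \<Gamma> by (rule Gamma_abelian_group)
    let ?H = "(\<lambda>r. r \<star> m) ` carrier \<Gamma>"
    have H: "submodule ?H \<Gamma> N"
    proof (intro submodule.intro submodule_axioms.intro)
      show "subgroup ?H (add_monoid N)"
      proof (rule N.add.subgroupI)
        show "?H \<subseteq> carrier N" using N.smult_closed m by auto
        show "?H \<noteq> {}" using Gamma_zero_closed by blast
        show "\<ominus>\<^bsub>N\<^esub> c \<in> ?H" if c: "c \<in> ?H" for c
        proof -
          obtain r where r: "r \<in> carrier \<Gamma>" "c = r \<star> m" using c by blast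
          have "(\<ominus>\<^bsub>\<Gamma>\<^esub> r) \<star> m \<oplus>\<^bsub>N\<^esub> r \<star> m = \<zero>\<^bsub>N\<^esub>"
            using N.smult_l_distr[of "\<ominus>\<^bsub>\<Gamma>\<^esub> r" r m] r(1) m smult_zero_left[OF m] by (simp add: \<Gamma>.l_neg)
          then have "\<ominus>\<^bsub>N\<^esub> c = (\<ominus>\<^bsub>\<Gamma>\<^esub> r) \<star> m"
            using N.minus_equality r N.smult_closed m \<Gamma>.a_inv_closed by simp
          then show ?thesis using r(1) \<Gamma>.a_inv_closed by auto
        qed
        show "c \<oplus>\<^bsub>N\<^esub> d \<in> ?H" if cd: "c \<in> ?H" "d \<in> ?H" for c d
        proof -
          obtain r r' where "r \<in> carrier \<Gamma>" "c = r \<star> m" "r' \<in> carrier \<Gamma>" "d = r' \<star> m" using cd by blast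
          then show ?thesis
            using N.smult_l_distr[of r r' m] m Gamma_add_closed by (intro image_eqI[of _ _ "r \<oplus>\<^bsub>\<Gamma>\<^esub> r'"]) auto
        qed
      qed
      show "f \<star> c \<in> ?H" if fc: "f \<in> carrier \<Gamma>" "c \<in> ?H" for f c
      proof -
        obtain r where "r \<in> carrier \<Gamma>" "c = r \<star> m" using fc by blast
        then show ?thesis
          using Gamma_mult_smult[of f r m] m fc Gamma_mult_closed by (intro image_eqI[of _ _ "f \<otimes>\<^bsub>\<Gamma>\<^esub> r"]) auto
      qed
    qed
    have "?H \<subseteq> germ_kernel x"
    proof
      fix c assume "c \<in> ?H"
      then obtain r where r: "r \<in> carrier \<Gamma>" "c = r \<star> m" by blast
      show "c \<in> germ_kernel x"
        unfolding r(2)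
      proof (rule germ_kernel_smult[OF r(1) x m])
        \<comment> \<open>The domain of an arrow of row \<open>x\<close> is the range of its
          inverse, which lies in column \<open>x\<close>; this places the domain in the orbit of
          \<open>x\<close>.\<close>
        fix \<beta> assume \<beta>: "\<beta> \<in> arrows \<G>" "gran \<G> \<beta> = x"
        then have "\<beta>\<^sup>- \<in> gdom_fiber \<G> x" by (simp add: gdom_fiber_iff inv_closed gdom_inv)
        from annihilator_Ind_germ_kernel[OF x aG a this n] show "m \<in> germ_kernel (gdom \<G> \<beta>)"
          using gran_inv[OF \<beta>(1)] by (simp add: m_def)
      qed
    qed
    moreover have "germ_kernel x \<subseteq> carrier N" using germ_kernel_carrier by blast
    ultimately have "?H = {\<zero>\<^bsub>N\<^esub>}" using sub[OF H] proper by blast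
    then have rm: "r \<star> m = \<zero>\<^bsub>N\<^esub>" if "r \<in> carrier \<Gamma>" for r using that by blast
    \<comment> \<open>That \<Gamma> annihilates \<open>m\<close> still has to be refuted: the
      elements annihilated by \<Gamma> form a submodule, and as it contains the nonzero
      \<open>m\<close> it would be all of \<open>N\<close>, against the nontriviality of the
      action.\<close>
    let ?Z = "{k \<in> carrier N. \<forall>r\<in>carrier \<Gamma>. r \<star> k = \<zero>\<^bsub>N\<^esub>}"
    have "submodule ?Z \<Gamma> N"
    proof (intro submodule.intro submodule_axioms.intro)
      show "subgroup ?Z (add_monoid N)"
      proof (rule N.add.subgroupI)
        show "?Z \<noteq> {}" using m rm by blast
        show "\<ominus>\<^bsub>N\<^esub> c \<in> ?Z" if "c \<in> ?Z" for c
        proof -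
          have "\<ominus>\<^bsub>N\<^esub> \<zero>\<^bsub>N\<^esub> = \<zero>\<^bsub>N\<^esub>" using N.add.inv_one by (simp add: a_inv_def)
          then show ?thesis using that smult_neg by simp
        qed
      qed (auto simp: N.smult_r_distr)
      show "f \<star> c \<in> ?Z" if "f \<in> carrier \<Gamma>" "c \<in> ?Z" for f c
        using that smult_zero_right by auto
    qed
    moreover have "m \<in> ?Z" using m rm by blast
    ultimately have "?Z = carrier N" using sub nz by (auto simp: m_def)
    then show False
      using simple by (auto simp: simple_left_module_def)
  qed
  then show ?thesis using aG by (simp add: annihilator_def)
qed

text \<open>A nonzero \<open>f n\<close> has a nonzero germ somewhere by
  \<open>smult_zero_if_germs_zero\<close>.\<close>

lemma simple_module_germ:
  assumes "simple_left_module \<Gamma> N"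
  obtains x where "x \<in> units \<G>" "germ_kernel x \<noteq> carrier N"
proof -
  obtain f n where "f \<in> carrier \<Gamma>" "n \<in> carrier N" "f \<star> n \<noteq> \<zero>\<^bsub>N\<^esub>"
    using assms by (auto simp: simple_left_module_def)
  then show thesis
    using smult_zero_if_germs_zero N.smult_closed that by metis
qed

end

theorem theorem4p1:
  fixes \<G> :: "'g top_groupoid"
    and \<O> :: "('g, 'e) ring_gsheaf"
    and I :: "('g \<Rightarrow> 'e) set"
  assumes "ample_groupoid \<G>"
    and "groupoid_ring_sheaf \<G> \<O>"
    and "left_primitive_ideal TYPE('n) (Gamma_c \<G> \<O>) I"
  shows "\<exists>x \<in> units \<G>. \<exists>M :: ('g \<Rightarrow> 'e, 'n set) module.
           unital_left_module (skew_group_ring \<G> \<O> x) M \<and>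
           I = annihilator (Gamma_c \<G> \<O>) (Ind \<G> \<O> x M)"
proof -
  obtain N :: "('g \<Rightarrow> 'e, 'n) module" where N: "simple_left_module (Gamma_c \<G> \<O>) N"
    and I: "I = annihilator (Gamma_c \<G> \<O>) N"
    using assms(3) by (auto simp: left_primitive_ideal_def)
  interpret convolution_module \<G> \<O> N
    using assms(1,2) N by (simp add: convolution_module_def ample_ring_sheaf_def simple_left_module_def)
  obtain x where x: "x \<in> units \<G>" "germ_kernel x \<noteq> carrier N"
    using simple_module_germ[OF N] .
  have "I = annihilator (Gamma_c \<G> \<O>) (Ind \<G> \<O> x (germ_module x))"
    using annihilator_subset_Ind[OF x(1)] annihilator_Ind_subset[OF N x] unfolding I by blast
  then show ?thesis
    using x(1) germ_module_unital[OF x(1)] by blast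
qed

end
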